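(* Let $\Lambda$ and $\Lambda'$ be artin algebras. Let $\mathcal{X}\subseteq\mathrm{mod}\text{-}\Lambda$ and $\mathcal{X}'\subseteq\mathrm{mod}\text{-}\Lambda'$ be subcategories of finite type such that $\Lambda, D(\Lambda)\in\mathcal{X}$ and $\Lambda', D(\Lambda')\in\mathcal{X}'$. If $\Gamma(\mathcal{X})$ and $\Gamma(\mathcal{X}')$ are Morita equivalent, then $\Lambda$ and $\Lambda'$ are Morita equivalent. In particular, in this situation $\Gamma(\underline{\mathcal{X}})$ and $\Gamma(\underline{\mathcal{X}'})$ are also Morita equivalent.
   Context: An artin algebra is an algebra over a commutative artinian ring $R$ that is finitely generated as an $R$-module. $\mathrm{mod}\text{-}\Lambda$ is the category of finitely presented (equivalently, finitely generated) right $\Lambda$-modules. $D=\mathrm{Hom}_R(-,E)$, with $E$ the injective envelope of $R/\mathrm{rad}\,R$, is the usual duality; $D(\Lambda)$ is regarded as a right $\Lambda$-module. Subcategories are full and closed under isomorphisms, finite direct sums and direct summands. $\mathcal{X}$ is of finite type if it has only finitely many isomorphism classes of indecomposable modules; then $\mathcal{X}=\mathrm{add}\,X$ for some $X\in\mathcal{X}$, where $\mathrm{add}\,X$ is the class of modules isomorphic to direct summands of finite direct sums of copies of $X$. In this case $\Gamma(\mathcal{X}):=\mathrm{End}_\Lambda(X)$ (the relative Auslander algebra, well defined up to Morita equivalence), and $\Gamma(\underline{\mathcal{X}}):=\mathrm{End}_\Lambda(X)/\mathcal{P}$ (the stable relative Auslander algebra), where $\mathcal{P}$ is the ideal of endomorphisms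 of $X$ that factor through a projective module. The same notation applies to $\mathcal{X}'$ over $\Lambda'$. *)

theory Defs
  imports "HOL-Algebra.Module" "HOL-Algebra.QuotRing"
begin

text \<open>
  The library's module locale requires a commutative ring.  We reuse its record type and
  its \<open>submodule\<close> locale for unital right modules over an arbitrary ring:
  \<open>a \<odot>\<^bsub>M\<^esub> x\<close> stands for the right action \<open>x a\<close>, whence the order of the factors in
  \<open>smult_assoc\<close>.  The multiplicative fields of a module record are never used.
\<close>

locale right_module = R?: ring R + M?: abelian_group M
  for R :: "('a, 'r) ring_scheme" (structure) and M :: "('a, 'b, 's) module_scheme" (structure) +
  assumes smult_closed: "\<lbrakk>a \<in> carrier R; x \<in> carrier M\<rbrakk> \<Longrightarrow> a \<odot>\<^bsub>M\<^esub> x \<in> carrier M"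
    and smult_l_distr: "\<lbrakk>a \<in> carrier R; b \<in> carrier R; x \<in> carrier M\<rbrakk> \<Longrightarrow>
      (a \<oplus> b) \<odot>\<^bsub>M\<^esub> x = a \<odot>\<^bsub>M\<^esub> x \<oplus>\<^bsub>M\<^esub> b \<odot>\<^bsub>M\<^esub> x"
    and smult_r_distr: "\<lbrakk>a \<in> carrier R; x \<in> carrier M; y \<in> carrier M\<rbrakk> \<Longrightarrow>
      a \<odot>\<^bsub>M\<^esub> (x \<oplus>\<^bsub>M\<^esub> y) = a \<odot>\<^bsub>M\<^esub> x \<oplus>\<^bsub>M\<^esub> a \<odot>\<^bsub>M\<^esub> y"
    and smult_assoc: "\<lbrakk>a \<in> carrier R; b \<in> carrier R; x \<in> carrier M\<rbrakk> \<Longrightarrow>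
      (a \<otimes> b) \<odot>\<^bsub>M\<^esub> x = b \<odot>\<^bsub>M\<^esub> (a \<odot>\<^bsub>M\<^esub> x)"
    and smult_one: "x \<in> carrier M \<Longrightarrow> \<one> \<odot>\<^bsub>M\<^esub> x = x"

lemma module_iff_right_module:
  assumes "cring R"
  shows "module R M \<longleftrightarrow> right_module R M"
proof -
  interpret cring R by fact
  show ?thesis
  proof
    assume "module R M"
    then interpret M: module R M .
    show "right_module R M"
      by unfold_locales
        (auto simp: M.smult_l_distr M.smult_r_distr M.smult_assoc1[symmetric] m_comm)
  next
    assume "right_module R M"
    then interpret M: right_module R M .
    show "module R M"
      by unfold_locales
        (auto simp: M.smult_closed M.smult_l_distr M.smult_r_distr M.smult_assoc[symmetric]
          M.smult_one m_comm)
  qed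
qed

text \<open>Homomorphisms are extensional functions, so that equal homomorphisms are equal in HOL.\<close>

definition rmod_hom ::
  "('a, 'r) ring_scheme \<Rightarrow> ('a, 'b, 's) module_scheme \<Rightarrow> ('a, 'c, 't) module_scheme \<Rightarrow> ('b \<Rightarrow> 'c) set"
  where "rmod_hom R M N = {f \<in> carrier M \<rightarrow>\<^sub>E carrier N.
    (\<forall>x\<in>carrier M. \<forall>y\<in>carrier M. f (x \<oplus>\<^bsub>M\<^esub> y) = f x \<oplus>\<^bsub>N\<^esub> f y) \<and>
    (\<forall>a\<in>carrier R. \<forall>x\<in>carrier M. f (a \<odot>\<^bsub>M\<^esub> x) = a \<odot>\<^bsub>N\<^esub> f x)}"

definition rmod_iso ::
  "('a, 'r) ring_scheme \<Rightarrow> ('a, 'b, 's) module_scheme \<Rightarrow> ('a, 'c, 't) module_scheme \<Rightarrow> bool"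
  where "rmod_iso R M N \<longleftrightarrow> (\<exists>f\<in>rmod_hom R M N. bij_betw f (carrier M) (carrier N))"

definition regular_module :: "('a, 'r) ring_scheme \<Rightarrow> ('a, 'a) module"
  where "regular_module R = \<lparr>carrier = carrier R, mult = mult R, one = one R,
    zero = zero R, add = add R, smult = (\<lambda>a x. x \<otimes>\<^bsub>R\<^esub> a)\<rparr>"

definition rmod_sum2 ::
  "('a, 'b, 's) module_scheme \<Rightarrow> ('a, 'c, 't) module_scheme \<Rightarrow> ('a, 'b \<times> 'c) module"
  where "rmod_sum2 M N = \<lparr>carrier = carrier M \<times> carrier N,
    mult = undefined, one = undefined, zero = (\<zero>\<^bsub>M\<^esub>, \<zero>\<^bsub>N\<^esub>),
    add = (\<lambda>x y. (fst x \<oplus>\<^bsub>M\<^esub> fst y, snd x \<oplus>\<^bsub>N\<^esub> snd y)),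
    smult = (\<lambda>a x. (a \<odot>\<^bsub>M\<^esub> fst x, a \<odot>\<^bsub>N\<^esub> snd x))\<rparr>"

definition rmod_sum ::
  "nat \<Rightarrow> (nat \<Rightarrow> ('a, 'b, 's) module_scheme) \<Rightarrow> ('a, nat \<Rightarrow> 'b) module"
  where "rmod_sum n M = \<lparr>carrier = (\<Pi>\<^sub>E i\<in>{..<n}. carrier (M i)),
    mult = undefined, one = undefined, zero = (\<lambda>i\<in>{..<n}. \<zero>\<^bsub>M i\<^esub>),
    add = (\<lambda>x y. \<lambda>i\<in>{..<n}. x i \<oplus>\<^bsub>M i\<^esub> y i),
    smult = (\<lambda>a x. \<lambda>i\<in>{..<n}. a \<odot>\<^bsub>M i\<^esub> x i)\<rparr>"

text \<open>\<open>M\<close> is isomorphic to a direct summand of \<open>N\<close>.  A complement of a direct summand of \<open>N\<close> is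
  a submodule of \<open>N\<close>, so its carrier may be taken in the carrier type of \<open>N\<close>; the same remark
  applies to the two summands in the definition of indecomposability.\<close>

definition is_summand ::
  "('a, 'r) ring_scheme \<Rightarrow> ('a, 'b) module \<Rightarrow> ('a, 'c) module \<Rightarrow> bool"
  where "is_summand R M N \<longleftrightarrow>
    (\<exists>K :: ('a, 'c) module. right_module R K \<and> rmod_iso R N (rmod_sum2 M K))"

definition indecomposable :: "('a, 'r) ring_scheme \<Rightarrow> ('a, 'b) module \<Rightarrow> bool"
  where "indecomposable R M \<longleftrightarrow> right_module R M \<and> carrier M \<noteq> {\<zero>\<^bsub>M\<^esub>} \<and>
    (\<forall>(A :: ('a, 'b) module) (B :: ('a, 'b) module). right_module R A \<longrightarrow> right_module R B \<longrightarrow>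
      rmod_iso R M (rmod_sum2 A B) \<longrightarrow> carrier A = {\<zero>\<^bsub>A\<^esub>} \<or> carrier B = {\<zero>\<^bsub>B\<^esub>})"

definition fg_submodule ::
  "('a, 'r) ring_scheme \<Rightarrow> ('a, 'b, 's) module_scheme \<Rightarrow> 'b set \<Rightarrow> bool"
  where "fg_submodule R M K \<longleftrightarrow> submodule K R M \<and>
    (\<exists>S. finite S \<and> S \<subseteq> K \<and> (\<forall>H. submodule H R M \<longrightarrow> S \<subseteq> H \<longrightarrow> K \<subseteq> H))"

definition finitely_presented :: "('a, 'r) ring_scheme \<Rightarrow> ('a, 'b, 's) module_scheme \<Rightarrow> bool"
  where "finitely_presented R M \<longleftrightarrow> right_module R M \<and>
    (\<exists>n. \<exists>p\<in>rmod_hom R (rmod_sum n (\<lambda>_. regular_module R)) M.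
      p ` carrier (rmod_sum n (\<lambda>_. regular_module R)) = carrier M \<and>
      fg_submodule R (rmod_sum n (\<lambda>_. regular_module R))
        {x \<in> carrier (rmod_sum n (\<lambda>_. regular_module R)). p x = \<zero>\<^bsub>M\<^esub>})"

text \<open>The class of all finitely presented modules is represented by those whose carrier lies in
  the type \<open>(nat \<Rightarrow> 'a) set\<close>, where \<open>'a\<close> is the type of the ring elements.  No isomorphism class
  is lost: a quotient of \<open>R\<^sup>n\<close> has cosets of functions \<open>nat \<Rightarrow> 'a\<close> as its elements.\<close>

type_synonym 'a umodule = "('a, (nat \<Rightarrow> 'a) set) module"

definition fp_modules :: "('a, 'r) ring_scheme \<Rightarrow> 'a umodule set"
  where "fp_modules R = {M. finitely_presented R M}"

text \<open>\<open>Comp C X Y Z g f\<close> is the composite of \<open>f : X \<rightarrow> Y\<close> followed by \<open>g : Y \<rightarrow> Z\<close>.\<close>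

record ('o, 'm) category_data =
  Ob :: "'o set"
  Hom :: "'o \<Rightarrow> 'o \<Rightarrow> 'm set"
  Id :: "'o \<Rightarrow> 'm"
  Comp :: "'o \<Rightarrow> 'o \<Rightarrow> 'o \<Rightarrow> 'm \<Rightarrow> 'm \<Rightarrow> 'm"

definition is_category :: "('o, 'm) category_data \<Rightarrow> bool"
  where "is_category C \<longleftrightarrow>
    (\<forall>X\<in>Ob C. Id C X \<in> Hom C X X) \<and>
    (\<forall>X\<in>Ob C. \<forall>Y\<in>Ob C. \<forall>Z\<in>Ob C. \<forall>f\<in>Hom C X Y. \<forall>g\<in>Hom C Y Z. Comp C X Y Z g f \<in> Hom C X Z) \<and>
    (\<forall>X\<in>Ob C. \<forall>Y\<in>Ob C. \<forall>f\<in>Hom C X Y.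
      Comp C X X Y f (Id C X) = f \<and> Comp C X Y Y (Id C Y) f = f) \<and>
    (\<forall>W\<in>Ob C. \<forall>X\<in>Ob C. \<forall>Y\<in>Ob C. \<forall>Z\<in>Ob C. \<forall>f\<in>Hom C W X. \<forall>g\<in>Hom C X Y. \<forall>h\<in>Hom C Y Z.
      Comp C W Y Z h (Comp C W X Y g f) = Comp C W X Z (Comp C X Y Z h g) f)"

definition is_functor ::
  "('o, 'm) category_data \<Rightarrow> ('p, 'n) category_data \<Rightarrow>
    ('o \<Rightarrow> 'p) \<Rightarrow> ('o \<Rightarrow> 'o \<Rightarrow> 'm \<Rightarrow> 'n) \<Rightarrow> bool"
  where "is_functor C D F \<phi> \<longleftrightarrow>
    (\<forall>X\<in>Ob C. F X \<in> Ob D) \<and>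
    (\<forall>X\<in>Ob C. \<forall>Y\<in>Ob C. \<forall>f\<in>Hom C X Y. \<phi> X Y f \<in> Hom D (F X) (F Y)) \<and>
    (\<forall>X\<in>Ob C. \<phi> X X (Id C X) = Id D (F X)) \<and>
    (\<forall>X\<in>Ob C. \<forall>Y\<in>Ob C. \<forall>Z\<in>Ob C. \<forall>f\<in>Hom C X Y. \<forall>g\<in>Hom C Y Z.
      \<phi> X Z (Comp C X Y Z g f) = Comp D (F X) (F Y) (F Z) (\<phi> Y Z g) (\<phi> X Y f))"

definition is_iso_in :: "('o, 'm) category_data \<Rightarrow> 'o \<Rightarrow> 'o \<Rightarrow> 'm \<Rightarrow> bool"
  where "is_iso_in C X Y f \<longleftrightarrow> f \<in> Hom C X Y \<and>
    (\<exists>g\<in>Hom C Y X. Comp C X Y X g f = Id C X \<and> Comp C Y X Y f g = Id C Y)"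

definition naturally_isomorphic ::
  "('o, 'm) category_data \<Rightarrow> ('p, 'n) category_data \<Rightarrow>
    ('o \<Rightarrow> 'p) \<Rightarrow> ('o \<Rightarrow> 'o \<Rightarrow> 'm \<Rightarrow> 'n) \<Rightarrow> ('o \<Rightarrow> 'p) \<Rightarrow> ('o \<Rightarrow> 'o \<Rightarrow> 'm \<Rightarrow> 'n) \<Rightarrow> bool"
  where "naturally_isomorphic C D F \<phi> G \<psi> \<longleftrightarrow> (\<exists>\<eta>.
    (\<forall>X\<in>Ob C. is_iso_in D (F X) (G X) (\<eta> X)) \<and>
    (\<forall>X\<in>Ob C. \<forall>Y\<in>Ob C. \<forall>f\<in>Hom C X Y.
      Comp D (F X) (F Y) (G Y) (\<eta> Y) (\<phi> X Y f) = Comp D (F X) (G X) (G Y) (\<psi> X Y f) (\<eta> X)))"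

definition equivalent_categories ::
  "('o, 'm) category_data \<Rightarrow> ('p, 'n) category_data \<Rightarrow> bool"
  where "equivalent_categories C D \<longleftrightarrow> (\<exists>F \<phi> G \<psi>.
    is_functor C D F \<phi> \<and> is_functor D C G \<psi> \<and>
    naturally_isomorphic C C (\<lambda>X. X) (\<lambda>X Y f. f)
      (\<lambda>X. G (F X)) (\<lambda>X Y f. \<psi> (F X) (F Y) (\<phi> X Y f)) \<and>
    naturally_isomorphic D D (\<lambda>X. F (G X)) (\<lambda>X Y f. \<phi> (G X) (G Y) (\<psi> X Y f))
      (\<lambda>X. X) (\<lambda>X Y f. f))"

definition mod_category ::
  "('a, 'r) ring_scheme \<Rightarrow> ('a umodule, (nat \<Rightarrow> 'a) set \<Rightarrow> (nat \<Rightarrow> 'a) set) category_data"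
  where "mod_category R = \<lparr>Ob = fp_modules R, Hom = rmod_hom R,
    Id = (\<lambda>M. \<lambda>x\<in>carrier M. x), Comp = (\<lambda>L M N g f. compose (carrier L) g f)\<rparr>"

lemma is_category_mod_category: "is_category (mod_category R)"
proof -
  have M: "right_module R M" if "M \<in> fp_modules R" for M
    using that by (simp add: fp_modules_def finitely_presented_def)
  have "x \<oplus>\<^bsub>M\<^esub> y \<in> carrier M" if "M \<in> fp_modules R" "x \<in> carrier M" "y \<in> carrier M" for M x y
    using M[OF that(1)] that(2,3) by (simp add: right_module_def abelian_groupE(1))
  moreover have "a \<odot>\<^bsub>M\<^esub> x \<in> carrier M"
    if "M \<in> fp_modules R" "a \<in> carrier R" "x \<in> carrier M" for M a x
    using right_module.smult_closed[OF M] that by blast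
  ultimately show ?thesis
    unfolding is_category_def mod_category_def
    by (auto simp: rmod_hom_def compose_def PiE_iff extensional_def fun_eq_iff)
qed

text \<open>Two rings are Morita equivalent if their module categories are equivalent.  Finitely
  presented modules suffice, over any ring: they are the compact objects of the category of all
  modules, and the latter is the category of filtered colimits of the former.\<close>

definition morita_equivalent :: "('a, 'r) ring_scheme \<Rightarrow> ('b, 's) ring_scheme \<Rightarrow> bool"
  where "morita_equivalent R S \<longleftrightarrow> equivalent_categories (mod_category R) (mod_category S)"

text \<open>The test modules range over the carrier type \<open>(nat \<Rightarrow> 'a) set\<close>.  This is no restriction for
  injectivity, since by Baer's criterion the inclusions of ideals into the ring suffice, nor for
  projectivity of finitely generated modules (the only case used), since a surjection from \<open>R\<^sup>n\<close>
  is a possible test map up to isomorphism.\<close>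

definition projective_module :: "('a, 'r) ring_scheme \<Rightarrow> ('a, 'b, 's) module_scheme \<Rightarrow> bool"
  where "projective_module R P \<longleftrightarrow> right_module R P \<and>
    (\<forall>(A :: 'a umodule) (B :: 'a umodule). right_module R A \<longrightarrow> right_module R B \<longrightarrow>
      (\<forall>q\<in>rmod_hom R A B. \<forall>g\<in>rmod_hom R P B. q ` carrier A = carrier B \<longrightarrow>
        (\<exists>h\<in>rmod_hom R P A. \<forall>x\<in>carrier P. q (h x) = g x)))"

definition injective_module :: "('a, 'r) ring_scheme \<Rightarrow> ('a, 'b, 's) module_scheme \<Rightarrow> bool"
  where "injective_module R E \<longleftrightarrow> right_module R E \<and>
    (\<forall>(A :: 'a umodule) (B :: 'a umodule). right_module R A \<longrightarrow> right_module R B \<longrightarrow>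
      (\<forall>i\<in>rmod_hom R A B. \<forall>g\<in>rmod_hom R A E. inj_on i (carrier A) \<longrightarrow>
        (\<exists>h\<in>rmod_hom R B E. \<forall>x\<in>carrier A. h (i x) = g x)))"

definition injective_envelope ::
  "('a, 'r) ring_scheme \<Rightarrow> ('a, 'b, 's) module_scheme \<Rightarrow> ('a, 'c, 't) module_scheme \<Rightarrow> bool"
  where "injective_envelope R M E \<longleftrightarrow> right_module R M \<and> injective_module R E \<and>
    (\<exists>i\<in>rmod_hom R M E. inj_on i (carrier M) \<and>
      (\<forall>H. submodule H R E \<longrightarrow> H \<inter> i ` carrier M = {\<zero>\<^bsub>E\<^esub>} \<longrightarrow> H = {\<zero>\<^bsub>E\<^esub>}))"

definition artinian_cring :: "('r, 'p) ring_scheme \<Rightarrow> bool"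
  where "artinian_cring R \<longleftrightarrow> cring R \<and>
    (\<forall>I :: nat \<Rightarrow> 'r set. (\<forall>n. ideal (I n) R \<and> I (Suc n) \<subseteq> I n) \<longrightarrow>
      (\<exists>n. \<forall>m\<ge>n. I m = I n))"

text \<open>An algebra is a record with both a ring and an \<open>R\<close>-module structure on the same additive
  group.  (The library's \<open>algebra\<close> locale is restricted to commutative algebras.)\<close>

locale artin_algebra = module R L + L?: ring L
  for R :: "('r, 'p) ring_scheme" (structure) and L :: "('r, 'a, 's) module_scheme" (structure) +
  assumes artinian: "artinian_cring R"
    and smult_mult_left: "\<lbrakk>r \<in> carrier R; x \<in> carrier L; y \<in> carrier L\<rbrakk> \<Longrightarrow>
      (r \<odot>\<^bsub>L\<^esub> x) \<otimes>\<^bsub>L\<^esub> y = r \<odot>\<^bsub>L\<^esub> (x \<otimes>\<^bsub>L\<^esub> y)"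
    and smult_mult_right: "\<lbrakk>r \<in> carrier R; x \<in> carrier L; y \<in> carrier L\<rbrakk> \<Longrightarrow>
      x \<otimes>\<^bsub>L\<^esub> (r \<odot>\<^bsub>L\<^esub> y) = r \<odot>\<^bsub>L\<^esub> (x \<otimes>\<^bsub>L\<^esub> y)"
    and finitely_generated: "fg_submodule R L (carrier L)"

definition jacobson_radical :: "('r, 'p) ring_scheme \<Rightarrow> 'r set"
  where "jacobson_radical R = carrier R \<inter> \<Inter>{I. maximalideal I R}"

definition quot_module :: "('r, 'p) ring_scheme \<Rightarrow> 'r set \<Rightarrow> ('r, 'r set) module"
  where "quot_module R I = \<lparr>carrier = carrier (R Quot I), mult = mult (R Quot I),
    one = one (R Quot I), zero = zero (R Quot I), add = add (R Quot I),
    smult = (\<lambda>r x. x \<otimes>\<^bsub>R Quot I\<^esub> (I +>\<^bsub>R\<^esub> r))\<rparr>"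

text \<open>\<open>D(\<Lambda>) = Hom\<^sub>R(\<Lambda>, E)\<close> as a right \<open>\<Lambda>\<close>-module: \<open>(h a)(x) = h (a x)\<close>.\<close>

definition dual_regular ::
  "('r, 'p) ring_scheme \<Rightarrow> ('r, 'a, 's) module_scheme \<Rightarrow> ('r, 'e, 't) module_scheme \<Rightarrow>
    ('a, 'a \<Rightarrow> 'e) module"
  where "dual_regular R L E = \<lparr>carrier = rmod_hom R L E, mult = undefined, one = undefined,
    zero = (\<lambda>x\<in>carrier L. \<zero>\<^bsub>E\<^esub>), add = (\<lambda>h k. \<lambda>x\<in>carrier L. h x \<oplus>\<^bsub>E\<^esub> k x),
    smult = (\<lambda>a h. \<lambda>x\<in>carrier L. h (a \<otimes>\<^bsub>L\<^esub> x))\<rparr>"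

text \<open>A full subcategory is given by its class of objects.\<close>

definition subcategory :: "('a, 'r) ring_scheme \<Rightarrow> 'a umodule set \<Rightarrow> bool"
  where "subcategory R \<X> \<longleftrightarrow> \<X> \<subseteq> fp_modules R \<and>
    (\<forall>M\<in>\<X>. \<forall>N\<in>fp_modules R. rmod_iso R M N \<longrightarrow> N \<in> \<X>) \<and>
    (\<forall>n M. (\<forall>i<n. M i \<in> \<X>) \<longrightarrow> (\<exists>N\<in>\<X>. rmod_iso R N (rmod_sum n M))) \<and>
    (\<forall>M\<in>\<X>. \<forall>N\<in>fp_modules R. is_summand R N M \<longrightarrow> N \<in> \<X>)"

text \<open>Membership of a module with an arbitrary carrier type in an isomorphism-closed class.\<close>

definition belongs_to ::
  "('a, 'r) ring_scheme \<Rightarrow> ('a, 'b, 's) module_scheme \<Rightarrow> 'a umodule set \<Rightarrow> bool"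
  where "belongs_to R M \<X> \<longleftrightarrow> (\<exists>N\<in>\<X>. rmod_iso R M N)"

definition finite_type :: "('a, 'r) ring_scheme \<Rightarrow> 'a umodule set \<Rightarrow> bool"
  where "finite_type R \<X> \<longleftrightarrow>
    finite ({M \<in> \<X>. indecomposable R M} //
      {(M, N). M \<in> \<X> \<and> N \<in> \<X> \<and> indecomposable R M \<and> indecomposable R N \<and> rmod_iso R M N})"

definition add_closure :: "('a, 'r) ring_scheme \<Rightarrow> 'a umodule \<Rightarrow> 'a umodule set"
  where "add_closure R X = {M \<in> fp_modules R. \<exists>n. is_summand R M (rmod_sum n (\<lambda>_. X))}"

definition End_ring :: "('a, 'r) ring_scheme \<Rightarrow> ('a, 'b, 's) module_scheme \<Rightarrow> ('b \<Rightarrow> 'b) ring"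
  where "End_ring R M = \<lparr>carrier = rmod_hom R M M, mult = compose (carrier M),
    one = (\<lambda>x\<in>carrier M. x), zero = (\<lambda>x\<in>carrier M. \<zero>\<^bsub>M\<^esub>),
    add = (\<lambda>f g. \<lambda>x\<in>carrier M. f x \<oplus>\<^bsub>M\<^esub> g x)\<rparr>"

definition proj_ideal ::
  "('a, 'r) ring_scheme \<Rightarrow> ('a, 'b, 's) module_scheme \<Rightarrow> ('b \<Rightarrow> 'b) set"
  where "proj_ideal R M = {f \<in> rmod_hom R M M.
    \<exists>P\<in>fp_modules R. projective_module R P \<and>
      (\<exists>g\<in>rmod_hom R M P. \<exists>h\<in>rmod_hom R P M. f = compose (carrier M) h g)}"

definition stable_End_ring ::
  "('a, 'r) ring_scheme \<Rightarrow> ('a, 'b, 's) module_scheme \<Rightarrow> ('b \<Rightarrow> 'b) set ring"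
  where "stable_End_ring R M = End_ring R M Quot proj_ideal R M"

end

theory Submission
  imports Defs
begin

text \<open>Let \<open>\<Gamma> = End(X)\<close> and \<open>T = Hom(X, -)\<close>.  Since \<open>\<Lambda>\<close> is a summand of some \<open>X\<^sup>n\<close>, the module
  \<open>P = T \<Lambda>\<close> is a finitely generated projective \<open>\<Gamma>\<close>-module, and \<open>End(P)\<close> is \<open>\<Lambda>\<close> acting by left
  multiplication (\<open>lmul_ring_iso\<close>).  Thus \<open>\<Gamma>\<close> knows \<open>\<Lambda>\<close> as soon as the class \<open>add P\<close> can be
  recognised inside the category of \<open>\<Gamma>\<close>-modules.

  The functor \<open>T\<close> identifies \<open>add X\<close> with the category of finitely generated projective
  \<open>\<Gamma>\<close>-modules.  Because \<open>add X\<close> contains the cogenerator \<open>D(\<Lambda>)\<close>, an epimorphism of \<open>add X\<close> is a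
  surjective map, and so it splits if its target is \<open>\<Lambda>\<close>; because \<open>add X\<close> contains \<open>\<Lambda>\<close>, every
  object of \<open>add X\<close> is the target of an epimorphism from some \<open>\<Lambda>\<^sup>n\<close>.  Hence an object of \<open>add X\<close> at which
  all epimorphisms of \<open>add X\<close> split is a summand of some \<open>\<Lambda>\<^sup>n\<close>, and \<open>\<Lambda>\<close> is such an object.  In terms
  of \<open>\<Gamma>\<close>, with finite jointly epimorphic families in place of single epimorphisms, this is the
  criterion \<open>split_wrt\<close>: the module \<open>P\<close> satisfies it (\<open>split_wrt_P\<close>), and a finitely generated projective
  module that satisfies it lies in \<open>add P\<close> (\<open>split_imp_in_add_P\<close>).

  The criterion speaks of composition, zero maps and sums of maps only.  An equivalence \<open>F\<close> of
  the categories of finitely presented modules is full and faithful, preserves zero maps, and is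
  additive on the maps into a finitely generated projective module (\<open>F_add\<close>), so it preserves the
  criterion relative to any class of modules that it preserves (\<open>F_split\<close>).  The class of all
  finitely presented modules yields that \<open>F\<close> preserves finitely generated projective modules
  (\<open>split_wrt_regular\<close>, \<open>split_wrt_all_in_add\<close>, \<open>F_in_add_regular\<close>); the class of these then yields that
  \<open>F P\<close> and \<open>P'\<close> are summands of finite sums of copies of each other.

  So \<open>\<Lambda>\<close> and \<open>\<Lambda>'\<close> are the endomorphism rings of two modules over \<open>\<Gamma>'\<close> with the same \<open>add\<close>.  They
  are corners \<open>e D e\<close> and \<open>f D f\<close> of the endomorphism ring \<open>D\<close> of the direct sum of the two modules, with
  \<open>e\<close> a sum of products from \<open>(e D f) (f D e)\<close> and \<open>f\<close> a sum of products from \<open>(f D e) (e D f)\<close>.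
  Hence they are Morita equivalent by the functors \<open>Hom(f D e, -)\<close> and \<open>Hom(e D f, -)\<close>
  (\<open>morita_equivalent_corners\<close>, \<open>morita_equivalent_End\<close>).

  The stable algebras are treated in the same way, with \<open>T X\<close> for \<open>P\<close>.  An endomorphism of \<open>X\<close>
  factors through a projective module if and only if its image under \<open>T\<close> is a sum of maps through
  \<open>P\<close> (\<open>hmap_through_P_iff\<close>), a condition that \<open>F\<close> preserves.  So both stable algebras are corners of one
  and the same quotient of a ring \<open>D\<close> (\<open>morita_equivalent_Quot\<close>).\<close>

section \<open>Homomorphisms of right modules\<close>

context right_module
begin

declare smult_closed [simp, intro] smult_one [simp]

lemma smult_zero [simp]:
  assumes "a \<in> carrier R" shows "a \<odot>\<^bsub>M\<^esub> \<zero>\<^bsub>M\<^esub> = \<zero>\<^bsub>M\<^esub>"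
proof -
  have "a \<odot>\<^bsub>M\<^esub> \<zero>\<^bsub>M\<^esub> \<oplus>\<^bsub>M\<^esub> a \<odot>\<^bsub>M\<^esub> \<zero>\<^bsub>M\<^esub> = a \<odot>\<^bsub>M\<^esub> \<zero>\<^bsub>M\<^esub>"
    using assms smult_r_distr[of a "\<zero>\<^bsub>M\<^esub>" "\<zero>\<^bsub>M\<^esub>"] by simp
  then show ?thesis
    using assms M.add.r_cancel_one' M.zero_closed smult_closed by metis
qed

lemma zero_smult [simp]:
  assumes "x \<in> carrier M" shows "\<zero> \<odot>\<^bsub>M\<^esub> x = \<zero>\<^bsub>M\<^esub>"
proof -
  have "\<zero> \<odot>\<^bsub>M\<^esub> x \<oplus>\<^bsub>M\<^esub> \<zero> \<odot>\<^bsub>M\<^esub> x = \<zero> \<odot>\<^bsub>M\<^esub> x"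
    using assms smult_l_distr[of \<zero> \<zero> x] by simp
  then show ?thesis
    using assms M.add.r_cancel_one' R.zero_closed smult_closed by metis
qed

lemma smult_neg_one:
  assumes "x \<in> carrier M" shows "(\<ominus> \<one>) \<odot>\<^bsub>M\<^esub> x = \<ominus>\<^bsub>M\<^esub> x"
proof -
  have "(\<ominus> \<one>) \<odot>\<^bsub>M\<^esub> x \<oplus>\<^bsub>M\<^esub> x = \<zero>\<^bsub>M\<^esub>"
    using assms smult_l_distr[of "\<ominus> \<one>" \<one> x] by (simp add: R.l_neg)
  then show ?thesis
    using assms by (simp add: M.minus_equality)
qed

lemma smult_minus:
  assumes "a \<in> carrier R" "x \<in> carrier M" shows "a \<odot>\<^bsub>M\<^esub> (\<ominus>\<^bsub>M\<^esub> x) = \<ominus>\<^bsub>M\<^esub> (a \<odot>\<^bsub>M\<^esub> x)"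
proof -
  have "a \<odot>\<^bsub>M\<^esub> (\<ominus>\<^bsub>M\<^esub> x) \<oplus>\<^bsub>M\<^esub> a \<odot>\<^bsub>M\<^esub> x = \<zero>\<^bsub>M\<^esub>"
    using assms smult_r_distr[of a "\<ominus>\<^bsub>M\<^esub> x" x] by (simp add: M.l_neg)
  then show ?thesis using assms by (simp add: M.minus_equality)
qed

lemma rsubmoduleI:
  assumes "H \<subseteq> carrier M" "\<zero>\<^bsub>M\<^esub> \<in> H"
    "\<And>x y. \<lbrakk>x \<in> H; y \<in> H\<rbrakk> \<Longrightarrow> x \<oplus>\<^bsub>M\<^esub> y \<in> H"
    "\<And>a x. \<lbrakk>a \<in> carrier R; x \<in> H\<rbrakk> \<Longrightarrow> a \<odot>\<^bsub>M\<^esub> x \<in> H"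
  shows "submodule H R M"
proof -
  have "\<ominus>\<^bsub>M\<^esub> x \<in> H" if "x \<in> H" for x
    using assms(1) assms(4)[of "\<ominus> \<one>" x] that smult_neg_one[of x] by auto
  then show ?thesis
    using assms by (intro submodule.intro subgroup.intro submodule_axioms.intro) (auto simp: a_inv_def)
qed

lemma rsubmoduleD:
  assumes "submodule H R M"
  shows "H \<subseteq> carrier M" "\<zero>\<^bsub>M\<^esub> \<in> H"
    "\<And>x y. \<lbrakk>x \<in> H; y \<in> H\<rbrakk> \<Longrightarrow> x \<oplus>\<^bsub>M\<^esub> y \<in> H"
    "\<And>a x. \<lbrakk>a \<in> carrier R; x \<in> H\<rbrakk> \<Longrightarrow> a \<odot>\<^bsub>M\<^esub> x \<in> H"
    "\<And>x. x \<in> H \<Longrightarrow> \<ominus>\<^bsub>M\<^esub> x \<in> H"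
    "\<And>x y. \<lbrakk>x \<in> H; y \<in> H\<rbrakk> \<Longrightarrow> x \<ominus>\<^bsub>M\<^esub> y \<in> H"
proof -
  interpret H: submodule H R M by fact
  show 1: "H \<subseteq> carrier M" "\<zero>\<^bsub>M\<^esub> \<in> H"
    "\<And>x y. \<lbrakk>x \<in> H; y \<in> H\<rbrakk> \<Longrightarrow> x \<oplus>\<^bsub>M\<^esub> y \<in> H"
    "\<And>a x. \<lbrakk>a \<in> carrier R; x \<in> H\<rbrakk> \<Longrightarrow> a \<odot>\<^bsub>M\<^esub> x \<in> H"
    using H.subset H.one_closed H.m_closed H.smult_closed by auto
  show 2: "\<And>x. x \<in> H \<Longrightarrow> \<ominus>\<^bsub>M\<^esub> x \<in> H"
    using H.m_inv_closed by (simp add: a_inv_def)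
  show "\<And>x y. \<lbrakk>x \<in> H; y \<in> H\<rbrakk> \<Longrightarrow> x \<ominus>\<^bsub>M\<^esub> y \<in> H"
    using 1 2 by (simp add: a_minus_def)
qed

end

lemma rmod_homI:
  assumes "\<And>x. x \<in> carrier M \<Longrightarrow> f x \<in> carrier N"
    "\<And>x y. \<lbrakk>x \<in> carrier M; y \<in> carrier M\<rbrakk> \<Longrightarrow> f (x \<oplus>\<^bsub>M\<^esub> y) = f x \<oplus>\<^bsub>N\<^esub> f y"
    "\<And>a x. \<lbrakk>a \<in> carrier R; x \<in> carrier M\<rbrakk> \<Longrightarrow> f (a \<odot>\<^bsub>M\<^esub> x) = a \<odot>\<^bsub>N\<^esub> f x"
    "f \<in> extensional (carrier M)"
  shows "f \<in> rmod_hom R M N"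
  using assms by (auto simp: rmod_hom_def PiE_def)

lemma rmod_hom_restrictI:
  assumes "right_module R M"
    "\<And>x. x \<in> carrier M \<Longrightarrow> f x \<in> carrier N"
    "\<And>x y. \<lbrakk>x \<in> carrier M; y \<in> carrier M\<rbrakk> \<Longrightarrow> f (x \<oplus>\<^bsub>M\<^esub> y) = f x \<oplus>\<^bsub>N\<^esub> f y"
    "\<And>a x. \<lbrakk>a \<in> carrier R; x \<in> carrier M\<rbrakk> \<Longrightarrow> f (a \<odot>\<^bsub>M\<^esub> x) = a \<odot>\<^bsub>N\<^esub> f x"
  shows "(\<lambda>x\<in>carrier M. f x) \<in> rmod_hom R M N"
proof -
  interpret M: right_module R M by fact
  show ?thesis using assms(2-) by (intro rmod_homI) auto
qed

lemma
  assumes "f \<in> rmod_hom R M N"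
  shows hom_closed: "x \<in> carrier M \<Longrightarrow> f x \<in> carrier N"
    and hom_add: "\<lbrakk>x \<in> carrier M; y \<in> carrier M\<rbrakk> \<Longrightarrow> f (x \<oplus>\<^bsub>M\<^esub> y) = f x \<oplus>\<^bsub>N\<^esub> f y"
    and hom_smult: "\<lbrakk>a \<in> carrier R; x \<in> carrier M\<rbrakk> \<Longrightarrow> f (a \<odot>\<^bsub>M\<^esub> x) = a \<odot>\<^bsub>N\<^esub> f x"
    and hom_extensional: "f \<in> extensional (carrier M)"
    and hom_undefined: "x \<notin> carrier M \<Longrightarrow> f x = undefined"
  using assms by (auto simp: rmod_hom_def PiE_def extensional_def)

lemma hom_eqI:
  assumes "f \<in> rmod_hom R M N" "g \<in> rmod_hom R M N'" "\<And>x. x \<in> carrier M \<Longrightarrow> f x = g x"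
  shows "f = g"
  using assms by (intro extensionalityI[of _ "carrier M"]) (auto intro: hom_extensional)

lemma hom_zero:
  assumes "right_module R M" "right_module R N" "f \<in> rmod_hom R M N"
  shows "f \<zero>\<^bsub>M\<^esub> = \<zero>\<^bsub>N\<^esub>"
proof -
  interpret M: right_module R M by fact
  interpret N: right_module R N by fact
  have "f \<zero>\<^bsub>M\<^esub> \<oplus>\<^bsub>N\<^esub> f \<zero>\<^bsub>M\<^esub> = f \<zero>\<^bsub>M\<^esub>"
    using hom_add[OF assms(3), of "\<zero>\<^bsub>M\<^esub>" "\<zero>\<^bsub>M\<^esub>"] by simp
  then show ?thesis
    using N.M.add.r_cancel_one' hom_closed[OF assms(3)] M.M.zero_closed by metis
qed

lemma hom_neg:
  assumes "right_module R M" "right_module R N" "f \<in> rmod_hom R M N" "x \<in> carrier M"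
  shows "f (\<ominus>\<^bsub>M\<^esub> x) = \<ominus>\<^bsub>N\<^esub> f x"
proof -
  interpret M: right_module R M by fact
  interpret N: right_module R N by fact
  show ?thesis
    using assms hom_smult[OF assms(3), of "\<ominus>\<^bsub>R\<^esub> \<one>\<^bsub>R\<^esub>" x]
    by (simp add: M.smult_neg_one N.smult_neg_one hom_closed[OF assms(3)])
qed

lemma hom_minus:
  assumes "right_module R M" "right_module R N" "f \<in> rmod_hom R M N" "x \<in> carrier M" "y \<in> carrier M"
  shows "f (x \<ominus>\<^bsub>M\<^esub> y) = f x \<ominus>\<^bsub>N\<^esub> f y"
proof -
  interpret M: right_module R M by fact
  show ?thesis
    using assms by (simp add: a_minus_def hom_add[OF assms(3)] hom_neg[OF assms(1-3)])
qed

abbreviation rcomp :: "('a, 'b, 's) module_scheme \<Rightarrow> ('c \<Rightarrow> 'd) \<Rightarrow> ('b \<Rightarrow> 'c) \<Rightarrow> 'b \<Rightarrow> 'd"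
  where "rcomp M g f \<equiv> compose (carrier M) g f"

abbreviation rid :: "('a, 'b, 's) module_scheme \<Rightarrow> 'b \<Rightarrow> 'b"
  where "rid M \<equiv> (\<lambda>x\<in>carrier M. x)"

definition hzero :: "('a, 'b, 's) module_scheme \<Rightarrow> ('a, 'c, 't) module_scheme \<Rightarrow> 'b \<Rightarrow> 'c"
  where "hzero M N = (\<lambda>x\<in>carrier M. \<zero>\<^bsub>N\<^esub>)"

definition hadd :: "('a, 'b, 's) module_scheme \<Rightarrow> ('a, 'c, 't) module_scheme \<Rightarrow>
    ('b \<Rightarrow> 'c) \<Rightarrow> ('b \<Rightarrow> 'c) \<Rightarrow> 'b \<Rightarrow> 'c"
  where "hadd M N f g = (\<lambda>x\<in>carrier M. f x \<oplus>\<^bsub>N\<^esub> g x)"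

lemma hzero_apply [simp]: "x \<in> carrier M \<Longrightarrow> hzero M N x = \<zero>\<^bsub>N\<^esub>"
  and hadd_apply [simp]: "x \<in> carrier M \<Longrightarrow> hadd M N f g x = f x \<oplus>\<^bsub>N\<^esub> g x"
  by (simp_all add: hzero_def hadd_def)

lemma rcomp_hom:
  assumes "right_module R L" "f \<in> rmod_hom R L M" "g \<in> rmod_hom R M N"
  shows "rcomp L g f \<in> rmod_hom R L N"
proof -
  interpret L: right_module R L by fact
  show ?thesis
    by (intro rmod_homI) (auto simp: compose_eq hom_closed[OF assms(2)] hom_closed[OF assms(3)]
      hom_add[OF assms(2)] hom_add[OF assms(3)] hom_smult[OF assms(2)] hom_smult[OF assms(3)])
qed

lemma rid_hom:
  assumes "right_module R M" shows "rid M \<in> rmod_hom R M M"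
proof -
  interpret M: right_module R M by fact
  show ?thesis by (intro rmod_homI) auto
qed

lemma hzero_hom:
  assumes "right_module R M" "right_module R N" shows "hzero M N \<in> rmod_hom R M N"
proof -
  interpret M: right_module R M by fact
  interpret N: right_module R N by fact
  show ?thesis by (intro rmod_homI) (auto simp: hzero_def)
qed

lemma hadd_hom:
  assumes "right_module R M" "right_module R N" "f \<in> rmod_hom R M N" "g \<in> rmod_hom R M N"
  shows "hadd M N f g \<in> rmod_hom R M N"
proof -
  interpret M: right_module R M by fact
  interpret N: right_module R N by fact
  show ?thesis
    by (intro rmod_homI) (auto simp: hadd_def hom_closed[OF assms(3)] hom_closed[OF assms(4)]
      hom_add[OF assms(3)] hom_add[OF assms(4)] hom_smult[OF assms(3)] hom_smult[OF assms(4)]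
      N.smult_r_distr N.M.a_ac)
qed

lemma hneg_hom:
  assumes M: "right_module R M" and N: "right_module R N" and f: "f \<in> rmod_hom R M N"
  shows "(\<lambda>x\<in>carrier M. \<ominus>\<^bsub>N\<^esub> f x) \<in> rmod_hom R M N"
proof -
  interpret N: right_module R N by fact
  show ?thesis
    by (rule rmod_hom_restrictI[OF M])
      (simp_all add: hom_closed[OF f] hom_add[OF f] hom_smult[OF f] N.smult_minus N.M.minus_add)
qed

lemma rcomp_rid:
  assumes "f \<in> rmod_hom R M N"
  shows "rcomp M f (rid M) = f" "rcomp M (rid N) f = f"
  using hom_closed[OF assms] hom_undefined[OF assms] by (auto simp: compose_def fun_eq_iff)

lemma bij_hom_inverse:
  assumes "right_module R M" and f: "f \<in> rmod_hom R M N" and b: "bij_betw f (carrier M) (carrier N)"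
  obtains g where "g \<in> rmod_hom R N M"
    "\<And>x. x \<in> carrier M \<Longrightarrow> g (f x) = x" "\<And>y. y \<in> carrier N \<Longrightarrow> f (g y) = y"
proof -
  interpret M: right_module R M by fact
  define g where "g = (\<lambda>y\<in>carrier N. inv_into (carrier M) f y)"
  have gc: "g y \<in> carrier M" and fg: "f (g y) = y" if "y \<in> carrier N" for y
    using that b by (auto simp: g_def bij_betw_def intro: inv_into_into f_inv_into_f)
  have gf: "g (f x) = x" if "x \<in> carrier M" for x
    using that b hom_closed[OF f] by (auto simp: g_def bij_betw_def)
  have ga: "g (x \<oplus>\<^bsub>N\<^esub> y) = g x \<oplus>\<^bsub>M\<^esub> g y" if "x \<in> carrier N" "y \<in> carrier N" for x y
    using gf[of "g x \<oplus>\<^bsub>M\<^esub> g y"] that gc by (simp add: hom_add[OF f] fg)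
  have gs: "g (a \<odot>\<^bsub>N\<^esub> y) = a \<odot>\<^bsub>M\<^esub> g y" if "a \<in> carrier R" "y \<in> carrier N" for a y
    using gf[of "a \<odot>\<^bsub>M\<^esub> g y"] that gc by (simp add: hom_smult[OF f] fg)
  have "g \<in> rmod_hom R N M"
    by (intro rmod_homI gc ga gs) (auto simp: g_def)
  then show thesis using that gf fg by blast
qed

lemma rmod_isoE:
  assumes "right_module R M" "rmod_iso R M N"
  obtains f g where "f \<in> rmod_hom R M N" "g \<in> rmod_hom R N M"
    "\<And>x. x \<in> carrier M \<Longrightarrow> g (f x) = x" "\<And>y. y \<in> carrier N \<Longrightarrow> f (g y) = y"
  using assms bij_hom_inverse unfolding rmod_iso_def by metis

lemma rmod_isoI:
  assumes "f \<in> rmod_hom R M N" "\<And>y. y \<in> carrier N \<Longrightarrow> g y \<in> carrier M"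
    "\<And>x. x \<in> carrier M \<Longrightarrow> g (f x) = x" "\<And>y. y \<in> carrier N \<Longrightarrow> f (g y) = y"
  shows "rmod_iso R M N"
  unfolding rmod_iso_def using assms
  by (intro bexI[of _ f] bij_betw_byWitness[of _ g]) (auto intro: hom_closed)

lemma bij_homI:
  assumes "f \<in> rmod_hom R M N" "\<And>y. y \<in> carrier N \<Longrightarrow> g y \<in> carrier M"
    "\<And>x. x \<in> carrier M \<Longrightarrow> g (f x) = x" "\<And>y. y \<in> carrier N \<Longrightarrow> f (g y) = y"
  shows "bij_betw f (carrier M) (carrier N)"
  using assms by (intro bij_betw_byWitness[of _ g]) (auto intro: hom_closed)

lemma hom_bijI:
  assumes M: "right_module R M" and N: "right_module R N" and f: "f \<in> rmod_hom R M N"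
    and ker: "\<And>x. \<lbrakk>x \<in> carrier M; f x = \<zero>\<^bsub>N\<^esub>\<rbrakk> \<Longrightarrow> x = \<zero>\<^bsub>M\<^esub>"
    and surj: "\<And>y. y \<in> carrier N \<Longrightarrow> \<exists>x\<in>carrier M. f x = y"
  shows "bij_betw f (carrier M) (carrier N)"
  unfolding bij_betw_def
proof
  interpret M: right_module R M by fact
  interpret N: right_module R N by fact
  show "inj_on f (carrier M)"
  proof (rule inj_onI)
    fix x y assume x: "x \<in> carrier M" and y: "y \<in> carrier M" and xy: "f x = f y"
    have "f (x \<ominus>\<^bsub>M\<^esub> y) = \<zero>\<^bsub>N\<^esub>"
      using hom_minus[OF M N f x y] hom_closed[OF f y] xy by (simp add: a_minus_def N.M.r_neg)
    then have "x \<ominus>\<^bsub>M\<^esub> y = \<zero>\<^bsub>M\<^esub>" using x y by (intro ker) simp_all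
    then show "x = y" using x y M.M.minus_equality[of "x" "\<ominus>\<^bsub>M\<^esub> y"] by (simp add: a_minus_def)
  qed
  show "f ` carrier M = carrier N" using surj hom_closed[OF f] by blast
qed

text \<open>Sums of maps \<open>V \<rightarrow> U \<rightarrow> W\<close> whose second factor lies in \<open>S\<close>, generated one summand at a
  time: properties of such a sum are then proved by induction, without indexed sums.\<close>

inductive_set through ::
  "('a, 'r) ring_scheme \<Rightarrow> ('a, 'u, 'i) module_scheme \<Rightarrow> ('a, 'v, 'j) module_scheme \<Rightarrow>
    ('a, 'w, 'k) module_scheme \<Rightarrow> ('u \<Rightarrow> 'w) set \<Rightarrow> ('v \<Rightarrow> 'w) set"
  for R U V W S where
  zero: "hzero V W \<in> through R U V W S"
| step: "\<lbrakk>f \<in> through R U V W S; a \<in> rmod_hom R V U; s \<in> S\<rbrakk> \<Longrightarrow>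
    hadd V W f (rcomp V s a) \<in> through R U V W S"

abbreviation through_all where "through_all R U V W \<equiv> through R U V W (rmod_hom R U W)"

text \<open>For right modules this says that \<open>V\<close> is a direct summand of some \<open>U\<^sup>n\<close>.\<close>

definition in_add ::
  "('a, 'r) ring_scheme \<Rightarrow> ('a, 'u, 'i) module_scheme \<Rightarrow> ('a, 'v, 'j) module_scheme \<Rightarrow> bool"
  where "in_add R U V \<longleftrightarrow> rid V \<in> through_all R U V V"

lemma through_hom:
  assumes "right_module R V" "right_module R W" "S \<subseteq> rmod_hom R U W" "f \<in> through R U V W S"
  shows "f \<in> rmod_hom R V W"
  using assms(4)
proof induction
  case zero
  then show ?case using assms by (simp add: hzero_hom)
next
  case (step f a s)
  then show ?case using assms by (intro hadd_hom rcomp_hom) auto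
qed

lemma through_single:
  assumes "right_module R V" "right_module R W" "S \<subseteq> rmod_hom R U W"
    "a \<in> rmod_hom R V U" "s \<in> S"
  shows "rcomp V s a \<in> through R U V W S"
proof -
  interpret W: right_module R W by fact
  have h: "rcomp V s a \<in> rmod_hom R V W" using assms by (intro rcomp_hom) auto
  have "hadd V W (hzero V W) (rcomp V s a) = rcomp V s a"
    by (rule hom_eqI[OF hadd_hom[OF assms(1,2) hzero_hom[OF assms(1,2)] h] h])
      (use hom_closed[OF h] in auto)
  then show ?thesis using through.step[OF through.zero assms(4,5)] by metis
qed

lemma through_add:
  assumes "right_module R V" "right_module R W" "S \<subseteq> rmod_hom R U W"
    "f \<in> through R U V W S" "g \<in> through R U V W S"
  shows "hadd V W f g \<in> through R U V W S"
  using assms(5)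
proof induction
  case zero
  interpret W: right_module R W by fact
  have f: "f \<in> rmod_hom R V W" using assms by (intro through_hom[OF _ _ _ assms(4)])
  have "hadd V W f (hzero V W) = f"
    by (rule hom_eqI[OF hadd_hom[OF assms(1,2) f hzero_hom[OF assms(1,2)]] f])
      (use hom_closed[OF f] in auto)
  then show ?case using assms by simp
next
  case (step g a s)
  interpret W: right_module R W by fact
  have f: "f \<in> rmod_hom R V W" and g: "g \<in> rmod_hom R V W"
    using assms step by (auto intro: through_hom)
  have h: "rcomp V s a \<in> rmod_hom R V W" using assms step by (intro rcomp_hom) auto
  have "hadd V W f (hadd V W g (rcomp V s a)) = hadd V W (hadd V W f g) (rcomp V s a)"
    by (rule hom_eqI[of _ R V W _ W]) (use assms f g h hom_closed[OF f] hom_closed[OF g] hom_closed[OF h]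
      in \<open>auto intro!: hadd_hom simp: W.M.a_assoc\<close>)
  then show ?case using through.step[OF step.IH step.hyps(2,3)] by simp
qed

text \<open>Composition with fixed maps on either side distributes over sums, so the composite lies in
  every set \<open>X\<close> that is closed under sums and contains the composites of the single summands.\<close>

lemma through_comp:
  assumes V: "right_module R V" "right_module R W" "right_module R V'" "right_module R W'"
    and S: "S \<subseteq> rmod_hom R U W"
    and d: "d \<in> rmod_hom R V' V" and c: "c \<in> rmod_hom R W W'"
    and X: "X \<subseteq> rmod_hom R V' W'"
    and X0: "hzero V' W' \<in> X" and Xadd: "\<And>f g. \<lbrakk>f \<in> X; g \<in> X\<rbrakk> \<Longrightarrow> hadd V' W' f g \<in> X"
    and Xs: "\<And>a s. \<lbrakk>a \<in> rmod_hom R V U; s \<in> S\<rbrakk> \<Longrightarrow> rcomp V' c (rcomp V' (rcomp V s a) d) \<in> X"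
    and f: "f \<in> through R U V W S"
  shows "rcomp V' c (rcomp V' f d) \<in> X"
  using f
proof induction
  case zero
  have "rcomp V' c (rcomp V' (hzero V W) d) = hzero V' W'"
    using hom_closed[OF d] hom_zero[OF V(2,4) c] by (auto simp: compose_def hzero_def fun_eq_iff)
  then show ?case using X0 by simp
next
  case (step f a s)
  have f: "f \<in> rmod_hom R V W" using V S step by (auto intro: through_hom)
  have h: "rcomp V s a \<in> rmod_hom R V W" using V S step by (intro rcomp_hom) auto
  have "rcomp V' c (rcomp V' (hadd V W f (rcomp V s a)) d) =
    hadd V' W' (rcomp V' c (rcomp V' f d)) (rcomp V' c (rcomp V' (rcomp V s a) d))"
    using hom_closed[OF d] hom_closed[OF f] hom_closed[OF h]
    by (auto simp: compose_def hadd_def fun_eq_iff hom_add[OF c])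
  then show ?case using Xadd[OF step.IH Xs[OF step.hyps(2,3)]] by simp
qed

lemma through_conj:
  assumes V: "right_module R U" "right_module R V" "right_module R W" "right_module R V'" "right_module R W'"
    and S: "S \<subseteq> rmod_hom R U W" and S': "S' \<subseteq> rmod_hom R U W'"
    and d: "d \<in> rmod_hom R V' V" and c: "c \<in> rmod_hom R W W'"
    and SS': "\<And>s. s \<in> S \<Longrightarrow> rcomp U c s \<in> S'"
    and f: "f \<in> through R U V W S"
  shows "rcomp V' c (rcomp V' f d) \<in> through R U V' W' S'"
proof (rule through_comp[OF V(2,3,4,5) S d c _ _ _ _ f])
  show "through R U V' W' S' \<subseteq> rmod_hom R V' W'" using V S' by (auto intro: through_hom)
  show "hzero V' W' \<in> through R U V' W' S'" by (rule through.zero)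
  show "hadd V' W' f g \<in> through R U V' W' S'"
    if "f \<in> through R U V' W' S'" "g \<in> through R U V' W' S'" for f g
    using that V S' by (intro through_add)
  fix a s assume a: "a \<in> rmod_hom R V U" and s: "s \<in> S"
  have "rcomp V' c (rcomp V' (rcomp V s a) d) = rcomp V' (rcomp U c s) (rcomp V' a d)"
    using hom_closed[OF d] hom_closed[OF a] by (auto simp: compose_def fun_eq_iff)
  then show "rcomp V' c (rcomp V' (rcomp V s a) d) \<in> through R U V' W' S'"
    using through_single[OF V(4,5) S' rcomp_hom[OF V(4) d a] SS'[OF s]] by simp
qed

lemma through_all_conj:
  assumes "right_module R U" "right_module R V" "right_module R W" "right_module R V'" "right_module R W'"
    and "d \<in> rmod_hom R V' V" and "c \<in> rmod_hom R W W'" and "f \<in> through_all R U V W"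
  shows "rcomp V' c (rcomp V' f d) \<in> through_all R U V' W'"
  by (rule through_conj[OF assms(1-5) subset_refl subset_refl assms(6,7) _ assms(8)])
    (rule rcomp_hom[OF assms(1) _ assms(7)])

text \<open>Inserting the identity of \<open>U\<close>, a sum of maps \<open>U \<rightarrow> U' \<rightarrow> U\<close>, in the middle of each summand
  \<open>V \<rightarrow> U \<rightarrow> W\<close> turns it into a sum of maps through \<open>U'\<close>.\<close>

lemma through_change:
  assumes V: "right_module R U" "right_module R V" "right_module R W" "right_module R U'"
    and a: "in_add R U' U" and f: "f \<in> through_all R U V W"
  shows "f \<in> through_all R U' V W"
proof -
  have fh: "f \<in> rmod_hom R V W" by (rule through_hom[OF V(2,3) subset_refl f])
  have "rcomp V (rid W) (rcomp V f (rid V)) \<in> through_all R U' V W"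
  proof (rule through_comp[OF V(2,3,2,3) subset_refl rid_hom[OF V(2)] rid_hom[OF V(3)] _ _ _ _ f])
    show "through_all R U' V W \<subseteq> rmod_hom R V W" using V by (auto intro: through_hom)
    show "hzero V W \<in> through_all R U' V W" by (rule through.zero)
    show "hadd V W f g \<in> through_all R U' V W"
      if "f \<in> through_all R U' V W" "g \<in> through_all R U' V W" for f g
      using that V by (intro through_add) auto
    fix b s assume b: "b \<in> rmod_hom R V U" and s: "s \<in> rmod_hom R U W"
    have "rcomp V s (rcomp V (rid U) b) \<in> through_all R U' V W"
      using through_all_conj[OF V(4,1,1,2,3) b s] a by (simp add: in_add_def)
    moreover have "rcomp V (rid W) (rcomp V (rcomp V s b) (rid V)) = rcomp V s (rcomp V (rid U) b)"
      using hom_closed[OF b] hom_closed[OF s] by (auto simp: compose_def fun_eq_iff)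
    ultimately show "rcomp V (rid W) (rcomp V (rcomp V s b) (rid V)) \<in> through_all R U' V W" by simp
  qed
  then show ?thesis by (simp only: rcomp_rid[OF fh])
qed

lemma in_add_trans:
  assumes "right_module R U" "right_module R V" "right_module R W"
    "in_add R U V" "in_add R V W"
  shows "in_add R U W"
  using through_change[OF assms(2,3,3,1,4)] assms(5) by (simp add: in_add_def)

lemma in_add_retract:
  assumes "right_module R U" "right_module R V" "a \<in> rmod_hom R V U" "b \<in> rmod_hom R U V"
    "\<And>x. x \<in> carrier V \<Longrightarrow> b (a x) = x"
  shows "in_add R U V"
proof -
  have "rcomp V b a = rid V" using assms(5) by (auto simp: compose_def fun_eq_iff)
  then show ?thesis
    using through_single[OF assms(2,2) subset_refl assms(3,4)] by (simp add: in_add_def)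
qed

lemma in_add_refl: "right_module R U \<Longrightarrow> in_add R U U"
  by (rule in_add_retract[of _ _ _ "rid U" "rid U"]) (auto intro: rid_hom)

lemma in_add_iso:
  assumes "right_module R U" "right_module R V" "rmod_iso R U V"
  shows "in_add R U V" "in_add R V U"
proof -
  obtain f g where fg: "f \<in> rmod_hom R U V" "g \<in> rmod_hom R V U"
    "\<And>x. x \<in> carrier U \<Longrightarrow> g (f x) = x" "\<And>y. y \<in> carrier V \<Longrightarrow> f (g y) = y"
    using assms(1,3) by (rule rmod_isoE) blast
  show "in_add R U V" by (rule in_add_retract[OF assms(1,2) fg(2,1,4)])
  show "in_add R V U" by (rule in_add_retract[OF assms(2,1) fg(1,2,3)])
qed

section \<open>Constructions of modules\<close>

lemma right_moduleI:
  assumes "ring R"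
    "\<And>x y. \<lbrakk>x \<in> carrier M; y \<in> carrier M\<rbrakk> \<Longrightarrow> x \<oplus>\<^bsub>M\<^esub> y \<in> carrier M"
    "\<zero>\<^bsub>M\<^esub> \<in> carrier M"
    "\<And>x y z. \<lbrakk>x \<in> carrier M; y \<in> carrier M; z \<in> carrier M\<rbrakk> \<Longrightarrow>
      (x \<oplus>\<^bsub>M\<^esub> y) \<oplus>\<^bsub>M\<^esub> z = x \<oplus>\<^bsub>M\<^esub> (y \<oplus>\<^bsub>M\<^esub> z)"
    "\<And>x y. \<lbrakk>x \<in> carrier M; y \<in> carrier M\<rbrakk> \<Longrightarrow> x \<oplus>\<^bsub>M\<^esub> y = y \<oplus>\<^bsub>M\<^esub> x"
    "\<And>x. x \<in> carrier M \<Longrightarrow> \<zero>\<^bsub>M\<^esub> \<oplus>\<^bsub>M\<^esub> x = x"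
    "\<And>x. x \<in> carrier M \<Longrightarrow> \<exists>y \<in> carrier M. y \<oplus>\<^bsub>M\<^esub> x = \<zero>\<^bsub>M\<^esub>"
    "\<And>a x. \<lbrakk>a \<in> carrier R; x \<in> carrier M\<rbrakk> \<Longrightarrow> a \<odot>\<^bsub>M\<^esub> x \<in> carrier M"
    "\<And>a b x. \<lbrakk>a \<in> carrier R; b \<in> carrier R; x \<in> carrier M\<rbrakk> \<Longrightarrow>
      (a \<oplus>\<^bsub>R\<^esub> b) \<odot>\<^bsub>M\<^esub> x = a \<odot>\<^bsub>M\<^esub> x \<oplus>\<^bsub>M\<^esub> b \<odot>\<^bsub>M\<^esub> x"
    "\<And>a x y. \<lbrakk>a \<in> carrier R; x \<in> carrier M; y \<in> carrier M\<rbrakk> \<Longrightarrow>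
      a \<odot>\<^bsub>M\<^esub> (x \<oplus>\<^bsub>M\<^esub> y) = a \<odot>\<^bsub>M\<^esub> x \<oplus>\<^bsub>M\<^esub> a \<odot>\<^bsub>M\<^esub> y"
    "\<And>a b x. \<lbrakk>a \<in> carrier R; b \<in> carrier R; x \<in> carrier M\<rbrakk> \<Longrightarrow>
      (a \<otimes>\<^bsub>R\<^esub> b) \<odot>\<^bsub>M\<^esub> x = b \<odot>\<^bsub>M\<^esub> (a \<odot>\<^bsub>M\<^esub> x)"
    "\<And>x. x \<in> carrier M \<Longrightarrow> \<one>\<^bsub>R\<^esub> \<odot>\<^bsub>M\<^esub> x = x"
  shows "right_module R M"
proof (rule right_module.intro[OF assms(1)])
  show "abelian_group M" by (rule abelian_groupI) (use assms(2-7) in blast)+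
  show "right_module_axioms R M" by (rule right_module_axioms.intro) (use assms(8-12) in blast)+
qed

lemma regular_simps [simp]:
  "carrier (regular_module R) = carrier R" "zero (regular_module R) = zero R"
  "add (regular_module R) = add R" "smult (regular_module R) a x = x \<otimes>\<^bsub>R\<^esub> a"
  by (simp_all add: regular_module_def)

lemma regular_right_module:
  assumes "ring R" shows "right_module R (regular_module R)"
proof -
  interpret ring R by fact
  show ?thesis
    by (rule right_moduleI[OF assms]) (auto simp: a_ac l_distr r_distr m_assoc
      intro!: bexI[of _ "\<ominus>\<^bsub>R\<^esub> _"] l_neg)
qed

lemma sum2_simps [simp]:
  "carrier (rmod_sum2 M N) = carrier M \<times> carrier N" "zero (rmod_sum2 M N) = (\<zero>\<^bsub>M\<^esub>, \<zero>\<^bsub>N\<^esub>)"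
  "add (rmod_sum2 M N) x y = (fst x \<oplus>\<^bsub>M\<^esub> fst y, snd x \<oplus>\<^bsub>N\<^esub> snd y)"
  "smult (rmod_sum2 M N) a x = (a \<odot>\<^bsub>M\<^esub> fst x, a \<odot>\<^bsub>N\<^esub> snd x)"
  by (simp_all add: rmod_sum2_def)

lemma sum2_right_module:
  assumes "right_module R M" "right_module R N" shows "right_module R (rmod_sum2 M N)"
proof -
  interpret M: right_module R M by fact
  interpret N: right_module R N by fact
  show ?thesis
  proof (rule right_moduleI)
    show "ring R" by (rule M.R.ring_axioms)
    fix x assume x: "x \<in> carrier (rmod_sum2 M N)"
    show "\<exists>y\<in>carrier (rmod_sum2 M N). y \<oplus>\<^bsub>rmod_sum2 M N\<^esub> x = \<zero>\<^bsub>rmod_sum2 M N\<^esub>"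
      by (rule bexI[of _ "(\<ominus>\<^bsub>M\<^esub> fst x, \<ominus>\<^bsub>N\<^esub> snd x)"]) (use x in \<open>auto simp: M.M.l_neg N.M.l_neg\<close>)
  qed (auto simp: M.M.a_ac N.M.a_ac M.smult_l_distr N.smult_l_distr M.smult_r_distr N.smult_r_distr
      M.smult_assoc N.smult_assoc)
qed

lemma sum_simps [simp]:
  "carrier (rmod_sum n M) = (\<Pi>\<^sub>E i\<in>{..<n}. carrier (M i))"
  "zero (rmod_sum n M) = (\<lambda>i\<in>{..<n}. \<zero>\<^bsub>M i\<^esub>)"
  "add (rmod_sum n M) x y = (\<lambda>i\<in>{..<n}. x i \<oplus>\<^bsub>M i\<^esub> y i)"
  "smult (rmod_sum n M) a x = (\<lambda>i\<in>{..<n}. a \<odot>\<^bsub>M i\<^esub> x i)"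
  by (simp_all add: rmod_sum_def)

lemma sum_right_module:
  assumes "ring R" "\<And>i. i < n \<Longrightarrow> right_module R (M i)" shows "right_module R (rmod_sum n M)"
proof (rule right_moduleI[OF assms(1)])
  note ag = right_module.axioms(2)[OF assms(2)]
  note C = abelian_groupE[OF ag]
  note S = right_module.smult_closed[OF assms(2)]
  have mem: "x i \<in> carrier (M i)" if "x \<in> carrier (rmod_sum n M)" "i < n" for x i
    using that by (auto simp: PiE_def)
  have eqI: "x = y" if "x \<in> extensional {..<n}" "y \<in> extensional {..<n}" "\<And>i. i < n \<Longrightarrow> x i = y i" for x y
    using that by (intro extensionalityI[of x "{..<n}" y]) auto
  have ext: "x \<in> extensional {..<n}" if "x \<in> carrier (rmod_sum n M)" for x
    using that by (auto simp: PiE_def)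
  fix x y z a b assume x: "x \<in> carrier (rmod_sum n M)"
  have "(\<lambda>i\<in>{..<n}. \<ominus>\<^bsub>M i\<^esub> x i) \<in> carrier (rmod_sum n M)"
    using abelian_group.a_inv_closed[OF ag mem[OF x]] by auto
  moreover have "(\<lambda>i\<in>{..<n}. \<ominus>\<^bsub>M i\<^esub> x i) \<oplus>\<^bsub>rmod_sum n M\<^esub> x = \<zero>\<^bsub>rmod_sum n M\<^esub>"
    using abelian_group.l_neg[OF ag mem[OF x]] by (auto simp: fun_eq_iff)
  ultimately show "\<exists>y\<in>carrier (rmod_sum n M). y \<oplus>\<^bsub>rmod_sum n M\<^esub> x = \<zero>\<^bsub>rmod_sum n M\<^esub>" by blast
  show "\<zero>\<^bsub>rmod_sum n M\<^esub> \<oplus>\<^bsub>rmod_sum n M\<^esub> x = x"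
    using C(5)[OF _ mem[OF x]] ext[OF x] by (intro eqI) auto
  show "\<one>\<^bsub>R\<^esub> \<odot>\<^bsub>rmod_sum n M\<^esub> x = x"
    using right_module.smult_one[OF assms(2) mem[OF x]] ext[OF x] by (intro eqI) auto
  { assume a: "a \<in> carrier R"
    show "a \<odot>\<^bsub>rmod_sum n M\<^esub> x \<in> carrier (rmod_sum n M)"
      using S[OF _ a mem[OF x]] by auto
    { assume b: "b \<in> carrier R"
      show "(a \<oplus>\<^bsub>R\<^esub> b) \<odot>\<^bsub>rmod_sum n M\<^esub> x = a \<odot>\<^bsub>rmod_sum n M\<^esub> x \<oplus>\<^bsub>rmod_sum n M\<^esub> b \<odot>\<^bsub>rmod_sum n M\<^esub> x"
        using right_module.smult_l_distr[OF assms(2) a b mem[OF x]] by (intro eqI) auto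
      show "(a \<otimes>\<^bsub>R\<^esub> b) \<odot>\<^bsub>rmod_sum n M\<^esub> x = b \<odot>\<^bsub>rmod_sum n M\<^esub> (a \<odot>\<^bsub>rmod_sum n M\<^esub> x)"
        using right_module.smult_assoc[OF assms(2) a b mem[OF x]] by (intro eqI) auto }
    assume y: "y \<in> carrier (rmod_sum n M)"
    show "a \<odot>\<^bsub>rmod_sum n M\<^esub> (x \<oplus>\<^bsub>rmod_sum n M\<^esub> y) = a \<odot>\<^bsub>rmod_sum n M\<^esub> x \<oplus>\<^bsub>rmod_sum n M\<^esub> a \<odot>\<^bsub>rmod_sum n M\<^esub> y"
      using right_module.smult_r_distr[OF assms(2) a mem[OF x] mem[OF y]] by (intro eqI) auto }
  assume y: "y \<in> carrier (rmod_sum n M)"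
  show "x \<oplus>\<^bsub>rmod_sum n M\<^esub> y \<in> carrier (rmod_sum n M)"
    using C(1)[OF _ mem[OF x] mem[OF y]] by auto
  show "x \<oplus>\<^bsub>rmod_sum n M\<^esub> y = y \<oplus>\<^bsub>rmod_sum n M\<^esub> x"
    using C(4)[OF _ mem[OF x] mem[OF y]] by (intro eqI) auto
  assume z: "z \<in> carrier (rmod_sum n M)"
  show "x \<oplus>\<^bsub>rmod_sum n M\<^esub> y \<oplus>\<^bsub>rmod_sum n M\<^esub> z = x \<oplus>\<^bsub>rmod_sum n M\<^esub> (y \<oplus>\<^bsub>rmod_sum n M\<^esub> z)"
    using C(3)[OF _ mem[OF x] mem[OF y] mem[OF z]] by (intro eqI) auto
next
  show "\<zero>\<^bsub>rmod_sum n M\<^esub> \<in> carrier (rmod_sum n M)"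
    using abelian_groupE(2)[OF right_module.axioms(2)[OF assms(2)]] by auto
qed

text \<open>The structure of \<open>M\<close> transported along a map \<open>c\<close> whose fibres are the classes of a congruence:
  for the coset map this is a quotient module, for an injective \<open>c\<close> a copy of \<open>M\<close> on another
  carrier.\<close>

definition pushforward :: "('b \<Rightarrow> 'c) \<Rightarrow> ('a, 'b, 's) module_scheme \<Rightarrow> ('a, 'c) module"
  where "pushforward c M = \<lparr>carrier = c ` carrier M, mult = undefined, one = undefined,
    zero = c \<zero>\<^bsub>M\<^esub>,
    add = (\<lambda>x y. c (inv_into (carrier M) c x \<oplus>\<^bsub>M\<^esub> inv_into (carrier M) c y)),
    smult = (\<lambda>a x. c (a \<odot>\<^bsub>M\<^esub> inv_into (carrier M) c x))\<rparr>"

lemma pushforward: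
  assumes "right_module R M"
    and add: "\<And>x y x' y'. \<lbrakk>x \<in> carrier M; y \<in> carrier M; x' \<in> carrier M; y' \<in> carrier M;
      c x = c x'; c y = c y'\<rbrakk> \<Longrightarrow> c (x \<oplus>\<^bsub>M\<^esub> y) = c (x' \<oplus>\<^bsub>M\<^esub> y')"
    and smult: "\<And>a x x'. \<lbrakk>a \<in> carrier R; x \<in> carrier M; x' \<in> carrier M; c x = c x'\<rbrakk> \<Longrightarrow>
      c (a \<odot>\<^bsub>M\<^esub> x) = c (a \<odot>\<^bsub>M\<^esub> x')"
  shows "right_module R (pushforward c M)"
    and "(\<lambda>x\<in>carrier M. c x) \<in> rmod_hom R M (pushforward c M)"
    and "(\<lambda>x\<in>carrier M. c x) ` carrier M = carrier (pushforward c M)"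
proof -
  interpret M: right_module R M by fact
  let ?N = "pushforward c M"
  let ?r = "inv_into (carrier M) c"
  have r: "?r (c x) \<in> carrier M" "c (?r (c x)) = c x" if "x \<in> carrier M" for x
    using that by (auto intro: inv_into_into f_inv_into_f)
  have C: "carrier ?N = c ` carrier M" and Z: "\<zero>\<^bsub>?N\<^esub> = c \<zero>\<^bsub>M\<^esub>" by (simp_all add: pushforward_def)
  have A: "c x \<oplus>\<^bsub>?N\<^esub> c y = c (x \<oplus>\<^bsub>M\<^esub> y)" if "x \<in> carrier M" "y \<in> carrier M" for x y
    using add[of "?r (c x)" "?r (c y)" x y] r that by (simp add: pushforward_def)
  have S: "a \<odot>\<^bsub>?N\<^esub> c x = c (a \<odot>\<^bsub>M\<^esub> x)" if "a \<in> carrier R" "x \<in> carrier M" for a x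
    using smult[of a "?r (c x)" x] r that by (simp add: pushforward_def)
  show "right_module R ?N"
  proof (rule right_moduleI[OF M.R.ring_axioms], unfold C)
    fix x assume "x \<in> c ` carrier M"
    then obtain u where u: "x = c u" "u \<in> carrier M" by blast
    show "\<exists>y\<in>c ` carrier M. y \<oplus>\<^bsub>?N\<^esub> x = \<zero>\<^bsub>?N\<^esub>"
      by (rule bexI[of _ "c (\<ominus>\<^bsub>M\<^esub> u)"]) (use u in \<open>auto simp: A Z M.M.l_neg\<close>)
  qed (auto simp: A Z S M.M.a_ac M.smult_l_distr M.smult_r_distr M.smult_assoc)
  show "(\<lambda>x\<in>carrier M. c x) \<in> rmod_hom R M (pushforward c M)"
    by (rule rmod_hom_restrictI[OF assms(1)]) (auto simp: A S C)
  show "(\<lambda>x\<in>carrier M. c x) ` carrier M = carrier (pushforward c M)"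
    by (auto simp: C)
qed

lemma quotient_module_exists:
  fixes M :: "('a, 'b, 's) module_scheme"
  assumes "right_module R M" "submodule N R M"
  obtains Q :: "('a, 'b set) module" and q where "right_module R Q" "q \<in> rmod_hom R M Q"
    "q ` carrier M = carrier Q" "{x \<in> carrier M. q x = \<zero>\<^bsub>Q\<^esub>} = N"
proof -
  interpret M: right_module R M by fact
  note N = M.rsubmoduleD[OF assms(2)]
  define c where "c = (\<lambda>x. {y \<in> carrier M. y \<ominus>\<^bsub>M\<^esub> x \<in> N})"
  have c_eq: "c x = c y \<longleftrightarrow> x \<ominus>\<^bsub>M\<^esub> y \<in> N" if x: "x \<in> carrier M" and y: "y \<in> carrier M" for x y
  proof
    assume "c x = c y"
    moreover have "x \<in> c x" using x N(2) by (simp add: c_def a_minus_def M.M.r_neg)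
    ultimately show "x \<ominus>\<^bsub>M\<^esub> y \<in> N" by (simp add: c_def)
  next
    assume xy: "x \<ominus>\<^bsub>M\<^esub> y \<in> N"
    have "z \<ominus>\<^bsub>M\<^esub> x \<in> N \<longleftrightarrow> z \<ominus>\<^bsub>M\<^esub> y \<in> N" if z: "z \<in> carrier M" for z
    proof -
      have u: "z \<ominus>\<^bsub>M\<^esub> x \<in> carrier M" and w: "x \<ominus>\<^bsub>M\<^esub> y \<in> carrier M" using x y z by simp_all
      have "(z \<ominus>\<^bsub>M\<^esub> x) \<oplus>\<^bsub>M\<^esub> (x \<ominus>\<^bsub>M\<^esub> y) = z \<oplus>\<^bsub>M\<^esub> ((\<ominus>\<^bsub>M\<^esub> x \<oplus>\<^bsub>M\<^esub> x) \<oplus>\<^bsub>M\<^esub> \<ominus>\<^bsub>M\<^esub> y)"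
        unfolding a_minus_def using x y z by (simp only: M.M.a_assoc M.M.a_closed M.M.a_inv_closed)
      then have 1: "z \<ominus>\<^bsub>M\<^esub> y = (z \<ominus>\<^bsub>M\<^esub> x) \<oplus>\<^bsub>M\<^esub> (x \<ominus>\<^bsub>M\<^esub> y)"
        using x y z by (simp add: M.M.l_neg) (simp add: a_minus_def)
      have "((z \<ominus>\<^bsub>M\<^esub> x) \<oplus>\<^bsub>M\<^esub> (x \<ominus>\<^bsub>M\<^esub> y)) \<ominus>\<^bsub>M\<^esub> (x \<ominus>\<^bsub>M\<^esub> y) = z \<ominus>\<^bsub>M\<^esub> x"
        using u w unfolding a_minus_def[of _ _ "x \<ominus>\<^bsub>M\<^esub> y"] by (simp add: M.M.a_assoc M.M.r_neg)
      then have 2: "z \<ominus>\<^bsub>M\<^esub> x = (z \<ominus>\<^bsub>M\<^esub> y) \<ominus>\<^bsub>M\<^esub> (x \<ominus>\<^bsub>M\<^esub> y)"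
        unfolding 1 by (rule sym)
      show ?thesis using 1 2 N(3,6) xy by metis
    qed
    then show "c x = c y" by (auto simp: c_def)
  qed
  have add: "c (x \<oplus>\<^bsub>M\<^esub> y) = c (x' \<oplus>\<^bsub>M\<^esub> y')"
    if "x \<in> carrier M" "y \<in> carrier M" "x' \<in> carrier M" "y' \<in> carrier M" "c x = c x'" "c y = c y'"
    for x y x' y'
  proof -
    have "(x \<oplus>\<^bsub>M\<^esub> y) \<ominus>\<^bsub>M\<^esub> (x' \<oplus>\<^bsub>M\<^esub> y') = (x \<ominus>\<^bsub>M\<^esub> x') \<oplus>\<^bsub>M\<^esub> (y \<ominus>\<^bsub>M\<^esub> y')"
      using that(1-4) by (simp add: a_minus_def M.M.minus_add M.M.a_ac)
    then show ?thesis using that N(3) by (simp add: c_eq)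
  qed
  have smult: "c (a \<odot>\<^bsub>M\<^esub> x) = c (a \<odot>\<^bsub>M\<^esub> x')"
    if "a \<in> carrier R" "x \<in> carrier M" "x' \<in> carrier M" "c x = c x'" for a x x'
  proof -
    have "a \<odot>\<^bsub>M\<^esub> x \<ominus>\<^bsub>M\<^esub> a \<odot>\<^bsub>M\<^esub> x' = a \<odot>\<^bsub>M\<^esub> (x \<ominus>\<^bsub>M\<^esub> x')"
      using that by (simp add: a_minus_def M.smult_r_distr M.smult_minus)
    then show ?thesis using that N(4) by (simp add: c_eq)
  qed
  note P = pushforward[OF assms(1) add smult]
  have "{x \<in> carrier M. (\<lambda>x\<in>carrier M. c x) x = \<zero>\<^bsub>pushforward c M\<^esub>} = N"
  proof -
    have "x \<ominus>\<^bsub>M\<^esub> \<zero>\<^bsub>M\<^esub> = x" if "x \<in> carrier M" for x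
      unfolding a_minus_def using that using M.M.minus_equality[of "\<zero>\<^bsub>M\<^esub>" "\<zero>\<^bsub>M\<^esub>"] by simp
    then show ?thesis
      using N(1) c_eq[of _ "\<zero>\<^bsub>M\<^esub>"] by (auto simp: pushforward_def)
  qed
  then show thesis using that[OF P] by blast
qed

section \<open>Finitely generated and finitely presented modules\<close>

abbreviation free where "free R n \<equiv> rmod_sum n (\<lambda>_. regular_module R)"

lemma free_right_module: "ring R \<Longrightarrow> right_module R (free R n)"
  by (rule sum_right_module) (auto intro: regular_right_module)

lemma submodule_carrier: "right_module R M \<Longrightarrow> submodule (carrier M) R M"
proof -
  assume "right_module R M"
  then interpret right_module R M .
  show ?thesis by (rule rsubmoduleI) auto
qed

lemma submodule_vimage:
  assumes "right_module R M" "right_module R N" "f \<in> rmod_hom R M N" "submodule H R N"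
  shows "submodule {x \<in> carrier M. f x \<in> H} R M"
proof -
  interpret M: right_module R M by fact
  interpret N: right_module R N by fact
  note H = N.rsubmoduleD[OF assms(4)]
  show ?thesis
    by (rule M.rsubmoduleI) (auto simp: hom_add[OF assms(3)] hom_smult[OF assms(3)]
      hom_zero[OF assms(1-3)] H)
qed

lemma submodule_image:
  assumes "right_module R M" "right_module R N" "f \<in> rmod_hom R M N" "submodule H R M"
  shows "submodule (f ` H) R N"
proof -
  interpret M: right_module R M by fact
  interpret N: right_module R N by fact
  note H = M.rsubmoduleD[OF assms(4)]
  have m: "x \<in> carrier M" if "x \<in> H" for x using that H(1) by blast
  show ?thesis
  proof (rule N.rsubmoduleI)
    show "f ` H \<subseteq> carrier N" using m hom_closed[OF assms(3)] by auto
    show "\<zero>\<^bsub>N\<^esub> \<in> f ` H" using H(2) hom_zero[OF assms(1-3)] by force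
    show "x \<oplus>\<^bsub>N\<^esub> y \<in> f ` H" if "x \<in> f ` H" "y \<in> f ` H" for x y
      using that m H(3) hom_add[OF assms(3)] by (auto simp: image_iff) metis
    show "a \<odot>\<^bsub>N\<^esub> x \<in> f ` H" if "a \<in> carrier R" "x \<in> f ` H" for a x
      using that m H(4) hom_smult[OF assms(3)] by (auto simp: image_iff) metis
  qed
qed

lemma submodule_zero: "right_module R M \<Longrightarrow> submodule {\<zero>\<^bsub>M\<^esub>} R M"
proof -
  assume "right_module R M"
  then interpret right_module R M .
  show ?thesis by (rule rsubmoduleI) auto
qed

lemma submodule_kernel:
  assumes "right_module R M" "right_module R N" "f \<in> rmod_hom R M N"
  shows "submodule {x \<in> carrier M. f x = \<zero>\<^bsub>N\<^esub>} R M"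
  using submodule_vimage[OF assms submodule_zero[OF assms(2)]] by simp

lemma fg_image:
  assumes "right_module R M" "right_module R N" "f \<in> rmod_hom R M N" "fg_submodule R M K"
  shows "fg_submodule R N (f ` K)"
proof -
  interpret M: right_module R M by fact
  from assms(4) obtain S where K: "submodule K R M" and S: "finite S" "S \<subseteq> K"
    and gen: "\<And>H. submodule H R M \<Longrightarrow> S \<subseteq> H \<Longrightarrow> K \<subseteq> H" by (auto simp: fg_submodule_def)
  show ?thesis
    unfolding fg_submodule_def
  proof (intro conjI exI[of _ "f ` S"] allI impI)
    fix H assume H: "submodule H R N" "f ` S \<subseteq> H"
    have "K \<subseteq> {x \<in> carrier M. f x \<in> H}"
      by (rule gen[OF submodule_vimage[OF assms(1-3) H(1)]])
        (use S(2) H(2) M.rsubmoduleD(1)[OF K] in auto)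
    then show "f ` K \<subseteq> H" by auto
  qed (use S submodule_image[OF assms(1-3) K] in auto)
qed

text \<open>A sum of maps through \<open>U\<close> is the same as one map through some \<open>U\<^sup>n\<close>.\<close>

lemma through_all_factors:
  assumes V: "right_module R U" "right_module R V" "right_module R W"
    and f: "f \<in> through_all R U V W"
  obtains n a b where "a \<in> rmod_hom R V (rmod_sum n (\<lambda>_. U))" "b \<in> rmod_hom R (rmod_sum n (\<lambda>_. U)) W"
    "f = rcomp V b a"
proof -
  interpret U: right_module R U by fact
  interpret V: right_module R V by fact
  interpret W: right_module R W by fact
  let ?P = "\<lambda>n. rmod_sum n (\<lambda>_. U)"
  have rmP: "right_module R (?P n)" for n by (rule sum_right_module) (auto intro: V U.R.ring_axioms)
  from f have "\<exists>n a b. a \<in> rmod_hom R V (?P n) \<and> b \<in> rmod_hom R (?P n) W \<and> f = rcomp V b a"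
  proof induction
    case zero
    have "hzero V W = rcomp V (hzero (?P 0) W) (hzero V (?P 0))"
      by (auto simp: compose_def hzero_def fun_eq_iff)
    then show ?case using hzero_hom[OF V(2) rmP] hzero_hom[OF rmP V(3)] by blast
  next
    case (step f a0 b0)
    then obtain n a b where a: "a \<in> rmod_hom R V (?P n)" and b: "b \<in> rmod_hom R (?P n) W"
      and f: "f = rcomp V b a" by blast
    note ca = hom_closed[OF a] and cb = hom_closed[OF b] and ca0 = hom_closed[OF step.hyps(2)]
      and cb0 = hom_closed[OF step.hyps(3)]
    define a' where "a' = (\<lambda>v\<in>carrier V. \<lambda>i\<in>{..<Suc n}. if i < n then a v i else a0 v)"
    define b' where "b' = (\<lambda>z\<in>carrier (?P (Suc n)). b (restrict z {..<n}) \<oplus>\<^bsub>W\<^esub> b0 (z n))"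
    have ai: "a v i \<in> carrier U" if "v \<in> carrier V" "i < n" for v i
      using ca[OF that(1)] that(2) by (auto simp: PiE_def)
    have zi: "z i \<in> carrier U" if "z \<in> carrier (?P (Suc n))" "i < Suc n" for z i
      using that by (auto simp: PiE_def)
    have zr: "restrict z {..<n} \<in> carrier (?P n)" if "z \<in> carrier (?P (Suc n))" for z
      using that by (auto simp: PiE_def)
    have a': "a' \<in> rmod_hom R V (?P (Suc n))"
      unfolding a'_def
      by (rule rmod_hom_restrictI[OF V(2)])
        (auto simp: fun_eq_iff ai ca0 hom_add[OF a] hom_smult[OF a] hom_add[OF step.hyps(2)]
          hom_smult[OF step.hyps(2)])
    have b': "b' \<in> rmod_hom R (?P (Suc n)) W"
      unfolding b'_def
    proof (rule rmod_hom_restrictI[OF rmP])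
      fix x y assume x: "x \<in> carrier (?P (Suc n))" and y: "y \<in> carrier (?P (Suc n))"
      show "b (restrict x {..<n}) \<oplus>\<^bsub>W\<^esub> b0 (x n) \<in> carrier W"
        using zr[OF x] zi[OF x, of n] cb cb0 by auto
      have "restrict (x \<oplus>\<^bsub>?P (Suc n)\<^esub> y) {..<n} = restrict x {..<n} \<oplus>\<^bsub>?P n\<^esub> restrict y {..<n}"
        by (auto simp: fun_eq_iff restrict_def)
      moreover have "(x \<oplus>\<^bsub>?P (Suc n)\<^esub> y) n = x n \<oplus>\<^bsub>U\<^esub> y n" by simp
      ultimately show "b (restrict (x \<oplus>\<^bsub>?P (Suc n)\<^esub> y) {..<n}) \<oplus>\<^bsub>W\<^esub> b0 ((x \<oplus>\<^bsub>?P (Suc n)\<^esub> y) n) =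
        b (restrict x {..<n}) \<oplus>\<^bsub>W\<^esub> b0 (x n) \<oplus>\<^bsub>W\<^esub> (b (restrict y {..<n}) \<oplus>\<^bsub>W\<^esub> b0 (y n))"
        using hom_add[OF b zr[OF x] zr[OF y]] hom_add[OF step.hyps(3) zi[OF x, of n] zi[OF y, of n]]
          cb[OF zr[OF x]] cb[OF zr[OF y]] cb0[OF zi[OF x, of n]] cb0[OF zi[OF y, of n]]
        by (simp add: W.M.a_ac)
      fix r assume r: "r \<in> carrier R"
      have "restrict (r \<odot>\<^bsub>?P (Suc n)\<^esub> x) {..<n} = r \<odot>\<^bsub>?P n\<^esub> restrict x {..<n}"
        by (auto simp: fun_eq_iff restrict_def)
      moreover have "(r \<odot>\<^bsub>?P (Suc n)\<^esub> x) n = r \<odot>\<^bsub>U\<^esub> x n" by simp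
      ultimately show "b (restrict (r \<odot>\<^bsub>?P (Suc n)\<^esub> x) {..<n}) \<oplus>\<^bsub>W\<^esub> b0 ((r \<odot>\<^bsub>?P (Suc n)\<^esub> x) n) =
        r \<odot>\<^bsub>W\<^esub> (b (restrict x {..<n}) \<oplus>\<^bsub>W\<^esub> b0 (x n))"
        using hom_smult[OF b r zr[OF x]] hom_smult[OF step.hyps(3) r zi[OF x, of n]]
          cb[OF zr[OF x]] cb0[OF zi[OF x, of n]] r
        by (simp add: W.smult_r_distr)
    qed
    have "hadd V W f (rcomp V b0 a0) = rcomp V b' a'"
    proof
      fix v show "hadd V W f (rcomp V b0 a0) v = rcomp V b' a' v"
      proof (cases "v \<in> carrier V")
        case True
        have "restrict (a' v) {..<n} = a v"
          using True ca[OF True] by (auto simp: a'_def fun_eq_iff PiE_def extensional_def restrict_def)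
        moreover have "a' v n = a0 v" using True by (simp add: a'_def)
        moreover have "a' v \<in> carrier (?P (Suc n))" by (rule hom_closed[OF a' True])
        ultimately show ?thesis using True by (simp add: f compose_eq b'_def)
      qed (simp add: hadd_def compose_def)
    qed
    then show ?case using a' b' by blast
  qed
  then show thesis using that by blast
qed

lemma sum_in_add:
  assumes "right_module R U" shows "in_add R U (rmod_sum n (\<lambda>_. U))"
proof -
  interpret U: right_module R U by fact
  let ?P = "rmod_sum n (\<lambda>_. U)"
  have P: "right_module R ?P" by (rule sum_right_module) (auto intro: assms U.R.ring_axioms)
  interpret P: right_module R ?P by fact
  \<comment> \<open>The truncation to the first \<open>k\<close> coordinates is a sum of \<open>k\<close> maps through \<open>U\<close>, each a
    coordinate projection followed by the inclusion of that coordinate; for \<open>k = n\<close> it is the identity.\<close>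
  have "(\<lambda>z\<in>carrier ?P. \<lambda>i\<in>{..<n}. if i < k then z i else \<zero>\<^bsub>U\<^esub>) \<in> through_all R U ?P ?P"
    if "k \<le> n" for k
    using that
  proof (induction k)
    case 0
    have "(\<lambda>z\<in>carrier ?P. \<lambda>i\<in>{..<n}. if i < 0 then z i else \<zero>\<^bsub>U\<^esub>) = hzero ?P ?P"
      by (auto simp: hzero_def)
    then show ?case by (simp only: through.zero)
  next
    case (Suc k)
    let ?a = "\<lambda>z\<in>carrier ?P. z k"
    let ?b = "\<lambda>u\<in>carrier U. \<lambda>i\<in>{..<n}. if i = k then u else \<zero>\<^bsub>U\<^esub>"
    have a: "?a \<in> rmod_hom R ?P U"
    proof (rule rmod_hom_restrictI[OF P])
      show "z k \<in> carrier U" if "z \<in> carrier ?P" for z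
        using that Suc.prems by (auto simp: PiE_def)
    qed (use Suc.prems in simp_all)
    have b: "?b \<in> rmod_hom R U ?P"
      by (rule rmod_hom_restrictI[OF assms]) (simp_all add: fun_eq_iff)
    have "(\<lambda>z\<in>carrier ?P. \<lambda>i\<in>{..<n}. if i < Suc k then z i else \<zero>\<^bsub>U\<^esub>) =
      hadd ?P ?P (\<lambda>z\<in>carrier ?P. \<lambda>i\<in>{..<n}. if i < k then z i else \<zero>\<^bsub>U\<^esub>) (rcomp ?P ?b ?a)"
    proof
      fix z
      show "(\<lambda>z\<in>carrier ?P. \<lambda>i\<in>{..<n}. if i < Suc k then z i else \<zero>\<^bsub>U\<^esub>) z =
        hadd ?P ?P (\<lambda>z\<in>carrier ?P. \<lambda>i\<in>{..<n}. if i < k then z i else \<zero>\<^bsub>U\<^esub>) (rcomp ?P ?b ?a) z"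
      proof (cases "z \<in> carrier ?P")
        case True
        then have zi: "z i \<in> carrier U" if "i < n" for i using that by (auto simp: PiE_def)
        have "(if i < Suc k then z i else \<zero>\<^bsub>U\<^esub>) =
          (if i < k then z i else \<zero>\<^bsub>U\<^esub>) \<oplus>\<^bsub>U\<^esub> (if i = k then z k else \<zero>\<^bsub>U\<^esub>)" if "i < n" for i
          using zi[OF that] zi[of k] Suc.prems by (cases "i < k"; cases "i = k") auto
        moreover have "z k \<in> carrier U" using zi[of k] Suc.prems by simp
        ultimately show ?thesis
          using True by (simp add: compose_eq cong: restrict_cong)
      qed (simp add: hadd_def)
    qed
    moreover have "k \<le> n" using Suc.prems by simp
    ultimately show ?case using through.step[OF Suc.IH a b] by (simp only: Suc.prems)
  qed
  from this[of n] have "(\<lambda>z\<in>carrier ?P. \<lambda>i\<in>{..<n}. if i < n then z i else \<zero>\<^bsub>U\<^esub>) \<in> through_all R U ?P ?P"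
    by simp
  moreover have "(\<lambda>z\<in>carrier ?P. \<lambda>i\<in>{..<n}. if i < n then z i else \<zero>\<^bsub>U\<^esub>) = rid ?P"
    by (auto simp: fun_eq_iff PiE_def extensional_def)
  ultimately show ?thesis by (simp only: in_add_def)
qed

declare sum_simps [simp del]

lemma fg_whole:
  assumes "right_module R M"
  shows "fg_submodule R M (carrier M) \<longleftrightarrow>
    (\<exists>S. finite S \<and> S \<subseteq> carrier M \<and> (\<forall>H. submodule H R M \<longrightarrow> S \<subseteq> H \<longrightarrow> carrier M \<subseteq> H))"
  using submodule_carrier[OF assms] by (simp add: fg_submodule_def)

lemma regular_fg: "ring R \<Longrightarrow> fg_submodule R (regular_module R) (carrier (regular_module R))"
proof -
  assume R: "ring R"
  then interpret ring R .
  interpret M: right_module R "regular_module R" by (rule regular_right_module[OF R])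
  have "carrier R \<subseteq> H" if H: "submodule H R (regular_module R)" "{\<one>\<^bsub>R\<^esub>} \<subseteq> H" for H
  proof
    fix a assume "a \<in> carrier R"
    then show "a \<in> H" using M.rsubmoduleD(4)[OF H(1), of a "\<one>\<^bsub>R\<^esub>"] H(2) by simp
  qed
  then show ?thesis
    unfolding fg_whole[OF M.right_module_axioms] by (intro exI[of _ "{\<one>\<^bsub>R\<^esub>}"]) auto
qed

text \<open>If the identity of \<open>V\<close> is a sum of maps \<open>s\<^sub>i \<circ> a\<^sub>i\<close> through \<open>U\<close>, then \<open>V\<close> is generated by the
  images under the \<open>s\<^sub>i\<close> of generators of \<open>U\<close>.\<close>

lemma in_add_fg:
  assumes V: "right_module R U" "right_module R V"
    and U: "fg_submodule R U (carrier U)" and a: "in_add R U V"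
  shows "fg_submodule R V (carrier V)"
proof -
  interpret V: right_module R V by fact
  obtain G where G: "finite G" "G \<subseteq> carrier U"
    "\<And>H. submodule H R U \<Longrightarrow> G \<subseteq> H \<Longrightarrow> carrier U \<subseteq> H"
    using U by (auto simp: fg_whole[OF V(1)])
  have "\<exists>S. finite S \<and> S \<subseteq> carrier V \<and> (\<forall>H. submodule H R V \<longrightarrow> S \<subseteq> H \<longrightarrow> f ` carrier V \<subseteq> H)"
    if "f \<in> through_all R U V V" for f
    using that
  proof induction
    case zero
    show ?case by (rule exI[of _ "{}"]) (auto dest: V.rsubmoduleD(2))
  next
    case (step f a s)
    then obtain S where S: "finite S" "S \<subseteq> carrier V"
      "\<And>H. submodule H R V \<Longrightarrow> S \<subseteq> H \<Longrightarrow> f ` carrier V \<subseteq> H" by blast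
    show ?case
    proof (intro exI[of _ "S \<union> s ` G"] conjI allI impI)
      show "S \<union> s ` G \<subseteq> carrier V" using S(2) G(2) hom_closed[OF step.hyps(3)] by auto
      fix H assume H: "submodule H R V" "S \<union> s ` G \<subseteq> H"
      have "carrier U \<subseteq> {x \<in> carrier U. s x \<in> H}"
        by (rule G(3)[OF submodule_vimage[OF V(1,2) step.hyps(3) H(1)]]) (use H(2) G(2) in auto)
      then have "s (a x) \<in> H" if "x \<in> carrier V" for x
        using hom_closed[OF step.hyps(2) that] by auto
      moreover have "f x \<in> H" if "x \<in> carrier V" for x using S(3)[OF H(1)] H(2) that by auto
      ultimately show "hadd V V f (rcomp V s a) ` carrier V \<subseteq> H"
        using V.rsubmoduleD(3)[OF H(1)] by (auto simp: compose_eq)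
    qed (use S(1) G(1) in auto)
  qed
  from this[OF a[unfolded in_add_def]] show ?thesis
    unfolding fg_whole[OF V(2)] by simp
qed

lemma finitely_presented_rm: "finitely_presented R M \<Longrightarrow> right_module R M"
  by (simp add: finitely_presented_def)

lemma fp_modules_rm: "M \<in> fp_modules R \<Longrightarrow> right_module R M"
  by (simp add: fp_modules_def finitely_presented_def)

text \<open>If \<open>b : R\<^sup>n \<rightarrow> W\<close> is split by \<open>a\<close>, then the kernel of \<open>b\<close> is the image of \<open>1 - a b\<close>, hence
  finitely generated.\<close>

lemma in_add_regular_finitely_presented:
  assumes W: "right_module R W" and a: "in_add R (regular_module R) W"
  shows "finitely_presented R W"
proof -
  interpret W: right_module R W by fact
  have R: "ring R" by (rule W.R.ring_axioms)
  obtain n a b where a: "a \<in> rmod_hom R W (free R n)" and b: "b \<in> rmod_hom R (free R n) W"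
    and ba: "rid W = rcomp W b a"
    using through_all_factors[OF regular_right_module[OF R] W W assms(2)[unfolded in_add_def]] by blast
  have F: "right_module R (free R n)" by (rule free_right_module[OF R])
  interpret F: right_module R "free R n" by fact
  have ba': "b (a x) = x" if "x \<in> carrier W" for x
    using fun_cong[OF ba, of x] that by (simp add: compose_eq)
  have fgF: "fg_submodule R (free R n) (carrier (free R n))"
    by (rule in_add_fg[OF regular_right_module[OF R] F regular_fg[OF R]
      sum_in_add[OF regular_right_module[OF R]]])
  let ?c = "\<lambda>z\<in>carrier (free R n). z \<ominus>\<^bsub>free R n\<^esub> a (b z)"
  note ca = hom_closed[OF a] and cb = hom_closed[OF b]
  have c: "?c \<in> rmod_hom R (free R n) (free R n)"
  proof (rule rmod_hom_restrictI[OF F])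
    fix x y r assume x: "x \<in> carrier (free R n)"
    note cx = x cb[OF x] ca[OF cb[OF x]]
    show "x \<ominus>\<^bsub>free R n\<^esub> a (b x) \<in> carrier (free R n)" using cx by simp
    { assume y: "y \<in> carrier (free R n)"
      note cy = y cb[OF y] ca[OF cb[OF y]]
      show "x \<oplus>\<^bsub>free R n\<^esub> y \<ominus>\<^bsub>free R n\<^esub> a (b (x \<oplus>\<^bsub>free R n\<^esub> y)) =
        x \<ominus>\<^bsub>free R n\<^esub> a (b x) \<oplus>\<^bsub>free R n\<^esub> (y \<ominus>\<^bsub>free R n\<^esub> a (b y))"
        using cx cy by (simp add: hom_add[OF b] hom_add[OF a] a_minus_def F.M.minus_add F.M.a_ac) }
    assume r: "r \<in> carrier R"
    show "r \<odot>\<^bsub>free R n\<^esub> x \<ominus>\<^bsub>free R n\<^esub> a (b (r \<odot>\<^bsub>free R n\<^esub> x)) =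
      r \<odot>\<^bsub>free R n\<^esub> (x \<ominus>\<^bsub>free R n\<^esub> a (b x))"
      using cx r by (simp add: hom_smult[OF b] hom_smult[OF a] a_minus_def F.smult_r_distr F.smult_minus)
  qed
  have ker: "{z \<in> carrier (free R n). b z = \<zero>\<^bsub>W\<^esub>} = ?c ` carrier (free R n)"
  proof (intro equalityI subsetI)
    fix z assume z: "z \<in> {z \<in> carrier (free R n). b z = \<zero>\<^bsub>W\<^esub>}"
    then have "a (b z) = \<zero>\<^bsub>free R n\<^esub>" using hom_zero[OF W F a] by simp
    moreover have "\<ominus>\<^bsub>free R n\<^esub> \<zero>\<^bsub>free R n\<^esub> = \<zero>\<^bsub>free R n\<^esub>"
      using F.M.minus_equality[of "\<zero>\<^bsub>free R n\<^esub>" "\<zero>\<^bsub>free R n\<^esub>"] by simp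
    ultimately have "z = ?c z" using z by (simp add: a_minus_def)
    then show "z \<in> ?c ` carrier (free R n)" using z by blast
  next
    fix z assume "z \<in> ?c ` carrier (free R n)"
    then obtain x where x: "x \<in> carrier (free R n)" and z: "z = x \<ominus>\<^bsub>free R n\<^esub> a (b x)" by auto
    have "b z = b x \<ominus>\<^bsub>W\<^esub> b (a (b x))"
      unfolding z by (rule hom_minus[OF F W b x ca[OF cb[OF x]]])
    then have "b z = \<zero>\<^bsub>W\<^esub>" using ba'[OF cb[OF x]] cb[OF x] by (simp add: a_minus_def W.M.r_neg)
    then show "z \<in> {z \<in> carrier (free R n). b z = \<zero>\<^bsub>W\<^esub>}"
      using x z ca[OF cb[OF x]] by simp
  qed
  have "b ` carrier (free R n) = carrier W"
  proof
    show "b ` carrier (free R n) \<subseteq> carrier W" using cb by blast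
    show "carrier W \<subseteq> b ` carrier (free R n)"
    proof
      fix w assume "w \<in> carrier W"
      then show "w \<in> b ` carrier (free R n)" using ba'[of w] ca[of w] by (metis image_eqI)
    qed
  qed
  then show ?thesis
    unfolding finitely_presented_def using W b fg_image[OF F F c fgF] unfolding ker[symmetric] by blast
qed

text \<open>For a presentation \<open>p : R\<^sup>n \<rightarrow> U\<close>, the kernel of \<open>f \<circ> p\<close> is generated by generators of the
  kernel of \<open>p\<close> together with lifts of generators of the kernel of \<open>f\<close>.\<close>

lemma finitely_presented_quotient:
  assumes U: "finitely_presented R U" and V: "right_module R V"
    and f: "f \<in> rmod_hom R U V" and surj: "f ` carrier U = carrier V"
    and ker: "fg_submodule R U {x \<in> carrier U. f x = \<zero>\<^bsub>V\<^esub>}"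
  shows "finitely_presented R V"
proof -
  have rU: "right_module R U" using U by (rule finitely_presented_rm)
  interpret U: right_module R U by fact
  interpret V: right_module R V by fact
  obtain n p where p: "p \<in> rmod_hom R (free R n) U" and sp: "p ` carrier (free R n) = carrier U"
    and kp: "fg_submodule R (free R n) {x \<in> carrier (free R n). p x = \<zero>\<^bsub>U\<^esub>}"
    using U unfolding finitely_presented_def by blast
  have F: "right_module R (free R n)" by (rule free_right_module[OF U.R.ring_axioms])
  interpret F: right_module R "free R n" by fact
  note cp = hom_closed[OF p]
  define q where "q = rcomp (free R n) f p"
  have q: "q \<in> rmod_hom R (free R n) V" unfolding q_def by (rule rcomp_hom[OF F p f])
  have qx: "q x = f (p x)" if "x \<in> carrier (free R n)" for x
    using that by (simp add: q_def compose_eq)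
  have "q ` carrier (free R n) = f ` (p ` carrier (free R n))"
    unfolding image_image by (rule image_cong[OF refl]) (rule qx)
  then have sq: "q ` carrier (free R n) = carrier V" using sp surj by simp
  obtain S where S: "finite S" "S \<subseteq> {x \<in> carrier (free R n). p x = \<zero>\<^bsub>U\<^esub>}"
    "\<And>H. submodule H R (free R n) \<Longrightarrow> S \<subseteq> H \<Longrightarrow> {x \<in> carrier (free R n). p x = \<zero>\<^bsub>U\<^esub>} \<subseteq> H"
    using kp by (auto simp: fg_submodule_def)
  obtain T where T: "finite T" "T \<subseteq> {x \<in> carrier U. f x = \<zero>\<^bsub>V\<^esub>}"
    "\<And>H. submodule H R U \<Longrightarrow> T \<subseteq> H \<Longrightarrow> {x \<in> carrier U. f x = \<zero>\<^bsub>V\<^esub>} \<subseteq> H"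
    using ker by (auto simp: fg_submodule_def)
  have "\<forall>t\<in>T. \<exists>z. z \<in> carrier (free R n) \<and> p z = t" using T(2) sp by (metis (no_types, lifting) CollectD image_iff subsetD)
  then obtain l where l: "l t \<in> carrier (free R n)" "p (l t) = t" if "t \<in> T" for t
    by (metis (no_types))
  have "fg_submodule R (free R n) {x \<in> carrier (free R n). q x = \<zero>\<^bsub>V\<^esub>}"
    unfolding fg_submodule_def
  proof (intro conjI exI[of _ "S \<union> l ` T"] allI impI)
    show "submodule {x \<in> carrier (free R n). q x = \<zero>\<^bsub>V\<^esub>} R (free R n)"
      by (rule submodule_kernel[OF F V q])
    show "finite (S \<union> l ` T)" using S(1) T(1) by simp
    show "S \<union> l ` T \<subseteq> {x \<in> carrier (free R n). q x = \<zero>\<^bsub>V\<^esub>}"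
      using S(2) T(2) l hom_zero[OF rU V f] qx by auto
    fix H assume H: "submodule H R (free R n)" "S \<union> l ` T \<subseteq> H"
    note HD = F.rsubmoduleD[OF H(1)]
    have "T \<subseteq> p ` H" using H(2) l(2) by (metis image_eqI le_supE subsetI image_subset_iff)
    then have kH: "{x \<in> carrier U. f x = \<zero>\<^bsub>V\<^esub>} \<subseteq> p ` H"
      by (rule T(3)[OF submodule_image[OF F rU p H(1)]])
    show "{x \<in> carrier (free R n). q x = \<zero>\<^bsub>V\<^esub>} \<subseteq> H"
    proof
      fix z assume "z \<in> {x \<in> carrier (free R n). q x = \<zero>\<^bsub>V\<^esub>}"
      then have z: "z \<in> carrier (free R n)" and "f (p z) = \<zero>\<^bsub>V\<^esub>" using qx by auto
      then have "p z \<in> p ` H" using kH cp by blast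
      then obtain y where y: "y \<in> H" "p z = p y" by blast
      have yc: "y \<in> carrier (free R n)" using y(1) HD(1) by blast
      have zy: "z \<ominus>\<^bsub>free R n\<^esub> y \<in> carrier (free R n)" using z yc by (rule F.M.minus_closed)
      have "p (z \<ominus>\<^bsub>free R n\<^esub> y) = p z \<ominus>\<^bsub>U\<^esub> p y"
        by (rule hom_minus[OF F rU p z yc])
      also have "\<dots> = \<zero>\<^bsub>U\<^esub>" using y(2) cp[OF yc] by (simp add: a_minus_def U.M.r_neg)
      finally have "z \<ominus>\<^bsub>free R n\<^esub> y \<in> H" using S(3)[OF H(1)] H(2) zy by blast
      then have "(z \<ominus>\<^bsub>free R n\<^esub> y) \<oplus>\<^bsub>free R n\<^esub> y \<in> H" using y(1) by (rule HD(3))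
      moreover have "(z \<ominus>\<^bsub>free R n\<^esub> y) \<oplus>\<^bsub>free R n\<^esub> y = z"
        using z yc by (simp add: a_minus_def F.M.a_assoc F.M.l_neg)
      ultimately show "z \<in> H" by simp
    qed
  qed
  then show ?thesis unfolding finitely_presented_def using V q sq by blast
qed

lemma finitely_presented_iso:
  assumes U: "finitely_presented R U" and V: "right_module R V" and iso: "rmod_iso R U V"
  shows "finitely_presented R V"
proof -
  have rU: "right_module R U" using U by (rule finitely_presented_rm)
  obtain f where f: "f \<in> rmod_hom R U V" and b: "bij_betw f (carrier U) (carrier V)"
    using iso by (auto simp: rmod_iso_def)
  interpret U: right_module R U by fact
  have "{x \<in> carrier U. f x = \<zero>\<^bsub>V\<^esub>} = {\<zero>\<^bsub>U\<^esub>}"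
  proof -
    have "x = \<zero>\<^bsub>U\<^esub>" if "x \<in> carrier U" "f x = \<zero>\<^bsub>V\<^esub>" for x
      using b that hom_zero[OF rU V f] inj_onD[of f "carrier U" x "\<zero>\<^bsub>U\<^esub>"] by (simp add: bij_betw_def)
    then show ?thesis using hom_zero[OF rU V f] by auto
  qed
  moreover have "fg_submodule R U {\<zero>\<^bsub>U\<^esub>}"
    unfolding fg_submodule_def using submodule_zero[OF rU] by (intro conjI exI[of _ "{\<zero>\<^bsub>U\<^esub>}"]) auto
  ultimately show ?thesis
    using b by (intro finitely_presented_quotient[OF U V f]) (auto simp: bij_betw_def)
qed

lemma finitely_presented_fg:
  assumes "finitely_presented R M" shows "fg_submodule R M (carrier M)"
proof -
  have M: "right_module R M" using assms by (rule finitely_presented_rm)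
  interpret M: right_module R M by fact
  have R: "ring R" by (rule M.R.ring_axioms)
  obtain n p where p: "p \<in> rmod_hom R (free R n) M" "p ` carrier (free R n) = carrier M"
    using assms unfolding finitely_presented_def by blast
  have "fg_submodule R (free R n) (carrier (free R n))"
    by (rule in_add_fg[OF regular_right_module[OF R] free_right_module[OF R] regular_fg[OF R]
      sum_in_add[OF regular_right_module[OF R]]])
  from fg_image[OF free_right_module[OF R] M p(1) this] show ?thesis unfolding p(2) .
qed

text \<open>The elements of the copy are the fibres of a presentation \<open>R\<^sup>n \<rightarrow> M\<close>, which are sets of
  functions from \<open>nat\<close> to \<open>R\<close>.\<close>

lemma fp_copy_exists:
  fixes M :: "('a, 'b, 's) module_scheme"
  assumes "finitely_presented R M"
  shows "\<exists>N\<in>fp_modules R. rmod_iso R M N"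
proof -
  have M: "right_module R M" using assms by (rule finitely_presented_rm)
  obtain n p where p: "p \<in> rmod_hom R (free R n) M" "p ` carrier (free R n) = carrier M"
    using assms unfolding finitely_presented_def by blast
  define c where "c = (\<lambda>m. {x \<in> carrier (free R n). p x = m})"
  have inj: "m = m'" if "m \<in> carrier M" "c m = c m'" for m m'
  proof -
    have "m \<in> p ` carrier (free R n)" using that(1) by (simp only: p(2))
    then obtain x where x: "x \<in> carrier (free R n)" "m = p x" by (rule imageE)
    then have "x \<in> c m" by (simp add: c_def)
    then have "x \<in> c m'" by (simp only: that(2))
    then show ?thesis using x(2) by (simp add: c_def)
  qed
  have add: "c (x \<oplus>\<^bsub>M\<^esub> y) = c (x' \<oplus>\<^bsub>M\<^esub> y')"
    if "x \<in> carrier M" "y \<in> carrier M" "x' \<in> carrier M" "y' \<in> carrier M" "c x = c x'" "c y = c y'"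
    for x y x' y'
    unfolding inj[OF that(1,5)] inj[OF that(2,6)] ..
  have smult: "c (a \<odot>\<^bsub>M\<^esub> x) = c (a \<odot>\<^bsub>M\<^esub> x')"
    if "a \<in> carrier R" "x \<in> carrier M" "x' \<in> carrier M" "c x = c x'" for a x x'
    unfolding inj[OF that(2,4)] ..
  note P = pushforward[OF M add smult]
  have "inj_on (\<lambda>x\<in>carrier M. c x) (carrier M)"
  proof (rule inj_onI)
    fix x y assume xy: "x \<in> carrier M" "y \<in> carrier M"
      "(\<lambda>x\<in>carrier M. c x) x = (\<lambda>x\<in>carrier M. c x) y"
    then have "c x = c y" by simp
    with xy(1) show "x = y" by (rule inj)
  qed
  then have iso: "rmod_iso R M (pushforward c M)"
    unfolding rmod_iso_def bij_betw_def by (intro bexI[OF _ P(2)] conjI P(3))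
  have "pushforward c M \<in> fp_modules R"
    unfolding fp_modules_def by (rule CollectI, rule finitely_presented_iso[OF assms P(1) iso])
  with iso show ?thesis by (rule bexI)
qed

lemma is_summand_in_add:
  fixes M :: "('a, 'b) module" and N :: "('a, 'c) module"
  assumes "right_module R M" "right_module R N" "is_summand R M N"
  shows "in_add R N M"
proof -
  obtain K :: "('a, 'c) module" where K: "right_module R K" and iso: "rmod_iso R N (rmod_sum2 M K)"
    using assms(3) unfolding is_summand_def by blast
  interpret M: right_module R M by fact
  interpret K: right_module R K by fact
  have S: "right_module R (rmod_sum2 M K)" by (rule sum2_right_module[OF assms(1) K])
  have "in_add R (rmod_sum2 M K) M"
  proof (rule in_add_retract[OF S assms(1)])
    show "(\<lambda>m\<in>carrier M. (m, \<zero>\<^bsub>K\<^esub>)) \<in> rmod_hom R M (rmod_sum2 M K)"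
      by (rule rmod_hom_restrictI[OF assms(1)]) auto
    show "(\<lambda>z\<in>carrier (rmod_sum2 M K). fst z) \<in> rmod_hom R (rmod_sum2 M K) M"
      by (rule rmod_hom_restrictI[OF S]) auto
  qed simp
  then show ?thesis
    by (rule in_add_trans[OF assms(2) S assms(1) in_add_iso(1)[OF assms(2) S iso]])
qed

lemma add_closure_in_add:
  assumes "right_module R X" "M \<in> add_closure R X" shows "in_add R X M"
proof -
  obtain n where M: "right_module R M" and s: "is_summand R M (rmod_sum n (\<lambda>_. X))"
    using assms(2) fp_modules_rm unfolding add_closure_def by blast
  interpret X: right_module R X by fact
  have S: "right_module R (rmod_sum n (\<lambda>_. X))"
    by (rule sum_right_module) (auto intro: assms X.R.ring_axioms)
  show ?thesis
    by (rule in_add_trans[OF assms(1) S M sum_in_add[OF assms(1)] is_summand_in_add[OF M S s]])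
qed

section \<open>The functor of homomorphisms out of a bimodule\<close>

text \<open>\<open>Hom(Q, V)\<close> over \<open>A\<close> as a right module over a ring that acts on \<open>Q\<close> from the left: \<open>(h b)(q) = h (b q)\<close>.
  The dual \<open>D(\<Lambda>)\<close>, the functor \<open>Hom(X, -)\<close> to modules over \<open>End(X)\<close>, and the two functors of a Morita
  context are all of this form.\<close>

definition hom_mod ::
  "('a, 'r) ring_scheme \<Rightarrow> ('b \<Rightarrow> 'q \<Rightarrow> 'q) \<Rightarrow> ('a, 'q, 's) module_scheme \<Rightarrow> ('a, 'c, 't) module_scheme \<Rightarrow>
    ('b, 'q \<Rightarrow> 'c) module"
  where "hom_mod A act Q V = \<lparr>carrier = rmod_hom A Q V, mult = undefined, one = undefined,
    zero = hzero Q V, add = hadd Q V, smult = (\<lambda>b h. \<lambda>x\<in>carrier Q. h (act b x))\<rparr>"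

lemma hom_mod_simps [simp]:
  "carrier (hom_mod A act Q V) = rmod_hom A Q V" "zero (hom_mod A act Q V) = hzero Q V"
  "add (hom_mod A act Q V) = hadd Q V" "smult (hom_mod A act Q V) b h = (\<lambda>x\<in>carrier Q. h (act b x))"
  by (simp_all add: hom_mod_def)

definition hmap :: "('a, 'r) ring_scheme \<Rightarrow> ('a, 'q, 's) module_scheme \<Rightarrow> ('a, 'c, 't) module_scheme \<Rightarrow>
    ('c \<Rightarrow> 'd) \<Rightarrow> ('q \<Rightarrow> 'c) \<Rightarrow> 'q \<Rightarrow> 'd"
  where "hmap A Q V f = (\<lambda>h\<in>rmod_hom A Q V. rcomp Q f h)"

locale left_action = Q: right_module A Q + B: ring B
  for A :: "('a, 'r) ring_scheme" and B :: "('b, 's) ring_scheme" and Q :: "('a, 'q, 't) module_scheme"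
    and act :: "'b \<Rightarrow> 'q \<Rightarrow> 'q" +
  assumes act_closed: "\<lbrakk>b \<in> carrier B; q \<in> carrier Q\<rbrakk> \<Longrightarrow> act b q \<in> carrier Q"
    and act_add: "\<lbrakk>b \<in> carrier B; q \<in> carrier Q; q' \<in> carrier Q\<rbrakk> \<Longrightarrow>
      act b (q \<oplus>\<^bsub>Q\<^esub> q') = act b q \<oplus>\<^bsub>Q\<^esub> act b q'"
    and act_smult: "\<lbrakk>b \<in> carrier B; a \<in> carrier A; q \<in> carrier Q\<rbrakk> \<Longrightarrow>
      act b (a \<odot>\<^bsub>Q\<^esub> q) = a \<odot>\<^bsub>Q\<^esub> act b q"
    and act_distr: "\<lbrakk>b \<in> carrier B; b' \<in> carrier B; q \<in> carrier Q\<rbrakk> \<Longrightarrow>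
      act (b \<oplus>\<^bsub>B\<^esub> b') q = act b q \<oplus>\<^bsub>Q\<^esub> act b' q"
    and act_mult: "\<lbrakk>b \<in> carrier B; b' \<in> carrier B; q \<in> carrier Q\<rbrakk> \<Longrightarrow>
      act (b \<otimes>\<^bsub>B\<^esub> b') q = act b (act b' q)"
    and act_one: "q \<in> carrier Q \<Longrightarrow> act \<one>\<^bsub>B\<^esub> q = q"
begin

lemma act_hom:
  assumes "right_module A V" "b \<in> carrier B" "h \<in> rmod_hom A Q V"
  shows "(\<lambda>x\<in>carrier Q. h (act b x)) \<in> rmod_hom A Q V"
  by (rule rmod_hom_restrictI[OF Q.right_module_axioms])
    (simp_all add: assms(2) act_closed act_add act_smult hom_closed[OF assms(3)] hom_add[OF assms(3)]
      hom_smult[OF assms(3)])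

lemma hom_mod_right_module:
  assumes V: "right_module A V" shows "right_module B (hom_mod A act Q V)"
proof -
  interpret V: right_module A V by fact
  note Q = Q.right_module_axioms
  note H = hadd_hom[OF Q V] act_hom[OF V] hzero_hom[OF Q V]
  have eqI: "f = g" if "f \<in> rmod_hom A Q V" "g \<in> rmod_hom A Q V" "\<And>x. x \<in> carrier Q \<Longrightarrow> f x = g x" for f g
    using that by (rule hom_eqI)
  show ?thesis
  proof (rule right_moduleI[OF B.ring_axioms], unfold hom_mod_simps)
    fix f g h a b
    assume f: "f \<in> rmod_hom A Q V"
    note cf = hom_closed[OF f]
    show "hadd Q V (hzero Q V) f = f"
      by (rule eqI) (simp_all add: H f cf)
    show "\<exists>y\<in>rmod_hom A Q V. hadd Q V y f = hzero Q V"
      by (rule bexI[OF _ hneg_hom[OF Q V f]]) (auto simp: hadd_def hzero_def V.M.l_neg cf)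
    show "(\<lambda>x\<in>carrier Q. f (act \<one>\<^bsub>B\<^esub> x)) = f"
      by (rule eqI) (simp_all add: H f cf act_one)
    { assume a: "a \<in> carrier B"
      show "(\<lambda>x\<in>carrier Q. f (act a x)) \<in> rmod_hom A Q V" by (rule H(2)[OF a f])
      { assume b: "b \<in> carrier B"
        show "(\<lambda>x\<in>carrier Q. f (act (a \<oplus>\<^bsub>B\<^esub> b) x)) =
          hadd Q V (\<lambda>x\<in>carrier Q. f (act a x)) (\<lambda>x\<in>carrier Q. f (act b x))"
          by (rule eqI) (simp_all add: H f a b act_distr act_closed hom_add[OF f])
        show "(\<lambda>x\<in>carrier Q. f (act (a \<otimes>\<^bsub>B\<^esub> b) x)) =
          (\<lambda>x\<in>carrier Q. (\<lambda>x\<in>carrier Q. f (act a x)) (act b x))"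
          using a b by (auto simp: act_mult act_closed) }
      assume g: "g \<in> rmod_hom A Q V"
      show "(\<lambda>x\<in>carrier Q. hadd Q V f g (act a x)) =
        hadd Q V (\<lambda>x\<in>carrier Q. f (act a x)) (\<lambda>x\<in>carrier Q. g (act a x))"
        using a by (auto simp: hadd_def act_closed) }
    assume g: "g \<in> rmod_hom A Q V"
    show "hadd Q V f g \<in> rmod_hom A Q V" by (rule H(1)[OF f g])
    show "hadd Q V f g = hadd Q V g f"
      by (auto simp: hadd_def V.M.a_comm cf hom_closed[OF g])
    assume h: "h \<in> rmod_hom A Q V"
    show "hadd Q V (hadd Q V f g) h = hadd Q V f (hadd Q V g h)"
      by (auto simp: hadd_def V.M.a_assoc cf hom_closed[OF g] hom_closed[OF h])
  qed (rule H(3))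
qed

abbreviation "HM \<equiv> hom_mod A act Q"

lemma hmap_apply: "\<lbrakk>h \<in> rmod_hom A Q V; x \<in> carrier Q\<rbrakk> \<Longrightarrow> hmap A Q V f h x = f (h x)"
  by (simp add: hmap_def compose_eq)

lemma hmap_closed:
  "\<lbrakk>f \<in> rmod_hom A V W; h \<in> rmod_hom A Q V\<rbrakk> \<Longrightarrow> hmap A Q V f h \<in> rmod_hom A Q W"
  by (simp add: hmap_def rcomp_hom[OF Q.right_module_axioms])

lemma hmap_hom:
  assumes V: "right_module A V" and W: "right_module A W" and f: "f \<in> rmod_hom A V W"
  shows "hmap A Q V f \<in> rmod_hom B (HM V) (HM W)"
proof -
  note Q = Q.right_module_axioms
  show ?thesis
  proof (rule rmod_homI, unfold hom_mod_simps)
    fix h k b assume h: "h \<in> rmod_hom A Q V"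
    show "hmap A Q V f h \<in> rmod_hom A Q W" by (rule hmap_closed[OF f h])
    { assume b: "b \<in> carrier B"
      note bh = act_hom[OF V b h]
      show "hmap A Q V f (\<lambda>x\<in>carrier Q. h (act b x)) = (\<lambda>x\<in>carrier Q. hmap A Q V f h (act b x))"
        by (rule hom_eqI[OF hmap_closed[OF f bh] act_hom[OF W b hmap_closed[OF f h]]])
          (simp add: hmap_apply bh h act_closed b) }
    assume k: "k \<in> rmod_hom A Q V"
    note hk = hadd_hom[OF Q V h k]
    show "hmap A Q V f (hadd Q V h k) = hadd Q W (hmap A Q V f h) (hmap A Q V f k)"
      by (rule hom_eqI[OF hmap_closed[OF f hk] hadd_hom[OF Q W hmap_closed[OF f h] hmap_closed[OF f k]]])
        (simp add: hmap_apply hk h k hom_closed[OF h] hom_closed[OF k] hom_add[OF f])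
  qed (simp add: hmap_def)
qed

lemma hmap_through:
  assumes U: "right_module A U" and V: "right_module A V" and W: "right_module A W"
    and f: "f \<in> through_all A U V W"
  shows "hmap A Q V f \<in> through_all B (HM U) (HM V) (HM W)"
  using f
proof induction
  case zero
  have "hmap A Q V (hzero V W) = hzero (HM V) (HM W)"
    by (auto simp: hmap_def hzero_def compose_def fun_eq_iff hom_closed)
  then show ?case using through.zero by metis
next
  case (step f a s)
  note Q = Q.right_module_axioms
  have f: "f \<in> rmod_hom A V W" by (rule through_hom[OF V W subset_refl step.hyps(1)])
  have sa: "rcomp V s a \<in> rmod_hom A V W" by (rule rcomp_hom[OF V step.hyps(2,3)])
  have "hmap A Q V (hadd V W f (rcomp V s a)) =
    hadd (HM V) (HM W) (hmap A Q V f) (rcomp (HM V) (hmap A Q U s) (hmap A Q V a))"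
  proof
    fix h
    show "hmap A Q V (hadd V W f (rcomp V s a)) h =
      hadd (HM V) (HM W) (hmap A Q V f) (rcomp (HM V) (hmap A Q U s) (hmap A Q V a)) h"
    proof (cases "h \<in> rmod_hom A Q V")
      case h: True
      have ah: "hmap A Q V a h \<in> rmod_hom A Q U" by (rule hmap_closed[OF step.hyps(2) h])
      show ?thesis
        using h ah
        by (auto simp: hmap_def compose_def hadd_def hom_closed[OF h] hom_closed[OF step.hyps(2)] fun_eq_iff)
    qed (simp add: hmap_def hadd_def)
  qed
  then show ?case
    using through.step[OF step.IH hmap_hom[OF V U step.hyps(2)] hmap_hom[OF U W step.hyps(3)]] by simp
qed

lemma hmap_rid: "hmap A Q V (rid V) = rid (HM V)"
  unfolding hmap_def hom_mod_simps by (rule restrict_ext) (rule rcomp_rid(2))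

lemma hom_mod_in_add:
  assumes "right_module A U" "right_module A V" "in_add A U V"
  shows "in_add B (HM U) (HM V)"
  using hmap_through[OF assms(1,2,2) assms(3)[unfolded in_add_def]] unfolding hmap_rid in_add_def .

lemma hmap_bij:
  assumes V: "right_module A V" and W: "right_module A W" and f: "f \<in> rmod_hom A V W"
    and bij: "bij_betw f (carrier V) (carrier W)"
  shows "bij_betw (hmap A Q V f) (carrier (HM V)) (carrier (HM W))"
proof -
  obtain g where g: "g \<in> rmod_hom A W V"
    "\<And>x. x \<in> carrier V \<Longrightarrow> g (f x) = x" "\<And>y. y \<in> carrier W \<Longrightarrow> f (g y) = y"
    using V f bij by (rule bij_hom_inverse) blast
  show ?thesis
  proof (rule bij_homI[OF hmap_hom[OF V W f]], unfold hom_mod_simps)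
    show "hmap A Q W g h \<in> rmod_hom A Q V" if "h \<in> rmod_hom A Q W" for h
      by (rule hmap_closed[OF g(1) that])
    show "hmap A Q W g (hmap A Q V f h) = h" if h: "h \<in> rmod_hom A Q V" for h
      by (rule hom_eqI[OF hmap_closed[OF g(1) hmap_closed[OF f h]] h])
        (simp add: hmap_apply h hmap_closed[OF f h] hom_closed[OF h] g(2))
    show "hmap A Q V f (hmap A Q W g h) = h" if h: "h \<in> rmod_hom A Q W" for h
      by (rule hom_eqI[OF hmap_closed[OF f hmap_closed[OF g(1) h]] h])
        (simp add: hmap_apply h hmap_closed[OF g(1) h] hom_closed[OF h] g(3))
  qed
qed

end

section \<open>Morita contexts inside a ring\<close>

text \<open>The Peirce component \<open>e D f\<close> of \<open>D\<close> for idempotents \<open>e\<close> and \<open>f\<close>.\<close>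

definition peirce :: "('d, 'x) ring_scheme \<Rightarrow> 'd \<Rightarrow> 'd \<Rightarrow> 'd set"
  where "peirce D e f = {x \<in> carrier D. e \<otimes>\<^bsub>D\<^esub> x = x \<and> x \<otimes>\<^bsub>D\<^esub> f = x}"

text \<open>The image of the multiplication \<open>(e D f) \<otimes> (f D e) \<rightarrow> e D e\<close>, generated one summand at a
  time so that facts about it are proved by induction.\<close>

inductive_set corner_sums :: "('d, 'x) ring_scheme \<Rightarrow> 'd \<Rightarrow> 'd \<Rightarrow> 'd set"
  for D e f where
  zero: "\<zero>\<^bsub>D\<^esub> \<in> corner_sums D e f"
| step: "\<lbrakk>x \<in> corner_sums D e f; p \<in> peirce D e f; q \<in> peirce D f e\<rbrakk> \<Longrightarrow>
    x \<oplus>\<^bsub>D\<^esub> p \<otimes>\<^bsub>D\<^esub> q \<in> corner_sums D e f"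

definition peirce_module ::
  "('d, 'x) ring_scheme \<Rightarrow> 'd \<Rightarrow> 'd \<Rightarrow> ('a \<Rightarrow> 'd) \<Rightarrow> ('a, 'd) module"
  where "peirce_module D f e \<alpha> = \<lparr>carrier = peirce D f e, mult = undefined, one = undefined,
    zero = zero D, add = add D, smult = (\<lambda>a x. x \<otimes>\<^bsub>D\<^esub> \<alpha> a)\<rparr>"

lemma peirce_module_simps [simp]:
  "carrier (peirce_module D f e \<alpha>) = peirce D f e" "zero (peirce_module D f e \<alpha>) = zero D"
  "add (peirce_module D f e \<alpha>) = add D" "smult (peirce_module D f e \<alpha>) a x = x \<otimes>\<^bsub>D\<^esub> \<alpha> a"
  by (simp_all add: peirce_module_def)

definition corner_iso :: "('d, 'x) ring_scheme \<Rightarrow> 'd \<Rightarrow> ('a, 'r) ring_scheme \<Rightarrow> ('a \<Rightarrow> 'd) \<Rightarrow> bool"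
  where "corner_iso D e A \<alpha> \<longleftrightarrow> bij_betw \<alpha> (carrier A) (peirce D e e) \<and>
    (\<forall>a\<in>carrier A. \<forall>b\<in>carrier A. \<alpha> (a \<oplus>\<^bsub>A\<^esub> b) = \<alpha> a \<oplus>\<^bsub>D\<^esub> \<alpha> b \<and> \<alpha> (a \<otimes>\<^bsub>A\<^esub> b) = \<alpha> a \<otimes>\<^bsub>D\<^esub> \<alpha> b)"

text \<open>\<open>A\<close> and \<open>B\<close> are the corners \<open>e D e\<close> and \<open>f D f\<close>, and both multiplication maps
  \<open>(e D f) \<otimes> (f D e) \<rightarrow> e D e\<close> and \<open>(f D e) \<otimes> (e D f) \<rightarrow> f D f\<close> are surjective.  The rings \<open>A\<close> and \<open>B\<close> are
  given with isomorphisms onto the corners, so that endomorphism rings and their quotients can be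
  taken for them directly.\<close>

locale morita_context = D?: ring D + A: ring A + B: ring B
  for D :: "('d, 'x) ring_scheme" (structure) and e f :: 'd
    and A :: "('a, 'r) ring_scheme" and B :: "('b, 's) ring_scheme"
    and \<alpha> :: "'a \<Rightarrow> 'd" and \<beta> :: "'b \<Rightarrow> 'd" +
  assumes idem_e: "e \<in> carrier D" "e \<otimes> e = e" and idem_f: "f \<in> carrier D" "f \<otimes> f = f"
    and full_e: "e \<in> corner_sums D e f" and full_f: "f \<in> corner_sums D f e"
    and iso_A: "corner_iso D e A \<alpha>" and iso_B: "corner_iso D f B \<beta>"
begin

lemma swap: "morita_context D f e B A \<beta> \<alpha>"
  by (intro morita_context.intro morita_context_axioms.intro D.ring_axioms A.ring_axioms B.ring_axioms
    idem_e idem_f full_e full_f iso_A iso_B)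

abbreviation "Q \<equiv> peirce_module D f e \<alpha>"
abbreviation "P \<equiv> peirce_module D e f \<beta>"
abbreviation "actQ \<equiv> \<lambda>b q. \<beta> b \<otimes> q"
abbreviation "actP \<equiv> \<lambda>a p. \<alpha> a \<otimes> p"
abbreviation "FM \<equiv> hom_mod A actQ Q"
abbreviation "GM \<equiv> hom_mod B actP P"

definition \<kappa> :: "'d \<Rightarrow> 'a" where "\<kappa> = inv_into (carrier A) \<alpha>"

lemma peirceD:
  assumes "x \<in> peirce D g h" shows "x \<in> carrier D" "g \<otimes> x = x" "x \<otimes> h = x"
  using assms by (simp_all add: peirce_def)

lemma peirce_zero: "\<lbrakk>g \<in> carrier D; h \<in> carrier D\<rbrakk> \<Longrightarrow> \<zero> \<in> peirce D g h"
  by (simp add: peirce_def)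

lemma peirce_add:
  "\<lbrakk>g \<in> carrier D; h \<in> carrier D; x \<in> peirce D g h; y \<in> peirce D g h\<rbrakk> \<Longrightarrow> x \<oplus> y \<in> peirce D g h"
  by (simp add: peirce_def D.l_distr D.r_distr)

lemma peirce_neg:
  "\<lbrakk>g \<in> carrier D; h \<in> carrier D; x \<in> peirce D g h\<rbrakk> \<Longrightarrow> \<ominus> x \<in> peirce D g h"
  by (simp add: peirce_def D.l_minus D.r_minus)

lemma peirce_mult:
  "\<lbrakk>g \<in> carrier D; h \<in> carrier D; k \<in> carrier D; x \<in> peirce D g h; y \<in> peirce D h k\<rbrakk> \<Longrightarrow> x \<otimes> y \<in> peirce D g k"
  by (simp add: peirce_def D.m_assoc) (metis D.m_assoc)

lemma \<alpha>_closed: "a \<in> carrier A \<Longrightarrow> \<alpha> a \<in> peirce D e e"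
  and \<alpha>_add: "\<lbrakk>a \<in> carrier A; b \<in> carrier A\<rbrakk> \<Longrightarrow> \<alpha> (a \<oplus>\<^bsub>A\<^esub> b) = \<alpha> a \<oplus> \<alpha> b"
  and \<alpha>_mult: "\<lbrakk>a \<in> carrier A; b \<in> carrier A\<rbrakk> \<Longrightarrow> \<alpha> (a \<otimes>\<^bsub>A\<^esub> b) = \<alpha> a \<otimes> \<alpha> b"
  and \<alpha>_inj: "inj_on \<alpha> (carrier A)" and \<alpha>_image: "\<alpha> ` carrier A = peirce D e e"
  using iso_A unfolding corner_iso_def bij_betw_def by blast+

lemma \<alpha>_carrier: "a \<in> carrier A \<Longrightarrow> \<alpha> a \<in> carrier D"
  using \<alpha>_closed peirceD(1) by blast

lemma e_corner: "e \<in> peirce D e e"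
  using idem_e by (simp add: peirce_def)

lemma \<kappa>_closed: "x \<in> peirce D e e \<Longrightarrow> \<kappa> x \<in> carrier A"
  and \<alpha>_\<kappa>: "x \<in> peirce D e e \<Longrightarrow> \<alpha> (\<kappa> x) = x"
  unfolding \<kappa>_def \<alpha>_image[symmetric] by (rule inv_into_into, assumption, rule f_inv_into_f)

lemma \<kappa>_\<alpha>: "a \<in> carrier A \<Longrightarrow> \<kappa> (\<alpha> a) = a"
  unfolding \<kappa>_def by (rule inv_into_f_f[OF \<alpha>_inj])

lemma \<kappa>_eqI: "\<lbrakk>a \<in> carrier A; \<alpha> a = x\<rbrakk> \<Longrightarrow> \<kappa> x = a"
  using \<kappa>_\<alpha> by blast

lemma \<kappa>_add: "\<lbrakk>x \<in> peirce D e e; y \<in> peirce D e e\<rbrakk> \<Longrightarrow> \<kappa> (x \<oplus> y) = \<kappa> x \<oplus>\<^bsub>A\<^esub> \<kappa> y"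
  by (rule \<kappa>_eqI) (simp_all add: \<kappa>_closed \<alpha>_add \<alpha>_\<kappa>)

lemma \<kappa>_mult: "\<lbrakk>x \<in> peirce D e e; y \<in> peirce D e e\<rbrakk> \<Longrightarrow> \<kappa> (x \<otimes> y) = \<kappa> x \<otimes>\<^bsub>A\<^esub> \<kappa> y"
  by (rule \<kappa>_eqI) (simp_all add: \<kappa>_closed \<alpha>_mult \<alpha>_\<kappa>)

lemma \<alpha>_one: "\<alpha> \<one>\<^bsub>A\<^esub> = e"
proof -
  have "\<alpha> (\<one>\<^bsub>A\<^esub> \<otimes>\<^bsub>A\<^esub> \<kappa> e) = \<alpha> \<one>\<^bsub>A\<^esub> \<otimes> e"
    using \<alpha>_mult[OF A.one_closed \<kappa>_closed[OF e_corner]] by (simp add: \<alpha>_\<kappa>[OF e_corner])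
  then show ?thesis
    using \<alpha>_\<kappa>[OF e_corner] \<kappa>_closed[OF e_corner] peirceD(3)[OF \<alpha>_closed[OF A.one_closed]] by simp
qed

lemma \<kappa>_e: "\<kappa> e = \<one>\<^bsub>A\<^esub>"
  by (rule \<kappa>_eqI[OF A.one_closed \<alpha>_one])

lemma \<kappa>_zero: "\<kappa> \<zero> = \<zero>\<^bsub>A\<^esub>"
proof (rule \<kappa>_eqI[OF A.zero_closed])
  have "\<alpha> \<zero>\<^bsub>A\<^esub> \<oplus> \<alpha> \<zero>\<^bsub>A\<^esub> = \<alpha> \<zero>\<^bsub>A\<^esub>"
    using \<alpha>_add[OF A.zero_closed A.zero_closed] by simp
  then show "\<alpha> \<zero>\<^bsub>A\<^esub> = \<zero>"
    using D.add.r_cancel_one'[OF \<alpha>_carrier[OF A.zero_closed] \<alpha>_carrier[OF A.zero_closed]] by simp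
qed

lemma Q_right_module: "right_module A Q"
proof (rule right_moduleI[OF A.ring_axioms], unfold peirce_module_simps)
  note c = peirceD(1)
  note ef = idem_e(1) idem_f(1)
  fix x y z a b assume x: "x \<in> peirce D f e"
  show "\<exists>y\<in>peirce D f e. y \<oplus> x = \<zero>"
    using peirce_neg[OF ef(2,1) x] D.l_neg[OF c[OF x]] by blast
  show "\<zero> \<oplus> x = x" by (simp add: c[OF x])
  show "x \<otimes> \<alpha> \<one>\<^bsub>A\<^esub> = x" by (simp add: \<alpha>_one peirceD(3)[OF x])
  { assume a: "a \<in> carrier A"
    show "x \<otimes> \<alpha> a \<in> peirce D f e" by (rule peirce_mult[OF ef(2,1,1) x \<alpha>_closed[OF a]])
    { assume b: "b \<in> carrier A"
      show "x \<otimes> \<alpha> (a \<oplus>\<^bsub>A\<^esub> b) = x \<otimes> \<alpha> a \<oplus> x \<otimes> \<alpha> b"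
        by (simp add: \<alpha>_add a b D.r_distr c[OF x] \<alpha>_carrier)
      show "x \<otimes> \<alpha> (a \<otimes>\<^bsub>A\<^esub> b) = x \<otimes> \<alpha> a \<otimes> \<alpha> b"
        by (simp add: \<alpha>_mult a b D.m_assoc c[OF x] \<alpha>_carrier) }
    assume y: "y \<in> peirce D f e"
    show "(x \<oplus> y) \<otimes> \<alpha> a = x \<otimes> \<alpha> a \<oplus> y \<otimes> \<alpha> a"
      by (simp add: a D.l_distr c[OF x] c[OF y] \<alpha>_carrier) }
  assume y: "y \<in> peirce D f e"
  show "x \<oplus> y \<in> peirce D f e" by (rule peirce_add[OF ef(2,1) x y])
  show "x \<oplus> y = y \<oplus> x" by (rule D.a_comm[OF c[OF x] c[OF y]])
  assume z: "z \<in> peirce D f e"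
  show "x \<oplus> y \<oplus> z = x \<oplus> (y \<oplus> z)" by (rule D.a_assoc[OF c[OF x] c[OF y] c[OF z]])
qed (rule peirce_zero[OF idem_f(1) idem_e(1)])

lemma Q_action: "left_action A B Q actQ"
proof -
  interpret S: morita_context D f e B A \<beta> \<alpha> by (rule swap)
  note ef = idem_e(1) idem_f(1)
  note c = peirceD(1)
  show ?thesis
  proof (rule left_action.intro[OF Q_right_module B.ring_axioms], rule left_action_axioms.intro, unfold peirce_module_simps)
    fix b b' a q q' assume q: "q \<in> peirce D f e"
    show "\<beta> \<one>\<^bsub>B\<^esub> \<otimes> q = q" by (simp add: S.\<alpha>_one peirceD(2)[OF q])
    assume b: "b \<in> carrier B"
    show "\<beta> b \<otimes> q \<in> peirce D f e" by (rule peirce_mult[OF ef(2,2,1) S.\<alpha>_closed[OF b] q])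
    { assume "q' \<in> peirce D f e"
      then show "\<beta> b \<otimes> (q \<oplus> q') = \<beta> b \<otimes> q \<oplus> \<beta> b \<otimes> q'"
        by (simp add: D.r_distr c[OF q] c S.\<alpha>_carrier[OF b]) }
    { assume "a \<in> carrier A"
      then show "\<beta> b \<otimes> (q \<otimes> \<alpha> a) = \<beta> b \<otimes> q \<otimes> \<alpha> a"
        by (simp add: D.m_assoc c[OF q] S.\<alpha>_carrier[OF b] \<alpha>_carrier) }
    assume b': "b' \<in> carrier B"
    show "\<beta> (b \<oplus>\<^bsub>B\<^esub> b') \<otimes> q = \<beta> b \<otimes> q \<oplus> \<beta> b' \<otimes> q"
      by (simp add: S.\<alpha>_add b b' D.l_distr c[OF q] S.\<alpha>_carrier)
    show "\<beta> (b \<otimes>\<^bsub>B\<^esub> b') \<otimes> q = \<beta> b \<otimes> (\<beta> b' \<otimes> q)"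
      by (simp add: S.\<alpha>_mult b b' D.m_assoc c[OF q] S.\<alpha>_carrier)
  qed
qed

lemma P_action: "left_action B A P actP" and P_right_module: "right_module B P"
proof -
  interpret S: morita_context D f e B A \<beta> \<alpha> by (rule swap)
  show "left_action B A P actP" "right_module B P" by (rule S.Q_action, rule S.Q_right_module)
qed

lemma FM_right_module: "right_module A V \<Longrightarrow> right_module B (FM V)"
  by (rule left_action.hom_mod_right_module[OF Q_action])

lemma GM_right_module: "right_module B W \<Longrightarrow> right_module A (GM W)"
  by (rule left_action.hom_mod_right_module[OF P_action])

lemma pq_corner: "\<lbrakk>p \<in> peirce D e f; q \<in> peirce D f e\<rbrakk> \<Longrightarrow> p \<otimes> q \<in> peirce D e e"
  by (rule peirce_mult[OF idem_e(1) idem_f(1) idem_e(1)])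

lemma qp_corner: "\<lbrakk>q \<in> peirce D f e; p \<in> peirce D e f\<rbrakk> \<Longrightarrow> q \<otimes> p \<in> peirce D f f"
  by (rule peirce_mult[OF idem_f(1) idem_e(1) idem_f(1)])

lemma corner_sums_corner: "x \<in> corner_sums D e f \<Longrightarrow> x \<in> peirce D e e"
  by (induction rule: corner_sums.induct)
    (simp_all add: peirce_zero idem_e peirce_add pq_corner)

text \<open>The natural map \<open>V \<rightarrow> Hom(P, Hom(Q, V))\<close> that sends \<open>v\<close> to \<open>p \<mapsto> (q \<mapsto> v (p q))\<close>.\<close>

definition unit where
  "unit V = (\<lambda>v\<in>carrier V. \<lambda>p\<in>peirce D e f. \<lambda>q\<in>peirce D f e. \<kappa> (p \<otimes> q) \<odot>\<^bsub>V\<^esub> v)"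

lemma unit_apply [simp]:
  "\<lbrakk>v \<in> carrier V; p \<in> peirce D e f; q \<in> peirce D f e\<rbrakk> \<Longrightarrow> unit V v p q = \<kappa> (p \<otimes> q) \<odot>\<^bsub>V\<^esub> v"
  by (simp add: unit_def)

lemma unit_ext: "v \<in> carrier V \<Longrightarrow> unit V v \<in> extensional (peirce D e f)"
  by (simp add: unit_def)

lemma unit_value_hom:
  assumes "right_module A V" and v: "v \<in> carrier V" and p: "p \<in> peirce D e f"
  shows "unit V v p \<in> rmod_hom A Q V"
proof -
  interpret V: right_module A V by fact
  note c = peirceD(1)
  have "(\<lambda>q\<in>carrier Q. \<kappa> (p \<otimes> q) \<odot>\<^bsub>V\<^esub> v) \<in> rmod_hom A Q V"
  proof (rule rmod_hom_restrictI[OF Q_right_module], unfold peirce_module_simps)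
    fix x y a assume x: "x \<in> peirce D f e"
    note px = pq_corner[OF p x]
    show "\<kappa> (p \<otimes> x) \<odot>\<^bsub>V\<^esub> v \<in> carrier V" by (simp add: \<kappa>_closed px v)
    { assume y: "y \<in> peirce D f e"
      show "\<kappa> (p \<otimes> (x \<oplus> y)) \<odot>\<^bsub>V\<^esub> v = \<kappa> (p \<otimes> x) \<odot>\<^bsub>V\<^esub> v \<oplus>\<^bsub>V\<^esub> \<kappa> (p \<otimes> y) \<odot>\<^bsub>V\<^esub> v"
        using pq_corner[OF p y] px
        by (simp add: D.r_distr c[OF p] c[OF x] c[OF y] \<kappa>_add \<kappa>_closed V.smult_l_distr v) }
    assume a: "a \<in> carrier A"
    have "\<kappa> (p \<otimes> (x \<otimes> \<alpha> a)) = \<kappa> (p \<otimes> x) \<otimes>\<^bsub>A\<^esub> a"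
      using \<kappa>_mult[OF px \<alpha>_closed[OF a]] by (simp add: D.m_assoc c[OF p] c[OF x] \<alpha>_carrier a \<kappa>_\<alpha>)
    then show "\<kappa> (p \<otimes> (x \<otimes> \<alpha> a)) \<odot>\<^bsub>V\<^esub> v = a \<odot>\<^bsub>V\<^esub> (\<kappa> (p \<otimes> x) \<odot>\<^bsub>V\<^esub> v)"
      by (simp add: V.smult_assoc \<kappa>_closed px a v)
  qed
  then show ?thesis by (simp add: unit_def v p)
qed

lemma unit_closed:
  assumes V: "right_module A V" and v: "v \<in> carrier V"
  shows "unit V v \<in> rmod_hom B P (FM V)"
proof -
  interpret V: right_module A V by fact
  interpret S: morita_context D f e B A \<beta> \<alpha> by (rule swap)
  interpret QA: left_action A B Q actQ by (rule Q_action)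
  note c = peirceD(1)
  show ?thesis
  proof (rule rmod_homI, unfold peirce_module_simps hom_mod_simps)
    fix p p' b assume p: "p \<in> peirce D e f"
    show "unit V v p \<in> rmod_hom A Q V" by (rule unit_value_hom[OF V v p])
    { assume p': "p' \<in> peirce D e f"
      note pp = peirce_add[OF idem_e(1) idem_f(1) p p']
      show "unit V v (p \<oplus> p') = hadd Q V (unit V v p) (unit V v p')"
      proof (rule hom_eqI[OF unit_value_hom[OF V v pp] hadd_hom[OF Q_right_module V unit_value_hom[OF V v p] unit_value_hom[OF V v p']]],
          unfold peirce_module_simps)
        fix q assume q: "q \<in> peirce D f e"
        have "\<kappa> ((p \<oplus> p') \<otimes> q) = \<kappa> (p \<otimes> q) \<oplus>\<^bsub>A\<^esub> \<kappa> (p' \<otimes> q)"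
          by (simp add: D.l_distr c[OF p] c[OF p'] c[OF q] \<kappa>_add pq_corner p p' q)
        then show "unit V v (p \<oplus> p') q = hadd Q V (unit V v p) (unit V v p') q"
          by (simp add: v p p' pp q V.smult_l_distr \<kappa>_closed pq_corner)
      qed }
    assume b: "b \<in> carrier B"
    note pb = peirce_mult[OF idem_e(1) idem_f(1) idem_f(1) p S.\<alpha>_closed[OF b]]
    show "unit V v (p \<otimes> \<beta> b) = (\<lambda>q\<in>peirce D f e. unit V v p (\<beta> b \<otimes> q))"
    proof (rule hom_eqI[OF unit_value_hom[OF V v pb] QA.act_hom[OF V b unit_value_hom[OF V v p], unfolded peirce_module_simps]],
        unfold peirce_module_simps)
      fix q assume q: "q \<in> peirce D f e"
      have "\<beta> b \<otimes> q \<in> peirce D f e" by (rule peirce_mult[OF idem_f(1) idem_f(1) idem_e(1) S.\<alpha>_closed[OF b] q])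
      then show "unit V v (p \<otimes> \<beta> b) q = (\<lambda>q\<in>peirce D f e. unit V v p (\<beta> b \<otimes> q)) q"
        by (simp add: v p pb q D.m_assoc c[OF p] c[OF q] S.\<alpha>_carrier[OF b])
    qed
  qed (rule unit_ext[OF v])
qed

lemma unit_hom:
  assumes V: "right_module A V" shows "unit V \<in> rmod_hom A V (GM (FM V))"
proof -
  interpret V: right_module A V by fact
  interpret PA: left_action B A P actP by (rule P_action)
  note c = peirceD(1)
  note FV = FM_right_module[OF V]
  show ?thesis
  proof (rule rmod_homI)
    fix v w a assume v: "v \<in> carrier V"
    show "unit V v \<in> carrier (GM (FM V))" using unit_closed[OF V v] by simp
    { assume w: "w \<in> carrier V"
      note vw = V.M.a_closed[OF v w]
      have "unit V (v \<oplus>\<^bsub>V\<^esub> w) = hadd P (FM V) (unit V v) (unit V w)"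
      proof (rule hom_eqI[OF unit_closed[OF V vw] hadd_hom[OF P_right_module FV unit_closed[OF V v] unit_closed[OF V w]]])
        fix p assume p: "p \<in> carrier P"
        then have p': "p \<in> peirce D e f" by simp
        have "unit V (v \<oplus>\<^bsub>V\<^esub> w) p = hadd Q V (unit V v p) (unit V w p)"
          by (rule hom_eqI[OF unit_value_hom[OF V vw p'] hadd_hom[OF Q_right_module V unit_value_hom[OF V v p'] unit_value_hom[OF V w p']]])
            (simp add: v w vw p' V.smult_r_distr \<kappa>_closed pq_corner)
        then show "unit V (v \<oplus>\<^bsub>V\<^esub> w) p = hadd P (FM V) (unit V v) (unit V w) p"
          using p by simp
      qed
      then show "unit V (v \<oplus>\<^bsub>V\<^esub> w) = unit V v \<oplus>\<^bsub>GM (FM V)\<^esub> unit V w" by simp }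
    assume a: "a \<in> carrier A"
    note av = V.smult_closed[OF a v]
    have "unit V (a \<odot>\<^bsub>V\<^esub> v) = (\<lambda>p\<in>carrier P. unit V v (\<alpha> a \<otimes> p))"
    proof (rule hom_eqI[OF unit_closed[OF V av] PA.act_hom[OF FV a unit_closed[OF V v]]])
      fix p assume p: "p \<in> carrier P"
      then have p': "p \<in> peirce D e f" by simp
      have ap: "\<alpha> a \<otimes> p \<in> peirce D e f"
        by (rule peirce_mult[OF idem_e(1) idem_e(1) idem_f(1) \<alpha>_closed[OF a] p'])
      have "unit V (a \<odot>\<^bsub>V\<^esub> v) p = unit V v (\<alpha> a \<otimes> p)"
      proof (rule hom_eqI[OF unit_value_hom[OF V av p'] unit_value_hom[OF V v ap]])
        fix q assume "q \<in> carrier Q"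
        then have q: "q \<in> peirce D f e" by simp
        have "\<kappa> (\<alpha> a \<otimes> p \<otimes> q) = a \<otimes>\<^bsub>A\<^esub> \<kappa> (p \<otimes> q)"
          using \<kappa>_mult[OF \<alpha>_closed[OF a] pq_corner[OF p' q]]
          by (simp add: D.m_assoc c[OF p'] c[OF q] \<alpha>_carrier a \<kappa>_\<alpha>)
        then show "unit V (a \<odot>\<^bsub>V\<^esub> v) p q = unit V v (\<alpha> a \<otimes> p) q"
          by (simp add: v av p' ap q V.smult_assoc a \<kappa>_closed pq_corner)
      qed
      then show "unit V (a \<odot>\<^bsub>V\<^esub> v) p = (\<lambda>p\<in>carrier P. unit V v (\<alpha> a \<otimes> p)) p" using p by simp
    qed
    then show "unit V (a \<odot>\<^bsub>V\<^esub> v) = a \<odot>\<^bsub>GM (FM V)\<^esub> unit V v" by simp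
  qed (simp add: unit_def)
qed

text \<open>Write \<open>e = \<Sum> p\<^sub>i q\<^sub>i\<close>.  If \<open>v (p q) = 0\<close> for all \<open>p\<close> and \<open>q\<close>, then \<open>v = v e = 0\<close>.  A map \<open>\<Phi>\<close> is
  the image of \<open>\<Sum> \<Phi> p\<^sub>i q\<^sub>i\<close>, since \<open>(\<Phi> p\<^sub>i q\<^sub>i) (p q) = \<Phi> p\<^sub>i (q\<^sub>i p q) = \<Phi> (p\<^sub>i q\<^sub>i p) q\<close> by linearity
  over \<open>A\<close> and over \<open>B\<close>.\<close>

lemma unit_bij:
  assumes V: "right_module A V" shows "bij_betw (unit V) (carrier V) (carrier (GM (FM V)))"
proof (rule hom_bijI[OF V GM_right_module[OF FM_right_module[OF V]] unit_hom[OF V]])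
  interpret V: right_module A V by fact
  interpret S: morita_context D f e B A \<beta> \<alpha> by (rule swap)
  note c = peirceD(1)
  fix v assume v: "v \<in> carrier V" and z: "unit V v = \<zero>\<^bsub>GM (FM V)\<^esub>"
  have pq: "\<kappa> (p \<otimes> q) \<odot>\<^bsub>V\<^esub> v = \<zero>\<^bsub>V\<^esub>" if p: "p \<in> peirce D e f" and q: "q \<in> peirce D f e" for p q
    using fun_cong[OF fun_cong[OF z, of p], of q] p q v by (simp add: hzero_def)
  have "\<kappa> x \<odot>\<^bsub>V\<^esub> v = \<zero>\<^bsub>V\<^esub>" if "x \<in> corner_sums D e f" for x
    using that
  proof induction
    case zero then show ?case by (simp add: \<kappa>_zero v)
  next
    case (step x p q)
    then show ?case
      by (simp add: \<kappa>_add corner_sums_corner pq_corner V.smult_l_distr \<kappa>_closed v pq)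
  qed
  from this[OF full_e] show "v = \<zero>\<^bsub>V\<^esub>" by (simp add: \<kappa>_e v)
next
  interpret V: right_module A V by fact
  interpret S: morita_context D f e B A \<beta> \<alpha> by (rule swap)
  note c = peirceD(1)
  fix \<Phi> assume "\<Phi> \<in> carrier (GM (FM V))"
  then have \<Phi>: "\<Phi> \<in> rmod_hom B P (FM V)" by simp
  have \<Phi>p: "\<Phi> p \<in> rmod_hom A Q V" if "p \<in> peirce D e f" for p
    using hom_closed[OF \<Phi>, of p] that by simp
  \<comment> \<open>Induction over the summands of \<open>x\<close>; the case \<open>x = e\<close> gives the preimage of \<open>\<Phi>\<close>.\<close>
  have "\<exists>v\<in>carrier V. \<forall>p\<in>peirce D e f. \<forall>q\<in>peirce D f e. \<kappa> (p \<otimes> q) \<odot>\<^bsub>V\<^esub> v = \<Phi> (x \<otimes> p) q"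
    if "x \<in> corner_sums D e f" for x
    using that
  proof induction
    case zero
    have "\<Phi> \<zero> = hzero Q V"
      using hom_zero[OF P_right_module FM_right_module[OF V] \<Phi>] by simp
    then have "\<kappa> (p \<otimes> q) \<odot>\<^bsub>V\<^esub> \<zero>\<^bsub>V\<^esub> = \<Phi> (\<zero> \<otimes> p) q"
      if "p \<in> peirce D e f" "q \<in> peirce D f e" for p q
      using that by (simp add: c[OF that(1)] \<kappa>_closed pq_corner)
    then show ?case by (intro bexI[of _ "\<zero>\<^bsub>V\<^esub>"] ballI) simp_all
  next
    case (step x p0 q0)
    then obtain v where v: "v \<in> carrier V"
      and vx: "\<And>p q. \<lbrakk>p \<in> peirce D e f; q \<in> peirce D f e\<rbrakk> \<Longrightarrow> \<kappa> (p \<otimes> q) \<odot>\<^bsub>V\<^esub> v = \<Phi> (x \<otimes> p) q"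
      by blast
    note p0 = step.hyps(2) and q0 = step.hyps(3)
    note x = corner_sums_corner[OF step.hyps(1)]
    have w: "\<Phi> p0 q0 \<in> carrier V" using hom_closed[OF \<Phi>p[OF p0], of q0] q0 by simp
    have "\<kappa> (p \<otimes> q) \<odot>\<^bsub>V\<^esub> (v \<oplus>\<^bsub>V\<^esub> \<Phi> p0 q0) = \<Phi> ((x \<oplus> p0 \<otimes> q0) \<otimes> p) q"
      if p: "p \<in> peirce D e f" and q: "q \<in> peirce D f e" for p q
    proof -
      note pq = pq_corner[OF p q] and qp = qp_corner[OF q0 p]
      have xp: "x \<otimes> p \<in> peirce D e f" by (rule peirce_mult[OF idem_e(1) idem_e(1) idem_f(1) x p])
      have p0qp: "p0 \<otimes> (q0 \<otimes> p) \<in> peirce D e f"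
        by (rule peirce_mult[OF idem_e(1) idem_f(1) idem_f(1) p0 qp])
      have "\<kappa> (p \<otimes> q) \<odot>\<^bsub>V\<^esub> \<Phi> p0 q0 = \<Phi> p0 (q0 \<otimes> (p \<otimes> q))"
        using hom_smult[OF \<Phi>p[OF p0] \<kappa>_closed[OF pq], of q0] q0 by (simp add: \<alpha>_\<kappa> pq)
      also have "\<dots> = \<Phi> (p0 \<otimes> (q0 \<otimes> p)) q"
        using fun_cong[OF hom_smult[OF \<Phi> S.\<kappa>_closed[OF qp], of p0], of q] p0 q
        by (simp add: S.\<alpha>_\<kappa> qp D.m_assoc c[OF p] c[OF q] c[OF q0])
      finally have 1: "\<kappa> (p \<otimes> q) \<odot>\<^bsub>V\<^esub> \<Phi> p0 q0 = \<Phi> (p0 \<otimes> (q0 \<otimes> p)) q" .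
      have "(x \<oplus> p0 \<otimes> q0) \<otimes> p = x \<otimes> p \<oplus> p0 \<otimes> (q0 \<otimes> p)"
        by (simp add: D.l_distr D.m_assoc c[OF x] c[OF p0] c[OF q0] c[OF p])
      then have "\<Phi> ((x \<oplus> p0 \<otimes> q0) \<otimes> p) q = \<Phi> (x \<otimes> p) q \<oplus>\<^bsub>V\<^esub> \<Phi> (p0 \<otimes> (q0 \<otimes> p)) q"
        using fun_cong[OF hom_add[OF \<Phi>, of "x \<otimes> p" "p0 \<otimes> (q0 \<otimes> p)"], of q] xp p0qp q by simp
      then show ?thesis
        using 1 vx[OF p q] by (simp add: V.smult_r_distr \<kappa>_closed pq v w)
    qed
    then show ?case using v w by (intro bexI[of _ "v \<oplus>\<^bsub>V\<^esub> \<Phi> p0 q0"] ballI) simp_all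
  qed
  from this[OF full_e] obtain v where v: "v \<in> carrier V"
    and vx: "\<And>p q. \<lbrakk>p \<in> peirce D e f; q \<in> peirce D f e\<rbrakk> \<Longrightarrow> \<kappa> (p \<otimes> q) \<odot>\<^bsub>V\<^esub> v = \<Phi> (e \<otimes> p) q"
    by blast
  have "unit V v = \<Phi>"
  proof (rule hom_eqI[OF unit_closed[OF V v] \<Phi>])
    fix p assume "p \<in> carrier P"
    then have p: "p \<in> peirce D e f" by simp
    show "unit V v p = \<Phi> p"
      by (rule hom_eqI[OF unit_value_hom[OF V v p] \<Phi>p[OF p]]) (simp add: v p vx peirceD(2)[OF p])
  qed
  then show "\<exists>x\<in>carrier V. unit V x = \<Phi>" using v by blast
qed

lemma unit_natural:
  assumes V: "right_module A V" and W: "right_module A W" and f: "f' \<in> rmod_hom A V W" and v: "v \<in> carrier V"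
    and p: "p \<in> peirce D e f"
  shows "unit W (f' v) p = hmap A Q V f' (unit V v p)"
proof -
  interpret QA: left_action A B Q actQ by (rule Q_action)
  have fv: "f' v \<in> carrier W" by (rule hom_closed[OF f v])
  show ?thesis
    by (rule hom_eqI[OF unit_value_hom[OF W fv p] QA.hmap_closed[OF f unit_value_hom[OF V v p]]])
      (simp add: QA.hmap_apply unit_value_hom[OF V v p] v fv p hom_smult[OF f] \<kappa>_closed pq_corner)
qed

text \<open>Left multiplication by a product \<open>p q\<close> factors through left multiplication by \<open>q\<close>, which maps
  \<open>A\<close> to \<open>Q\<close> and \<open>P\<close> to \<open>B\<close>.  For \<open>x = e\<close> both sums are identities.\<close>

lemma corner_sums_left:
  assumes "x \<in> corner_sums D e f"
  shows "(\<lambda>a\<in>carrier A. \<kappa> (x \<otimes> \<alpha> a)) \<in> through_all A Q (regular_module A) (regular_module A)"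
    and "(\<lambda>p\<in>peirce D e f. x \<otimes> p) \<in> through_all B (regular_module B) P P"
proof -
  interpret S: morita_context D f e B A \<beta> \<alpha> by (rule swap)
  interpret P: right_module B P by (rule P_right_module)
  note RA = regular_right_module[OF A.ring_axioms] and RB = regular_right_module[OF B.ring_axioms]
  note c = peirceD(1)
  note ef = idem_e(1) idem_f(1)
  show "(\<lambda>a\<in>carrier A. \<kappa> (x \<otimes> \<alpha> a)) \<in> through_all A Q (regular_module A) (regular_module A)"
    using assms
  proof induction
    case zero
    have "(\<lambda>a\<in>carrier A. \<kappa> (\<zero> \<otimes> \<alpha> a)) = hzero (regular_module A) (regular_module A)"
      by (auto simp: hzero_def \<alpha>_carrier \<kappa>_zero)
    then show ?case by (simp only: through.zero)
  next
    case (step x p q)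
    note p = step.hyps(2) and q = step.hyps(3) and x = corner_sums_corner[OF step.hyps(1)]
    have 1: "(\<lambda>a\<in>carrier (regular_module A). q \<otimes> \<alpha> a) \<in> rmod_hom A (regular_module A) Q"
    proof (rule rmod_hom_restrictI[OF RA], unfold peirce_module_simps regular_simps)
      fix a b assume a: "a \<in> carrier A"
      show "q \<otimes> \<alpha> a \<in> peirce D f e" by (rule peirce_mult[OF ef(2,1,1) q \<alpha>_closed[OF a]])
      assume b: "b \<in> carrier A"
      show "q \<otimes> \<alpha> (a \<oplus>\<^bsub>A\<^esub> b) = q \<otimes> \<alpha> a \<oplus> q \<otimes> \<alpha> b"
        by (simp add: a b \<alpha>_add D.r_distr c[OF q] \<alpha>_carrier)
      show "q \<otimes> \<alpha> (b \<otimes>\<^bsub>A\<^esub> a) = q \<otimes> \<alpha> b \<otimes> \<alpha> a"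
        by (simp add: a b \<alpha>_mult D.m_assoc c[OF q] \<alpha>_carrier)
    qed
    have 2: "(\<lambda>r\<in>carrier Q. \<kappa> (p \<otimes> r)) \<in> rmod_hom A Q (regular_module A)"
    proof (rule rmod_hom_restrictI[OF Q_right_module], unfold peirce_module_simps regular_simps)
      fix r s a assume r: "r \<in> peirce D f e"
      note pr = pq_corner[OF p r]
      show "\<kappa> (p \<otimes> r) \<in> carrier A" by (rule \<kappa>_closed[OF pr])
      { assume s: "s \<in> peirce D f e"
        show "\<kappa> (p \<otimes> (r \<oplus> s)) = \<kappa> (p \<otimes> r) \<oplus>\<^bsub>A\<^esub> \<kappa> (p \<otimes> s)"
          by (simp add: D.r_distr c[OF p] c[OF r] c[OF s] \<kappa>_add pr pq_corner[OF p s]) }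
      assume a: "a \<in> carrier A"
      show "\<kappa> (p \<otimes> (r \<otimes> \<alpha> a)) = \<kappa> (p \<otimes> r) \<otimes>\<^bsub>A\<^esub> a"
        using \<kappa>_mult[OF pr \<alpha>_closed[OF a]] by (simp add: D.m_assoc c[OF p] c[OF r] \<alpha>_carrier a \<kappa>_\<alpha>)
    qed
    have "(\<lambda>a\<in>carrier A. \<kappa> ((x \<oplus> p \<otimes> q) \<otimes> \<alpha> a)) =
      hadd (regular_module A) (regular_module A) (\<lambda>a\<in>carrier A. \<kappa> (x \<otimes> \<alpha> a))
        (rcomp (regular_module A) (\<lambda>r\<in>carrier Q. \<kappa> (p \<otimes> r)) (\<lambda>a\<in>carrier (regular_module A). q \<otimes> \<alpha> a))"
    proof (rule ext)
      fix a
      show "(\<lambda>a\<in>carrier A. \<kappa> ((x \<oplus> p \<otimes> q) \<otimes> \<alpha> a)) a =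
        hadd (regular_module A) (regular_module A) (\<lambda>a\<in>carrier A. \<kappa> (x \<otimes> \<alpha> a))
          (rcomp (regular_module A) (\<lambda>r\<in>carrier Q. \<kappa> (p \<otimes> r)) (\<lambda>a\<in>carrier (regular_module A). q \<otimes> \<alpha> a)) a"
      proof (cases "a \<in> carrier A")
        case a: True
        have qa: "q \<otimes> \<alpha> a \<in> peirce D f e" by (rule peirce_mult[OF ef(2,1,1) q \<alpha>_closed[OF a]])
        have xa: "x \<otimes> \<alpha> a \<in> peirce D e e" by (rule peirce_mult[OF ef(1,1,1) x \<alpha>_closed[OF a]])
        have "(x \<oplus> p \<otimes> q) \<otimes> \<alpha> a = x \<otimes> \<alpha> a \<oplus> p \<otimes> (q \<otimes> \<alpha> a)"
          by (simp add: D.l_distr D.m_assoc c[OF x] c[OF p] c[OF q] \<alpha>_carrier a)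
        then show ?thesis
          using a qa xa by (simp add: compose_def \<kappa>_add pq_corner p)
      qed (simp add: hadd_def)
    qed
    then show ?case using through.step[OF step.IH 1 2] by (simp only:)
  qed
  show "(\<lambda>p\<in>peirce D e f. x \<otimes> p) \<in> through_all B (regular_module B) P P"
    using assms
  proof induction
    case zero
    have "(\<lambda>p\<in>peirce D e f. \<zero> \<otimes> p) = hzero P P"
      unfolding hzero_def peirce_module_simps by (rule restrict_ext) (simp add: c)
    then show ?case by (simp only: through.zero)
  next
    case (step x p q)
    note p = step.hyps(2) and q = step.hyps(3) and x = corner_sums_corner[OF step.hyps(1)]
    have 1: "(\<lambda>r\<in>carrier P. S.\<kappa> (q \<otimes> r)) \<in> rmod_hom B P (regular_module B)"
    proof (rule rmod_hom_restrictI[OF P_right_module], unfold peirce_module_simps regular_simps)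
      fix r s a assume r: "r \<in> peirce D e f"
      note qr = qp_corner[OF q r]
      show "S.\<kappa> (q \<otimes> r) \<in> carrier B" by (rule S.\<kappa>_closed[OF qr])
      { assume s: "s \<in> peirce D e f"
        show "S.\<kappa> (q \<otimes> (r \<oplus> s)) = S.\<kappa> (q \<otimes> r) \<oplus>\<^bsub>B\<^esub> S.\<kappa> (q \<otimes> s)"
          by (simp add: D.r_distr c[OF q] c[OF r] c[OF s] S.\<kappa>_add qr qp_corner[OF q s]) }
      assume a: "a \<in> carrier B"
      show "S.\<kappa> (q \<otimes> (r \<otimes> \<beta> a)) = S.\<kappa> (q \<otimes> r) \<otimes>\<^bsub>B\<^esub> a"
        using S.\<kappa>_mult[OF qr S.\<alpha>_closed[OF a]] by (simp add: D.m_assoc c[OF q] c[OF r] S.\<alpha>_carrier a S.\<kappa>_\<alpha>)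
    qed
    have 2: "(\<lambda>b\<in>carrier (regular_module B). p \<otimes> \<beta> b) \<in> rmod_hom B (regular_module B) P"
    proof (rule rmod_hom_restrictI[OF RB], unfold peirce_module_simps regular_simps)
      fix a b assume a: "a \<in> carrier B"
      show "p \<otimes> \<beta> a \<in> peirce D e f" by (rule peirce_mult[OF ef(1,2,2) p S.\<alpha>_closed[OF a]])
      assume b: "b \<in> carrier B"
      show "p \<otimes> \<beta> (a \<oplus>\<^bsub>B\<^esub> b) = p \<otimes> \<beta> a \<oplus> p \<otimes> \<beta> b"
        by (simp add: a b S.\<alpha>_add D.r_distr c[OF p] S.\<alpha>_carrier)
      show "p \<otimes> \<beta> (b \<otimes>\<^bsub>B\<^esub> a) = p \<otimes> \<beta> b \<otimes> \<beta> a"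
        by (simp add: a b S.\<alpha>_mult D.m_assoc c[OF p] S.\<alpha>_carrier)
    qed
    have "(\<lambda>r\<in>peirce D e f. (x \<oplus> p \<otimes> q) \<otimes> r) = hadd P P (\<lambda>r\<in>peirce D e f. x \<otimes> r)
        (rcomp P (\<lambda>b\<in>carrier (regular_module B). p \<otimes> \<beta> b) (\<lambda>r\<in>carrier P. S.\<kappa> (q \<otimes> r)))"
    proof (rule ext)
      fix r
      show "(\<lambda>r\<in>peirce D e f. (x \<oplus> p \<otimes> q) \<otimes> r) r = hadd P P (\<lambda>r\<in>peirce D e f. x \<otimes> r)
        (rcomp P (\<lambda>b\<in>carrier (regular_module B). p \<otimes> \<beta> b) (\<lambda>r\<in>carrier P. S.\<kappa> (q \<otimes> r))) r"
      proof (cases "r \<in> peirce D e f")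
        case r: True
        show ?thesis
          by (simp add: r compose_def S.\<kappa>_closed S.\<alpha>_\<kappa> qp_corner[OF q r] D.l_distr D.m_assoc
            c[OF x] c[OF p] c[OF q] c[OF r])
      qed (simp add: hadd_def)
    qed
    then show ?case using through.step[OF step.IH 1 2] by (simp only:)
  qed
qed

lemma in_add_Q_regular: "in_add A Q (regular_module A)"
proof -
  have "(\<lambda>a\<in>carrier A. \<kappa> (e \<otimes> \<alpha> a)) = rid (regular_module A)"
    by (auto simp: peirceD(2)[OF \<alpha>_closed] \<kappa>_\<alpha>)
  then show ?thesis using corner_sums_left(1)[OF full_e] by (simp only: in_add_def)
qed

lemma in_add_regular_P: "in_add B (regular_module B) P"
proof -
  have "(\<lambda>p\<in>peirce D e f. e \<otimes> p) = rid P"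
    unfolding peirce_module_simps by (rule restrict_ext) (rule peirceD(2))
  then show ?thesis using corner_sums_left(2)[OF full_e] by (simp only: in_add_def)
qed

text \<open>Left multiplication identifies \<open>B\<close> with \<open>End\<^sub>A(Q)\<close>.\<close>

lemma regular_iso_FM_Q: "rmod_iso B (regular_module B) (FM Q)"
proof -
  interpret S: morita_context D f e B A \<beta> \<alpha> by (rule swap)
  interpret QA: left_action A B Q actQ by (rule Q_action)
  note RB = regular_right_module[OF B.ring_axioms]
  note c = peirceD(1)
  note FQ = FM_right_module[OF Q_right_module]
  define l where "l = (\<lambda>b\<in>carrier (regular_module B). \<lambda>q\<in>carrier Q. \<beta> b \<otimes> q)"
  have lb: "l b \<in> rmod_hom A Q Q" if "b \<in> carrier B" for b
    using QA.act_hom[OF Q_right_module that rid_hom[OF Q_right_module]] that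
    by (simp add: l_def QA.act_closed[simplified] cong: restrict_cong)
  have l: "l \<in> rmod_hom B (regular_module B) (FM Q)"
    unfolding l_def
  proof (rule rmod_hom_restrictI[OF RB], unfold regular_simps hom_mod_simps)
    fix a b assume a: "a \<in> carrier B"
    show "(\<lambda>q\<in>carrier Q. \<beta> a \<otimes> q) \<in> rmod_hom A Q Q" using lb[OF a] a by (simp add: l_def)
    assume b: "b \<in> carrier B"
    show "(\<lambda>q\<in>carrier Q. \<beta> (a \<oplus>\<^bsub>B\<^esub> b) \<otimes> q) = hadd Q Q (\<lambda>q\<in>carrier Q. \<beta> a \<otimes> q) (\<lambda>q\<in>carrier Q. \<beta> b \<otimes> q)"
      by (auto simp: hadd_def S.\<alpha>_add a b D.l_distr S.\<alpha>_carrier c)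
    have "\<beta> a \<otimes> q \<in> peirce D f e" if "q \<in> peirce D f e" for q
      by (rule peirce_mult[OF idem_f(1) idem_f(1) idem_e(1) S.\<alpha>_closed[OF a] that])
    then show "(\<lambda>q\<in>carrier Q. \<beta> (b \<otimes>\<^bsub>B\<^esub> a) \<otimes> q) = (\<lambda>x\<in>carrier Q. (\<lambda>q\<in>carrier Q. \<beta> b \<otimes> q) (\<beta> a \<otimes> x))"
      by (auto simp: S.\<alpha>_mult a b D.m_assoc S.\<alpha>_carrier c)
  qed
  have "bij_betw l (carrier (regular_module B)) (carrier (FM Q))"
  proof (rule hom_bijI[OF RB FQ l])
    fix b assume b: "b \<in> carrier (regular_module B)" and z: "l b = \<zero>\<^bsub>FM Q\<^esub>"
    have bq: "\<beta> b \<otimes> q = \<zero>" if "q \<in> peirce D f e" for q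
      using fun_cong[OF z, of q] that b by (simp add: l_def hzero_def)
    have "\<beta> b \<otimes> x = \<zero>" if "x \<in> corner_sums D f e" for x
      using that
    proof induction
      case (step x q p)
      have "\<beta> b \<otimes> (q \<otimes> p) = \<zero>"
        using bq[OF step.hyps(2)] b c[OF step.hyps(2)] c[OF step.hyps(3)]
        by (simp add: D.m_assoc[symmetric] S.\<alpha>_carrier)
      then show ?case
        using step.IH b c[OF step.hyps(2)] c[OF step.hyps(3)] c[OF S.corner_sums_corner[OF step.hyps(1)]]
        by (simp add: D.r_distr S.\<alpha>_carrier)
    qed (use b in \<open>simp add: S.\<alpha>_carrier\<close>)
    from this[OF full_f] have "\<beta> b = \<zero>" using b peirceD(3)[OF S.\<alpha>_closed[of b]] by simp
    then show "b = \<zero>\<^bsub>regular_module B\<^esub>" using S.\<kappa>_\<alpha>[of b] S.\<kappa>_zero b by simp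
  next
    fix h assume "h \<in> carrier (FM Q)"
    then have h: "h \<in> rmod_hom A Q Q" by simp
    have hc: "h q \<in> peirce D f e" if "q \<in> peirce D f e" for q
      using hom_closed[OF h, of q] that by simp
    have "\<exists>b\<in>carrier B. \<forall>q\<in>peirce D f e. h (x \<otimes> q) = \<beta> b \<otimes> q" if "x \<in> corner_sums D f e" for x
      using that
    proof induction
      case zero
      have "h \<zero> = \<zero>" using hom_zero[OF Q_right_module Q_right_module h] by simp
      moreover have "\<beta> \<zero>\<^bsub>B\<^esub> = \<zero>" using S.\<alpha>_\<kappa>[OF peirce_zero[OF idem_f(1) idem_f(1)]] by (simp add: S.\<kappa>_zero)
      ultimately show ?case by (intro bexI[of _ "\<zero>\<^bsub>B\<^esub>"]) (auto dest: c)
    next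
      case (step x q0 p0)
      then obtain b where b: "b \<in> carrier B" and bx: "\<And>q. q \<in> peirce D f e \<Longrightarrow> h (x \<otimes> q) = \<beta> b \<otimes> q" by blast
      note q0 = step.hyps(2) and p0 = step.hyps(3) and x = S.corner_sums_corner[OF step.hyps(1)]
      note hp = qp_corner[OF hc[OF q0] p0]
      have "h ((x \<oplus> q0 \<otimes> p0) \<otimes> q) = \<beta> (b \<oplus>\<^bsub>B\<^esub> S.\<kappa> (h q0 \<otimes> p0)) \<otimes> q" if q: "q \<in> peirce D f e" for q
      proof -
        note pq = pq_corner[OF p0 q]
        have xq: "x \<otimes> q \<in> peirce D f e" by (rule peirce_mult[OF idem_f(1) idem_f(1) idem_e(1) x q])
        have qpq: "q0 \<otimes> (p0 \<otimes> q) \<in> peirce D f e" by (rule peirce_mult[OF idem_f(1) idem_e(1) idem_e(1) q0 pq])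
        have "(x \<oplus> q0 \<otimes> p0) \<otimes> q = x \<otimes> q \<oplus> q0 \<otimes> (p0 \<otimes> q)"
          by (simp add: D.l_distr D.m_assoc c[OF x] c[OF p0] c[OF q0] c[OF q])
        then have "h ((x \<oplus> q0 \<otimes> p0) \<otimes> q) = h (x \<otimes> q) \<oplus> h (q0 \<otimes> (p0 \<otimes> q))"
          using hom_add[OF h, of "x \<otimes> q" "q0 \<otimes> (p0 \<otimes> q)"] xq qpq by simp
        also have "h (q0 \<otimes> (p0 \<otimes> q)) = h q0 \<otimes> (p0 \<otimes> q)"
          using hom_smult[OF h \<kappa>_closed[OF pq], of q0] q0 by (simp add: \<alpha>_\<kappa> pq)
        finally show ?thesis
          by (simp add: bx q S.\<alpha>_add b S.\<kappa>_closed hp S.\<alpha>_\<kappa> D.l_distr S.\<alpha>_carrier c[OF hc[OF q0]] c[OF p0] c[OF q] D.m_assoc)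
      qed
      then show ?case using b hp by (intro bexI[of _ "b \<oplus>\<^bsub>B\<^esub> S.\<kappa> (h q0 \<otimes> p0)"]) (simp_all add: S.\<kappa>_closed)
    qed
    from this[OF full_f] obtain b where b: "b \<in> carrier B"
      and bx: "\<And>q. q \<in> peirce D f e \<Longrightarrow> h (f \<otimes> q) = \<beta> b \<otimes> q" by blast
    have "l b = h"
      by (rule hom_eqI[OF lb[OF b] h]) (use b bx in \<open>simp add: l_def peirceD(2)\<close>)
    then show "\<exists>x\<in>carrier (regular_module B). l x = h" using b by auto
  qed
  then show ?thesis using l unfolding rmod_iso_def by blast
qed

lemma FM_in_add_regular:
  assumes V: "right_module A V" and a: "in_add A (regular_module A) V"
  shows "in_add B (regular_module B) (FM V)"
proof -
  note RA = regular_right_module[OF A.ring_axioms] and RB = regular_right_module[OF B.ring_axioms]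
  have QV: "in_add A Q V" by (rule in_add_trans[OF Q_right_module RA V in_add_Q_regular a])
  note FQ = FM_right_module[OF Q_right_module]
  show ?thesis
    by (rule in_add_trans[OF RB FQ FM_right_module[OF V] in_add_iso(1)[OF RB FQ regular_iso_FM_Q]
      left_action.hom_mod_in_add[OF Q_action Q_right_module V QV]])
qed

section \<open>Preservation of finite presentation by a Morita context\<close>

lemma submodule_FM:
  assumes V: "right_module A V" and K: "submodule K A V"
  shows "submodule {h \<in> rmod_hom A Q V. \<forall>q\<in>peirce D f e. h q \<in> K} B (FM V)"
proof -
  interpret V: right_module A V by fact
  interpret FV: right_module B "FM V" by (rule FM_right_module[OF V])
  interpret QA: left_action A B Q actQ by (rule Q_action)
  note K = V.rsubmoduleD[OF K]
  show ?thesis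
  proof (rule FV.rsubmoduleI)
    show "{h \<in> rmod_hom A Q V. \<forall>q\<in>peirce D f e. h q \<in> K} \<subseteq> carrier (FM V)" by auto
    show "\<zero>\<^bsub>FM V\<^esub> \<in> {h \<in> rmod_hom A Q V. \<forall>q\<in>peirce D f e. h q \<in> K}"
      using K(2) hzero_hom[OF Q_right_module V] by simp
    fix h k b assume h: "h \<in> {h \<in> rmod_hom A Q V. \<forall>q\<in>peirce D f e. h q \<in> K}"
    { assume k: "k \<in> {h \<in> rmod_hom A Q V. \<forall>q\<in>peirce D f e. h q \<in> K}"
      show "h \<oplus>\<^bsub>FM V\<^esub> k \<in> {h \<in> rmod_hom A Q V. \<forall>q\<in>peirce D f e. h q \<in> K}"
        using h k K(3) hadd_hom[OF Q_right_module V] by simp }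
    assume b: "b \<in> carrier B"
    show "b \<odot>\<^bsub>FM V\<^esub> h \<in> {h \<in> rmod_hom A Q V. \<forall>q\<in>peirce D f e. h q \<in> K}"
      using h b QA.act_hom[OF V b] QA.act_closed[OF b] by simp
  qed
qed

text \<open>Write \<open>f = \<Sum> q\<^sub>i p\<^sub>i\<close>.  A map \<open>h : Q \<rightarrow> K\<close> satisfies \<open>h q = h (f q) = \<Sum> h q\<^sub>i (p\<^sub>i q)\<close>, so it is the
  sum of the maps \<open>unit V (h q\<^sub>i) p\<^sub>i\<close>.  As \<open>unit V v p\<close> is linear in \<open>v\<close> and in \<open>p\<close>, the finitely many
  maps with \<open>v\<close> and \<open>p\<close> ranging over generators of \<open>K\<close> and of \<open>P\<close> suffice.\<close>

lemma fg_FM: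
  assumes V: "right_module A V" and fg: "fg_submodule A V K"
  shows "fg_submodule B (FM V) {h \<in> rmod_hom A Q V. \<forall>q\<in>peirce D f e. h q \<in> K}"
proof -
  interpret S: morita_context D f e B A \<beta> \<alpha> by (rule swap)
  interpret V: right_module A V by fact
  interpret FV: right_module B "FM V" by (rule FM_right_module[OF V])
  interpret PM: right_module B P by (rule P_right_module)
  note c = peirceD(1)
  note RB = regular_right_module[OF B.ring_axioms]
  from fg obtain G where K: "submodule K A V" and G: "finite G" "G \<subseteq> K"
    and gen: "\<And>H. submodule H A V \<Longrightarrow> G \<subseteq> H \<Longrightarrow> K \<subseteq> H" by (auto simp: fg_submodule_def)
  note KD = V.rsubmoduleD[OF K]
  obtain L where L: "finite L" "L \<subseteq> carrier P" "\<And>H. submodule H B P \<Longrightarrow> L \<subseteq> H \<Longrightarrow> carrier P \<subseteq> H"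
    using in_add_fg[OF RB P_right_module regular_fg[OF B.ring_axioms] in_add_regular_P]
    unfolding fg_whole[OF P_right_module] by blast
  let ?T = "(\<lambda>(v, p). unit V v p) ` (G \<times> L)"
  show ?thesis
    unfolding fg_submodule_def
  proof (intro conjI exI[of _ ?T] allI impI)
    show "submodule {h \<in> rmod_hom A Q V. \<forall>q\<in>peirce D f e. h q \<in> K} B (FM V)"
      by (rule submodule_FM[OF V K])
    show "finite ?T" using G(1) L(1) by simp
    show "?T \<subseteq> {h \<in> rmod_hom A Q V. \<forall>q\<in>peirce D f e. h q \<in> K}"
    proof
      fix t assume "t \<in> ?T"
      then obtain v p where vp: "v \<in> G" "p \<in> L" "t = unit V v p" by auto
      have v: "v \<in> K" "v \<in> carrier V" using vp(1) G(2) KD(1) by auto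
      have p: "p \<in> peirce D e f" using vp(2) L(2) by auto
      show "t \<in> {h \<in> rmod_hom A Q V. \<forall>q\<in>peirce D f e. h q \<in> K}"
        using unit_value_hom[OF V v(2) p] KD(4)[OF \<kappa>_closed[OF pq_corner[OF p]] v(1)] by (simp add: vp(3) v p)
    qed
    fix H assume H: "submodule H B (FM V)" "?T \<subseteq> H"
    note HD = FV.rsubmoduleD[OF H(1)]
    have *: "unit V v p \<in> H" if v: "v \<in> G" and p: "p \<in> peirce D e f" for v p
    proof -
      have vc: "v \<in> carrier V" using v G(2) KD(1) by auto
      have "carrier P \<subseteq> {p \<in> carrier P. unit V v p \<in> H}"
      proof (rule L(3)[OF submodule_vimage[OF P_right_module FM_right_module[OF V] unit_closed[OF V vc] H(1)]])
        show "L \<subseteq> {p \<in> carrier P. unit V v p \<in> H}" using L(2) H(2) v by auto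
      qed
      then show ?thesis using p by auto
    qed
    \<comment> \<open>Those \<open>v\<close> for which all maps \<open>unit V v p\<close> lie in \<open>H\<close> form a submodule, so it contains \<open>K\<close>.\<close>
    have "submodule {v \<in> carrier V. \<forall>p\<in>peirce D e f. unit V v p \<in> H} A V"
    proof (rule V.rsubmoduleI)
      show "{v \<in> carrier V. \<forall>p\<in>peirce D e f. unit V v p \<in> H} \<subseteq> carrier V" by blast
      note uh = unit_hom[OF V] and GF = GM_right_module[OF FM_right_module[OF V]]
      have "unit V \<zero>\<^bsub>V\<^esub> p = \<zero>\<^bsub>FM V\<^esub>" if "p \<in> peirce D e f" for p
        using fun_cong[OF hom_zero[OF V GF uh], of p] that by simp
      then show "\<zero>\<^bsub>V\<^esub> \<in> {v \<in> carrier V. \<forall>p\<in>peirce D e f. unit V v p \<in> H}" using HD(2) by simp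
      fix v w a assume v: "v \<in> {v \<in> carrier V. \<forall>p\<in>peirce D e f. unit V v p \<in> H}"
      { assume w: "w \<in> {v \<in> carrier V. \<forall>p\<in>peirce D e f. unit V v p \<in> H}"
        have "unit V (v \<oplus>\<^bsub>V\<^esub> w) p = unit V v p \<oplus>\<^bsub>FM V\<^esub> unit V w p" if "p \<in> peirce D e f" for p
          using fun_cong[OF hom_add[OF uh, of v w], of p] that v w by simp
        then show "v \<oplus>\<^bsub>V\<^esub> w \<in> {v \<in> carrier V. \<forall>p\<in>peirce D e f. unit V v p \<in> H}"
          using v w HD(3) by simp }
      assume a: "a \<in> carrier A"
      have "unit V (a \<odot>\<^bsub>V\<^esub> v) p \<in> H" if p: "p \<in> peirce D e f" for p
      proof -
        have "\<alpha> a \<otimes> p \<in> peirce D e f"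
          by (rule peirce_mult[OF idem_e(1) idem_e(1) idem_f(1) \<alpha>_closed[OF a] p])
        then show ?thesis using fun_cong[OF hom_smult[OF uh a, of v], of p] p v by simp
      qed
      then show "a \<odot>\<^bsub>V\<^esub> v \<in> {v \<in> carrier V. \<forall>p\<in>peirce D e f. unit V v p \<in> H}"
        using a v by simp
    qed
    then have KH: "K \<subseteq> {v \<in> carrier V. \<forall>p\<in>peirce D e f. unit V v p \<in> H}"
      by (rule gen) (use * G(2) KD(1) in auto)
    show "{h \<in> rmod_hom A Q V. \<forall>q\<in>peirce D f e. h q \<in> K} \<subseteq> H"
    proof
      fix h assume "h \<in> {h \<in> rmod_hom A Q V. \<forall>q\<in>peirce D f e. h q \<in> K}"
      then have h: "h \<in> rmod_hom A Q V" and hK: "\<And>q. q \<in> peirce D f e \<Longrightarrow> h q \<in> K" by auto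
      have "(\<lambda>q\<in>peirce D f e. h (x \<otimes> q)) \<in> H" if "x \<in> corner_sums D f e" for x
        using that
      proof induction
        case zero
        have hz: "h \<zero> = \<zero>\<^bsub>V\<^esub>" using hom_zero[OF Q_right_module V h] by simp
        have "(\<lambda>q\<in>peirce D f e. h (\<zero> \<otimes> q)) = \<zero>\<^bsub>FM V\<^esub>"
          unfolding hom_mod_simps hzero_def peirce_module_simps by (rule restrict_ext) (simp add: c hz)
        then show ?case using HD(2) by (simp only:)
      next
        case (step x q0 p0)
        note q0 = step.hyps(2) and p0 = step.hyps(3) and x = S.corner_sums_corner[OF step.hyps(1)]
        have hq0: "h q0 \<in> carrier V" using hK[OF q0] KD(1) by blast
        have "h ((x \<oplus> q0 \<otimes> p0) \<otimes> q) = h (x \<otimes> q) \<oplus>\<^bsub>V\<^esub> unit V (h q0) p0 q" if q: "q \<in> peirce D f e" for q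
        proof -
          note pq = pq_corner[OF p0 q]
          have xq: "x \<otimes> q \<in> peirce D f e" by (rule peirce_mult[OF idem_f(1) idem_f(1) idem_e(1) x q])
          have qpq: "q0 \<otimes> (p0 \<otimes> q) \<in> peirce D f e" by (rule peirce_mult[OF idem_f(1) idem_e(1) idem_e(1) q0 pq])
          have "(x \<oplus> q0 \<otimes> p0) \<otimes> q = x \<otimes> q \<oplus> q0 \<otimes> (p0 \<otimes> q)"
            by (simp add: D.l_distr D.m_assoc c[OF x] c[OF p0] c[OF q0] c[OF q])
          then have "h ((x \<oplus> q0 \<otimes> p0) \<otimes> q) = h (x \<otimes> q) \<oplus>\<^bsub>V\<^esub> h (q0 \<otimes> (p0 \<otimes> q))"
            using hom_add[OF h, of "x \<otimes> q" "q0 \<otimes> (p0 \<otimes> q)"] xq qpq by simp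
          also have "h (q0 \<otimes> (p0 \<otimes> q)) = \<kappa> (p0 \<otimes> q) \<odot>\<^bsub>V\<^esub> h q0"
            using hom_smult[OF h \<kappa>_closed[OF pq], of q0] q0 by (simp add: \<alpha>_\<kappa> pq)
          finally show ?thesis by (simp add: hq0 p0 q)
        qed
        then have "(\<lambda>q\<in>peirce D f e. h ((x \<oplus> q0 \<otimes> p0) \<otimes> q)) =
          (\<lambda>q\<in>peirce D f e. h (x \<otimes> q)) \<oplus>\<^bsub>FM V\<^esub> unit V (h q0) p0"
          by (auto simp: hadd_def)
        moreover have "unit V (h q0) p0 \<in> H" using KH hK[OF q0] p0 by blast
        ultimately show ?case using HD(3)[OF step.IH] by (simp only:)
      qed
      from this[OF full_f] have "(\<lambda>q\<in>peirce D f e. h (f \<otimes> q)) \<in> H" .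
      moreover have "(\<lambda>q\<in>peirce D f e. h (f \<otimes> q)) = h"
        using hom_undefined[OF h] by (auto simp: fun_eq_iff peirceD(2))
      ultimately show "h \<in> H" by (simp only:)
    qed
  qed
qed

text \<open>With \<open>f = \<Sum> q\<^sub>i p\<^sub>i\<close> and preimages \<open>u\<^sub>i\<close> of \<open>h q\<^sub>i\<close> under \<open>g\<close>, the map \<open>\<Sum> unit U u\<^sub>i p\<^sub>i\<close> lifts \<open>h\<close>:
  it sends \<open>q\<close> to \<open>\<Sum> u\<^sub>i (p\<^sub>i q)\<close>, and \<open>\<Sum> h q\<^sub>i (p\<^sub>i q) = h (f q) = h q\<close>.\<close>

lemma hmap_surj:
  assumes U: "right_module A U" and V: "right_module A V" and g: "g \<in> rmod_hom A U V"
    and surj: "g ` carrier U = carrier V"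
  shows "hmap A Q U g ` carrier (FM U) = carrier (FM V)"
proof (intro equalityI subsetI)
  interpret QA: left_action A B Q actQ by (rule Q_action)
  fix h assume "h \<in> hmap A Q U g ` carrier (FM U)"
  then show "h \<in> carrier (FM V)" using QA.hmap_closed[OF g] by auto
next
  interpret S: morita_context D f e B A \<beta> \<alpha> by (rule swap)
  interpret QA: left_action A B Q actQ by (rule Q_action)
  interpret U: right_module A U by fact
  interpret V: right_module A V by fact
  note c = peirceD(1)
  fix h assume "h \<in> carrier (FM V)"
  then have h: "h \<in> rmod_hom A Q V" by simp
  have "\<exists>k\<in>rmod_hom A Q U. \<forall>q\<in>peirce D f e. g (k q) = h (x \<otimes> q)" if "x \<in> corner_sums D f e" for x
    using that
  proof induction
    case zero
    show ?case
      by (rule bexI[OF _ hzero_hom[OF Q_right_module U]])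
        (use hom_zero[OF U V g] hom_zero[OF Q_right_module V h] in \<open>auto dest: c\<close>)
  next
    case (step x q0 p0)
    then obtain k where k: "k \<in> rmod_hom A Q U" and kx: "\<And>q. q \<in> peirce D f e \<Longrightarrow> g (k q) = h (x \<otimes> q)" by blast
    note q0 = step.hyps(2) and p0 = step.hyps(3) and x = S.corner_sums_corner[OF step.hyps(1)]
    have "h q0 \<in> g ` carrier U" using hom_closed[OF h, of q0] q0 unfolding surj by simp
    then obtain u where u: "u \<in> carrier U" "h q0 = g u" by blast
    have "g (hadd Q U k (unit U u p0) q) = h ((x \<oplus> q0 \<otimes> p0) \<otimes> q)" if q: "q \<in> peirce D f e" for q
    proof -
      note pq = pq_corner[OF p0 q]
      have kq: "k q \<in> carrier U" using hom_closed[OF k, of q] q by simp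
      have xq: "x \<otimes> q \<in> peirce D f e" by (rule peirce_mult[OF idem_f(1) idem_f(1) idem_e(1) x q])
      have qpq: "q0 \<otimes> (p0 \<otimes> q) \<in> peirce D f e" by (rule peirce_mult[OF idem_f(1) idem_e(1) idem_e(1) q0 pq])
      have "(x \<oplus> q0 \<otimes> p0) \<otimes> q = x \<otimes> q \<oplus> q0 \<otimes> (p0 \<otimes> q)"
        by (simp add: D.l_distr D.m_assoc c[OF x] c[OF p0] c[OF q0] c[OF q])
      then have "h ((x \<oplus> q0 \<otimes> p0) \<otimes> q) = h (x \<otimes> q) \<oplus>\<^bsub>V\<^esub> h (q0 \<otimes> (p0 \<otimes> q))"
        using hom_add[OF h, of "x \<otimes> q" "q0 \<otimes> (p0 \<otimes> q)"] xq qpq by simp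
      also have "h (q0 \<otimes> (p0 \<otimes> q)) = \<kappa> (p0 \<otimes> q) \<odot>\<^bsub>V\<^esub> g u"
        using hom_smult[OF h \<kappa>_closed[OF pq], of q0] q0 u(2) by (simp add: \<alpha>_\<kappa> pq)
      finally show ?thesis
        using kx[OF q] u(1) p0 q kq by (simp add: hom_add[OF g] hom_smult[OF g] \<kappa>_closed pq)
    qed
    then show ?case
      using hadd_hom[OF Q_right_module U k unit_value_hom[OF U u(1) p0]] by blast
  qed
  from this[OF full_f] obtain k where k: "k \<in> rmod_hom A Q U"
    and kx: "\<And>q. q \<in> peirce D f e \<Longrightarrow> g (k q) = h (f \<otimes> q)" by blast
  have "hmap A Q U g k = h"
    by (rule hom_eqI[OF QA.hmap_closed[OF g k] h]) (simp add: QA.hmap_apply k kx peirceD(2))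
  then show "h \<in> hmap A Q U g ` carrier (FM U)" using k by auto
qed

text \<open>The functor \<open>FM\<close> is left exact and preserves surjections, so a presentation of \<open>V\<close> by \<open>A\<^sup>n\<close> yields
  a presentation of \<open>FM V\<close> by \<open>FM (A\<^sup>n)\<close>, which is a finitely generated projective module.\<close>

lemma FM_finitely_presented:
  assumes V: "finitely_presented A V" shows "finitely_presented B (FM V)"
proof -
  interpret QA: left_action A B Q actQ by (rule Q_action)
  have rV: "right_module A V" using V by (rule finitely_presented_rm)
  obtain n p where p: "p \<in> rmod_hom A (free A n) V" "p ` carrier (free A n) = carrier V"
    "fg_submodule A (free A n) {x \<in> carrier (free A n). p x = \<zero>\<^bsub>V\<^esub>}"
    using V unfolding finitely_presented_def by blast
  note F = free_right_module[OF A.ring_axioms, of n]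
  have 1: "finitely_presented B (FM (free A n))"
    by (rule in_add_regular_finitely_presented[OF FM_right_module[OF F] FM_in_add_regular[OF F
      sum_in_add[OF regular_right_module[OF A.ring_axioms]]]])
  have "{h \<in> carrier (FM (free A n)). hmap A Q (free A n) p h = \<zero>\<^bsub>FM V\<^esub>} =
    {h \<in> rmod_hom A Q (free A n). \<forall>q\<in>peirce D f e. h q \<in> {x \<in> carrier (free A n). p x = \<zero>\<^bsub>V\<^esub>}}"
  proof (intro equalityI subsetI CollectI conjI)
    fix h assume "h \<in> {h \<in> carrier (FM (free A n)). hmap A Q (free A n) p h = \<zero>\<^bsub>FM V\<^esub>}"
    then have h: "h \<in> rmod_hom A Q (free A n)" and z: "hmap A Q (free A n) p h = hzero Q V" by auto
    show "h \<in> rmod_hom A Q (free A n)" by (rule h)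
    show "\<forall>q\<in>peirce D f e. h q \<in> {x \<in> carrier (free A n). p x = \<zero>\<^bsub>V\<^esub>}"
    proof
      fix q assume q: "q \<in> peirce D f e"
      show "h q \<in> {x \<in> carrier (free A n). p x = \<zero>\<^bsub>V\<^esub>}"
        using fun_cong[OF z, of q] q hom_closed[OF h, of q] by (simp add: QA.hmap_apply h)
    qed
  next
    fix h assume "h \<in> {h \<in> rmod_hom A Q (free A n). \<forall>q\<in>peirce D f e. h q \<in> {x \<in> carrier (free A n). p x = \<zero>\<^bsub>V\<^esub>}}"
    then have h: "h \<in> rmod_hom A Q (free A n)" and z: "\<And>q. q \<in> peirce D f e \<Longrightarrow> p (h q) = \<zero>\<^bsub>V\<^esub>" by auto
    show "h \<in> carrier (FM (free A n))" using h by simp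
    have "hmap A Q (free A n) p h = hzero Q V"
      by (rule hom_eqI[OF QA.hmap_closed[OF p(1) h] hzero_hom[OF Q_right_module rV]])
        (simp add: QA.hmap_apply h z)
    then show "hmap A Q (free A n) p h = \<zero>\<^bsub>FM V\<^esub>" by simp
  qed
  then have 2: "fg_submodule B (FM (free A n)) {h \<in> carrier (FM (free A n)). hmap A Q (free A n) p h = \<zero>\<^bsub>FM V\<^esub>}"
    using fg_FM[OF F p(3)] by (simp only:)
  show ?thesis
    by (rule finitely_presented_quotient[OF 1 FM_right_module[OF rV] QA.hmap_hom[OF F rV p(1)]
      hmap_surj[OF F rV p(1,2)] 2])
qed

end

section \<open>Equivalences of module categories\<close>

lemma mod_category_simps [simp]:
  "Ob (mod_category R) = fp_modules R" "Hom (mod_category R) = rmod_hom R"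
  "Id (mod_category R) M = rid M" "Comp (mod_category R) L M N g f = rcomp L g f"
  by (simp_all add: mod_category_def)

lemma is_iso_in_modI:
  assumes M: "M \<in> fp_modules R" and N: "N \<in> fp_modules R" and f: "f \<in> rmod_hom R M N"
    and bij: "bij_betw f (carrier M) (carrier N)"
  shows "is_iso_in (mod_category R) M N f"
proof -
  obtain g where g: "g \<in> rmod_hom R N M"
    "\<And>x. x \<in> carrier M \<Longrightarrow> g (f x) = x" "\<And>y. y \<in> carrier N \<Longrightarrow> f (g y) = y"
    using fp_modules_rm[OF M] f bij by (rule bij_hom_inverse) blast
  have "rcomp M g f = rid M" "rcomp N f g = rid N"
    by (auto simp: compose_def g fun_eq_iff)
  then show ?thesis using f g(1) unfolding is_iso_in_def mod_category_simps by blast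
qed

text \<open>A chosen isomorphic copy, inside the class of objects of the module category, of a
  finitely presented module on any carrier type, with a chosen isomorphism and its inverse.\<close>

definition fp_copy_data where
  "fp_copy_data R M = (SOME (N, f, g). N \<in> fp_modules R \<and> f \<in> rmod_hom R M N \<and> g \<in> rmod_hom R N M \<and>
    (\<forall>x\<in>carrier M. g (f x) = x) \<and> (\<forall>y\<in>carrier N. f (g y) = y))"

definition fp_copy :: "('a, 'r) ring_scheme \<Rightarrow> ('a, 'b, 's) module_scheme \<Rightarrow> 'a umodule"
  where "fp_copy R M = fst (fp_copy_data R M)"

definition to_copy :: "('a, 'r) ring_scheme \<Rightarrow> ('a, 'b, 's) module_scheme \<Rightarrow> 'b \<Rightarrow> (nat \<Rightarrow> 'a) set"
  where "to_copy R M = fst (snd (fp_copy_data R M))"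

definition from_copy :: "('a, 'r) ring_scheme \<Rightarrow> ('a, 'b, 's) module_scheme \<Rightarrow> (nat \<Rightarrow> 'a) set \<Rightarrow> 'b"
  where "from_copy R M = snd (snd (fp_copy_data R M))"

lemma
  fixes M :: "('a, 'b, 's) module_scheme"
  assumes "finitely_presented R M"
  shows fp_copy: "fp_copy R M \<in> fp_modules R"
    and to_copy_hom: "to_copy R M \<in> rmod_hom R M (fp_copy R M)"
    and from_copy_hom: "from_copy R M \<in> rmod_hom R (fp_copy R M) M"
    and from_to_copy: "x \<in> carrier M \<Longrightarrow> from_copy R M (to_copy R M x) = x"
    and to_from_copy: "y \<in> carrier (fp_copy R M) \<Longrightarrow> to_copy R M (from_copy R M y) = y"
proof -
  obtain N where N: "N \<in> fp_modules R" "rmod_iso R M N" using fp_copy_exists[OF assms] by blast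
  obtain f g where fg: "f \<in> rmod_hom R M N" "g \<in> rmod_hom R N M"
    "\<And>x. x \<in> carrier M \<Longrightarrow> g (f x) = x" "\<And>y. y \<in> carrier N \<Longrightarrow> f (g y) = y"
    using finitely_presented_rm[OF assms] N(2) by (rule rmod_isoE) blast
  let ?P = "\<lambda>z. case z of (N, f, g) \<Rightarrow> N \<in> fp_modules R \<and> f \<in> rmod_hom R M N \<and> g \<in> rmod_hom R N M \<and>
    (\<forall>x\<in>carrier M. g (f x) = x) \<and> (\<forall>y\<in>carrier N. f (g y) = y)"
  have "?P (N, f, g)" using N(1) fg by simp
  then have "?P (fp_copy_data R M)" unfolding fp_copy_data_def by (rule someI)
  then show "fp_copy R M \<in> fp_modules R" "to_copy R M \<in> rmod_hom R M (fp_copy R M)"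
    "from_copy R M \<in> rmod_hom R (fp_copy R M) M"
    "x \<in> carrier M \<Longrightarrow> from_copy R M (to_copy R M x) = x"
    "y \<in> carrier (fp_copy R M) \<Longrightarrow> to_copy R M (from_copy R M y) = y"
    by (auto simp: fp_copy_def to_copy_def from_copy_def split: prod.splits)
qed

lemma fp_copy_iso:
  assumes "finitely_presented R M" shows "rmod_iso R M (fp_copy R M)"
  by (rule rmod_isoI[OF to_copy_hom[OF assms] _ from_to_copy[OF assms] to_from_copy[OF assms]])
    (auto intro: hom_closed[OF from_copy_hom[OF assms]])

lemma to_copy_bij:
  assumes "finitely_presented R M" shows "bij_betw (to_copy R M) (carrier M) (carrier (fp_copy R M))"
  by (rule bij_homI[OF to_copy_hom[OF assms] _ from_to_copy[OF assms] to_from_copy[OF assms]])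
    (auto intro: hom_closed[OF from_copy_hom[OF assms]])

lemma naturally_isomorphic_sym:
  assumes D: "is_category D" and F: "is_functor C D F \<phi>" and G: "is_functor C D G \<psi>"
    and iso: "naturally_isomorphic C D F \<phi> G \<psi>"
  shows "naturally_isomorphic C D G \<psi> F \<phi>"
proof -
  obtain \<eta> where \<eta>: "\<And>X. X \<in> Ob C \<Longrightarrow> is_iso_in D (F X) (G X) (\<eta> X)"
    and nat: "\<And>X Y f. \<lbrakk>X \<in> Ob C; Y \<in> Ob C; f \<in> Hom C X Y\<rbrakk> \<Longrightarrow>
      Comp D (F X) (F Y) (G Y) (\<eta> Y) (\<phi> X Y f) = Comp D (F X) (G X) (G Y) (\<psi> X Y f) (\<eta> X)"
    using iso unfolding naturally_isomorphic_def by blast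
  have "\<forall>X\<in>Ob C. \<exists>g. g \<in> Hom D (G X) (F X) \<and> Comp D (F X) (G X) (F X) g (\<eta> X) = Id D (F X) \<and>
      Comp D (G X) (F X) (G X) (\<eta> X) g = Id D (G X)"
    using \<eta> unfolding is_iso_in_def by blast
  then obtain \<theta> where \<theta>: "\<And>X. X \<in> Ob C \<Longrightarrow> \<theta> X \<in> Hom D (G X) (F X)"
    "\<And>X. X \<in> Ob C \<Longrightarrow> Comp D (F X) (G X) (F X) (\<theta> X) (\<eta> X) = Id D (F X)"
    "\<And>X. X \<in> Ob C \<Longrightarrow> Comp D (G X) (F X) (G X) (\<eta> X) (\<theta> X) = Id D (G X)"
    by (metis (no_types))
  have \<eta>h: "\<And>X. X \<in> Ob C \<Longrightarrow> \<eta> X \<in> Hom D (F X) (G X)" using \<eta> unfolding is_iso_in_def by blast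
  have FO: "\<And>X. X \<in> Ob C \<Longrightarrow> F X \<in> Ob D" and GO: "\<And>X. X \<in> Ob C \<Longrightarrow> G X \<in> Ob D"
    and functor_map: "\<And>X Y f. \<lbrakk>X \<in> Ob C; Y \<in> Ob C; f \<in> Hom C X Y\<rbrakk> \<Longrightarrow> \<phi> X Y f \<in> Hom D (F X) (F Y)"
    and Gh: "\<And>X Y f. \<lbrakk>X \<in> Ob C; Y \<in> Ob C; f \<in> Hom C X Y\<rbrakk> \<Longrightarrow> \<psi> X Y f \<in> Hom D (G X) (G Y)"
    using F G unfolding is_functor_def by blast+
  have comp: "\<And>X Y Z f g. \<lbrakk>X \<in> Ob D; Y \<in> Ob D; Z \<in> Ob D; f \<in> Hom D X Y; g \<in> Hom D Y Z\<rbrakk> \<Longrightarrow>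
      Comp D X Y Z g f \<in> Hom D X Z"
    and idr: "\<And>X Y f. \<lbrakk>X \<in> Ob D; Y \<in> Ob D; f \<in> Hom D X Y\<rbrakk> \<Longrightarrow> Comp D X X Y f (Id D X) = f"
    and idl: "\<And>X Y f. \<lbrakk>X \<in> Ob D; Y \<in> Ob D; f \<in> Hom D X Y\<rbrakk> \<Longrightarrow> Comp D X Y Y (Id D Y) f = f"
    and assoc: "\<And>W X Y Z f g h. \<lbrakk>W \<in> Ob D; X \<in> Ob D; Y \<in> Ob D; Z \<in> Ob D; f \<in> Hom D W X; g \<in> Hom D X Y;
      h \<in> Hom D Y Z\<rbrakk> \<Longrightarrow> Comp D W Y Z h (Comp D W X Y g f) = Comp D W X Z (Comp D X Y Z h g) f"
    using D unfolding is_category_def by blast+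
  have "Comp D (G X) (G Y) (F Y) (\<theta> Y) (\<psi> X Y f) = Comp D (G X) (F X) (F Y) (\<phi> X Y f) (\<theta> X)"
    if X: "X \<in> Ob C" and Y: "Y \<in> Ob C" and f: "f \<in> Hom C X Y" for X Y f
  proof -
    note O = FO[OF X] FO[OF Y] GO[OF X] GO[OF Y]
    note Ff = functor_map[OF X Y f] and Gf = Gh[OF X Y f]
    have "\<psi> X Y f = Comp D (G X) (G X) (G Y) (\<psi> X Y f) (Comp D (G X) (F X) (G X) (\<eta> X) (\<theta> X))"
      by (simp only: \<theta>(3)[OF X] idr[OF O(3,4) Gf])
    also have "\<dots> = Comp D (G X) (F X) (G Y) (Comp D (F X) (G X) (G Y) (\<psi> X Y f) (\<eta> X)) (\<theta> X)"
      by (rule assoc[OF O(3,1,3,4) \<theta>(1)[OF X] \<eta>h[OF X] Gf])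
    also have "\<dots> = Comp D (G X) (F X) (G Y) (Comp D (F X) (F Y) (G Y) (\<eta> Y) (\<phi> X Y f)) (\<theta> X)"
      by (simp only: nat[OF X Y f])
    also have "\<dots> = Comp D (G X) (F Y) (G Y) (\<eta> Y) (Comp D (G X) (F X) (F Y) (\<phi> X Y f) (\<theta> X))"
      by (rule assoc[OF O(3,1,2,4) \<theta>(1)[OF X] Ff \<eta>h[OF Y], symmetric])
    finally have "Comp D (G X) (G Y) (F Y) (\<theta> Y) (\<psi> X Y f) =
      Comp D (G X) (G Y) (F Y) (\<theta> Y) (Comp D (G X) (F Y) (G Y) (\<eta> Y) (Comp D (G X) (F X) (F Y) (\<phi> X Y f) (\<theta> X)))"
      by (rule arg_cong)
    also have "\<dots> = Comp D (G X) (F Y) (F Y) (Comp D (F Y) (G Y) (F Y) (\<theta> Y) (\<eta> Y)) (Comp D (G X) (F X) (F Y) (\<phi> X Y f) (\<theta> X))"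
      by (rule assoc[OF O(3,2,4,2) comp[OF O(3,1,2) \<theta>(1)[OF X] Ff] \<eta>h[OF Y] \<theta>(1)[OF Y]])
    finally show ?thesis
      by (simp only: \<theta>(2)[OF Y] idl[OF O(3,2) comp[OF O(3,1,2) \<theta>(1)[OF X] Ff]])
  qed
  moreover have "is_iso_in D (G X) (F X) (\<theta> X)" if "X \<in> Ob C" for X
    using \<theta>[OF that] \<eta>h[OF that] unfolding is_iso_in_def by blast
  ultimately show ?thesis unfolding naturally_isomorphic_def by blast
qed

lemma is_functor_comp:
  assumes "is_functor C D F \<phi>" "is_functor D E G \<psi>"
  shows "is_functor C E (\<lambda>X. G (F X)) (\<lambda>X Y f. \<psi> (F X) (F Y) (\<phi> X Y f))"
  using assms unfolding is_functor_def by simp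

lemma is_functor_id: "is_functor C C (\<lambda>X. X) (\<lambda>X Y f. f)"
  unfolding is_functor_def by simp

context morita_context
begin

definition functor_ob :: "'a umodule \<Rightarrow> 'b umodule" where "functor_ob V = fp_copy B (FM V)"

definition functor_map where
  "functor_map V W g = rcomp (functor_ob V) (to_copy B (FM W)) (rcomp (functor_ob V) (hmap A Q V g) (from_copy B (FM V)))"

lemma FM_fp: "V \<in> fp_modules A \<Longrightarrow> finitely_presented B (FM V)"
  using FM_finitely_presented by (simp add: fp_modules_def)

lemma functor_map_hom:
  assumes V: "V \<in> fp_modules A" and W: "W \<in> fp_modules A" and g: "g \<in> rmod_hom A V W"
  shows "functor_map V W g \<in> rmod_hom B (functor_ob V) (functor_ob W)"
proof -
  interpret QA: left_action A B Q actQ by (rule Q_action)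
  note K = fp_modules_rm[OF fp_copy[OF FM_fp[OF V]]]
  show ?thesis
    unfolding functor_map_def functor_ob_def
    by (rule rcomp_hom[OF K rcomp_hom[OF K from_copy_hom[OF FM_fp[OF V]]
      QA.hmap_hom[OF fp_modules_rm[OF V] fp_modules_rm[OF W] g]] to_copy_hom[OF FM_fp[OF W]]])
qed

lemma functor_map_to_copy:
  assumes V: "V \<in> fp_modules A" and h: "h \<in> rmod_hom A Q V"
  shows "functor_map V W g (to_copy B (FM V) h) = to_copy B (FM W) (hmap A Q V g h)"
  using hom_closed[OF to_copy_hom[OF FM_fp[OF V]], of h] h from_to_copy[OF FM_fp[OF V], of h]
  by (simp add: functor_map_def functor_ob_def compose_eq)

lemma functor_ob_cases:
  assumes V: "V \<in> fp_modules A" and z: "z \<in> carrier (functor_ob V)"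
  obtains h where "h \<in> rmod_hom A Q V" "z = to_copy B (FM V) h"
proof -
  have "z \<in> carrier (fp_copy B (FM V))" using z by (simp add: functor_ob_def)
  then show thesis
    using that[of "from_copy B (FM V) z"] hom_closed[OF from_copy_hom[OF FM_fp[OF V]], of z]
      to_from_copy[OF FM_fp[OF V], of z] by simp
qed

lemma is_functor_F: "is_functor (mod_category A) (mod_category B) functor_ob functor_map"
proof -
  interpret QA: left_action A B Q actQ by (rule Q_action)
  have O: "functor_ob V \<in> fp_modules B" if "V \<in> fp_modules A" for V
    unfolding functor_ob_def by (rule fp_copy[OF FM_fp[OF that]])
  have I: "functor_map V V (rid V) = rid (functor_ob V)" if V: "V \<in> fp_modules A" for V
  proof (rule hom_eqI[OF functor_map_hom[OF V V rid_hom[OF fp_modules_rm[OF V]]] rid_hom[OF fp_modules_rm[OF O[OF V]]]])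
    fix z assume z: "z \<in> carrier (functor_ob V)"
    then obtain h where h: "h \<in> rmod_hom A Q V" "z = to_copy B (FM V) h" by (rule functor_ob_cases[OF V])
    have "hmap A Q V (rid V) h = h"
      using fun_cong[OF QA.hmap_rid[of V], of h] h(1) by simp
    then show "functor_map V V (rid V) z = rid (functor_ob V) z" using z by (simp add: h functor_map_to_copy[OF V])
  qed
  have M: "functor_map U W (rcomp U g k) = rcomp (functor_ob U) (functor_map V W g) (functor_map U V k)"
    if U: "U \<in> fp_modules A" and V: "V \<in> fp_modules A" and W: "W \<in> fp_modules A"
      and k: "k \<in> rmod_hom A U V" and g: "g \<in> rmod_hom A V W" for U V W g k
  proof -
    note gk = rcomp_hom[OF fp_modules_rm[OF U] k g]
    show ?thesis
    proof (rule hom_eqI[OF functor_map_hom[OF U W gk] rcomp_hom[OF fp_modules_rm[OF O[OF U]] functor_map_hom[OF U V k] functor_map_hom[OF V W g]]])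
      fix z assume z: "z \<in> carrier (functor_ob U)"
      then obtain h where h: "h \<in> rmod_hom A Q U" "z = to_copy B (FM U) h" by (rule functor_ob_cases[OF U])
      have kh: "hmap A Q U k h \<in> rmod_hom A Q V" by (rule QA.hmap_closed[OF k h(1)])
      have "hmap A Q U (rcomp U g k) h = hmap A Q V g (hmap A Q U k h)"
        by (rule hom_eqI[OF QA.hmap_closed[OF gk h(1)] QA.hmap_closed[OF g kh]])
          (simp add: QA.hmap_apply h kh compose_eq hom_closed[OF h(1)])
      then show "functor_map U W (rcomp U g k) z = rcomp (functor_ob U) (functor_map V W g) (functor_map U V k) z"
        using z h kh by (simp add: compose_eq functor_map_to_copy[OF U] functor_map_to_copy[OF V])
    qed
  qed
  show ?thesis
    unfolding is_functor_def mod_category_simps using O I M functor_map_hom by blast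
qed

text \<open>The map \<open>unit\<close>, composed with the isomorphisms to the chosen copies of \<open>FM V\<close> and of the value of
  \<open>GM\<close> at that copy.\<close>

lemma unit_natural_iso:
  "naturally_isomorphic (mod_category A) (mod_category A) (\<lambda>X. X) (\<lambda>X Y f. f)
    (\<lambda>X. morita_context.functor_ob D f e B A \<beta> \<alpha> (functor_ob X))
    (\<lambda>X Y g. morita_context.functor_map D f e B A \<beta> \<alpha> (functor_ob X) (functor_ob Y) (functor_map X Y g))"
proof -
  interpret S: morita_context D f e B A \<beta> \<alpha> by (rule swap)
  interpret QA: left_action A B Q actQ by (rule Q_action)
  interpret PA: left_action B A P actP by (rule P_action)
  have O: "functor_ob V \<in> fp_modules B" if "V \<in> fp_modules A" for V
    unfolding functor_ob_def by (rule fp_copy[OF FM_fp[OF that]])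
  define N where "N V = rcomp V (to_copy A (GM (functor_ob V))) (rcomp V (hmap B P (FM V) (to_copy B (FM V))) (unit V))" for V
  have Nx: "N V v = to_copy A (GM (functor_ob V)) (hmap B P (FM V) (to_copy B (FM V)) (unit V v))"
    if "v \<in> carrier V" for V v using that by (simp add: N_def compose_eq)
  have hb: "hmap B P (FM V) (to_copy B (FM V)) \<in> rmod_hom A (GM (FM V)) (GM (functor_ob V))"
    "bij_betw (hmap B P (FM V) (to_copy B (FM V))) (carrier (GM (FM V))) (carrier (GM (functor_ob V)))"
    if V: "V \<in> fp_modules A" for V
  proof -
    note m = FM_right_module[OF fp_modules_rm[OF V]] fp_modules_rm[OF O[OF V]]
    note t = to_copy_hom[OF FM_fp[OF V], folded functor_ob_def] and b = to_copy_bij[OF FM_fp[OF V], folded functor_ob_def]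
    show "hmap B P (FM V) (to_copy B (FM V)) \<in> rmod_hom A (GM (FM V)) (GM (functor_ob V))"
      by (rule PA.hmap_hom[OF m t])
    show "bij_betw (hmap B P (FM V) (to_copy B (FM V))) (carrier (GM (FM V))) (carrier (GM (functor_ob V)))"
      by (rule PA.hmap_bij[OF m t b])
  qed
  have Nh: "N V \<in> rmod_hom A V (S.functor_ob (functor_ob V))" if V: "V \<in> fp_modules A" for V
    unfolding N_def S.functor_ob_def
    by (rule rcomp_hom[OF fp_modules_rm[OF V] rcomp_hom[OF fp_modules_rm[OF V]
      unit_hom[OF fp_modules_rm[OF V]] hb(1)[OF V]] to_copy_hom[OF S.FM_fp[OF O[OF V]]]])
  have Nb: "bij_betw (N V) (carrier V) (carrier (S.functor_ob (functor_ob V)))" if V: "V \<in> fp_modules A" for V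
  proof -
    have "bij_betw (to_copy A (GM (functor_ob V)) \<circ> (hmap B P (FM V) (to_copy B (FM V)) \<circ> unit V))
      (carrier V) (carrier (S.functor_ob (functor_ob V)))"
      unfolding S.functor_ob_def
      by (rule bij_betw_trans[OF bij_betw_trans[OF unit_bij[OF fp_modules_rm[OF V]] hb(2)[OF V]]
        to_copy_bij[OF S.FM_fp[OF O[OF V]]]])
    then show ?thesis
      using bij_betw_cong[of "carrier V" "N V" "to_copy A (GM (functor_ob V)) \<circ> (hmap B P (FM V) (to_copy B (FM V)) \<circ> unit V)"]
      by (simp add: Nx)
  qed
  have nat: "rcomp X (N Y) g = rcomp X (S.functor_map (functor_ob X) (functor_ob Y) (functor_map X Y g)) (N X)"
    if X: "X \<in> fp_modules A" and Y: "Y \<in> fp_modules A" and g: "g \<in> rmod_hom A X Y" for X Y g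
  proof -
    note rX = fp_modules_rm[OF X] and rY = fp_modules_rm[OF Y]
    note Fg = functor_map_hom[OF X Y g]
    note SFO = S.functor_map_hom[OF O[OF X] O[OF Y] Fg]
    show ?thesis
    proof (rule hom_eqI[OF rcomp_hom[OF rX g Nh[OF Y]] rcomp_hom[OF rX Nh[OF X] SFO]])
      fix x assume x: "x \<in> carrier X"
      have gx: "g x \<in> carrier Y" by (rule hom_closed[OF g x])
      note tX = to_copy_hom[OF FM_fp[OF X], folded functor_ob_def] and tY = to_copy_hom[OF FM_fp[OF Y], folded functor_ob_def]
      note ux = unit_closed[OF rX x] and uy = unit_closed[OF rY gx]
      note hx = PA.hmap_closed[OF tX ux] and hy = PA.hmap_closed[OF tY uy]
      have "hmap B P (functor_ob X) (functor_map X Y g) (hmap B P (FM X) (to_copy B (FM X)) (unit X x)) =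
        hmap B P (FM Y) (to_copy B (FM Y)) (unit Y (g x))"
      proof (rule hom_eqI[OF PA.hmap_closed[OF Fg hx] hy])
        fix p assume p: "p \<in> carrier P"
        then have p': "p \<in> peirce D e f" by simp
        show "hmap B P (functor_ob X) (functor_map X Y g) (hmap B P (FM X) (to_copy B (FM X)) (unit X x)) p =
          hmap B P (FM Y) (to_copy B (FM Y)) (unit Y (g x)) p"
          by (simp only: PA.hmap_apply[OF hx p] PA.hmap_apply[OF ux p] PA.hmap_apply[OF uy p]
            functor_map_to_copy[OF X unit_value_hom[OF rX x p']] unit_natural[OF rX rY g x p'])
      qed
      then show "rcomp X (N Y) g x = rcomp X (S.functor_map (functor_ob X) (functor_ob Y) (functor_map X Y g)) (N X) x"
        using x gx by (simp only: compose_eq Nx S.functor_map_to_copy[OF O[OF X] hx])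
    qed
  qed
  have "is_iso_in (mod_category A) X (S.functor_ob (functor_ob X)) (N X)" if "X \<in> fp_modules A" for X
    by (rule is_iso_in_modI[OF that _ Nh[OF that] Nb[OF that]])
      (simp add: S.functor_ob_def fp_copy[OF S.FM_fp[OF O[OF that]]])
  then show ?thesis
    unfolding naturally_isomorphic_def mod_category_simps using nat by (intro exI[of _ N]) blast
qed

theorem morita_equivalent_corners: "morita_equivalent A B"
proof -
  interpret S: morita_context D f e B A \<beta> \<alpha> by (rule swap)
  have "naturally_isomorphic (mod_category B) (mod_category B) (\<lambda>X. functor_ob (S.functor_ob X))
    (\<lambda>X Y g. functor_map (S.functor_ob X) (S.functor_ob Y) (S.functor_map X Y g)) (\<lambda>X. X) (\<lambda>X Y f. f)"
    by (rule naturally_isomorphic_sym[OF is_category_mod_category is_functor_id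
      is_functor_comp[OF S.is_functor_F is_functor_F] S.unit_natural_iso])
  then show ?thesis
    unfolding morita_equivalent_def equivalent_categories_def
    using is_functor_F S.is_functor_F unit_natural_iso by blast
qed

end

section \<open>Morita equivalence of endomorphism rings and of their quotients\<close>

lemma Quot_simps:
  assumes "ideal I R"
  shows "ring (R Quot I)" "carrier (R Quot I) = (\<lambda>x. I +>\<^bsub>R\<^esub> x) ` carrier R"
    "\<one>\<^bsub>R Quot I\<^esub> = I +>\<^bsub>R\<^esub> \<one>\<^bsub>R\<^esub>" "\<zero>\<^bsub>R Quot I\<^esub> = I +>\<^bsub>R\<^esub> \<zero>\<^bsub>R\<^esub>"
    "\<And>x y. \<lbrakk>x \<in> carrier R; y \<in> carrier R\<rbrakk> \<Longrightarrow>
      (I +>\<^bsub>R\<^esub> x) \<oplus>\<^bsub>R Quot I\<^esub> (I +>\<^bsub>R\<^esub> y) = I +>\<^bsub>R\<^esub> (x \<oplus>\<^bsub>R\<^esub> y)"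
    "\<And>x y. \<lbrakk>x \<in> carrier R; y \<in> carrier R\<rbrakk> \<Longrightarrow>
      (I +>\<^bsub>R\<^esub> x) \<otimes>\<^bsub>R Quot I\<^esub> (I +>\<^bsub>R\<^esub> y) = I +>\<^bsub>R\<^esub> (x \<otimes>\<^bsub>R\<^esub> y)"
    "\<And>x y. \<lbrakk>x \<in> carrier R; y \<in> carrier R\<rbrakk> \<Longrightarrow>
      I +>\<^bsub>R\<^esub> x = I +>\<^bsub>R\<^esub> y \<longleftrightarrow> x \<ominus>\<^bsub>R\<^esub> y \<in> I"
proof -
  interpret ideal I R by fact
  show "ring (R Quot I)" by (rule quotient_is_ring)
  show "carrier (R Quot I) = (\<lambda>x. I +>\<^bsub>R\<^esub> x) ` carrier R"
    by (auto simp: FactRing_def A_RCOSETS_def' a_r_coset_def r_coset_def)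
  show "\<one>\<^bsub>R Quot I\<^esub> = I +>\<^bsub>R\<^esub> \<one>\<^bsub>R\<^esub>" by (simp add: FactRing_def)
  show "\<zero>\<^bsub>R Quot I\<^esub> = I +>\<^bsub>R\<^esub> \<zero>\<^bsub>R\<^esub>"
    using a_coset_add_zero[OF a_subset] by (simp add: FactRing_def)
  show "(I +>\<^bsub>R\<^esub> x) \<oplus>\<^bsub>R Quot I\<^esub> (I +>\<^bsub>R\<^esub> y) = I +>\<^bsub>R\<^esub> (x \<oplus>\<^bsub>R\<^esub> y)"
    if "x \<in> carrier R" "y \<in> carrier R" for x y using that by (simp add: FactRing_def a_rcos_sum)
  show "(I +>\<^bsub>R\<^esub> x) \<otimes>\<^bsub>R Quot I\<^esub> (I +>\<^bsub>R\<^esub> y) = I +>\<^bsub>R\<^esub> (x \<otimes>\<^bsub>R\<^esub> y)"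
    if "x \<in> carrier R" "y \<in> carrier R" for x y using that by (simp add: FactRing_def rcoset_mult_add)
  show "I +>\<^bsub>R\<^esub> x = I +>\<^bsub>R\<^esub> y \<longleftrightarrow> x \<ominus>\<^bsub>R\<^esub> y \<in> I"
    if "x \<in> carrier R" "y \<in> carrier R" for x y
    using quotient_eq_iff_same_a_r_cos[OF ideal_axioms that] by blast
qed

context morita_context
begin

lemma \<alpha>_zero: "\<alpha> \<zero>\<^bsub>A\<^esub> = \<zero>"
  using \<alpha>_\<kappa>[OF peirce_zero[OF idem_e(1) idem_e(1)]] by (simp add: \<kappa>_zero)

lemma \<alpha>_neg:
  assumes "a \<in> carrier A" shows "\<alpha> (\<ominus>\<^bsub>A\<^esub> a) = \<ominus> \<alpha> a"
proof -
  have "\<alpha> (\<ominus>\<^bsub>A\<^esub> a) \<oplus> \<alpha> a = \<zero>"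
    using \<alpha>_add[of "\<ominus>\<^bsub>A\<^esub> a" a] assms by (simp add: A.l_neg \<alpha>_zero)
  then show ?thesis using assms by (intro D.minus_equality[symmetric]) (simp_all add: \<alpha>_carrier)
qed

text \<open>The ideal of \<open>A\<close> that corresponds to \<open>e I e\<close>.\<close>

definition contract where "contract I = {a \<in> carrier A. \<alpha> a \<in> I}"

lemma ideal_contract:
  assumes "ideal I D" shows "ideal (contract I) A"
proof (rule idealI[OF A.ring_axioms])
  interpret I: ideal I D by fact
  show "subgroup (contract I) (add_monoid A)"
    by (rule subgroup.intro)
      (auto simp: contract_def \<alpha>_add \<alpha>_zero \<alpha>_neg a_inv_def[symmetric] I.a_inv_closed)
  show "x \<otimes>\<^bsub>A\<^esub> a \<in> contract I" "a \<otimes>\<^bsub>A\<^esub> x \<in> contract I" if "a \<in> contract I" "x \<in> carrier A" for a x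
    using that by (simp_all add: contract_def \<alpha>_mult \<alpha>_carrier I.I_l_closed I.I_r_closed)
qed

text \<open>The kernel of the composite of \<open>\<alpha>\<close> with \<open>D \<rightarrow> D/I\<close> is \<open>contract I\<close>, and every element of the
  corner \<open>(e + I) (D/I) (e + I)\<close> is represented by an element of \<open>e D e\<close>.\<close>

lemma corner_iso_Quot:
  assumes I: "ideal I D"
  shows "\<exists>\<alpha>'. corner_iso (D Quot I) (I +> e) (A Quot contract I) \<alpha>'"
proof -
  interpret I: ideal I D by fact
  interpret DI: ring "D Quot I" by (rule Quot_simps(1)[OF I])
  note Q = Quot_simps[OF I] and QA = Quot_simps[OF ideal_contract[OF I]]
  let ?J = "contract I"
  define \<alpha>' where "\<alpha>' X = I +> \<alpha> (SOME a. a \<in> carrier A \<and> X = ?J +>\<^bsub>A\<^esub> a)" for X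
  have eq: "?J +>\<^bsub>A\<^esub> a = ?J +>\<^bsub>A\<^esub> b \<longleftrightarrow> I +> \<alpha> a = I +> \<alpha> b" if "a \<in> carrier A" "b \<in> carrier A" for a b
  proof -
    have "a \<ominus>\<^bsub>A\<^esub> b \<in> contract I \<longleftrightarrow> \<alpha> a \<ominus> \<alpha> b \<in> I"
      using that by (simp add: contract_def a_minus_def \<alpha>_add \<alpha>_neg)
    then show ?thesis using that by (simp add: QA(7) Q(7) \<alpha>_carrier)
  qed
  have \<alpha>': "\<alpha>' (?J +>\<^bsub>A\<^esub> a) = I +> \<alpha> a" if a: "a \<in> carrier A" for a
  proof -
    let ?b = "SOME b. b \<in> carrier A \<and> ?J +>\<^bsub>A\<^esub> a = ?J +>\<^bsub>A\<^esub> b"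
    have "?b \<in> carrier A \<and> ?J +>\<^bsub>A\<^esub> a = ?J +>\<^bsub>A\<^esub> ?b"
      by (rule someI[of _ a]) (simp add: a)
    then show ?thesis using eq[OF a, of ?b] by (simp add: \<alpha>'_def)
  qed
  have img: "\<alpha>' ` carrier (A Quot ?J) = peirce (D Quot I) (I +> e) (I +> e)"
  proof (intro equalityI subsetI)
    fix Y assume "Y \<in> \<alpha>' ` carrier (A Quot ?J)"
    then obtain a where a: "a \<in> carrier A" "Y = I +> \<alpha> a" by (auto simp: QA(2) \<alpha>')
    then show "Y \<in> peirce (D Quot I) (I +> e) (I +> e)"
      using \<alpha>_carrier[OF a(1)] peirceD[OF \<alpha>_closed[OF a(1)]] idem_e(1) by (simp add: peirce_def Q(2,6))
  next
    fix Y assume Y: "Y \<in> peirce (D Quot I) (I +> e) (I +> e)"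
    then obtain x where x: "x \<in> carrier D" "Y = I +> x" by (auto simp: peirce_def Q(2))
    have exe: "e \<otimes> x \<otimes> e \<in> peirce D e e"
      using x(1) idem_e by (simp add: peirce_def D.m_assoc) (metis D.m_assoc D.m_closed)
    have "Y = (I +> e) \<otimes>\<^bsub>D Quot I\<^esub> Y \<otimes>\<^bsub>D Quot I\<^esub> (I +> e)" using Y by (simp add: peirce_def)
    also have "\<dots> = I +> (e \<otimes> x \<otimes> e)" using x idem_e(1) by (simp add: Q(6))
    finally have "Y = \<alpha>' (?J +>\<^bsub>A\<^esub> \<kappa> (e \<otimes> x \<otimes> e))" by (simp add: \<alpha>' \<kappa>_closed exe \<alpha>_\<kappa>)
    then show "Y \<in> \<alpha>' ` carrier (A Quot ?J)" using \<kappa>_closed[OF exe] unfolding QA(2) by blast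
  qed
  have "inj_on \<alpha>' (carrier (A Quot ?J))"
  proof (rule inj_onI)
    fix X Y assume "X \<in> carrier (A Quot ?J)" "Y \<in> carrier (A Quot ?J)" and XY: "\<alpha>' X = \<alpha>' Y"
    then obtain a b where a: "a \<in> carrier A" "X = ?J +>\<^bsub>A\<^esub> a" and b: "b \<in> carrier A" "Y = ?J +>\<^bsub>A\<^esub> b"
      unfolding QA(2) by blast
    show "X = Y" using XY unfolding a(2) b(2) \<alpha>'[OF a(1)] \<alpha>'[OF b(1)] eq[OF a(1) b(1)] .
  qed
  moreover have "\<alpha>' (X \<oplus>\<^bsub>A Quot ?J\<^esub> Y) = \<alpha>' X \<oplus>\<^bsub>D Quot I\<^esub> \<alpha>' Y \<and>
      \<alpha>' (X \<otimes>\<^bsub>A Quot ?J\<^esub> Y) = \<alpha>' X \<otimes>\<^bsub>D Quot I\<^esub> \<alpha>' Y"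
    if "X \<in> carrier (A Quot ?J)" "Y \<in> carrier (A Quot ?J)" for X Y
    using that unfolding QA(2) by (auto simp: QA(5,6) \<alpha>' Q(5,6) \<alpha>_add \<alpha>_mult \<alpha>_carrier)
  ultimately show ?thesis using img unfolding corner_iso_def bij_betw_def by blast
qed

lemma corner_sums_Quot:
  assumes I: "ideal I D" and g: "g \<in> carrier D" "h \<in> carrier D" and x: "x \<in> corner_sums D g h"
  shows "x \<in> carrier D \<and> I +> x \<in> corner_sums (D Quot I) (I +> g) (I +> h)"
  using x
proof induction
  case zero
  then show ?case using corner_sums.zero[of "D Quot I"] by (simp add: Quot_simps(4)[OF I])
next
  case (step x p q)
  note Q = Quot_simps[OF I]
  note p = peirceD[OF step.hyps(2)] and q = peirceD[OF step.hyps(3)]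
  have "I +> p \<in> peirce (D Quot I) (I +> g) (I +> h)" "I +> q \<in> peirce (D Quot I) (I +> h) (I +> g)"
    using p q g by (simp_all add: peirce_def Q(2,6))
  then show ?case
    using corner_sums.step[of "I +> x" "D Quot I"] step.IH p(1) q(1) by (simp add: Q(5,6)[symmetric])
qed

text \<open>The image of a Morita context in \<open>D/I\<close> is a Morita context for the two quotients.\<close>

theorem morita_equivalent_Quot:
  assumes I: "ideal I D"
  shows "morita_equivalent (A Quot {a \<in> carrier A. \<alpha> a \<in> I}) (B Quot {b \<in> carrier B. \<beta> b \<in> I})"
proof -
  interpret S: morita_context D f e B A \<beta> \<alpha> by (rule swap)
  note Q = Quot_simps[OF I]
  obtain \<alpha>' where \<alpha>': "corner_iso (D Quot I) (I +> e) (A Quot contract I) \<alpha>'"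
    using corner_iso_Quot[OF I] by blast
  obtain \<beta>' where \<beta>': "corner_iso (D Quot I) (I +> f) (B Quot S.contract I) \<beta>'"
    using S.corner_iso_Quot[OF I] by blast
  have "morita_context (D Quot I) (I +> e) (I +> f) (A Quot contract I) (B Quot S.contract I) \<alpha>' \<beta>'"
  proof (intro morita_context.intro morita_context_axioms.intro \<alpha>' \<beta>' Q(1)
      Quot_simps(1)[OF ideal_contract[OF I]] Quot_simps(1)[OF S.ideal_contract[OF I]])
    show "I +> e \<in> carrier (D Quot I)" "I +> f \<in> carrier (D Quot I)"
      using idem_e(1) idem_f(1) by (simp_all add: Q(2))
    show "(I +> e) \<otimes>\<^bsub>D Quot I\<^esub> (I +> e) = I +> e" "(I +> f) \<otimes>\<^bsub>D Quot I\<^esub> (I +> f) = I +> f"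
      using idem_e idem_f by (simp_all add: Q(6))
    show "I +> e \<in> corner_sums (D Quot I) (I +> e) (I +> f)"
      using corner_sums_Quot[OF I idem_e(1) idem_f(1) full_e] by simp
    show "I +> f \<in> corner_sums (D Quot I) (I +> f) (I +> e)"
      using corner_sums_Quot[OF I idem_f(1) idem_e(1) full_f] by simp
  qed
  from morita_context.morita_equivalent_corners[OF this] show ?thesis
    unfolding contract_def S.contract_def .
qed

end

lemma End_ring_simps [simp]:
  "carrier (End_ring R M) = rmod_hom R M M" "mult (End_ring R M) = compose (carrier M)"
  "one (End_ring R M) = rid M" "zero (End_ring R M) = hzero M M" "add (End_ring R M) = hadd M M"
  by (auto simp: End_ring_def hzero_def hadd_def fun_eq_iff)

lemma End_ring_ring:
  assumes M: "right_module R M" shows "ring (End_ring R M)"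
proof (rule ringI)
  interpret M: right_module R M by fact
  note H = hadd_hom[OF M M] and C = rcomp_hom[OF M, of _ M _ M] and I = rid_hom[OF M] and Z = hzero_hom[OF M M]
  show "abelian_group (End_ring R M)"
  proof (rule abelian_groupI, unfold End_ring_simps)
    fix f g h assume f: "f \<in> rmod_hom R M M"
    show "\<exists>y\<in>rmod_hom R M M. hadd M M y f = hzero M M"
      by (rule bexI[OF _ hneg_hom[OF M M f]]) (auto simp: hadd_def hzero_def M.M.l_neg hom_closed[OF f])
    show "hadd M M (hzero M M) f = f"
      by (rule hom_eqI[OF H[OF Z f] f]) (simp add: hom_closed[OF f])
    assume g: "g \<in> rmod_hom R M M"
    show "hadd M M f g \<in> rmod_hom R M M" by (rule H[OF f g])
    show "hadd M M f g = hadd M M g f"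
      by (rule hom_eqI[OF H[OF f g] H[OF g f]]) (simp add: hom_closed[OF f] hom_closed[OF g] M.M.a_comm)
    assume h: "h \<in> rmod_hom R M M"
    show "hadd M M (hadd M M f g) h = hadd M M f (hadd M M g h)"
      by (rule hom_eqI[OF H[OF H[OF f g] h] H[OF f H[OF g h]]])
        (simp add: hom_closed[OF f] hom_closed[OF g] hom_closed[OF h] M.M.a_assoc)
  qed (rule Z)
  show "monoid (End_ring R M)"
  proof (rule monoidI, unfold End_ring_simps)
    fix f g h assume f: "f \<in> rmod_hom R M M"
    show "rcomp M (rid M) f = f" "rcomp M f (rid M) = f"
      by (rule hom_eqI[OF C[OF f I] f], simp add: compose_eq hom_closed[OF f])
        (rule hom_eqI[OF C[OF I f] f], simp add: compose_eq hom_closed[OF f])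
    assume g: "g \<in> rmod_hom R M M"
    show "rcomp M f g \<in> rmod_hom R M M" by (rule C[OF g f])
    show "rcomp M (rcomp M f g) h = rcomp M f (rcomp M g h)" if h: "h \<in> rmod_hom R M M"
      by (rule hom_eqI[OF C[OF h C[OF g f]] C[OF C[OF h g] f]]) (simp add: compose_eq hom_closed[OF h])
  qed (rule I)
  fix f g h assume "f \<in> carrier (End_ring R M)" "g \<in> carrier (End_ring R M)" "h \<in> carrier (End_ring R M)"
  then have fgh: "f \<in> rmod_hom R M M" "g \<in> rmod_hom R M M" "h \<in> rmod_hom R M M" by simp_all
  have "rcomp M (hadd M M f g) h = hadd M M (rcomp M f h) (rcomp M g h)"
    by (rule hom_eqI[OF C[OF fgh(3) H[OF fgh(1,2)]] H[OF C[OF fgh(3,1)] C[OF fgh(3,2)]]])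
      (simp add: compose_eq hom_closed[OF fgh(3)])
  then show "(f \<oplus>\<^bsub>End_ring R M\<^esub> g) \<otimes>\<^bsub>End_ring R M\<^esub> h =
    f \<otimes>\<^bsub>End_ring R M\<^esub> h \<oplus>\<^bsub>End_ring R M\<^esub> g \<otimes>\<^bsub>End_ring R M\<^esub> h" by simp
  have "rcomp M h (hadd M M f g) = hadd M M (rcomp M h f) (rcomp M h g)"
    by (rule hom_eqI[OF C[OF H[OF fgh(1,2)] fgh(3)] H[OF C[OF fgh(1,3)] C[OF fgh(2,3)]]])
      (simp add: compose_eq hom_add[OF fgh(3)] hom_closed[OF fgh(1)] hom_closed[OF fgh(2)])
  then show "h \<otimes>\<^bsub>End_ring R M\<^esub> (f \<oplus>\<^bsub>End_ring R M\<^esub> g) =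
    h \<otimes>\<^bsub>End_ring R M\<^esub> f \<oplus>\<^bsub>End_ring R M\<^esub> h \<otimes>\<^bsub>End_ring R M\<^esub> g" by simp
qed

lemma through_all_ideal:
  assumes S: "right_module R S" and M: "right_module R M"
  shows "ideal (through_all R S M M) (End_ring R M)"
proof (rule idealI[OF End_ring_ring[OF M]])
  interpret E: ring "End_ring R M" by (rule End_ring_ring[OF M])
  interpret M: right_module R M by fact
  have T: "f \<in> rmod_hom R M M" if "f \<in> through_all R S M M" for f
    by (rule through_hom[OF M M subset_refl that])
  note I = rid_hom[OF M]
  note id1 = rcomp_rid[of _ R M M]
  have l: "rcomp M c f \<in> through_all R S M M" "rcomp M f c \<in> through_all R S M M"
    if f: "f \<in> through_all R S M M" and c: "c \<in> rmod_hom R M M" for f c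
    using through_all_conj[OF S M M M M I c f] through_all_conj[OF S M M M M c I f]
      id1[OF T[OF f]] id1[OF rcomp_hom[OF M c T[OF f]]] by simp_all
  show "subgroup (through_all R S M M) (add_monoid (End_ring R M))"
  proof (rule subgroup.intro)
    show "through_all R S M M \<subseteq> carrier (add_monoid (End_ring R M))" using T by auto
    show "f \<otimes>\<^bsub>add_monoid (End_ring R M)\<^esub> g \<in> through_all R S M M"
      if "f \<in> through_all R S M M" "g \<in> through_all R S M M" for f g
      using through_add[OF M M subset_refl that] by simp
    show "\<one>\<^bsub>add_monoid (End_ring R M)\<^esub> \<in> through_all R S M M" using through.zero by simp
    fix f assume f: "f \<in> through_all R S M M"
    have "\<ominus>\<^bsub>End_ring R M\<^esub> f = (\<ominus>\<^bsub>End_ring R M\<^esub> (rid M)) \<otimes>\<^bsub>End_ring R M\<^esub> f"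
      using E.l_minus[of "rid M" f] T[OF f] I id1(2)[OF T[OF f]] by simp
    also have "\<dots> \<in> through_all R S M M"
      using l(1)[OF f, of "\<ominus>\<^bsub>End_ring R M\<^esub> (rid M)"] E.a_inv_closed[of "rid M"] I by simp
    finally show "inv\<^bsub>add_monoid (End_ring R M)\<^esub> f \<in> through_all R S M M" by (simp add: a_inv_def)
  qed
  show "x \<otimes>\<^bsub>End_ring R M\<^esub> a \<in> through_all R S M M" "a \<otimes>\<^bsub>End_ring R M\<^esub> x \<in> through_all R S M M"
    if "a \<in> through_all R S M M" "x \<in> carrier (End_ring R M)" for a x
    using l[OF that(1), of x] that(2) by simp_all
qed

text \<open>If \<open>i : U \<rightarrow> Z\<close> is split by \<open>p\<close>, then \<open>i p\<close> is an idempotent of \<open>End(Z)\<close>, and its corner consists of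
  the maps \<open>i g p\<close> with \<open>g\<close> in \<open>End(U)\<close>.\<close>

lemma retract_corner_iso:
  assumes U: "right_module R U" and Z: "right_module R Z"
    and i: "i \<in> rmod_hom R U Z" and p: "p \<in> rmod_hom R Z U"
    and pi: "\<And>u. u \<in> carrier U \<Longrightarrow> p (i u) = u"
    and a: "a \<in> ring_iso A (End_ring R U)"
  shows "corner_iso (End_ring R Z) (rcomp Z i p) A (\<lambda>x. rcomp Z i (rcomp Z (a x) p))"
proof -
  note ci = hom_closed[OF i] and cp = hom_closed[OF p]
  note C = rcomp_hom[OF Z]
  have ab: "a ` carrier A = rmod_hom R U U" "inj_on a (carrier A)" and ah: "a \<in> ring_hom A (End_ring R U)"
    using a by (auto simp: ring_iso_def bij_betw_def)
  have ax: "a x \<in> rmod_hom R U U" if "x \<in> carrier A" for x using that ab(1) by blast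
  have emb: "rcomp Z i (rcomp Z g p) \<in> rmod_hom R Z Z" if "g \<in> rmod_hom R U U" for g
    by (rule C[OF C[OF p that] i])
  have embx: "rcomp Z i (rcomp Z g p) z = i (g (p z))" if "z \<in> carrier Z" for g z
    using that by (simp add: compose_eq)
  have g_eqI: "g = h" if g: "g \<in> rmod_hom R U U" and h: "h \<in> rmod_hom R U U"
    and eq: "rcomp Z i (rcomp Z g p) = rcomp Z i (rcomp Z h p)" for g h
  proof (rule hom_eqI[OF g h])
    fix u assume u: "u \<in> carrier U"
    have "p (i (g (p (i u)))) = p (i (h (p (i u))))"
      using fun_cong[OF eq, of "i u"] ci[OF u] by (simp add: embx)
    then show "g u = h u" using u by (simp add: pi hom_closed[OF g] hom_closed[OF h])
  qed
  have img: "(\<lambda>x. rcomp Z i (rcomp Z (a x) p)) ` carrier A = peirce (End_ring R Z) (rcomp Z i p) (rcomp Z i p)"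
  proof (intro equalityI subsetI)
    fix h assume "h \<in> (\<lambda>x. rcomp Z i (rcomp Z (a x) p)) ` carrier A"
    then obtain g where g: "g \<in> rmod_hom R U U" and h: "h = rcomp Z i (rcomp Z g p)" using ax by blast
    have "rcomp Z (rcomp Z i p) h = h" "rcomp Z h (rcomp Z i p) = h"
      unfolding h by (auto simp: compose_def fun_eq_iff cp ci hom_closed[OF g] pi)
    then show "h \<in> peirce (End_ring R Z) (rcomp Z i p) (rcomp Z i p)"
      using emb[OF g] by (simp add: peirce_def h)
  next
    fix h assume "h \<in> peirce (End_ring R Z) (rcomp Z i p) (rcomp Z i p)"
    then have h: "h \<in> rmod_hom R Z Z" and 1: "rcomp Z (rcomp Z i p) h = h" and 2: "rcomp Z h (rcomp Z i p) = h"
      by (simp_all add: peirce_def)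
    define g where "g = rcomp U p (rcomp U h i)"
    have g: "g \<in> rmod_hom R U U" unfolding g_def by (rule rcomp_hom[OF U rcomp_hom[OF U i h] p])
    have "rcomp Z i (rcomp Z g p) = h"
    proof (rule hom_eqI[OF emb[OF g] h])
      fix z assume z: "z \<in> carrier Z"
      have "h z = h (i (p z))" using fun_cong[OF 2, of z] z by (simp add: compose_eq)
      also have "\<dots> = i (p (h (i (p z))))"
        using fun_cong[OF 1, of "i (p z)"] z ci cp hom_closed[OF h] by (simp add: compose_eq)
      finally show "rcomp Z i (rcomp Z g p) z = h z" using z cp[OF z] by (simp add: embx g_def compose_eq)
    qed
    moreover from g obtain x where x: "x \<in> carrier A" "g = a x" unfolding ab(1)[symmetric] by (rule imageE)
    ultimately have "h = rcomp Z i (rcomp Z (a x) p)" by (simp only:)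
    then show "h \<in> (\<lambda>x. rcomp Z i (rcomp Z (a x) p)) ` carrier A" using x(1) by (rule image_eqI)
  qed
  have inj: "inj_on (\<lambda>x. rcomp Z i (rcomp Z (a x) p)) (carrier A)"
  proof (rule inj_onI)
    fix x y assume x: "x \<in> carrier A" and y: "y \<in> carrier A"
      and eq: "rcomp Z i (rcomp Z (a x) p) = rcomp Z i (rcomp Z (a y) p)"
    have "a x = a y" by (rule g_eqI[OF ax[OF x] ax[OF y] eq])
    then show "x = y" by (rule inj_onD[OF ab(2) _ x y])
  qed
  have "rcomp Z i (rcomp Z (a (x \<oplus>\<^bsub>A\<^esub> y)) p) = hadd Z Z (rcomp Z i (rcomp Z (a x) p)) (rcomp Z i (rcomp Z (a y) p)) \<and>
    rcomp Z i (rcomp Z (a (x \<otimes>\<^bsub>A\<^esub> y)) p) = rcomp Z (rcomp Z i (rcomp Z (a x) p)) (rcomp Z i (rcomp Z (a y) p))"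
    if x: "x \<in> carrier A" and y: "y \<in> carrier A" for x y
  proof
    note cx = hom_closed[OF ax[OF x]] and cy = hom_closed[OF ax[OF y]]
    have 1: "a (x \<oplus>\<^bsub>A\<^esub> y) = hadd U U (a x) (a y)" and 2: "a (x \<otimes>\<^bsub>A\<^esub> y) = rcomp U (a x) (a y)"
      using ring_hom_add[OF ah x y] ring_hom_mult[OF ah x y] by simp_all
    show "rcomp Z i (rcomp Z (a (x \<oplus>\<^bsub>A\<^esub> y)) p) = hadd Z Z (rcomp Z i (rcomp Z (a x) p)) (rcomp Z i (rcomp Z (a y) p))"
      unfolding 1 by (auto simp: compose_def hadd_def fun_eq_iff cp cx cy hom_add[OF i])
    show "rcomp Z i (rcomp Z (a (x \<otimes>\<^bsub>A\<^esub> y)) p) = rcomp Z (rcomp Z i (rcomp Z (a x) p)) (rcomp Z i (rcomp Z (a y) p))"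
      unfolding 2 by (auto simp: compose_def fun_eq_iff cp cx cy ci pi)
  qed
  then show ?thesis unfolding corner_iso_def bij_betw_def using img inj by simp
qed

text \<open>A composite of \<open>a : U \<rightarrow> V\<close> and \<open>s : V \<rightarrow> U\<close> becomes in \<open>End(Z)\<close> the product of \<open>i s q\<close> and \<open>j a p\<close>,
  which lie in the two off-diagonal Peirce components of the idempotents \<open>i p\<close> and \<open>j q\<close>.\<close>

lemma retract_corner_sums:
  assumes U: "right_module R U" and V: "right_module R V" and Z: "right_module R Z"
    and i: "i \<in> rmod_hom R U Z" and p: "p \<in> rmod_hom R Z U"
    and pi: "\<And>u. u \<in> carrier U \<Longrightarrow> p (i u) = u"
    and j: "j \<in> rmod_hom R V Z" and q: "q \<in> rmod_hom R Z V"
    and qj: "\<And>v. v \<in> carrier V \<Longrightarrow> q (j v) = v"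
    and h: "h \<in> through_all R V U U"
  shows "rcomp Z i (rcomp Z h p) \<in> corner_sums (End_ring R Z) (rcomp Z i p) (rcomp Z j q)"
  using h
proof induction
  case zero
  have "rcomp Z i (rcomp Z (hzero U U) p) = hzero Z Z"
    using hom_zero[OF U Z i] by (auto simp: compose_def hzero_def fun_eq_iff hom_closed[OF p])
  then show ?case using corner_sums.zero[of "End_ring R Z"] by simp
next
  case (step h a s)
  note a = step.hyps(2) and s = step.hyps(3)
  have h: "h \<in> rmod_hom R U U" by (rule through_hom[OF U U subset_refl step.hyps(1)])
  note C = hom_closed[OF i] hom_closed[OF p] hom_closed[OF j] hom_closed[OF q] hom_closed[OF a] hom_closed[OF s] hom_closed[OF h]
  note K = rcomp_hom[OF Z]
  have x: "rcomp Z i (rcomp Z s q) \<in> peirce (End_ring R Z) (rcomp Z i p) (rcomp Z j q)"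
    using K[OF K[OF q s] i] by (auto simp: peirce_def compose_def fun_eq_iff C pi qj)
  have y: "rcomp Z j (rcomp Z a p) \<in> peirce (End_ring R Z) (rcomp Z j q) (rcomp Z i p)"
    using K[OF K[OF p a] j] by (auto simp: peirce_def compose_def fun_eq_iff C pi qj)
  have "rcomp Z i (rcomp Z (hadd U U h (rcomp U s a)) p) =
    hadd Z Z (rcomp Z i (rcomp Z h p)) (rcomp Z (rcomp Z i (rcomp Z s q)) (rcomp Z j (rcomp Z a p)))"
    by (auto simp: compose_def hadd_def fun_eq_iff C qj hom_add[OF i])
  then show ?case using corner_sums.step[OF step.IH x y] by simp
qed

lemma through_all_retract_iff:
  assumes S: "right_module R S" and U: "right_module R U" and Z: "right_module R Z"
    and i: "i \<in> rmod_hom R U Z" and p: "p \<in> rmod_hom R Z U"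
    and pi: "\<And>u. u \<in> carrier U \<Longrightarrow> p (i u) = u" and g: "g \<in> rmod_hom R U U"
  shows "rcomp Z i (rcomp Z g p) \<in> through_all R S Z Z \<longleftrightarrow> g \<in> through_all R S U U"
proof
  assume "rcomp Z i (rcomp Z g p) \<in> through_all R S Z Z"
  then have "rcomp U p (rcomp U (rcomp Z i (rcomp Z g p)) i) \<in> through_all R S U U"
    by (rule through_all_conj[OF S Z Z U U i p])
  moreover have "rcomp U p (rcomp U (rcomp Z i (rcomp Z g p)) i) = g"
    by (rule hom_eqI[OF rcomp_hom[OF U rcomp_hom[OF U i rcomp_hom[OF Z rcomp_hom[OF Z p g] i]] p] g])
      (simp add: compose_eq hom_closed[OF i] pi hom_closed[OF g])
  ultimately show "g \<in> through_all R S U U" by simp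
qed (rule through_all_conj[OF S U U Z Z p i])

text \<open>Both endomorphism rings are corners of \<open>End(U \<oplus> V)\<close>, for the projections \<open>e\<close> onto \<open>U\<close> and \<open>f\<close> onto
  \<open>V\<close>.  That \<open>U\<close> is in \<open>add V\<close> says that \<open>e\<close> is a sum of products from \<open>(e D f) (f D e)\<close>, and likewise for \<open>V\<close>
  and \<open>f\<close>.  The sums of endomorphisms of \<open>U \<oplus> V\<close> through \<open>S\<close> form an ideal, which cuts out the
  corresponding ideal in each corner.\<close>

lemma morita_equivalent_End:
  assumes U: "right_module R U" and V: "right_module R V" and A: "ring A" and B: "ring B"
    and a: "a \<in> ring_iso A (End_ring R U)" and b: "b \<in> ring_iso B (End_ring R V)"
    and UV: "in_add R U V" and VU: "in_add R V U"
  shows "morita_equivalent A B"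
    and "right_module R S \<Longrightarrow> morita_equivalent
      (A Quot {x \<in> carrier A. a x \<in> through_all R S U U}) (B Quot {x \<in> carrier B. b x \<in> through_all R S V V})"
proof -
  let ?Z = "rmod_sum2 U V"
  interpret U: right_module R U by fact
  interpret V: right_module R V by fact
  have Z: "right_module R ?Z" by (rule sum2_right_module[OF U V])
  define i where "i = (\<lambda>u\<in>carrier U. (u, \<zero>\<^bsub>V\<^esub>))"
  define j where "j = (\<lambda>v\<in>carrier V. (\<zero>\<^bsub>U\<^esub>, v))"
  define p where "p = (\<lambda>z\<in>carrier ?Z. fst z)"
  define q where "q = (\<lambda>z\<in>carrier ?Z. snd z)"
  have i: "i \<in> rmod_hom R U ?Z" unfolding i_def by (rule rmod_hom_restrictI[OF U]) auto
  have j: "j \<in> rmod_hom R V ?Z" unfolding j_def by (rule rmod_hom_restrictI[OF V]) auto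
  have p: "p \<in> rmod_hom R ?Z U" unfolding p_def by (rule rmod_hom_restrictI[OF Z]) auto
  have q: "q \<in> rmod_hom R ?Z V" unfolding q_def by (rule rmod_hom_restrictI[OF Z]) auto
  have pi: "p (i u) = u" if "u \<in> carrier U" for u using that by (simp add: p_def i_def)
  have qj: "q (j v) = v" if "v \<in> carrier V" for v using that by (simp add: q_def j_def)
  let ?D = "End_ring R ?Z"
  let ?\<alpha> = "\<lambda>x. rcomp ?Z i (rcomp ?Z (a x) p)" and ?\<beta> = "\<lambda>x. rcomp ?Z j (rcomp ?Z (b x) q)"
  note ip = rcomp_hom[OF Z p i] and jq = rcomp_hom[OF Z q j]
  note C = hom_closed[OF p] hom_closed[OF i] hom_closed[OF q] hom_closed[OF j]
  have idem: "rcomp ?Z i p \<in> carrier ?D" "rcomp ?Z i p \<otimes>\<^bsub>?D\<^esub> rcomp ?Z i p = rcomp ?Z i p"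
    "rcomp ?Z j q \<in> carrier ?D" "rcomp ?Z j q \<otimes>\<^bsub>?D\<^esub> rcomp ?Z j q = rcomp ?Z j q"
    unfolding End_ring_simps
    by (rule ip, rule hom_eqI[OF rcomp_hom[OF Z ip ip] ip], simp add: compose_eq C pi del: sum2_simps,
      rule jq, rule hom_eqI[OF rcomp_hom[OF Z jq jq] jq], simp add: compose_eq C qj del: sum2_simps)
  have red: "rcomp ?Z i (rcomp ?Z (rid U) p) = rcomp ?Z i p" "rcomp ?Z j (rcomp ?Z (rid V) q) = rcomp ?Z j q"
    by (rule hom_eqI[OF rcomp_hom[OF Z rcomp_hom[OF Z p rid_hom[OF U]] i] ip], simp add: compose_eq C del: sum2_simps,
      rule hom_eqI[OF rcomp_hom[OF Z rcomp_hom[OF Z q rid_hom[OF V]] j] jq], simp add: compose_eq C del: sum2_simps)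
  have full: "rcomp ?Z i p \<in> corner_sums ?D (rcomp ?Z i p) (rcomp ?Z j q)"
    "rcomp ?Z j q \<in> corner_sums ?D (rcomp ?Z j q) (rcomp ?Z i p)"
    using retract_corner_sums[OF U V Z i p pi j q qj VU[unfolded in_add_def]]
      retract_corner_sums[OF V U Z j q qj i p pi UV[unfolded in_add_def]] by (simp_all only: red)
  interpret M: morita_context ?D "rcomp ?Z i p" "rcomp ?Z j q" A B ?\<alpha> ?\<beta>
    by (intro morita_context.intro morita_context_axioms.intro End_ring_ring[OF Z] A B idem full
      retract_corner_iso[OF U Z i p pi a] retract_corner_iso[OF V Z j q qj b])
  show "morita_equivalent A B" by (rule M.morita_equivalent_corners)
  assume S: "right_module R S"
  have aU: "a x \<in> rmod_hom R U U" if "x \<in> carrier A" for x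
    using a that by (auto simp: ring_iso_def ring_hom_def)
  have bV: "b x \<in> rmod_hom R V V" if "x \<in> carrier B" for x
    using b that by (auto simp: ring_iso_def ring_hom_def)
  have 1: "{x \<in> carrier A. ?\<alpha> x \<in> through_all R S ?Z ?Z} = {x \<in> carrier A. a x \<in> through_all R S U U}"
    using through_all_retract_iff[OF S U Z i p pi aU] by blast
  have 2: "{x \<in> carrier B. ?\<beta> x \<in> through_all R S ?Z ?Z} = {x \<in> carrier B. b x \<in> through_all R S V V}"
    using through_all_retract_iff[OF S V Z j q qj bV] by blast
  show "morita_equivalent (A Quot {x \<in> carrier A. a x \<in> through_all R S U U})
    (B Quot {x \<in> carrier B. b x \<in> through_all R S V V})"
    using M.morita_equivalent_Quot[OF through_all_ideal[OF S Z]] unfolding 1 2 .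
qed

section \<open>Transporting module-theoretic properties along an equivalence\<close>

lemma through_mono:
  assumes "f \<in> through R U V W S" "S \<subseteq> S'" shows "f \<in> through R U V W S'"
  using assms(1)
proof induction
  case zero
  show ?case by (rule through.zero)
next
  case (step f a s)
  then show ?case using assms(2) by (intro through.step) auto
qed

lemma sum2_in_add:
  assumes U: "right_module R U" and V: "right_module R V" and W: "right_module R W"
    and UV: "in_add R U V" and UW: "in_add R U W"
  shows "in_add R U (rmod_sum2 V W)"
proof -
  let ?Z = "rmod_sum2 V W"
  interpret V: right_module R V by fact
  interpret W: right_module R W by fact
  have Z: "right_module R ?Z" by (rule sum2_right_module[OF V W])
  have i: "(\<lambda>u\<in>carrier V. (u, \<zero>\<^bsub>W\<^esub>)) \<in> rmod_hom R V ?Z" by (rule rmod_hom_restrictI[OF V]) auto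
  have j: "(\<lambda>v\<in>carrier W. (\<zero>\<^bsub>V\<^esub>, v)) \<in> rmod_hom R W ?Z" by (rule rmod_hom_restrictI[OF W]) auto
  have p: "(\<lambda>z\<in>carrier ?Z. fst z) \<in> rmod_hom R ?Z V" by (rule rmod_hom_restrictI[OF Z]) auto
  have q: "(\<lambda>z\<in>carrier ?Z. snd z) \<in> rmod_hom R ?Z W" by (rule rmod_hom_restrictI[OF Z]) auto
  have "hadd ?Z ?Z (rcomp ?Z (\<lambda>u\<in>carrier V. (u, \<zero>\<^bsub>W\<^esub>)) (rcomp ?Z (rid V) (\<lambda>z\<in>carrier ?Z. fst z)))
      (rcomp ?Z (\<lambda>v\<in>carrier W. (\<zero>\<^bsub>V\<^esub>, v)) (rcomp ?Z (rid W) (\<lambda>z\<in>carrier ?Z. snd z))) = rid ?Z"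
    by (auto simp: hadd_def compose_def fun_eq_iff)
  moreover have "hadd ?Z ?Z (rcomp ?Z (\<lambda>u\<in>carrier V. (u, \<zero>\<^bsub>W\<^esub>)) (rcomp ?Z (rid V) (\<lambda>z\<in>carrier ?Z. fst z)))
      (rcomp ?Z (\<lambda>v\<in>carrier W. (\<zero>\<^bsub>V\<^esub>, v)) (rcomp ?Z (rid W) (\<lambda>z\<in>carrier ?Z. snd z))) \<in> through_all R U ?Z ?Z"
    by (rule through_add[OF Z Z subset_refl through_all_conj[OF U V V Z Z p i UV[unfolded in_add_def]]
      through_all_conj[OF U W W Z Z q j UW[unfolded in_add_def]]])
  ultimately show ?thesis by (simp only: in_add_def)
qed

text \<open>Every finite family \<open>S\<close> of maps \<open>W \<rightarrow> V\<close> that is jointly epimorphic, when tested by maps from \<open>V\<close> to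
  modules in \<open>\<C>\<close>, splits: the identity of \<open>V\<close> is a sum of composites with members of \<open>S\<close>.  Finite
  families take the place of single maps \<open>W\<^sup>n \<rightarrow> V\<close>, so that no biproducts have to be formed in \<open>\<C>\<close>.\<close>

definition split_wrt ::
  "('a, 'r) ring_scheme \<Rightarrow> 'a umodule set \<Rightarrow> ('a, 'v, 'j) module_scheme \<Rightarrow> bool"
  where "split_wrt R \<C> V \<longleftrightarrow> (\<forall>W\<in>\<C>. \<forall>S. finite S \<longrightarrow> S \<subseteq> rmod_hom R W V \<longrightarrow>
    (\<forall>W'\<in>\<C>. \<forall>g\<in>rmod_hom R V W'. (\<forall>s\<in>S. rcomp W g s = hzero W W') \<longrightarrow> g = hzero V W') \<longrightarrow>
    rid V \<in> through R W V V S)"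

lemma split_wrtD:
  assumes "split_wrt R \<C> V" "W \<in> \<C>" "finite S" "S \<subseteq> rmod_hom R W V"
    "\<And>W' g. \<lbrakk>W' \<in> \<C>; g \<in> rmod_hom R V W'; \<And>s. s \<in> S \<Longrightarrow> rcomp W g s = hzero W W'\<rbrakk> \<Longrightarrow> g = hzero V W'"
  shows "rid V \<in> through R W V V S"
proof -
  have "\<forall>W'\<in>\<C>. \<forall>g\<in>rmod_hom R V W'. (\<forall>s\<in>S. rcomp W g s = hzero W W') \<longrightarrow> g = hzero V W'"
    by (intro ballI impI, rule assms(5)) simp_all
  then show ?thesis
    using assms(1)[unfolded split_wrt_def, rule_format, OF assms(2-4)] by simp
qed

lemma split_wrt_iso:
  assumes C: "\<C> \<subseteq> fp_modules R" and V: "right_module R V" and V': "right_module R V'"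
    and iso: "rmod_iso R V V'" and sp: "split_wrt R \<C> V"
  shows "split_wrt R \<C> V'"
  unfolding split_wrt_def
proof (intro ballI allI impI)
  obtain u t where u: "u \<in> rmod_hom R V V'" and t: "t \<in> rmod_hom R V' V"
    and tu: "\<And>x. x \<in> carrier V \<Longrightarrow> t (u x) = x" and ut: "\<And>y. y \<in> carrier V' \<Longrightarrow> u (t y) = y"
    using V iso by (rule rmod_isoE) blast
  fix W S assume W: "W \<in> \<C>" and fin: "finite S" and S: "S \<subseteq> rmod_hom R W V'"
    and epi: "\<forall>W'\<in>\<C>. \<forall>g\<in>rmod_hom R V' W'. (\<forall>s\<in>S. rcomp W g s = hzero W W') \<longrightarrow> g = hzero V' W'"
  have rW: "right_module R W" using W C fp_modules_rm by blast
  have "rid V \<in> through R W V V ((\<lambda>s. rcomp W t s) ` S)"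
  proof (rule split_wrtD[OF sp W])
    show "finite ((\<lambda>s. rcomp W t s) ` S)" using fin by simp
    show "(\<lambda>s. rcomp W t s) ` S \<subseteq> rmod_hom R W V" using rcomp_hom[OF rW _ t] S by blast
    fix W' g assume W': "W' \<in> \<C>" and g: "g \<in> rmod_hom R V W'"
      and z: "\<And>s. s \<in> (\<lambda>s. rcomp W t s) ` S \<Longrightarrow> rcomp W g s = hzero W W'"
    have gt: "rcomp V' g t \<in> rmod_hom R V' W'" by (rule rcomp_hom[OF V' t g])
    have "rcomp W (rcomp V' g t) s = hzero W W'" if s: "s \<in> S" for s
    proof -
      have "rcomp W (rcomp V' g t) s = rcomp W g (rcomp W t s)"
        using S s by (auto simp: compose_def fun_eq_iff dest: hom_closed)
      then show ?thesis using z[of "rcomp W t s"] s by simp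
    qed
    then have "rcomp V' g t = hzero V' W'" using epi W' gt by blast
    then have "g (t (u x)) = \<zero>\<^bsub>W'\<^esub>" if "x \<in> carrier V" for x
      using hom_closed[OF u that] by (metis compose_eq hzero_apply)
    then show "g = hzero V W'"
      using hom_undefined[OF g] by (auto simp: hzero_def tu fun_eq_iff)
  qed
  then have "rcomp V' u (rcomp V' (rid V) t) \<in> through R W V' V' S"
  proof (rule through_conj[OF rW V V V' V' _ S t u, rotated -1])
    show "(\<lambda>s. rcomp W t s) ` S \<subseteq> rmod_hom R W V" using rcomp_hom[OF rW _ t] S by blast
    fix r assume "r \<in> (\<lambda>s. rcomp W t s) ` S"
    then obtain s where s: "s \<in> S" "r = rcomp W t s" by blast
    have sh: "s \<in> rmod_hom R W V'" using s S by blast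
    have "rcomp W u r = s"
      using hom_closed[OF sh] hom_undefined[OF sh] by (auto simp: s(2) compose_def fun_eq_iff ut)
    then show "rcomp W u r \<in> S" using s(1) by simp
  qed
  moreover have "rcomp V' u (rcomp V' (rid V) t) = rid V'"
    by (auto simp: compose_def fun_eq_iff hom_closed[OF t] ut)
  ultimately show "rid V' \<in> through R W V' V' S" by simp
qed

text \<open>A finite jointly epimorphic family of maps into \<open>R\<close> generates \<open>R\<close> as a right ideal:
  otherwise the projection onto the (finitely presented) quotient would be a nonzero map
  killed by the family.\<close>

lemma split_wrt_regular:
  assumes R: "ring R" shows "split_wrt R (fp_modules R) (regular_module R)"
  unfolding split_wrt_def
proof (intro ballI allI impI)
  let ?M = "regular_module R"
  fix W S assume W: "W \<in> fp_modules R" and fin: "finite S" and S: "S \<subseteq> rmod_hom R W ?M"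
    and epi: "\<forall>W'\<in>fp_modules R. \<forall>g\<in>rmod_hom R ?M W'. (\<forall>s\<in>S. rcomp W g s = hzero W W') \<longrightarrow> g = hzero ?M W'"
  interpret R: ring R by fact
  have M: "right_module R ?M" by (rule regular_right_module[OF R])
  interpret M: right_module R ?M by fact
  have rW: "right_module R W" by (rule fp_modules_rm[OF W])
  interpret W: right_module R W by fact
  have th: "f \<in> rmod_hom R ?M ?M" if "f \<in> through R W ?M ?M S" for f
    by (rule through_hom[OF M M S that])
  \<comment> \<open>The right ideal generated by the images of the maps in \<open>S\<close>; it is the whole ring exactly if
    the identity is a sum of maps through \<open>S\<close>.\<close>
  define N where "N = {f \<one>\<^bsub>R\<^esub> | f. f \<in> through R W ?M ?M S}"
  have NI: "f \<one>\<^bsub>R\<^esub> \<in> N" if "f \<in> through R W ?M ?M S" for f using that by (auto simp: N_def)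
  have N: "submodule N R ?M"
  proof (rule M.rsubmoduleI)
    show "N \<subseteq> carrier ?M" using hom_closed[OF th] by (force simp: N_def)
    show "\<zero>\<^bsub>?M\<^esub> \<in> N" using NI[OF through.zero] by simp
    fix x y a assume "x \<in> N"
    then obtain f where f: "f \<in> through R W ?M ?M S" "x = f \<one>\<^bsub>R\<^esub>" by (auto simp: N_def)
    { assume "y \<in> N"
      then obtain g where g: "g \<in> through R W ?M ?M S" "y = g \<one>\<^bsub>R\<^esub>" by (auto simp: N_def)
      show "x \<oplus>\<^bsub>?M\<^esub> y \<in> N" using NI[OF through_add[OF M M S f(1) g(1)]] by (simp add: f(2) g(2)) }
    assume a: "a \<in> carrier R"
    have l: "(\<lambda>x\<in>carrier ?M. a \<otimes>\<^bsub>R\<^esub> x) \<in> rmod_hom R ?M ?M"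
      by (rule rmod_hom_restrictI[OF M]) (use a in \<open>simp_all add: R.r_distr R.m_assoc\<close>)
    have "rcomp ?M (rid ?M) (rcomp ?M f (\<lambda>x\<in>carrier ?M. a \<otimes>\<^bsub>R\<^esub> x)) \<in> through R W ?M ?M S"
    proof (rule through_conj[OF rW M M M M S S l rid_hom[OF M] _ f(1)])
      fix s assume s: "s \<in> S"
      then have sh: "s \<in> rmod_hom R W ?M" using S by blast
      show "rcomp W (rid ?M) s \<in> S" using s by (simp only: rcomp_rid(2)[OF sh])
    qed
    from NI[OF this] have "f a \<in> N" using a hom_closed[OF th[OF f(1)], of a] by (simp add: compose_eq)
    then show "a \<odot>\<^bsub>?M\<^esub> x \<in> N"
      using hom_smult[OF th[OF f(1)] a, of "\<one>\<^bsub>R\<^esub>"] a by (simp add: f(2))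
  qed
  have sN: "s w \<in> N" if s: "s \<in> S" and w: "w \<in> carrier W" for s w
  proof -
    have "(\<lambda>x\<in>carrier ?M. x \<odot>\<^bsub>W\<^esub> w) \<in> rmod_hom R ?M W"
      by (rule rmod_hom_restrictI[OF M]) (use w in \<open>simp_all add: W.smult_l_distr W.smult_assoc\<close>)
    from NI[OF through_single[OF M M S this s]] show ?thesis using w by (simp add: compose_eq)
  qed
  obtain G where G: "finite G" "G \<subseteq> carrier W" "\<And>H. submodule H R W \<Longrightarrow> G \<subseteq> H \<Longrightarrow> carrier W \<subseteq> H"
    using finitely_presented_fg[of R W] W unfolding fg_whole[OF rW] fp_modules_def by blast
  have fgN: "fg_submodule R ?M N"
    unfolding fg_submodule_def
  proof (intro conjI exI[of _ "(\<lambda>(s, w). s w) ` (S \<times> G)"] allI impI N)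
    show "finite ((\<lambda>(s, w). s w) ` (S \<times> G))" using fin G(1) by simp
    show "(\<lambda>(s, w). s w) ` (S \<times> G) \<subseteq> N" using sN G(2) by auto
    fix H assume H: "submodule H R ?M" "(\<lambda>(s, w). s w) ` (S \<times> G) \<subseteq> H"
    have sH: "s w \<in> H" if s: "s \<in> S" and w: "w \<in> carrier W" for s w
    proof -
      have "s \<in> rmod_hom R W ?M" using s S by blast
      then have "carrier W \<subseteq> {w \<in> carrier W. s w \<in> H}"
        by (rule G(3)[OF submodule_vimage[OF rW M _ H(1)]]) (use H(2) G(2) s in auto)
      then show ?thesis using w by blast
    qed
    have "f \<one>\<^bsub>R\<^esub> \<in> H" if "f \<in> through R W ?M ?M S" for f
      using that
    proof induction
      case zero
      then show ?case using M.rsubmoduleD(2)[OF H(1)] by simp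
    next
      case (step f a s)
      then show ?case
        using M.rsubmoduleD(3)[OF H(1) step.IH sH[OF step.hyps(3) hom_closed[OF step.hyps(2), of "\<one>\<^bsub>R\<^esub>"]]]
        by (simp add: compose_eq)
    qed
    then show "N \<subseteq> H" by (auto simp: N_def)
  qed
  obtain Q0 :: "('a, 'a set) module" and q where Q0: "right_module R Q0" and q: "q \<in> rmod_hom R ?M Q0"
    and sq: "q ` carrier ?M = carrier Q0" and kq: "{x \<in> carrier ?M. q x = \<zero>\<^bsub>Q0\<^esub>} = N"
    by (rule quotient_module_exists[OF M N]) blast
  have fpM: "finitely_presented R ?M"
    by (rule in_add_regular_finitely_presented[OF M in_add_refl[OF M]])
  have fpQ: "finitely_presented R Q0"
    by (rule finitely_presented_quotient[OF fpM Q0 q sq]) (simp only: kq fgN)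
  let ?W = "fp_copy R Q0" and ?g = "rcomp ?M (to_copy R Q0) q"
  have g: "?g \<in> rmod_hom R ?M ?W" by (rule rcomp_hom[OF M q to_copy_hom[OF fpQ]])
  have "rcomp W ?g s = hzero W ?W" if s: "s \<in> S" for s
  proof -
    have sh: "s \<in> rmod_hom R W ?M" using s S by blast
    have "q (s w) = \<zero>\<^bsub>Q0\<^esub>" if "w \<in> carrier W" for w using sN[OF s that] unfolding kq[symmetric] by simp
    then show ?thesis
      using hom_closed[OF sh] hom_zero[OF Q0 fp_modules_rm[OF fp_copy[OF fpQ]] to_copy_hom[OF fpQ]]
      by (auto simp: compose_def hzero_def fun_eq_iff)
  qed
  then have "?g = hzero ?M ?W" using epi fp_copy[OF fpQ] g by blast
  from fun_cong[OF this, of "\<one>\<^bsub>R\<^esub>"] have t: "to_copy R Q0 (q \<one>\<^bsub>R\<^esub>) = \<zero>\<^bsub>?W\<^esub>" by (simp add: compose_eq)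
  have q1: "q \<one>\<^bsub>R\<^esub> \<in> carrier Q0" using hom_closed[OF q, of "\<one>\<^bsub>R\<^esub>"] by simp
  have "q \<one>\<^bsub>R\<^esub> = \<zero>\<^bsub>Q0\<^esub>"
    using from_to_copy[OF fpQ q1] hom_zero[OF fp_modules_rm[OF fp_copy[OF fpQ]] Q0 from_copy_hom[OF fpQ]] t by simp
  then have "\<one>\<^bsub>R\<^esub> \<in> N" unfolding kq[symmetric] by simp
  then obtain f where f: "f \<in> through R W ?M ?M S" "\<one>\<^bsub>R\<^esub> = f \<one>\<^bsub>R\<^esub>" by (auto simp: N_def)
  have "f = rid ?M"
  proof (rule hom_eqI[OF th[OF f(1)] rid_hom[OF M]])
    fix x assume x: "x \<in> carrier ?M"
    show "f x = rid ?M x"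
      using hom_smult[OF th[OF f(1)], of x "\<one>\<^bsub>R\<^esub>"] x f(2)[symmetric] by simp
  qed
  then show "rid ?M \<in> through R W ?M ?M S" using f(1) by simp
qed

lemma regular_fp: "ring R \<Longrightarrow> finitely_presented R (regular_module R)"
  by (rule in_add_regular_finitely_presented[OF regular_right_module in_add_refl[OF regular_right_module]])

abbreviation regular_copy where "regular_copy R \<equiv> fp_copy R (regular_module R)"

lemma regular_copy:
  assumes "ring R"
  shows "regular_copy R \<in> fp_modules R" "right_module R (regular_copy R)" "in_add R (regular_module R) (regular_copy R)"
    "in_add R (regular_copy R) (regular_module R)"
proof -
  note f = regular_fp[OF assms]
  show 1: "regular_copy R \<in> fp_modules R" by (rule fp_copy[OF f])
  show 2: "right_module R (regular_copy R)" by (rule fp_modules_rm[OF 1])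
  show "in_add R (regular_module R) (regular_copy R)" "in_add R (regular_copy R) (regular_module R)"
    by (rule in_add_iso[OF regular_right_module[OF assms] 2 fp_copy_iso[OF f]])+
qed

text \<open>The maps \<open>R \<rightarrow> V\<close> that send \<open>1\<close> to the members of a finite generating set are jointly epimorphic,
  and a splitting of this family exhibits \<open>V\<close> as a summand of some \<open>R\<^sup>n\<close>.\<close>

lemma split_wrt_all_in_add:
  assumes R: "ring R" and V: "V \<in> fp_modules R" and sp: "split_wrt R (fp_modules R) V"
  shows "in_add R (regular_module R) V"
proof -
  let ?W = "regular_copy R"
  have rV: "right_module R V" by (rule fp_modules_rm[OF V])
  interpret V: right_module R V by fact
  note W = regular_copy(2)[OF R] and M = regular_right_module[OF R]
  interpret W: right_module R ?W by (rule W)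
  let ?c = "from_copy R (regular_module R)" and ?t = "to_copy R (regular_module R)"
  note ch = from_copy_hom[OF regular_fp[OF R]] and thh = to_copy_hom[OF regular_fp[OF R]]
  have cc: "?c x \<in> carrier R" if "x \<in> carrier ?W" for x using hom_closed[OF ch that] by simp
  obtain G where G: "finite G" "G \<subseteq> carrier V" "\<And>H. submodule H R V \<Longrightarrow> G \<subseteq> H \<Longrightarrow> carrier V \<subseteq> H"
    using finitely_presented_fg[of R V] V unfolding fg_whole[OF rV] fp_modules_def by blast
  define s where "s v = (\<lambda>x\<in>carrier ?W. ?c x \<odot>\<^bsub>V\<^esub> v)" for v
  have s: "s v \<in> rmod_hom R ?W V" if "v \<in> carrier V" for v
    unfolding s_def
    by (rule rmod_hom_restrictI[OF W])
      (simp_all add: cc that hom_add[OF ch] hom_smult[OF ch] V.smult_l_distr V.smult_assoc)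
  have "rid V \<in> through R ?W V V (s ` G)"
  proof (rule split_wrtD[OF sp regular_copy(1)[OF R]])
    show "finite (s ` G)" using G(1) by simp
    show sG: "s ` G \<subseteq> rmod_hom R ?W V" using s G(2) by blast
    fix W' g assume W': "W' \<in> fp_modules R" and g: "g \<in> rmod_hom R V W'"
      and z: "\<And>r. r \<in> s ` G \<Longrightarrow> rcomp ?W g r = hzero ?W W'"
    note rW' = fp_modules_rm[OF W']
    have "g v = \<zero>\<^bsub>W'\<^esub>" if v: "v \<in> G" for v
    proof -
      have t1: "?t \<one>\<^bsub>R\<^esub> \<in> carrier ?W" "?c (?t \<one>\<^bsub>R\<^esub>) = \<one>\<^bsub>R\<^esub>"
        using hom_closed[OF thh, of "\<one>\<^bsub>R\<^esub>"] from_to_copy[OF regular_fp[OF R], of "\<one>\<^bsub>R\<^esub>"] by simp_all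
      have "v \<in> carrier V" using v G(2) by blast
      then show ?thesis
        using fun_cong[OF z[of "s v"], of "?t \<one>\<^bsub>R\<^esub>"] v t1 by (simp add: compose_eq s_def)
    qed
    then have "carrier V \<subseteq> {x \<in> carrier V. g x = \<zero>\<^bsub>W'\<^esub>}"
      using G(2) by (intro G(3) submodule_kernel[OF rV rW' g]) blast
    then have "g x = \<zero>\<^bsub>W'\<^esub>" if "x \<in> carrier V" for x using that by blast
    then show "g = hzero V W'" using hom_undefined[OF g] by (auto simp: hzero_def fun_eq_iff)
  qed
  then have "in_add R ?W V" unfolding in_add_def
    by (rule through_mono) (use s G(2) in blast)
  then show ?thesis by (rule in_add_trans[OF M W rV regular_copy(3)[OF R]])
qed

locale mod_equiv = R: ring R + S: ring S
  for R :: "('a, 'r) ring_scheme" and S :: "('b, 's) ring_scheme"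
    and F :: "'a umodule \<Rightarrow> 'b umodule" and \<phi> and G :: "'b umodule \<Rightarrow> 'a umodule" and \<psi> +
  assumes functor_F: "is_functor (mod_category R) (mod_category S) F \<phi>"
    and functor_G: "is_functor (mod_category S) (mod_category R) G \<psi>"
    and iso_GF: "naturally_isomorphic (mod_category R) (mod_category R) (\<lambda>X. X) (\<lambda>X Y f. f)
      (\<lambda>X. G (F X)) (\<lambda>X Y f. \<psi> (F X) (F Y) (\<phi> X Y f))"
    and iso_FG: "naturally_isomorphic (mod_category S) (mod_category S) (\<lambda>X. X) (\<lambda>X Y f. f)
      (\<lambda>X. F (G X)) (\<lambda>X Y f. \<phi> (G X) (G Y) (\<psi> X Y f))"
begin

lemma swap: "mod_equiv S R G \<psi> F \<phi>"
  by (intro mod_equiv.intro mod_equiv_axioms.intro R.ring_axioms S.ring_axioms functor_F functor_G iso_GF iso_FG)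

lemma F_ob: "X \<in> fp_modules R \<Longrightarrow> F X \<in> fp_modules S"
  and F_hom: "\<lbrakk>X \<in> fp_modules R; Y \<in> fp_modules R; f \<in> rmod_hom R X Y\<rbrakk> \<Longrightarrow> \<phi> X Y f \<in> rmod_hom S (F X) (F Y)"
  and F_id: "X \<in> fp_modules R \<Longrightarrow> \<phi> X X (rid X) = rid (F X)"
  and F_comp: "\<lbrakk>X \<in> fp_modules R; Y \<in> fp_modules R; Z \<in> fp_modules R; f \<in> rmod_hom R X Y; g \<in> rmod_hom R Y Z\<rbrakk> \<Longrightarrow>
    \<phi> X Z (rcomp X g f) = rcomp (F X) (\<phi> Y Z g) (\<phi> X Y f)"
  using functor_F unfolding is_functor_def mod_category_simps by blast+

lemma G_ob: "X \<in> fp_modules S \<Longrightarrow> G X \<in> fp_modules R"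
  and G_hom: "\<lbrakk>X \<in> fp_modules S; Y \<in> fp_modules S; f \<in> rmod_hom S X Y\<rbrakk> \<Longrightarrow> \<psi> X Y f \<in> rmod_hom R (G X) (G Y)"
  using functor_G unfolding is_functor_def mod_category_simps by blast+

lemma F_rm: "X \<in> fp_modules R \<Longrightarrow> right_module S (F X)"
  using F_ob fp_modules_rm by blast

lemma unit_data:
  obtains \<eta> \<theta> where
    "\<And>X. X \<in> fp_modules R \<Longrightarrow> \<eta> X \<in> rmod_hom R X (G (F X))"
    "\<And>X. X \<in> fp_modules R \<Longrightarrow> \<theta> X \<in> rmod_hom R (G (F X)) X"
    "\<And>X x. \<lbrakk>X \<in> fp_modules R; x \<in> carrier X\<rbrakk> \<Longrightarrow> \<theta> X (\<eta> X x) = x"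
    "\<And>X y. \<lbrakk>X \<in> fp_modules R; y \<in> carrier (G (F X))\<rbrakk> \<Longrightarrow> \<eta> X (\<theta> X y) = y"
    "\<And>X Y f x. \<lbrakk>X \<in> fp_modules R; Y \<in> fp_modules R; f \<in> rmod_hom R X Y; x \<in> carrier X\<rbrakk> \<Longrightarrow>
      \<eta> Y (f x) = \<psi> (F X) (F Y) (\<phi> X Y f) (\<eta> X x)"
proof -
  obtain \<eta> where \<eta>: "\<And>X. X \<in> fp_modules R \<Longrightarrow> is_iso_in (mod_category R) X (G (F X)) (\<eta> X)"
    and nat: "\<And>X Y f. \<lbrakk>X \<in> fp_modules R; Y \<in> fp_modules R; f \<in> rmod_hom R X Y\<rbrakk> \<Longrightarrow>
      rcomp X (\<eta> Y) f = rcomp X (\<psi> (F X) (F Y) (\<phi> X Y f)) (\<eta> X)"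
    using iso_GF unfolding naturally_isomorphic_def mod_category_simps by blast
  have "\<forall>X\<in>fp_modules R. \<exists>g. g \<in> rmod_hom R (G (F X)) X \<and> rcomp X g (\<eta> X) = rid X \<and>
      rcomp (G (F X)) (\<eta> X) g = rid (G (F X))"
    using \<eta> unfolding is_iso_in_def mod_category_simps by blast
  then obtain \<theta> where \<theta>: "\<And>X. X \<in> fp_modules R \<Longrightarrow> \<theta> X \<in> rmod_hom R (G (F X)) X"
    "\<And>X. X \<in> fp_modules R \<Longrightarrow> rcomp X (\<theta> X) (\<eta> X) = rid X"
    "\<And>X. X \<in> fp_modules R \<Longrightarrow> rcomp (G (F X)) (\<eta> X) (\<theta> X) = rid (G (F X))"
    by (metis (no_types))
  show thesis
  proof (rule that[of \<eta> \<theta>])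
    show "\<eta> X \<in> rmod_hom R X (G (F X))" if "X \<in> fp_modules R" for X
      using \<eta>[OF that] unfolding is_iso_in_def mod_category_simps by blast
    show "\<theta> X (\<eta> X x) = x" if "X \<in> fp_modules R" "x \<in> carrier X" for X x
      using fun_cong[OF \<theta>(2)[OF that(1)], of x] that(2) by (simp add: compose_eq)
    show "\<eta> X (\<theta> X y) = y" if "X \<in> fp_modules R" "y \<in> carrier (G (F X))" for X y
      using fun_cong[OF \<theta>(3)[OF that(1)], of y] that(2) by (simp add: compose_eq)
    show "\<eta> Y (f x) = \<psi> (F X) (F Y) (\<phi> X Y f) (\<eta> X x)"
      if "X \<in> fp_modules R" "Y \<in> fp_modules R" "f \<in> rmod_hom R X Y" "x \<in> carrier X" for X Y f x
      using fun_cong[OF nat[OF that(1-3)], of x] that(4) by (simp add: compose_eq)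
  qed (rule \<theta>(1))
qed

lemma iso_X_GFX:
  assumes "X \<in> fp_modules R" shows "rmod_iso R X (G (F X))"
proof -
  obtain \<eta> \<theta> where \<eta>: "\<And>X. X \<in> fp_modules R \<Longrightarrow> \<eta> X \<in> rmod_hom R X (G (F X))"
    and \<theta>: "\<And>X. X \<in> fp_modules R \<Longrightarrow> \<theta> X \<in> rmod_hom R (G (F X)) X"
    and "\<And>X x. \<lbrakk>X \<in> fp_modules R; x \<in> carrier X\<rbrakk> \<Longrightarrow> \<theta> X (\<eta> X x) = x"
    and "\<And>X y. \<lbrakk>X \<in> fp_modules R; y \<in> carrier (G (F X))\<rbrakk> \<Longrightarrow> \<eta> X (\<theta> X y) = y"
    by (rule unit_data) blast
  note inv = this(3,4)
  show ?thesis
    by (rule rmod_isoI[OF \<eta>[OF assms] hom_closed[OF \<theta>[OF assms]] inv(1)[OF assms] inv(2)[OF assms]])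
qed

lemma faithful:
  assumes X: "X \<in> fp_modules R" and Y: "Y \<in> fp_modules R"
    and f: "f \<in> rmod_hom R X Y" and g: "g \<in> rmod_hom R X Y" and eq: "\<phi> X Y f = \<phi> X Y g"
  shows "f = g"
proof -
  obtain \<eta> \<theta> where \<theta>: "\<And>X x. \<lbrakk>X \<in> fp_modules R; x \<in> carrier X\<rbrakk> \<Longrightarrow> \<theta> X (\<eta> X x) = x"
    and nat: "\<And>X Y f x. \<lbrakk>X \<in> fp_modules R; Y \<in> fp_modules R; f \<in> rmod_hom R X Y; x \<in> carrier X\<rbrakk> \<Longrightarrow>
      \<eta> Y (f x) = \<psi> (F X) (F Y) (\<phi> X Y f) (\<eta> X x)"
    by (rule unit_data) blast
  show "f = g"
  proof (rule hom_eqI[OF f g])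
    fix x assume x: "x \<in> carrier X"
    have "\<eta> Y (f x) = \<eta> Y (g x)" unfolding nat[OF X Y f x] nat[OF X Y g x] eq ..
    then have "\<theta> Y (\<eta> Y (f x)) = \<theta> Y (\<eta> Y (g x))" by (rule arg_cong)
    then show "f x = g x" unfolding \<theta>[OF Y hom_closed[OF f x]] \<theta>[OF Y hom_closed[OF g x]] .
  qed
qed

text \<open>The map \<open>h\<close> is the image of the map \<open>f\<close> that corresponds to \<open>G h\<close> under the natural isomorphism:
  \<open>G (F f) = G h\<close> by naturality, and \<open>G\<close> is faithful.\<close>

lemma full:
  assumes X: "X \<in> fp_modules R" and Y: "Y \<in> fp_modules R" and h: "h \<in> rmod_hom S (F X) (F Y)"
  shows "\<exists>f\<in>rmod_hom R X Y. \<phi> X Y f = h"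
proof -
  interpret W: mod_equiv S R G \<psi> F \<phi> by (rule swap)
  obtain \<eta> \<theta> where \<eta>: "\<And>X. X \<in> fp_modules R \<Longrightarrow> \<eta> X \<in> rmod_hom R X (G (F X))"
    and \<theta>: "\<And>X. X \<in> fp_modules R \<Longrightarrow> \<theta> X \<in> rmod_hom R (G (F X)) X"
    and \<eta>\<theta>: "\<And>X y. \<lbrakk>X \<in> fp_modules R; y \<in> carrier (G (F X))\<rbrakk> \<Longrightarrow> \<eta> X (\<theta> X y) = y"
    and nat: "\<And>X Y f x. \<lbrakk>X \<in> fp_modules R; Y \<in> fp_modules R; f \<in> rmod_hom R X Y; x \<in> carrier X\<rbrakk> \<Longrightarrow>
      \<eta> Y (f x) = \<psi> (F X) (F Y) (\<phi> X Y f) (\<eta> X x)"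
    by (rule unit_data) blast
  note rX = fp_modules_rm[OF X]
  note Gh = G_hom[OF F_ob[OF X] F_ob[OF Y] h]
  define f where "f = rcomp X (\<theta> Y) (rcomp X (\<psi> (F X) (F Y) h) (\<eta> X))"
  have f: "f \<in> rmod_hom R X Y" unfolding f_def by (rule rcomp_hom[OF rX rcomp_hom[OF rX \<eta>[OF X] Gh] \<theta>[OF Y]])
  note Ff = F_hom[OF X Y f]
  have "\<psi> (F X) (F Y) (\<phi> X Y f) = \<psi> (F X) (F Y) h"
  proof (rule hom_eqI[OF G_hom[OF F_ob[OF X] F_ob[OF Y] Ff] Gh])
    fix y assume y: "y \<in> carrier (G (F X))"
    let ?x = "\<theta> X y"
    have x: "?x \<in> carrier X" by (rule hom_closed[OF \<theta>[OF X] y])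
    have "\<psi> (F X) (F Y) (\<phi> X Y f) y = \<eta> Y (f ?x)" using nat[OF X Y f x] \<eta>\<theta>[OF X y] by simp
    also have "f ?x = \<theta> Y (\<psi> (F X) (F Y) h y)" using x \<eta>\<theta>[OF X y] by (simp add: f_def compose_eq)
    also have "\<eta> Y \<dots> = \<psi> (F X) (F Y) h y" by (rule \<eta>\<theta>[OF Y hom_closed[OF Gh y]])
    finally show "\<psi> (F X) (F Y) (\<phi> X Y f) y = \<psi> (F X) (F Y) h y" .
  qed
  then have "\<phi> X Y f = h" by (rule W.faithful[OF F_ob[OF X] F_ob[OF Y] Ff h])
  then show ?thesis using f by blast
qed

text \<open>Zero maps are those that factor through a module \<open>O\<close> whose only endomorphism is the identity;
  by fullness, \<open>F O\<close> is such a module too.\<close>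

lemma F_zero:
  assumes X: "X \<in> fp_modules R" and Y: "Y \<in> fp_modules R"
  shows "\<phi> X Y (hzero X Y) = hzero (F X) (F Y)"
proof -
  let ?O = "fp_copy R (free R 0)"
  note M = regular_right_module[OF R.ring_axioms] and F0 = free_right_module[OF R.ring_axioms, of 0]
  have fp0: "finitely_presented R (free R 0)" by (rule in_add_regular_finitely_presented[OF F0 sum_in_add[OF M]])
  note Z = fp_copy[OF fp0]
  note rX = fp_modules_rm[OF X] and rY = fp_modules_rm[OF Y] and rZ = fp_modules_rm[OF Z]
  have one: "x = \<zero>\<^bsub>?O\<^esub>" if x: "x \<in> carrier ?O" for x
  proof -
    have "from_copy R (free R 0) x = \<zero>\<^bsub>free R 0\<^esub>"
      using hom_closed[OF from_copy_hom[OF fp0] x] by (auto simp: sum_simps)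
    then show ?thesis using to_from_copy[OF fp0 x] hom_zero[OF F0 rZ to_copy_hom[OF fp0]] by simp
  qed
  note a = hzero_hom[OF rX rZ] and b = hzero_hom[OF rZ rY]
  have "hzero X Y = rcomp X (hzero ?O Y) (hzero X ?O)"
    using hom_closed[OF a] by (auto simp: compose_def hzero_def fun_eq_iff)
  then have eq: "\<phi> X Y (hzero X Y) = rcomp (F X) (\<phi> ?O Y (hzero ?O Y)) (\<phi> X ?O (hzero X ?O))"
    using F_comp[OF X Z Y a b] by simp
  \<comment> \<open>The zero endomorphism of \<open>F O\<close> is the image of an endomorphism of \<open>O\<close>, that is, of the identity.\<close>
  obtain k where k: "k \<in> rmod_hom R ?O ?O" "\<phi> ?O ?O k = hzero (F ?O) (F ?O)"
    using full[OF Z Z hzero_hom[OF F_rm[OF Z] F_rm[OF Z]]] by blast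
  have "k = rid ?O"
    by (rule hom_eqI[OF k(1) rid_hom[OF rZ]]) (use one hom_closed[OF k(1)] in \<open>metis restrict_apply'\<close>)
  then have "rid (F ?O) = hzero (F ?O) (F ?O)" using k(2) F_id[OF Z] by simp
  then have z: "z = \<zero>\<^bsub>F ?O\<^esub>" if "z \<in> carrier (F ?O)" for z using fun_cong[of _ _ z] that by (metis hzero_apply restrict_apply')
  show ?thesis
  proof (rule hom_eqI[OF F_hom[OF X Y hzero_hom[OF rX rY]] hzero_hom[OF F_rm[OF X] F_rm[OF Y]]])
    fix x assume x: "x \<in> carrier (F X)"
    have "\<phi> X ?O (hzero X ?O) x = \<zero>\<^bsub>F ?O\<^esub>" by (rule z[OF hom_closed[OF F_hom[OF X Z a] x]])
    then show "\<phi> X Y (hzero X Y) x = hzero (F X) (F Y) x"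
      using x hom_zero[OF F_rm[OF Z] F_rm[OF Y] F_hom[OF Z Y b]] by (simp add: eq compose_eq)
  qed
qed

text \<open>The sum of \<open>f\<close> and \<open>g\<close> is the composite \<open>X \<rightarrow> Y \<oplus> Y \<rightarrow> Y\<close> of the map with components \<open>f\<close> and \<open>g\<close> and
  the codiagonal, and a functor that is full, faithful and preserves zero maps preserves the
  biproduct \<open>Y \<oplus> Y\<close>.  If \<open>Y\<close> is finitely generated projective, then so is \<open>Y \<oplus> Y\<close>, which
  is therefore finitely presented.\<close>

lemma F_add:
  assumes X: "X \<in> fp_modules R" and Y: "Y \<in> fp_modules R" and aY: "in_add R (regular_module R) Y"
    and f: "f \<in> rmod_hom R X Y" and g: "g \<in> rmod_hom R X Y"
  shows "\<phi> X Y (hadd X Y f g) = hadd (F X) (F Y) (\<phi> X Y f) (\<phi> X Y g)"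
proof -
  note M = regular_right_module[OF R.ring_axioms]
  note rX = fp_modules_rm[OF X] and rY = fp_modules_rm[OF Y]
  interpret Y: right_module R Y by (rule rY)
  interpret FY: right_module S "F Y" by (rule F_rm[OF Y])
  let ?Z = "rmod_sum2 Y Y"
  have rZ: "right_module R ?Z" by (rule sum2_right_module[OF rY rY])
  have fpZ: "finitely_presented R ?Z"
    by (rule in_add_regular_finitely_presented[OF rZ sum2_in_add[OF M rY rY aY aY]])
  let ?W = "fp_copy R ?Z"
  note W = fp_copy[OF fpZ]
  note rW = fp_modules_rm[OF W]
  note t = to_copy_hom[OF fpZ] and c = from_copy_hom[OF fpZ]
  interpret FW: right_module S "F ?W" by (rule F_rm[OF W])
  define i1 where "i1 = rcomp Y (to_copy R ?Z) (\<lambda>y\<in>carrier Y. (y, \<zero>\<^bsub>Y\<^esub>))"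
  define i2 where "i2 = rcomp Y (to_copy R ?Z) (\<lambda>y\<in>carrier Y. (\<zero>\<^bsub>Y\<^esub>, y))"
  define p1 where "p1 = rcomp ?W (\<lambda>z\<in>carrier ?Z. fst z) (from_copy R ?Z)"
  define p2 where "p2 = rcomp ?W (\<lambda>z\<in>carrier ?Z. snd z) (from_copy R ?Z)"
  have i1: "i1 \<in> rmod_hom R Y ?W" unfolding i1_def
    by (rule rcomp_hom[OF rY _ t], rule rmod_hom_restrictI[OF rY]) auto
  have i2: "i2 \<in> rmod_hom R Y ?W" unfolding i2_def
    by (rule rcomp_hom[OF rY _ t], rule rmod_hom_restrictI[OF rY]) auto
  have p1: "p1 \<in> rmod_hom R ?W Y" unfolding p1_def
    by (rule rcomp_hom[OF rW c], rule rmod_hom_restrictI[OF rZ]) auto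
  have p2: "p2 \<in> rmod_hom R ?W Y" unfolding p2_def
    by (rule rcomp_hom[OF rW c], rule rmod_hom_restrictI[OF rZ]) auto
  have pi: "p1 (i1 y) = y" "p2 (i2 y) = y" "p1 (i2 y) = \<zero>\<^bsub>Y\<^esub>" "p2 (i1 y) = \<zero>\<^bsub>Y\<^esub>" if y: "y \<in> carrier Y" for y
  proof -
    have 1: "i1 y = to_copy R ?Z (y, \<zero>\<^bsub>Y\<^esub>)" "i2 y = to_copy R ?Z (\<zero>\<^bsub>Y\<^esub>, y)"
      using y by (simp_all add: i1_def i2_def compose_eq)
    have m: "(y, \<zero>\<^bsub>Y\<^esub>) \<in> carrier ?Z" "(\<zero>\<^bsub>Y\<^esub>, y) \<in> carrier ?Z" using y by simp_all
    have 2: "p1 z = fst (from_copy R ?Z z)" "p2 z = snd (from_copy R ?Z z)" if "z \<in> carrier ?W" for z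
      unfolding p1_def p2_def compose_eq[OF that] using hom_closed[OF c that] by (simp_all only: restrict_apply')
    note 3 = 2[OF hom_closed[OF i1 y]] 2[OF hom_closed[OF i2 y]]
    show "p1 (i1 y) = y" "p2 (i2 y) = y" "p1 (i2 y) = \<zero>\<^bsub>Y\<^esub>" "p2 (i1 y) = \<zero>\<^bsub>Y\<^esub>"
      unfolding 3 unfolding 1 from_to_copy[OF fpZ m(1)] from_to_copy[OF fpZ m(2)] fst_conv snd_conv by (rule refl)+
  qed
  have joint: "z = z'" if z: "z \<in> carrier ?W" and z': "z' \<in> carrier ?W" and "p1 z = p1 z'" "p2 z = p2 z'" for z z'
  proof -
    have "from_copy R ?Z z = from_copy R ?Z z'"
      using that(3,4) z z' hom_closed[OF c z] hom_closed[OF c z'] by (simp add: p1_def p2_def compose_eq prod_eq_iff)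
    then have "to_copy R ?Z (from_copy R ?Z z) = to_copy R ?Z (from_copy R ?Z z')" by (rule arg_cong)
    then show ?thesis unfolding to_from_copy[OF fpZ z] to_from_copy[OF fpZ z'] .
  qed
  let ?I1 = "\<phi> Y ?W i1" and ?I2 = "\<phi> Y ?W i2" and ?P1 = "\<phi> ?W Y p1" and ?P2 = "\<phi> ?W Y p2"
  note I1 = F_hom[OF Y W i1] and I2 = F_hom[OF Y W i2] and P1 = F_hom[OF W Y p1] and P2 = F_hom[OF W Y p2]
  have e: "rcomp Y p1 i1 = rid Y" "rcomp Y p2 i2 = rid Y" "rcomp Y p1 i2 = hzero Y Y" "rcomp Y p2 i1 = hzero Y Y"
    by (auto simp: compose_def hzero_def fun_eq_iff pi)
  have PI: "?P1 (?I1 y) = y" "?P2 (?I2 y) = y" "?P1 (?I2 y) = \<zero>\<^bsub>F Y\<^esub>" "?P2 (?I1 y) = \<zero>\<^bsub>F Y\<^esub>"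
    if y: "y \<in> carrier (F Y)" for y
    using fun_cong[OF F_comp[OF Y W Y i1 p1], of y] fun_cong[OF F_comp[OF Y W Y i2 p2], of y]
      fun_cong[OF F_comp[OF Y W Y i2 p1], of y] fun_cong[OF F_comp[OF Y W Y i1 p2], of y] y
    by (simp_all add: e F_id[OF Y] F_zero[OF Y Y] compose_eq)
  \<comment> \<open>The endomorphism \<open>I1 P1 + I2 P2\<close> of \<open>F (Y \<oplus> Y)\<close> is the identity: it is compatible with both
    projections, hence so is its preimage \<open>t0\<close>, and the projections are jointly injective.\<close>
  define t where "t = hadd (F ?W) (F ?W) (rcomp (F ?W) ?I1 ?P1) (rcomp (F ?W) ?I2 ?P2)"
  have th: "t \<in> rmod_hom S (F ?W) (F ?W)" unfolding t_def
    by (rule hadd_hom[OF F_rm[OF W] F_rm[OF W] rcomp_hom[OF F_rm[OF W] P1 I1] rcomp_hom[OF F_rm[OF W] P2 I2]])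
  have tx: "t w = ?I1 (?P1 w) \<oplus>\<^bsub>F ?W\<^esub> ?I2 (?P2 w)" if "w \<in> carrier (F ?W)" for w
    using that by (simp add: t_def compose_eq)
  have Pt: "?P1 (t w) = ?P1 w" "?P2 (t w) = ?P2 w" if w: "w \<in> carrier (F ?W)" for w
    using hom_closed[OF P1 w] hom_closed[OF P2 w] hom_closed[OF I1] hom_closed[OF I2]
    by (simp_all add: tx[OF w] hom_add[OF P1] hom_add[OF P2] PI)
  obtain t0 where t0: "t0 \<in> rmod_hom R ?W ?W" "\<phi> ?W ?W t0 = t" using full[OF W W th] by blast
  have "rcomp ?W p1 t0 = p1"
  proof (rule faithful[OF W Y rcomp_hom[OF rW t0(1) p1] p1])
    show "\<phi> ?W Y (rcomp ?W p1 t0) = ?P1"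
      unfolding F_comp[OF W W Y t0(1) p1] t0(2)
      by (rule hom_eqI[OF rcomp_hom[OF F_rm[OF W] th P1] P1]) (simp add: compose_eq Pt)
  qed
  moreover have "rcomp ?W p2 t0 = p2"
  proof (rule faithful[OF W Y rcomp_hom[OF rW t0(1) p2] p2])
    show "\<phi> ?W Y (rcomp ?W p2 t0) = ?P2"
      unfolding F_comp[OF W W Y t0(1) p2] t0(2)
      by (rule hom_eqI[OF rcomp_hom[OF F_rm[OF W] th P2] P2]) (simp add: compose_eq Pt)
  qed
  ultimately have "p1 (t0 w) = p1 w" "p2 (t0 w) = p2 w" if "w \<in> carrier ?W" for w
    using that by (metis compose_eq)+
  then have "t0 = rid ?W"
    by (intro hom_eqI[OF t0(1) rid_hom[OF rW]]) (simp add: joint hom_closed[OF t0(1)])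
  then have "t = rid (F ?W)" using t0(2) F_id[OF W] by simp
  then have tw: "?I1 (?P1 w) \<oplus>\<^bsub>F ?W\<^esub> ?I2 (?P2 w) = w" if "w \<in> carrier (F ?W)" for w
    using tx[OF that] that by simp
  \<comment> \<open>The codiagonal.\<close>
  define s where "s = hadd ?W Y p1 p2"
  have s: "s \<in> rmod_hom R ?W Y" unfolding s_def by (rule hadd_hom[OF rW rY p1 p2])
  have si: "rcomp Y s i1 = rid Y" "rcomp Y s i2 = rid Y"
    by (auto simp: compose_def s_def fun_eq_iff pi hom_closed[OF i1] hom_closed[OF i2])
  have Fsi: "\<phi> ?W Y s (?I1 y) = y" "\<phi> ?W Y s (?I2 y) = y" if y: "y \<in> carrier (F Y)" for y
    using fun_cong[OF F_comp[OF Y W Y i1 s], of y] fun_cong[OF F_comp[OF Y W Y i2 s], of y] y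
    by (simp_all add: si F_id[OF Y] compose_eq)
  have Fs: "\<phi> ?W Y s w = ?P1 w \<oplus>\<^bsub>F Y\<^esub> ?P2 w" if w: "w \<in> carrier (F ?W)" for w
  proof -
    note pw = hom_closed[OF P1 w] hom_closed[OF P2 w]
    have "\<phi> ?W Y s w = \<phi> ?W Y s (?I1 (?P1 w) \<oplus>\<^bsub>F ?W\<^esub> ?I2 (?P2 w))" by (simp only: tw[OF w])
    also have "\<dots> = ?P1 w \<oplus>\<^bsub>F Y\<^esub> ?P2 w"
      by (simp add: hom_add[OF F_hom[OF W Y s]] hom_closed[OF I1] hom_closed[OF I2] pw Fsi)
    finally show ?thesis .
  qed
  define k where "k = hadd X ?W (rcomp X i1 f) (rcomp X i2 g)"
  have k: "k \<in> rmod_hom R X ?W" unfolding k_def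
    by (rule hadd_hom[OF rX rW rcomp_hom[OF rX f i1] rcomp_hom[OF rX g i2]])
  have kx: "k x = i1 (f x) \<oplus>\<^bsub>?W\<^esub> i2 (g x)" if "x \<in> carrier X" for x using that by (simp add: k_def compose_eq)
  have pk: "rcomp X p1 k = f" "rcomp X p2 k = g" "rcomp X s k = hadd X Y f g"
  proof -
    note K = rcomp_hom[OF rX k]
    have 1: "p1 (k x) = f x" "p2 (k x) = g x" if x: "x \<in> carrier X" for x
      using hom_closed[OF f x] hom_closed[OF g x] hom_closed[OF i1] hom_closed[OF i2]
      by (simp_all add: kx[OF x] hom_add[OF p1] hom_add[OF p2] pi)
    show "rcomp X p1 k = f" by (rule hom_eqI[OF K[OF p1] f]) (simp add: compose_eq 1)
    show "rcomp X p2 k = g" by (rule hom_eqI[OF K[OF p2] g]) (simp add: compose_eq 1)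
    show "rcomp X s k = hadd X Y f g"
      by (rule hom_eqI[OF K[OF s] hadd_hom[OF rX rY f g]]) (simp add: compose_eq s_def 1 hom_closed[OF k])
  qed
  have "\<phi> X Y (hadd X Y f g) = rcomp (F X) (\<phi> ?W Y s) (\<phi> X ?W k)"
    using F_comp[OF X W Y k s] pk(3) by simp
  also have "\<dots> = hadd (F X) (F Y) (rcomp (F X) ?P1 (\<phi> X ?W k)) (rcomp (F X) ?P2 (\<phi> X ?W k))"
    by (auto simp: compose_def hadd_def fun_eq_iff Fs hom_closed[OF F_hom[OF X W k]])
  also have "\<dots> = hadd (F X) (F Y) (\<phi> X Y f) (\<phi> X Y g)"
    using F_comp[OF X W Y k p1] F_comp[OF X W Y k p2] pk(1,2) by simp
  finally show ?thesis .
qed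

lemma F_through:
  assumes U: "U \<in> fp_modules R" and V: "V \<in> fp_modules R" and W: "W \<in> fp_modules R"
    and aW: "in_add R (regular_module R) W" and T: "T \<subseteq> rmod_hom R U W" and f: "f \<in> through R U V W T"
  shows "\<phi> V W f \<in> through S (F U) (F V) (F W) (\<phi> U W ` T)"
  using f
proof induction
  case zero
  then show ?case by (simp add: F_zero[OF V W] through.zero)
next
  case (step f a s)
  note rV = fp_modules_rm[OF V] and rW = fp_modules_rm[OF W]
  have f: "f \<in> rmod_hom R V W" by (rule through_hom[OF rV rW T step.hyps(1)])
  have s: "s \<in> rmod_hom R U W" using step.hyps(3) T by blast
  have "\<phi> V W (hadd V W f (rcomp V s a)) = hadd (F V) (F W) (\<phi> V W f) (rcomp (F V) (\<phi> U W s) (\<phi> V U a))"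
    using F_add[OF V W aW f rcomp_hom[OF rV step.hyps(2) s]] F_comp[OF V U W step.hyps(2) s] by simp
  then show ?case
    using through.step[OF step.IH F_hom[OF V U step.hyps(2)] imageI[OF step.hyps(3)]] by simp
qed

lemma F_through_all:
  assumes U: "U \<in> fp_modules R" and V: "V \<in> fp_modules R" and W: "W \<in> fp_modules R"
    and aW: "in_add R (regular_module R) W" and f: "f \<in> through_all R U V W"
  shows "\<phi> V W f \<in> through_all S (F U) (F V) (F W)"
  by (rule through_mono[OF F_through[OF U V W aW subset_refl f]]) (use F_hom[OF U W] in blast)

lemma F_in_add:
  assumes U: "U \<in> fp_modules R" and V: "V \<in> fp_modules R"
    and aV: "in_add R (regular_module R) V" and UV: "in_add R U V"
  shows "in_add S (F U) (F V)"
  using F_through_all[OF U V V aV UV[unfolded in_add_def]] unfolding F_id[OF V] in_add_def .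

text \<open>A family of maps \<open>W' \<rightarrow> F V\<close> corresponds to a family of maps \<open>G W' \<rightarrow> V\<close> by fullness, a test map out
  of \<open>V\<close> to a test map out of \<open>F V\<close>, and a splitting of the family at \<open>V\<close> to one at \<open>F V\<close>.\<close>

lemma F_split:
  assumes C: "\<C> \<subseteq> fp_modules R" and D: "\<D> \<subseteq> fp_modules S"
    and FC: "\<And>W. W \<in> \<C> \<Longrightarrow> F W \<in> \<D>" and GD: "\<And>W. W \<in> \<D> \<Longrightarrow> G W \<in> \<C>"
    and V: "V \<in> fp_modules R" and aV: "in_add R (regular_module R) V" and sp: "split_wrt R \<C> V"
  shows "split_wrt S \<D> (F V)"
  unfolding split_wrt_def
proof (intro ballI allI impI)
  interpret W: mod_equiv S R G \<psi> F \<phi> by (rule swap)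
  fix W' S' assume W': "W' \<in> \<D>" and fin: "finite S'" and S': "S' \<subseteq> rmod_hom S W' (F V)"
    and epi: "\<forall>W1\<in>\<D>. \<forall>g\<in>rmod_hom S (F V) W1. (\<forall>s\<in>S'. rcomp W' g s = hzero W' W1) \<longrightarrow> g = hzero (F V) W1"
  have W'f: "W' \<in> fp_modules S" using W' D by blast
  note rW' = fp_modules_rm[OF W'f] and rV = fp_modules_rm[OF V]
  let ?W = "G W'"
  have W: "?W \<in> fp_modules R" by (rule G_ob[OF W'f])
  note FW = F_rm[OF W] and FV = F_rm[OF V]
  obtain u' u where u': "u' \<in> rmod_hom S W' (F ?W)" and u: "u \<in> rmod_hom S (F ?W) W'"
    and "\<And>x. x \<in> carrier W' \<Longrightarrow> u (u' x) = x" and "\<And>y. y \<in> carrier (F ?W) \<Longrightarrow> u' (u y) = y"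
    using rW' W.iso_X_GFX[OF W'f] by (rule rmod_isoE) blast
  note uu' = this(3)
  have "\<exists>s. s \<in> rmod_hom R ?W V \<and> \<phi> ?W V s = rcomp (F ?W) s' u" if "s' \<in> S'" for s'
    using full[OF W V rcomp_hom[OF FW u]] S' that by blast
  then obtain \<sigma> where \<sigma>: "\<And>s'. s' \<in> S' \<Longrightarrow> \<sigma> s' \<in> rmod_hom R ?W V"
    "\<And>s'. s' \<in> S' \<Longrightarrow> \<phi> ?W V (\<sigma> s') = rcomp (F ?W) s' u" by metis
  have 1: "rid V \<in> through R ?W V V (\<sigma> ` S')"
  proof (rule split_wrtD[OF sp GD[OF W']])
    show "finite (\<sigma> ` S')" using fin by simp
    show "\<sigma> ` S' \<subseteq> rmod_hom R ?W V" using \<sigma>(1) by blast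
    fix W1 g assume W1: "W1 \<in> \<C>" and g: "g \<in> rmod_hom R V W1"
      and z: "\<And>s. s \<in> \<sigma> ` S' \<Longrightarrow> rcomp ?W g s = hzero ?W W1"
    have W1f: "W1 \<in> fp_modules R" using W1 C by blast
    note Fg = F_hom[OF V W1f g]
    have "rcomp W' (\<phi> V W1 g) s' = hzero W' (F W1)" if s': "s' \<in> S'" for s'
    proof (rule hom_eqI)
      have sh: "s' \<in> rmod_hom S W' (F V)" using s' S' by blast
      show "rcomp W' (\<phi> V W1 g) s' \<in> rmod_hom S W' (F W1)" by (rule rcomp_hom[OF rW' sh Fg])
      show "hzero W' (F W1) \<in> rmod_hom S W' (F W1)" by (rule hzero_hom[OF rW' F_rm[OF W1f]])
      fix x assume x: "x \<in> carrier W'"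
      have "rcomp (F ?W) (\<phi> V W1 g) (rcomp (F ?W) s' u) = hzero (F ?W) (F W1)"
        using F_comp[OF W V W1f \<sigma>(1)[OF s'] g] \<sigma>(2)[OF s'] z[of "\<sigma> s'"] s' F_zero[OF W W1f] by simp
      from fun_cong[OF this, of "u' x"] show "rcomp W' (\<phi> V W1 g) s' x = hzero W' (F W1) x"
        using hom_closed[OF u' x] x by (simp add: compose_eq uu')
    qed
    then have "\<phi> V W1 g = hzero (F V) (F W1)" using epi FC[OF W1] Fg by blast
    then have "\<phi> V W1 g = \<phi> V W1 (hzero V W1)" by (simp add: F_zero[OF V W1f])
    then show "g = hzero V W1" by (rule faithful[OF V W1f g hzero_hom[OF rV fp_modules_rm[OF W1f]]])
  qed
  have \<sigma>S: "\<sigma> ` S' \<subseteq> rmod_hom R ?W V" using \<sigma>(1) by blast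
  have 2: "rid (F V) \<in> through S (F ?W) (F V) (F V) (\<phi> ?W V ` \<sigma> ` S')"
    using F_through[OF W V V aV \<sigma>S 1] by (simp only: F_id[OF V])
  \<comment> \<open>The members of the transported family factor through those of \<open>S'\<close> by the isomorphism
    between \<open>F (G W')\<close> and \<open>W'\<close>.\<close>
  have "rcomp (F V) (rid (F V)) (rcomp (F V) (rid (F V)) (rid (F V))) \<in> through S W' (F V) (F V) S'"
  proof (rule through_comp[OF FV FV FV FV _ rid_hom[OF FV] rid_hom[OF FV] _ _ _ _ 2])
    show "\<phi> ?W V ` \<sigma> ` S' \<subseteq> rmod_hom S (F ?W) (F V)" using \<sigma>(1) F_hom[OF W V] by blast
    show "through S W' (F V) (F V) S' \<subseteq> rmod_hom S (F V) (F V)" using through_hom[OF FV FV S'] by blast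
    show "hzero (F V) (F V) \<in> through S W' (F V) (F V) S'" by (rule through.zero)
    show "hadd (F V) (F V) f g \<in> through S W' (F V) (F V) S'"
      if "f \<in> through S W' (F V) (F V) S'" "g \<in> through S W' (F V) (F V) S'" for f g
      by (rule through_add[OF FV FV S' that])
    fix a r assume a: "a \<in> rmod_hom S (F V) (F ?W)" and "r \<in> \<phi> ?W V ` \<sigma> ` S'"
    then obtain s' where s': "s' \<in> S'" "r = rcomp (F ?W) s' u" using \<sigma>(2) by auto
    have sh: "s' \<in> rmod_hom S W' (F V)" using s' S' by blast
    have "rcomp (F V) (rid (F V)) (rcomp (F V) (rcomp (F V) r a) (rid (F V))) = rcomp (F V) s' (rcomp (F V) u a)"
      using hom_closed[OF a] hom_closed[OF u] hom_closed[OF sh] by (auto simp: s'(2) compose_def fun_eq_iff)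
    then show "rcomp (F V) (rid (F V)) (rcomp (F V) (rcomp (F V) r a) (rid (F V))) \<in> through S W' (F V) (F V) S'"
      using through_single[OF FV FV S' rcomp_hom[OF FV a u] s'(1)] by simp
  qed
  then show "rid (F V) \<in> through S W' (F V) (F V) S'" by (simp only: rcomp_rid[OF rid_hom[OF FV]])
qed

text \<open>The regular module satisfies the splitting criterion relative to all finitely presented
  modules, hence so does its image, which is therefore finitely generated projective.\<close>

lemma F_regular_in_add: "in_add S (regular_module S) (F (regular_copy R))"
proof -
  note M = regular_right_module[OF R.ring_axioms] and c = regular_copy[OF R.ring_axioms]
  have "split_wrt R (fp_modules R) (regular_copy R)"
    by (rule split_wrt_iso[OF subset_refl M c(2) fp_copy_iso[OF regular_fp[OF R.ring_axioms]]
      split_wrt_regular[OF R.ring_axioms]])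
  then have "split_wrt S (fp_modules S) (F (regular_copy R))"
    by (rule F_split[OF subset_refl subset_refl _ _ c(1,3), rotated -1]) (erule F_ob, erule G_ob)
  then show ?thesis by (rule split_wrt_all_in_add[OF S.ring_axioms F_ob[OF c(1)]])
qed

lemma F_in_add_regular:
  assumes X: "X \<in> fp_modules R" and a: "in_add R (regular_module R) X"
  shows "in_add S (regular_module S) (F X)"
proof -
  note M = regular_right_module[OF R.ring_axioms] and c = regular_copy[OF R.ring_axioms]
  note MS = regular_right_module[OF S.ring_axioms]
  have "in_add R (regular_copy R) X" by (rule in_add_trans[OF c(2) M fp_modules_rm[OF X] c(4) a])
  then have "in_add S (F (regular_copy R)) (F X)" by (rule F_in_add[OF c(1) X a])
  then show ?thesis by (rule in_add_trans[OF MS F_rm[OF c(1)] F_rm[OF X] F_regular_in_add])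
qed

text \<open>A sum of maps through \<open>F U\<close> is carried by \<open>G\<close> to one through \<open>G (F U)\<close>, which is isomorphic to \<open>U\<close>.
  The functor \<open>G\<close> is additive on these maps because \<open>F V\<close> is again finitely generated projective.\<close>

lemma F_through_all_iff:
  assumes U: "U \<in> fp_modules R" and V: "V \<in> fp_modules R"
    and aV: "in_add R (regular_module R) V" and f: "f \<in> rmod_hom R V V"
  shows "\<phi> V V f \<in> through_all S (F U) (F V) (F V) \<longleftrightarrow> f \<in> through_all R U V V"
proof
  interpret W: mod_equiv S R G \<psi> F \<phi> by (rule swap)
  note rU = fp_modules_rm[OF U] and rV = fp_modules_rm[OF V]
  note GU = W.F_rm[OF F_ob[OF U]] and GV = W.F_rm[OF F_ob[OF V]]
  assume "\<phi> V V f \<in> through_all S (F U) (F V) (F V)"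
  then have 1: "\<psi> (F V) (F V) (\<phi> V V f) \<in> through_all R (G (F U)) (G (F V)) (G (F V))"
    by (rule W.F_through_all[OF F_ob[OF U] F_ob[OF V] F_ob[OF V] F_in_add_regular[OF V aV]])
  obtain \<eta> \<theta> where \<eta>: "\<And>X. X \<in> fp_modules R \<Longrightarrow> \<eta> X \<in> rmod_hom R X (G (F X))"
    and \<theta>: "\<And>X. X \<in> fp_modules R \<Longrightarrow> \<theta> X \<in> rmod_hom R (G (F X)) X"
    and \<theta>\<eta>: "\<And>X x. \<lbrakk>X \<in> fp_modules R; x \<in> carrier X\<rbrakk> \<Longrightarrow> \<theta> X (\<eta> X x) = x"
    and nat: "\<And>X Y f x. \<lbrakk>X \<in> fp_modules R; Y \<in> fp_modules R; f \<in> rmod_hom R X Y; x \<in> carrier X\<rbrakk> \<Longrightarrow>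
      \<eta> Y (f x) = \<psi> (F X) (F Y) (\<phi> X Y f) (\<eta> X x)"
    by (rule unit_data) blast
  let ?k = "rcomp V (\<theta> V) (rcomp V (\<psi> (F V) (F V) (\<phi> V V f)) (\<eta> V))"
  have k: "?k \<in> through_all R (G (F U)) V V"
    by (rule through_all_conj[OF GU GV GV rV rV \<eta>[OF V] \<theta>[OF V] 1])
  have "?k = f"
    by (rule hom_eqI[OF through_hom[OF rV rV subset_refl k] f])
      (simp add: compose_eq nat[OF V V f, symmetric] \<theta>\<eta>[OF V] hom_closed[OF f])
  then have "f \<in> through_all R (G (F U)) V V" using k by simp
  then show "f \<in> through_all R U V V"
    by (rule through_change[OF GU rV rV rU in_add_iso(1)[OF rU GU iso_X_GFX[OF U]]])
qed (rule F_through_all[OF U V V aV])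

lemma F_ring_iso:
  assumes V: "V \<in> fp_modules R" and aV: "in_add R (regular_module R) V"
  shows "\<phi> V V \<in> ring_iso (End_ring R V) (End_ring S (F V))"
proof (rule ring_iso_memI)
  have "inj_on (\<phi> V V) (rmod_hom R V V)" by (rule inj_onI) (rule faithful[OF V V])
  moreover have "\<phi> V V ` rmod_hom R V V = rmod_hom S (F V) (F V)"
    using full[OF V V] F_hom[OF V V] by blast
  ultimately show "bij_betw (\<phi> V V) (carrier (End_ring R V)) (carrier (End_ring S (F V)))"
    by (simp add: bij_betw_def)
qed (use F_hom[OF V V] F_comp[OF V V V] F_add[OF V V aV] F_id[OF V] in simp_all)

end

lemma morita_equivalent_imp_mod_equiv:
  assumes R: "ring R" and S: "ring S" and m: "morita_equivalent R S"
  obtains F \<phi> G \<psi> where "mod_equiv R S F \<phi> G \<psi>"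
proof -
  obtain F \<phi> G \<psi> where F: "is_functor (mod_category R) (mod_category S) F \<phi>"
    and G: "is_functor (mod_category S) (mod_category R) G \<psi>"
    and 1: "naturally_isomorphic (mod_category R) (mod_category R) (\<lambda>X. X) (\<lambda>X Y f. f)
      (\<lambda>X. G (F X)) (\<lambda>X Y f. \<psi> (F X) (F Y) (\<phi> X Y f))"
    and 2: "naturally_isomorphic (mod_category S) (mod_category S) (\<lambda>X. F (G X))
      (\<lambda>X Y f. \<phi> (G X) (G Y) (\<psi> X Y f)) (\<lambda>X. X) (\<lambda>X Y f. f)"
    using m unfolding morita_equivalent_def equivalent_categories_def by blast
  have "mod_equiv R S F \<phi> G \<psi>"
    by (intro mod_equiv.intro mod_equiv_axioms.intro R S F G 1
      naturally_isomorphic_sym[OF is_category_mod_category is_functor_comp[OF G F] is_functor_id 2])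
  then show thesis by (rule that)
qed

section \<open>The dual of an artin algebra is a cogenerator\<close>

text \<open>Zorn's lemma for the ideals that contain \<open>I\<close> and omit \<open>1\<close>.\<close>

lemma (in ring) exists_maximalideal:
  assumes I: "ideal I R" and proper: "I \<noteq> carrier R"
  shows "\<exists>m. maximalideal m R \<and> I \<subseteq> m"
proof -
  define A where "A = {J. ideal J R \<and> I \<subseteq> J \<and> \<one> \<notin> J}"
  have one: "\<one> \<notin> J \<longleftrightarrow> J \<noteq> carrier R" if "ideal J R" for J
    using that ideal.one_imp_carrier one_closed by metis
  have "\<exists>M\<in>A. \<forall>X\<in>A. M \<subseteq> X \<longrightarrow> X = M"
  proof (rule subset_Zorn_nonempty)
    show "A \<noteq> {}" using I proper one[OF I] by (auto simp: A_def)
    fix C assume C: "C \<noteq> {}" "subset.chain A C"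
    have CA: "\<And>J. J \<in> C \<Longrightarrow> J \<in> A" using C(2) by (auto simp: subset.chain_def)
    have Ci: "\<And>J. J \<in> C \<Longrightarrow> ideal J R" using CA by (simp add: A_def)
    have tot: "J \<subseteq> K \<or> K \<subseteq> J" if "J \<in> C" "K \<in> C" for J K
      using C(2) that by (auto simp: subset_chain_def)
    have "ideal (\<Union>C) R"
    proof (rule idealI[OF ring_axioms])
      show "subgroup (\<Union>C) (add_monoid R)"
      proof (rule subgroup.intro)
        show "\<Union>C \<subseteq> carrier (add_monoid R)"
          using ideal.Icarr[OF Ci] by auto
        show "\<one>\<^bsub>add_monoid R\<^esub> \<in> \<Union>C"
          using C(1) additive_subgroup.zero_closed[OF ideal.axioms(1)[OF Ci]] by auto
        show "inv\<^bsub>add_monoid R\<^esub> x \<in> \<Union>C" if "x \<in> \<Union>C" for x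
          using that additive_subgroup.a_inv_closed[OF ideal.axioms(1)[OF Ci]] by (auto simp: a_inv_def)
        fix x y assume "x \<in> \<Union>C" "y \<in> \<Union>C"
        then obtain J K where JK: "J \<in> C" "x \<in> J" "K \<in> C" "y \<in> K" by blast
        show "x \<otimes>\<^bsub>add_monoid R\<^esub> y \<in> \<Union>C"
          using tot[OF JK(1,3)]
        proof
          assume "J \<subseteq> K"
          then have "x \<oplus> y \<in> K"
            using JK additive_subgroup.a_closed[OF ideal.axioms(1)[OF Ci[OF JK(3)]]] by blast
          then show ?thesis using JK(3) by auto
        next
          assume "K \<subseteq> J"
          then have "x \<oplus> y \<in> J"
            using JK additive_subgroup.a_closed[OF ideal.axioms(1)[OF Ci[OF JK(1)]]] by blast
          then show ?thesis using JK(1) by auto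
        qed
      qed
      show "x \<otimes> a \<in> \<Union>C" "a \<otimes> x \<in> \<Union>C" if "a \<in> \<Union>C" "x \<in> carrier R" for a x
        using that ideal.I_l_closed[OF Ci] ideal.I_r_closed[OF Ci] by blast+
    qed
    then show "\<Union>C \<in> A" using C(1) CA by (auto simp: A_def)
  qed
  then obtain m where m: "m \<in> A" and max: "\<And>X. X \<in> A \<Longrightarrow> m \<subseteq> X \<Longrightarrow> X = m" by blast
  have mi: "ideal m R" using m by (simp add: A_def)
  have "maximalideal m R"
  proof (rule maximalidealI[OF mi])
    show "carrier R \<noteq> m" using m one[OF mi] by (auto simp: A_def)
    fix J assume J: "ideal J R" "m \<subseteq> J" "J \<subseteq> carrier R"
    show "J = m \<or> J = carrier R"
    proof (cases "\<one> \<in> J")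
      case True then show ?thesis using one[OF J(1)] by blast
    next
      case False
      then have "J \<in> A" using J m by (auto simp: A_def)
      then show ?thesis using max J(2) by blast
    qed
  qed
  then show ?thesis using m by (auto simp: A_def)
qed

text \<open>\<open>R/m\<close> embeds in \<open>R/rad R\<close>: an ideal minimal among those not contained in \<open>m\<close> lies in every
  other maximal ideal, because \<open>m\<close> is prime.\<close>

lemma artinian_cring_annihilator_mod_radical:
  assumes R: "artinian_cring R" and m: "maximalideal m R"
  shows "\<exists>u\<in>carrier R. u \<notin> jacobson_radical R \<and> (\<forall>x\<in>m. u \<otimes>\<^bsub>R\<^esub> x \<in> jacobson_radical R)"
proof -
  interpret cring R using R by (simp add: artinian_cring_def)
  interpret m: maximalideal m R by fact
  interpret p: primeideal m R by (rule maximalideal_prime[OF m])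
  define A where "A = {J. ideal J R \<and> \<not> J \<subseteq> m}"
  have "\<exists>J\<in>A. \<forall>K\<in>A. K \<subseteq> J \<longrightarrow> K = J"
  proof (rule ccontr)
    assume "\<not> (\<exists>J\<in>A. \<forall>K\<in>A. K \<subseteq> J \<longrightarrow> K = J)"
    then have "\<forall>J\<in>A. \<exists>K\<in>A. K \<subset> J" by blast
    then obtain g where g: "\<And>J. J \<in> A \<Longrightarrow> g J \<in> A" "\<And>J. J \<in> A \<Longrightarrow> g J \<subset> J" by metis
    define c where "c n = (g ^^ n) (carrier R)" for n
    have "carrier R \<in> A" using oneideal m.I_notcarr m.a_subset by (auto simp: A_def)
    then have cA: "c n \<in> A" for n by (induction n) (simp_all add: c_def g(1))
    have cs: "c (Suc n) \<subset> c n" for n using g(2)[OF cA[of n]] by (simp add: c_def)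
    have dcc: "\<forall>I. (\<forall>n. ideal (I n) R \<and> I (Suc n) \<subseteq> I n) \<longrightarrow> (\<exists>n. \<forall>k\<ge>n. I k = I n)"
      using R by (simp add: artinian_cring_def)
    have "\<forall>n. ideal (c n) R \<and> c (Suc n) \<subseteq> c n" using cA cs by (auto simp: A_def)
    from dcc[THEN spec, of c, THEN mp, OF this] obtain n where "\<forall>k\<ge>n. c k = c n" by (rule exE)
    then have "n \<le> Suc n \<longrightarrow> c (Suc n) = c n" by (rule spec)
    then have "c (Suc n) = c n" by (rule mp) (rule le_SucI, rule order_refl)
    then show False using cs[of n] by blast
  qed
  then obtain J where J: "J \<in> A" and min: "\<And>K. K \<in> A \<Longrightarrow> K \<subseteq> J \<Longrightarrow> K = J" by blast
  interpret J: ideal J R using J by (simp add: A_def)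
  obtain u where u: "u \<in> J" "u \<notin> m" using J by (auto simp: A_def)
  have uR: "u \<in> carrier R" by (rule J.Icarr[OF u(1)])
  have sub: "J \<subseteq> m'" if m': "maximalideal m' R" "m' \<noteq> m" for m'
  proof -
    interpret m': maximalideal m' R by fact
    have "\<not> m' \<subseteq> m"
      using m'.I_maximal[OF m.ideal_axioms _ m.a_subset] m'(2) m.I_notcarr by blast
    then obtain b where b: "b \<in> m'" "b \<notin> m" by blast
    have bR: "b \<in> carrier R" by (rule m'.Icarr[OF b(1)])
    have "u \<otimes>\<^bsub>R\<^esub> b \<in> J \<inter> m'" using J.I_r_closed[OF u(1) bR] m'.I_l_closed[OF b(1) uR] by blast
    moreover have "u \<otimes>\<^bsub>R\<^esub> b \<notin> m" using p.I_prime[OF uR bR] u(2) b(2) by blast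
    ultimately have "J \<inter> m' \<in> A" using i_intersect[OF J.ideal_axioms m'.ideal_axioms] by (auto simp: A_def)
    then have "J \<inter> m' = J" by (rule min) blast
    then show ?thesis by blast
  qed
  have "u \<notin> jacobson_radical R" using u(2) m by (auto simp: jacobson_radical_def)
  moreover have "u \<otimes>\<^bsub>R\<^esub> x \<in> jacobson_radical R" if x: "x \<in> m" for x
  proof -
    have xR: "x \<in> carrier R" by (rule m.Icarr[OF x])
    have "u \<otimes>\<^bsub>R\<^esub> x \<in> m'" if "maximalideal m' R" for m'
    proof (cases "m' = m")
      case True then show ?thesis using m.I_l_closed[OF x uR] by simp
    next
      case False
      then show ?thesis using sub[OF that] J.I_r_closed[OF u(1) xR] by blast
    qed
    then show ?thesis using uR xR by (simp add: jacobson_radical_def)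
  qed
  ultimately show ?thesis using uR by blast
qed

lemma ideal_jacobson_radical:
  assumes "ring R" "maximalideal m R" shows "ideal (jacobson_radical R) R"
proof -
  interpret ring R by fact
  have "ideal (\<Inter>{I. maximalideal I R}) R"
    by (rule i_Intersect) (use assms(2) maximalideal.axioms(1) in auto)
  moreover have "jacobson_radical R = \<Inter>{I. maximalideal I R}"
    using ideal.Icarr[OF maximalideal.axioms(1)[OF assms(2)]] assms(2) by (auto simp: jacobson_radical_def)
  ultimately show ?thesis by simp
qed

text \<open>Adjoin the generators of \<open>M\<close> to \<open>N\<close> one at a time: at the last proper submodule reached, a single
  further generator \<open>s\<close> suffices.\<close>

lemma fg_proper_submodule_cyclic_quotient:
  assumes M: "right_module R M" and fg: "fg_submodule R M (carrier M)"
    and N: "submodule N R M" "N \<noteq> carrier M"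
  obtains N' s where "submodule N' R M" "N \<subseteq> N'" "s \<in> carrier M" "s \<notin> N'"
    "\<And>x. x \<in> carrier M \<Longrightarrow> \<exists>r\<in>carrier R. x \<ominus>\<^bsub>M\<^esub> r \<odot>\<^bsub>M\<^esub> s \<in> N'"
proof -
  interpret M: right_module R M by fact
  obtain S where S: "finite S" "S \<subseteq> carrier M" "\<And>H. submodule H R M \<Longrightarrow> S \<subseteq> H \<Longrightarrow> carrier M \<subseteq> H"
    using fg unfolding fg_whole[OF M] by blast
  have "\<exists>N' s. submodule N' R M \<and> N \<subseteq> N' \<and> s \<in> carrier M \<and> s \<notin> N' \<and>
      (\<forall>x\<in>carrier M. \<exists>r\<in>carrier R. x \<ominus>\<^bsub>M\<^esub> r \<odot>\<^bsub>M\<^esub> s \<in> N')"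
    if "finite S" "S \<subseteq> carrier M" "submodule N R M" "N \<noteq> carrier M"
      "\<forall>H. submodule H R M \<longrightarrow> N \<union> S \<subseteq> H \<longrightarrow> carrier M \<subseteq> H" for N S
    using that
  proof (induction S arbitrary: N rule: finite_induct)
    case empty
    then show ?case using M.rsubmoduleD(1)[OF empty(2)] by blast
  next
    case (insert s S)
    note ND = M.rsubmoduleD[OF insert.prems(2)]
    have s: "s \<in> carrier M" using insert.prems(1) by blast
    define N1 where "N1 = {n \<oplus>\<^bsub>M\<^esub> r \<odot>\<^bsub>M\<^esub> s | n r. n \<in> N \<and> r \<in> carrier R}"
    have n: "n \<in> carrier M" if "n \<in> N" for n using that ND(1) by blast
    have N1: "submodule N1 R M"
    proof (rule M.rsubmoduleI)
      show "N1 \<subseteq> carrier M" using n s by (auto simp: N1_def)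
      have "\<zero>\<^bsub>M\<^esub> = \<zero>\<^bsub>M\<^esub> \<oplus>\<^bsub>M\<^esub> \<zero>\<^bsub>R\<^esub> \<odot>\<^bsub>M\<^esub> s" using s by simp
      then show "\<zero>\<^bsub>M\<^esub> \<in> N1" unfolding N1_def using ND(2) by blast
      fix x y a assume "x \<in> N1"
      then obtain n1 r1 where x: "n1 \<in> N" "r1 \<in> carrier R" "x = n1 \<oplus>\<^bsub>M\<^esub> r1 \<odot>\<^bsub>M\<^esub> s" by (auto simp: N1_def)
      { assume "y \<in> N1"
        then obtain n2 r2 where y: "n2 \<in> N" "r2 \<in> carrier R" "y = n2 \<oplus>\<^bsub>M\<^esub> r2 \<odot>\<^bsub>M\<^esub> s" by (auto simp: N1_def)
        have "x \<oplus>\<^bsub>M\<^esub> y = (n1 \<oplus>\<^bsub>M\<^esub> n2) \<oplus>\<^bsub>M\<^esub> (r1 \<oplus>\<^bsub>R\<^esub> r2) \<odot>\<^bsub>M\<^esub> s"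
          using x y n s by (simp add: M.smult_l_distr M.M.a_ac)
        then show "x \<oplus>\<^bsub>M\<^esub> y \<in> N1" unfolding N1_def using ND(3)[OF x(1) y(1)] x(2) y(2) by blast }
      assume a: "a \<in> carrier R"
      have "a \<odot>\<^bsub>M\<^esub> x = a \<odot>\<^bsub>M\<^esub> n1 \<oplus>\<^bsub>M\<^esub> (r1 \<otimes>\<^bsub>R\<^esub> a) \<odot>\<^bsub>M\<^esub> s"
        using x n s a by (simp add: M.smult_r_distr M.smult_assoc)
      then show "a \<odot>\<^bsub>M\<^esub> x \<in> N1" unfolding N1_def using ND(4)[OF a x(1)] x(2) a by blast
    qed
    have NN1: "N \<subseteq> N1"
    proof
      fix x assume x: "x \<in> N"
      have "x = x \<oplus>\<^bsub>M\<^esub> \<zero>\<^bsub>R\<^esub> \<odot>\<^bsub>M\<^esub> s" using n[OF x] s by simp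
      then show "x \<in> N1" unfolding N1_def using x by blast
    qed
    have "s = \<zero>\<^bsub>M\<^esub> \<oplus>\<^bsub>M\<^esub> \<one>\<^bsub>R\<^esub> \<odot>\<^bsub>M\<^esub> s" using s by simp
    then have sN1: "s \<in> N1" unfolding N1_def using ND(2) by blast
    show ?case
    proof (cases "N1 = carrier M")
      case True
      have "N1 \<subseteq> N" if "s \<in> N" using ND(3,4) that by (auto simp: N1_def)
      then have "s \<notin> N" using True NN1 insert.prems(3) by blast
      moreover have "\<exists>r\<in>carrier R. x \<ominus>\<^bsub>M\<^esub> r \<odot>\<^bsub>M\<^esub> s \<in> N" if "x \<in> carrier M" for x
      proof -
        have "x \<in> N1" using that by (simp only: True)
        then obtain n1 r1 where x: "n1 \<in> N" "r1 \<in> carrier R" "x = n1 \<oplus>\<^bsub>M\<^esub> r1 \<odot>\<^bsub>M\<^esub> s"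
          by (auto simp: N1_def)
        have "x \<ominus>\<^bsub>M\<^esub> r1 \<odot>\<^bsub>M\<^esub> s = n1"
          using x n s by (simp add: a_minus_def M.M.a_assoc M.M.r_neg)
        then show ?thesis using x by blast
      qed
      ultimately show ?thesis using insert.prems(2) s by blast
    next
      case False
      have "\<exists>N' s. submodule N' R M \<and> N1 \<subseteq> N' \<and> s \<in> carrier M \<and> s \<notin> N' \<and>
        (\<forall>x\<in>carrier M. \<exists>r\<in>carrier R. x \<ominus>\<^bsub>M\<^esub> r \<odot>\<^bsub>M\<^esub> s \<in> N')"
        by (rule insert.IH[OF _ N1 False]) (use insert.prems(1,4) NN1 sN1 in blast)+
      then show ?thesis using NN1 by blast
    qed
  qed
  from this[OF S(1,2) N] S(3) that show thesis by blast
qed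

lemma artin_algebra_right_module:
  assumes "artin_algebra R L" shows "right_module R L"
proof -
  interpret artin_algebra R L by fact
  show ?thesis using module_iff_right_module[of R L] module_axioms R.is_cring by blast
qed

lemma artin_algebra_left_action:
  assumes "artin_algebra R L" shows "left_action R L L (mult L)"
proof -
  interpret artin_algebra R L by fact
  show ?thesis
    by (rule left_action.intro[OF artin_algebra_right_module[OF assms] L.ring_axioms],
      rule left_action_axioms.intro)
      (simp_all add: L.r_distr L.l_distr L.m_assoc smult_mult_right)
qed

lemma dual_regular_eq: "dual_regular R L E = hom_mod R (mult L) L E"
  by (simp add: dual_regular_def hom_mod_def hzero_def hadd_def fun_eq_iff)

lemma dual_regular_right_module:
  assumes "artin_algebra R L" "right_module R E" shows "right_module L (dual_regular R L E)"
  unfolding dual_regular_eq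
  by (rule left_action.hom_mod_right_module[OF artin_algebra_left_action[OF assms(1)] assms(2)])

text \<open>A proper right ideal \<open>N\<close> of \<open>L\<close> is killed by a nonzero functional \<open>L \<rightarrow> E\<close>: as an \<open>R\<close>-module
  \<open>L/N\<close> is finitely generated, so it has a simple quotient \<open>R/m\<close>, and \<open>R/m\<close> embeds in
  \<open>R/rad R\<close>, hence in \<open>E\<close>.\<close>

lemma artin_algebra_separating_functional:
  assumes LR: "artin_algebra R L" and E: "injective_envelope R (quot_module R (jacobson_radical R)) E"
    and N: "submodule N L (regular_module L)" "N \<noteq> carrier L"
  obtains \<eta> x where "\<eta> \<in> rmod_hom R L E" "\<And>n. n \<in> N \<Longrightarrow> \<eta> n = \<zero>\<^bsub>E\<^esub>" "x \<in> carrier L" "\<eta> x \<noteq> \<zero>\<^bsub>E\<^esub>"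
proof -
  interpret LR: artin_algebra R L by fact
  have rL: "right_module R L" by (rule artin_algebra_right_module[OF LR])
  interpret rL: right_module R L by (rule rL)
  interpret reg: right_module L "regular_module L" by (rule regular_right_module[OF LR.L.ring_axioms])
  have R: "artinian_cring R" by (rule LR.artinian)
  note ND = reg.rsubmoduleD[OF N(1), simplified]
  have NR: "submodule N R L"
  proof (rule rL.rsubmoduleI[OF ND(1,2,3)])
    fix r n assume r: "r \<in> carrier R" and n: "n \<in> N"
    have nL: "n \<in> carrier L" using n ND(1) by blast
    have "r \<odot>\<^bsub>L\<^esub> n = n \<otimes>\<^bsub>L\<^esub> (r \<odot>\<^bsub>L\<^esub> \<one>\<^bsub>L\<^esub>)" using LR.smult_mult_right[OF r nL LR.L.one_closed] nL r by simp
    then show "r \<odot>\<^bsub>L\<^esub> n \<in> N" using ND(4)[of "r \<odot>\<^bsub>L\<^esub> \<one>\<^bsub>L\<^esub>" n] n r by simp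
  qed
  obtain N' s where N': "submodule N' R L" "N \<subseteq> N'" and s: "s \<in> carrier L" "s \<notin> N'"
    and gen: "\<And>x. x \<in> carrier L \<Longrightarrow> \<exists>r\<in>carrier R. x \<ominus>\<^bsub>L\<^esub> r \<odot>\<^bsub>L\<^esub> s \<in> N'"
    by (rule fg_proper_submodule_cyclic_quotient[OF rL LR.finitely_generated NR N(2)]) blast
  note N'D = rL.rsubmoduleD[OF N'(1)]
  \<comment> \<open>The quotient \<open>L/N'\<close> is generated by \<open>s\<close>, so it is \<open>R/I\<close>.\<close>
  define I where "I = {r \<in> carrier R. r \<odot>\<^bsub>L\<^esub> s \<in> N'}"
  have sneg: "(\<ominus>\<^bsub>R\<^esub> r) \<odot>\<^bsub>L\<^esub> s = \<ominus>\<^bsub>L\<^esub> (r \<odot>\<^bsub>L\<^esub> s)" if "r \<in> carrier R" for r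
    using LR.smult_l_minus[OF that s(1)] .
  have I: "ideal I R"
  proof (rule idealI[OF LR.R.ring_axioms])
    show "subgroup I (add_monoid R)"
      by (rule subgroup.intro)
        (use s(1) N'D(2,3,5) in \<open>auto simp: I_def rL.smult_l_distr a_inv_def[symmetric] sneg\<close>)
    show "x \<otimes>\<^bsub>R\<^esub> a \<in> I" "a \<otimes>\<^bsub>R\<^esub> x \<in> I" if "a \<in> I" "x \<in> carrier R" for a x
      using that s(1) N'D(4)[of x "a \<odot>\<^bsub>L\<^esub> s"] LR.R.m_comm[of x a] by (simp_all add: I_def rL.smult_assoc)
  qed
  have "\<one>\<^bsub>R\<^esub> \<notin> I" using s by (simp add: I_def)
  then have "I \<noteq> carrier R" by blast
  then obtain m where m: "maximalideal m R" "I \<subseteq> m" using LR.R.exists_maximalideal[OF I] by blast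
  obtain u where u: "u \<in> carrier R" "u \<notin> jacobson_radical R"
    and um: "\<And>x. x \<in> m \<Longrightarrow> u \<otimes>\<^bsub>R\<^esub> x \<in> jacobson_radical R"
    using artinian_cring_annihilator_mod_radical[OF R m(1)] by blast
  let ?J = "jacobson_radical R"
  have J: "ideal ?J R" by (rule ideal_jacobson_radical[OF LR.R.ring_axioms m(1)])
  note Q = Quot_simps[OF J]
  let ?q = "quot_module R ?J"
  have q: "right_module R ?q" and rE: "right_module R E"
    using E by (simp_all add: injective_envelope_def injective_module_def)
  obtain i where i: "i \<in> rmod_hom R ?q E" and inj: "inj_on i (carrier ?q)"
    using E unfolding injective_envelope_def by blast
  interpret rE: right_module R E by (rule rE)
  have qs: "carrier ?q = carrier (R Quot ?J)" "\<zero>\<^bsub>?q\<^esub> = \<zero>\<^bsub>R Quot ?J\<^esub>"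
    "\<And>x y. x \<oplus>\<^bsub>?q\<^esub> y = x \<oplus>\<^bsub>R Quot ?J\<^esub> y" "\<And>r x. r \<odot>\<^bsub>?q\<^esub> x = x \<otimes>\<^bsub>R Quot ?J\<^esub> (?J +>\<^bsub>R\<^esub> r)"
    by (simp_all add: quot_module_def)
  \<comment> \<open>The coefficient of \<open>x\<close> with respect to the generator \<open>s\<close> of \<open>L/N'\<close>; it is determined modulo \<open>I\<close>.
    The functional is \<open>k \<circ> \<rho>\<close>, and \<open>k\<close> is constant on the classes modulo \<open>I\<close> because \<open>u\<close> maps \<open>m\<close>
    into the radical.\<close>
  define \<rho> where "\<rho> x = (SOME r. r \<in> carrier R \<and> x \<ominus>\<^bsub>L\<^esub> r \<odot>\<^bsub>L\<^esub> s \<in> N')" for x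
  have \<rho>: "\<rho> x \<in> carrier R \<and> x \<ominus>\<^bsub>L\<^esub> \<rho> x \<odot>\<^bsub>L\<^esub> s \<in> N'" if "x \<in> carrier L" for x
    unfolding \<rho>_def by (rule someI_ex) (use gen[OF that] in blast)
  define k where "k r = i (?J +>\<^bsub>R\<^esub> (u \<otimes>\<^bsub>R\<^esub> r))" for r
  have pic: "?J +>\<^bsub>R\<^esub> r \<in> carrier ?q" if "r \<in> carrier R" for r using that by (simp add: qs Q(2))
  have kE: "k r \<in> carrier E" if "r \<in> carrier R" for r
    unfolding k_def using that u(1) by (intro hom_closed[OF i] pic) simp
  have kadd: "k (r \<oplus>\<^bsub>R\<^esub> r') = k r \<oplus>\<^bsub>E\<^esub> k r'" if "r \<in> carrier R" "r' \<in> carrier R" for r r'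
    using hom_add[OF i pic pic, of "u \<otimes>\<^bsub>R\<^esub> r" "u \<otimes>\<^bsub>R\<^esub> r'"] that u(1) by (simp add: k_def qs Q(5) LR.R.r_distr)
  have ksm: "k (r \<otimes>\<^bsub>R\<^esub> a) = a \<odot>\<^bsub>E\<^esub> k r" if "r \<in> carrier R" "a \<in> carrier R" for r a
    using hom_smult[OF i that(2) pic, of "u \<otimes>\<^bsub>R\<^esub> r"] that u(1) by (simp add: k_def qs Q(6) LR.R.m_assoc)
  have kI: "k r = k r'" if r: "r \<in> carrier R" "r' \<in> carrier R" and "r \<ominus>\<^bsub>R\<^esub> r' \<in> I" for r r'
  proof -
    have "u \<otimes>\<^bsub>R\<^esub> (r \<ominus>\<^bsub>R\<^esub> r') \<in> ?J" using that(3) m(2) by (intro um) blast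
    then have "u \<otimes>\<^bsub>R\<^esub> r \<ominus>\<^bsub>R\<^esub> u \<otimes>\<^bsub>R\<^esub> r' \<in> ?J" using r u(1) by (simp add: a_minus_def LR.R.r_distr LR.R.r_minus)
    then have "?J +>\<^bsub>R\<^esub> (u \<otimes>\<^bsub>R\<^esub> r) = ?J +>\<^bsub>R\<^esub> (u \<otimes>\<^bsub>R\<^esub> r')" using r u(1) by (simp add: Q(7))
    then show ?thesis by (simp add: k_def)
  qed
  have k: "k (\<rho> x) = k r" if x: "x \<in> carrier L" and r: "r \<in> carrier R" and xr: "x \<ominus>\<^bsub>L\<^esub> r \<odot>\<^bsub>L\<^esub> s \<in> N'" for x r
  proof (rule kI)
    note rx = \<rho>[OF x]
    show "\<rho> x \<in> carrier R" "r \<in> carrier R" using rx r by blast+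
    have "(x \<ominus>\<^bsub>L\<^esub> r \<odot>\<^bsub>L\<^esub> s) \<ominus>\<^bsub>L\<^esub> (x \<ominus>\<^bsub>L\<^esub> \<rho> x \<odot>\<^bsub>L\<^esub> s) \<in> N'" by (rule N'D(6)[OF xr]) (use rx in blast)
    moreover have "(x \<ominus>\<^bsub>L\<^esub> r \<odot>\<^bsub>L\<^esub> s) \<ominus>\<^bsub>L\<^esub> (x \<ominus>\<^bsub>L\<^esub> \<rho> x \<odot>\<^bsub>L\<^esub> s) = (\<rho> x \<ominus>\<^bsub>R\<^esub> r) \<odot>\<^bsub>L\<^esub> s"
    proof -
      have c: "x \<in> carrier L" "r \<odot>\<^bsub>L\<^esub> s \<in> carrier L" "\<rho> x \<odot>\<^bsub>L\<^esub> s \<in> carrier L" using x r rx s(1) by simp_all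
      have "(x \<ominus>\<^bsub>L\<^esub> r \<odot>\<^bsub>L\<^esub> s) \<ominus>\<^bsub>L\<^esub> (x \<ominus>\<^bsub>L\<^esub> \<rho> x \<odot>\<^bsub>L\<^esub> s) = \<rho> x \<odot>\<^bsub>L\<^esub> s \<ominus>\<^bsub>L\<^esub> r \<odot>\<^bsub>L\<^esub> s"
        using c by (simp add: a_minus_def LR.M.minus_add LR.M.minus_minus LR.M.a_ac LR.M.r_neg LR.M.r_neg1 LR.M.r_neg2)
      then show ?thesis using rx r s(1) by (simp add: a_minus_def rL.smult_l_distr sneg)
    qed
    ultimately show "\<rho> x \<ominus>\<^bsub>R\<^esub> r \<in> I" using rx r by (simp add: I_def)
  qed
  have \<eta>: "(\<lambda>x\<in>carrier L. k (\<rho> x)) \<in> rmod_hom R L E"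
  proof (rule rmod_hom_restrictI[OF rL])
    fix x y a assume x: "x \<in> carrier L"
    note rx = \<rho>[OF x]
    show "k (\<rho> x) \<in> carrier E" using rx kE by blast
    { assume y: "y \<in> carrier L"
      note ry = \<rho>[OF y]
      have "(x \<ominus>\<^bsub>L\<^esub> \<rho> x \<odot>\<^bsub>L\<^esub> s) \<oplus>\<^bsub>L\<^esub> (y \<ominus>\<^bsub>L\<^esub> \<rho> y \<odot>\<^bsub>L\<^esub> s) = (x \<oplus>\<^bsub>L\<^esub> y) \<ominus>\<^bsub>L\<^esub> (\<rho> x \<oplus>\<^bsub>R\<^esub> \<rho> y) \<odot>\<^bsub>L\<^esub> s"
        using x y rx ry s(1) by (simp add: a_minus_def rL.smult_l_distr LR.M.minus_add LR.M.a_ac)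
      then have "(x \<oplus>\<^bsub>L\<^esub> y) \<ominus>\<^bsub>L\<^esub> (\<rho> x \<oplus>\<^bsub>R\<^esub> \<rho> y) \<odot>\<^bsub>L\<^esub> s \<in> N'" using N'D(3) rx ry by metis
      then have "k (\<rho> (x \<oplus>\<^bsub>L\<^esub> y)) = k (\<rho> x \<oplus>\<^bsub>R\<^esub> \<rho> y)" using x y rx ry by (intro k) simp_all
      then show "k (\<rho> (x \<oplus>\<^bsub>L\<^esub> y)) = k (\<rho> x) \<oplus>\<^bsub>E\<^esub> k (\<rho> y)" using kadd rx ry by simp }
    assume a: "a \<in> carrier R"
    have "a \<odot>\<^bsub>L\<^esub> (x \<ominus>\<^bsub>L\<^esub> \<rho> x \<odot>\<^bsub>L\<^esub> s) = a \<odot>\<^bsub>L\<^esub> x \<ominus>\<^bsub>L\<^esub> (\<rho> x \<otimes>\<^bsub>R\<^esub> a) \<odot>\<^bsub>L\<^esub> s"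
      using x rx a s(1) by (simp add: a_minus_def rL.smult_r_distr rL.smult_assoc LR.smult_r_minus)
    then have "a \<odot>\<^bsub>L\<^esub> x \<ominus>\<^bsub>L\<^esub> (\<rho> x \<otimes>\<^bsub>R\<^esub> a) \<odot>\<^bsub>L\<^esub> s \<in> N'" using N'D(4)[OF a] rx by metis
    then have "k (\<rho> (a \<odot>\<^bsub>L\<^esub> x)) = k (\<rho> x \<otimes>\<^bsub>R\<^esub> a)" using x rx a by (intro k) simp_all
    then show "k (\<rho> (a \<odot>\<^bsub>L\<^esub> x)) = a \<odot>\<^bsub>E\<^esub> k (\<rho> x)" using ksm rx a by simp
  qed
  have k0: "k \<zero>\<^bsub>R\<^esub> = \<zero>\<^bsub>E\<^esub>" using ksm[of "\<zero>\<^bsub>R\<^esub>" "\<zero>\<^bsub>R\<^esub>"] kE[of "\<zero>\<^bsub>R\<^esub>"] by simp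
  have "k (\<rho> n) = \<zero>\<^bsub>E\<^esub>" if n: "n \<in> N" for n
  proof -
    have nL: "n \<in> carrier L" using n ND(1) by blast
    have "n \<ominus>\<^bsub>L\<^esub> \<zero>\<^bsub>R\<^esub> \<odot>\<^bsub>L\<^esub> s = n" using nL s(1) LR.M.minus_equality[of "\<zero>\<^bsub>L\<^esub>" "\<zero>\<^bsub>L\<^esub>"] by (simp add: a_minus_def)
    then have "k (\<rho> n) = k \<zero>\<^bsub>R\<^esub>" using n N'(2) nL by (intro k) auto
    then show ?thesis by (simp add: k0)
  qed
  then have 1: "(\<lambda>x\<in>carrier L. k (\<rho> x)) n = \<zero>\<^bsub>E\<^esub>" if "n \<in> N" for n using that ND(1) by auto
  have "s \<ominus>\<^bsub>L\<^esub> \<one>\<^bsub>R\<^esub> \<odot>\<^bsub>L\<^esub> s \<in> N'" using s(1) N'D(2) by (simp add: a_minus_def LR.M.r_neg)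
  then have ks: "k (\<rho> s) = k \<one>\<^bsub>R\<^esub>" by (rule k[OF s(1) LR.R.one_closed])
  have "k \<one>\<^bsub>R\<^esub> \<noteq> \<zero>\<^bsub>E\<^esub>"
  proof
    assume "k \<one>\<^bsub>R\<^esub> = \<zero>\<^bsub>E\<^esub>"
    then have "i (?J +>\<^bsub>R\<^esub> u) = i \<zero>\<^bsub>?q\<^esub>" using u(1) hom_zero[OF q rE i] by (simp add: k_def)
    then have "?J +>\<^bsub>R\<^esub> u = \<zero>\<^bsub>?q\<^esub>"
      using inj_onD[OF inj _ pic[OF u(1)], of "\<zero>\<^bsub>?q\<^esub>"] pic[OF LR.R.zero_closed] by (simp add: qs Q(4))
    then have "u \<ominus>\<^bsub>R\<^esub> \<zero>\<^bsub>R\<^esub> \<in> ?J" using u(1) by (simp add: qs Q(4) Q(7))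
    then show False using u LR.R.minus_equality[of "\<zero>\<^bsub>R\<^esub>" "\<zero>\<^bsub>R\<^esub>"] by (simp add: a_minus_def)
  qed
  then have 2: "(\<lambda>x\<in>carrier L. k (\<rho> x)) s \<noteq> \<zero>\<^bsub>E\<^esub>" using s(1) ks by simp
  show thesis by (rule that[OF \<eta> 1 s(1) 2])
qed

section \<open>Projective modules\<close>

text \<open>A map through \<open>R\<close> has the form \<open>x \<mapsto> y (a x)\<close> with \<open>y\<close> the image of \<open>1\<close>, and it is lifted along a
  surjection by lifting \<open>g y\<close>.\<close>

lemma in_add_regular_projective:
  assumes P: "right_module R P" and a: "in_add R (regular_module R) P"
  shows "projective_module R P"
  unfolding projective_module_def
proof (intro conjI P allI impI ballI)
  fix A B :: "'a umodule" and q g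
  assume A: "right_module R A" and B: "right_module R B" and q: "q \<in> rmod_hom R A B"
    and g: "g \<in> rmod_hom R P B" and sq: "q ` carrier A = carrier B"
  interpret P: right_module R P by fact
  interpret A: right_module R A by fact
  interpret B: right_module R B by fact
  have "\<exists>h\<in>rmod_hom R P A. \<forall>x\<in>carrier P. q (h x) = g (f x)"
    if "f \<in> through_all R (regular_module R) P P" for f
    using that
  proof induction
    case zero
    show ?case
      by (rule bexI[OF _ hzero_hom[OF P A]]) (simp add: hom_zero[OF A B q] hom_zero[OF P B g])
  next
    case (step f a s)
    then obtain h where h: "h \<in> rmod_hom R P A" "\<And>x. x \<in> carrier P \<Longrightarrow> q (h x) = g (f x)" by blast
    note ca = hom_closed[OF step.hyps(2), simplified]
    have fh: "f \<in> rmod_hom R P P" by (rule through_hom[OF P P subset_refl step.hyps(1)])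
    have s1: "s \<one>\<^bsub>R\<^esub> \<in> carrier P" using hom_closed[OF step.hyps(3)] by simp
    then have "g (s \<one>\<^bsub>R\<^esub>) \<in> q ` carrier A" unfolding sq by (rule hom_closed[OF g])
    then obtain \<alpha> where \<alpha>: "\<alpha> \<in> carrier A" "g (s \<one>\<^bsub>R\<^esub>) = q \<alpha>" by blast
    have k: "(\<lambda>x\<in>carrier P. a x \<odot>\<^bsub>A\<^esub> \<alpha>) \<in> rmod_hom R P A"
      by (rule rmod_hom_restrictI[OF P])
        (simp_all add: ca \<alpha>(1) hom_add[OF step.hyps(2)] hom_smult[OF step.hyps(2)] A.smult_l_distr A.smult_assoc)
    have "q (hadd P A h (\<lambda>x\<in>carrier P. a x \<odot>\<^bsub>A\<^esub> \<alpha>) x) = g (hadd P P f (rcomp P s a) x)" if x: "x \<in> carrier P" for x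
    proof -
      have "s (a x) = a x \<odot>\<^bsub>P\<^esub> s \<one>\<^bsub>R\<^esub>"
        using hom_smult[OF step.hyps(3) ca[OF x], of "\<one>\<^bsub>R\<^esub>"] ca[OF x] by simp
      then have "q (a x \<odot>\<^bsub>A\<^esub> \<alpha>) = g (s (a x))"
        using hom_smult[OF q ca[OF x] \<alpha>(1)] hom_smult[OF g ca[OF x] s1] \<alpha>(2) by simp
      moreover have "s (a x) \<in> carrier P" using hom_closed[OF step.hyps(3), of "a x"] ca[OF x] by simp
      ultimately show ?thesis
        using x h(2)[OF x] hom_closed[OF h(1) x] hom_closed[OF fh x] ca[OF x] \<alpha>(1)
        by (simp add: compose_eq hom_add[OF q] hom_add[OF g])
    qed
    then show ?case using hadd_hom[OF P A h(1) k] by blast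
  qed
  from this[OF a[unfolded in_add_def]] show "\<exists>h\<in>rmod_hom R P A. \<forall>x\<in>carrier P. q (h x) = g x"
    by simp
qed

text \<open>A presentation \<open>R\<^sup>n \<rightarrow> P\<close> splits.  The test module is the copy of \<open>R\<^sup>n\<close> on the carrier type over
  which projectivity is tested.\<close>

lemma projective_fp_in_add_regular:
  assumes P: "P \<in> fp_modules R" and pr: "projective_module R P"
  shows "in_add R (regular_module R) P"
proof -
  have rP: "right_module R P" by (rule fp_modules_rm[OF P])
  interpret P: right_module R P by (rule rP)
  note R = P.R.ring_axioms
  obtain n p where p: "p \<in> rmod_hom R (free R n) P" and sp: "p ` carrier (free R n) = carrier P"
    using P unfolding fp_modules_def finitely_presented_def by blast
  note M = regular_right_module[OF R] and F = free_right_module[OF R, of n]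
  have fpF: "finitely_presented R (free R n)" by (rule in_add_regular_finitely_presented[OF F sum_in_add[OF M]])
  let ?A = "fp_copy R (free R n)"
  note A = fp_modules_rm[OF fp_copy[OF fpF]] and c = from_copy_hom[OF fpF] and t = to_copy_hom[OF fpF]
  have q: "rcomp ?A p (from_copy R (free R n)) \<in> rmod_hom R ?A P" by (rule rcomp_hom[OF A c p])
  have "rcomp ?A p (from_copy R (free R n)) ` carrier ?A = carrier P"
  proof (intro equalityI subsetI)
    fix y assume "y \<in> rcomp ?A p (from_copy R (free R n)) ` carrier ?A"
    then show "y \<in> carrier P" using hom_closed[OF q] by blast
  next
    fix y assume "y \<in> carrier P"
    then have "y \<in> p ` carrier (free R n)" by (simp only: sp)
    then obtain x where x: "x \<in> carrier (free R n)" "y = p x" by blast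
    have "y = rcomp ?A p (from_copy R (free R n)) (to_copy R (free R n) x)"
      using x from_to_copy[OF fpF x(1)] hom_closed[OF t x(1)] by (simp add: compose_eq)
    then show "y \<in> rcomp ?A p (from_copy R (free R n)) ` carrier ?A" using hom_closed[OF t x(1)] by (rule image_eqI)
  qed
  moreover have "\<And>(A :: 'a umodule) (B :: 'a umodule) q g. \<lbrakk>right_module R A; right_module R B;
      q \<in> rmod_hom R A B; g \<in> rmod_hom R P B; q ` carrier A = carrier B\<rbrakk> \<Longrightarrow>
      \<exists>h\<in>rmod_hom R P A. \<forall>x\<in>carrier P. q (h x) = g x"
    using pr unfolding projective_module_def by blast
  ultimately have "\<exists>h\<in>rmod_hom R P ?A. \<forall>x\<in>carrier P. rcomp ?A p (from_copy R (free R n)) (h x) = rid P x"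
    using A rP q rid_hom[OF rP] by (simp only:)
  then obtain h where h: "h \<in> rmod_hom R P ?A"
    and ph: "\<And>x. x \<in> carrier P \<Longrightarrow> rcomp ?A p (from_copy R (free R n)) (h x) = rid P x" by blast
  have "in_add R (free R n) P"
  proof (rule in_add_retract[OF F rP rcomp_hom[OF rP h c] p])
    fix x assume x: "x \<in> carrier P"
    show "p (rcomp P (from_copy R (free R n)) h x) = x"
      using ph[OF x] x hom_closed[OF h x] by (simp add: compose_eq)
  qed
  then show ?thesis by (rule in_add_trans[OF M F rP sum_in_add[OF M]])
qed

text \<open>Sums need not be formed on the left, since a sum of maps through \<open>R\<close> is a single map through some
  \<open>R\<^sup>n\<close>.\<close>

lemma proj_ideal_eq_through:
  assumes X: "right_module R X"
  shows "proj_ideal R X = through_all R (regular_module R) X X"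
proof (intro equalityI subsetI)
  interpret X: right_module R X by fact
  note R = X.R.ring_axioms and M = regular_right_module[OF X.R.ring_axioms]
  fix f assume "f \<in> proj_ideal R X"
  then obtain P g h where P: "P \<in> fp_modules R" "projective_module R P" and g: "g \<in> rmod_hom R X P"
    and h: "h \<in> rmod_hom R P X" and f: "f = rcomp X h g"
    by (auto simp: proj_ideal_def)
  note rP = fp_modules_rm[OF P(1)]
  have "f \<in> through_all R P X X" unfolding f by (rule through_single[OF X X subset_refl g h])
  then show "f \<in> through_all R (regular_module R) X X"
    by (rule through_change[OF rP X X M projective_fp_in_add_regular[OF P]])
next
  interpret X: right_module R X by fact
  note R = X.R.ring_axioms and M = regular_right_module[OF X.R.ring_axioms]
  fix f assume f: "f \<in> through_all R (regular_module R) X X"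
  obtain n a b where a: "a \<in> rmod_hom R X (free R n)" and b: "b \<in> rmod_hom R (free R n) X"
    and fab: "f = rcomp X b a"
    by (rule through_all_factors[OF M X X f]) blast
  note F = free_right_module[OF R, of n]
  have fpF: "finitely_presented R (free R n)" by (rule in_add_regular_finitely_presented[OF F sum_in_add[OF M]])
  let ?A = "fp_copy R (free R n)"
  note A = fp_modules_rm[OF fp_copy[OF fpF]] and c = from_copy_hom[OF fpF] and t = to_copy_hom[OF fpF]
  have "in_add R (regular_module R) ?A"
    by (rule in_add_trans[OF M F A sum_in_add[OF M] in_add_iso(1)[OF F A fp_copy_iso[OF fpF]]])
  then have pr: "projective_module R ?A" by (rule in_add_regular_projective[OF A])
  have g: "rcomp X (to_copy R (free R n)) a \<in> rmod_hom R X ?A" by (rule rcomp_hom[OF X a t])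
  have h: "rcomp ?A b (from_copy R (free R n)) \<in> rmod_hom R ?A X" by (rule rcomp_hom[OF A c b])
  have "f = rcomp X (rcomp ?A b (from_copy R (free R n))) (rcomp X (to_copy R (free R n)) a)"
    unfolding fab
    by (rule hom_eqI[OF rcomp_hom[OF X a b] rcomp_hom[OF X g h]])
      (simp add: compose_eq hom_closed[OF a] hom_closed[OF t] from_to_copy[OF fpF])
  then show "f \<in> proj_ideal R X"
    using through_hom[OF X X subset_refl f] fp_copy[OF fpF] pr g h unfolding proj_ideal_def by blast
qed

section \<open>The relative Auslander algebra of a generator-cogenerator\<close>

locale relative_auslander =
  fixes R :: "('r, 'p) ring_scheme" and \<Lambda> :: "('r, 'a) module" and E :: "('r, 'e) module" and X :: "'a umodule"
  assumes artin: "artin_algebra R \<Lambda>"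
    and E: "injective_envelope R (quot_module R (jacobson_radical R)) E"
    and X_fp: "X \<in> fp_modules \<Lambda>"
    and generator: "in_add \<Lambda> X (regular_module \<Lambda>)"
    and cogenerator: "in_add \<Lambda> X (dual_regular R \<Lambda> E)"
begin

abbreviation "\<Gamma> \<equiv> End_ring \<Lambda> X"
abbreviation "T \<equiv> hom_mod \<Lambda> (\<lambda>g x. g x) X"
abbreviation "\<Lambda>\<Lambda> \<equiv> regular_module \<Lambda>"
abbreviation "P \<equiv> T \<Lambda>\<Lambda>"

lemma ring_\<Lambda>: "ring \<Lambda>"
proof -
  interpret artin_algebra R \<Lambda> by (rule artin)
  show ?thesis by (rule L.ring_axioms)
qed

lemma rX: "right_module \<Lambda> X" by (rule fp_modules_rm[OF X_fp])

lemma rL: "right_module \<Lambda> \<Lambda>\<Lambda>" by (rule regular_right_module[OF ring_\<Lambda>])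

lemma ring_\<Gamma>: "ring \<Gamma>" by (rule End_ring_ring[OF rX])

lemma action: "left_action \<Lambda> \<Gamma> X (\<lambda>g x. g x)"
proof (rule left_action.intro[OF rX ring_\<Gamma>], rule left_action_axioms.intro)
  fix b q q' a b' assume "b \<in> carrier \<Gamma>"
  then have b: "b \<in> rmod_hom \<Lambda> X X" by simp
  show "b q \<in> carrier X" if "q \<in> carrier X" using hom_closed[OF b that] .
  show "b (q \<oplus>\<^bsub>X\<^esub> q') = b q \<oplus>\<^bsub>X\<^esub> b q'" if "q \<in> carrier X" "q' \<in> carrier X" by (rule hom_add[OF b that])
  show "b (a \<odot>\<^bsub>X\<^esub> q) = a \<odot>\<^bsub>X\<^esub> b q" if "a \<in> carrier \<Lambda>" "q \<in> carrier X" by (rule hom_smult[OF b that])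
qed (simp_all add: compose_eq)

end

sublocale relative_auslander \<subseteq> TA: left_action \<Lambda> "End_ring \<Lambda> X" X "\<lambda>g x. g x"
  by (rule action)

context relative_auslander
begin

lemma rT: "right_module \<Lambda> Y \<Longrightarrow> right_module \<Gamma> (T Y)" by (rule TA.hom_mod_right_module)

lemma T_X_iso_regular: "rmod_iso \<Gamma> (T X) (regular_module \<Gamma>)"
proof (rule rmod_isoI[of "\<lambda>h\<in>carrier (T X). h" _ _ _ "\<lambda>h. h"])
  show "(\<lambda>h\<in>carrier (T X). h) \<in> rmod_hom \<Gamma> (T X) (regular_module \<Gamma>)"
    by (rule rmod_hom_restrictI[OF rT[OF rX]]) (simp_all add: compose_def)
qed simp_all

lemma T_in_add_regular:
  assumes "right_module \<Lambda> Y" "in_add \<Lambda> X Y" shows "in_add \<Gamma> (regular_module \<Gamma>) (T Y)"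
  by (rule in_add_trans[OF regular_right_module[OF ring_\<Gamma>] rT[OF rX] rT[OF assms(1)]
    in_add_iso(2)[OF rT[OF rX] regular_right_module[OF ring_\<Gamma>] T_X_iso_regular]
    TA.hom_mod_in_add[OF rX assms]])

lemma T_fp: "\<lbrakk>right_module \<Lambda> Y; in_add \<Lambda> X Y\<rbrakk> \<Longrightarrow> finitely_presented \<Gamma> (T Y)"
  by (rule in_add_regular_finitely_presented[OF rT T_in_add_regular])

text \<open>The finitely generated projective \<open>\<Gamma>\<close>-modules.\<close>

definition \<C> where "\<C> = {W \<in> fp_modules \<Gamma>. in_add \<Gamma> (regular_module \<Gamma>) W}"

lemma T_copy: "\<lbrakk>right_module \<Lambda> Y; in_add \<Lambda> X Y\<rbrakk> \<Longrightarrow> fp_copy \<Gamma> (T Y) \<in> \<C>"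
proof -
  assume Y: "right_module \<Lambda> Y" "in_add \<Lambda> X Y"
  note f = T_fp[OF Y]
  note c = fp_copy[OF f]
  have "in_add \<Gamma> (regular_module \<Gamma>) (fp_copy \<Gamma> (T Y))"
    by (rule in_add_trans[OF regular_right_module[OF ring_\<Gamma>] rT[OF Y(1)] fp_modules_rm[OF c]
      T_in_add_regular[OF Y] in_add_iso(1)[OF rT[OF Y(1)] fp_modules_rm[OF c] fp_copy_iso[OF f]]])
  then show ?thesis using c by (simp add: \<C>_def)
qed

lemma T_smult: "\<lbrakk>h \<in> rmod_hom \<Lambda> X Y; \<gamma> \<in> rmod_hom \<Lambda> X X\<rbrakk> \<Longrightarrow> \<gamma> \<odot>\<^bsub>T Y\<^esub> h = rcomp X h \<gamma>"
  by (simp add: compose_def)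

definition lmul where "lmul l = (\<lambda>\<phi>\<in>rmod_hom \<Lambda> X \<Lambda>\<Lambda>. \<lambda>x\<in>carrier X. l \<otimes>\<^bsub>\<Lambda>\<^esub> \<phi> x)"

lemma lmul_apply:
  "\<lbrakk>\<phi> \<in> rmod_hom \<Lambda> X \<Lambda>\<Lambda>; x \<in> carrier X\<rbrakk> \<Longrightarrow> lmul l \<phi> x = l \<otimes>\<^bsub>\<Lambda>\<^esub> \<phi> x"
  by (simp add: lmul_def)

lemma P_closed: "\<lbrakk>\<phi> \<in> rmod_hom \<Lambda> X \<Lambda>\<Lambda>; x \<in> carrier X\<rbrakk> \<Longrightarrow> \<phi> x \<in> carrier \<Lambda>"
  using hom_closed[of \<phi> \<Lambda> X \<Lambda>\<Lambda> x] by simp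

lemma left_mult_hom:
  assumes "l \<in> carrier \<Lambda>" shows "(\<lambda>x\<in>carrier \<Lambda>\<Lambda>. l \<otimes>\<^bsub>\<Lambda>\<^esub> x) \<in> rmod_hom \<Lambda> \<Lambda>\<Lambda> \<Lambda>\<Lambda>"
proof -
  show ?thesis by (rule rmod_hom_restrictI[OF rL]) (use assms in \<open>simp_all add: TA.Q.R.r_distr TA.Q.R.m_assoc\<close>)
qed

lemma lmul_eq_hmap:
  "lmul l = hmap \<Lambda> X \<Lambda>\<Lambda> (\<lambda>x\<in>carrier \<Lambda>\<Lambda>. l \<otimes>\<^bsub>\<Lambda>\<^esub> x)"
  by (auto simp: lmul_def hmap_def compose_def fun_eq_iff P_closed)

lemma lmul_hom: "l \<in> carrier \<Lambda> \<Longrightarrow> lmul l \<in> rmod_hom \<Gamma> P P"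
  unfolding lmul_eq_hmap by (rule TA.hmap_hom[OF rL rL left_mult_hom])

lemma lmul_closed: "\<lbrakk>l \<in> carrier \<Lambda>; \<phi> \<in> rmod_hom \<Lambda> X \<Lambda>\<Lambda>\<rbrakk> \<Longrightarrow> lmul l \<phi> \<in> rmod_hom \<Lambda> X \<Lambda>\<Lambda>"
  using hom_closed[OF lmul_hom, of l \<phi>] by simp

text \<open>As \<open>\<Lambda>\<close> is in \<open>add X\<close>, there are maps \<open>a\<^sub>i : \<Lambda> \<rightarrow> X\<close> and \<open>b\<^sub>i : X \<rightarrow> \<Lambda>\<close> with \<open>\<Sum> b\<^sub>i a\<^sub>i\<close> the identity.  A
  \<open>\<Gamma>\<close>-endomorphism \<open>y\<close> of \<open>P\<close> then satisfies \<open>y \<phi> = \<Sum> y (b\<^sub>i (a\<^sub>i \<phi>)) = \<Sum> y b\<^sub>i \<circ> (a\<^sub>i \<phi>)\<close>, because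
  \<open>a\<^sub>i \<phi>\<close> is in \<open>\<Gamma>\<close>, so \<open>y\<close> is left multiplication by \<open>\<Sum> y b\<^sub>i (a\<^sub>i 1)\<close>.\<close>

lemma lmul_ring_iso: "lmul \<in> ring_iso \<Lambda> (End_ring \<Gamma> P)"
proof (rule ring_iso_memI)
  note rP = rT[OF rL]
  have eqI: "f = g" if "f \<in> rmod_hom \<Gamma> P P" "g \<in> rmod_hom \<Gamma> P P"
    "\<And>\<phi> x. \<phi> \<in> rmod_hom \<Lambda> X \<Lambda>\<Lambda> \<Longrightarrow> x \<in> carrier X \<Longrightarrow> f \<phi> x = g \<phi> x" for f g
  proof (rule hom_eqI[OF that(1,2)])
    fix \<phi> assume \<phi>: "\<phi> \<in> carrier P"
    have "f \<phi> \<in> rmod_hom \<Lambda> X \<Lambda>\<Lambda>" "g \<phi> \<in> rmod_hom \<Lambda> X \<Lambda>\<Lambda>"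
      using hom_closed[OF that(1) \<phi>] hom_closed[OF that(2) \<phi>] by simp_all
    then show "f \<phi> = g \<phi>" by (rule hom_eqI) (use that(3)[of \<phi>] \<phi> in simp)
  qed
  fix l m assume l: "l \<in> carrier \<Lambda>"
  show "lmul l \<in> carrier (End_ring \<Gamma> P)" using lmul_hom[OF l] by simp
  assume m: "m \<in> carrier \<Lambda>"
  show "lmul (l \<otimes>\<^bsub>\<Lambda>\<^esub> m) = lmul l \<otimes>\<^bsub>End_ring \<Gamma> P\<^esub> lmul m"
    unfolding End_ring_simps
    by (rule eqI[OF lmul_hom[OF TA.Q.R.m_closed[OF l m]] rcomp_hom[OF rP lmul_hom[OF m] lmul_hom[OF l]]])
      (simp add: compose_eq lmul_apply lmul_closed l m P_closed TA.Q.R.m_assoc)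
  show "lmul (l \<oplus>\<^bsub>\<Lambda>\<^esub> m) = lmul l \<oplus>\<^bsub>End_ring \<Gamma> P\<^esub> lmul m"
    unfolding End_ring_simps
    by (rule eqI[OF lmul_hom[OF TA.Q.R.a_closed[OF l m]] hadd_hom[OF rP rP lmul_hom[OF l] lmul_hom[OF m]]])
      (simp add: lmul_apply lmul_closed l m P_closed TA.Q.R.l_distr)
next
  note rP = rT[OF rL]
  show "lmul \<one>\<^bsub>\<Lambda>\<^esub> = \<one>\<^bsub>End_ring \<Gamma> P\<^esub>"
    unfolding End_ring_simps
  proof (rule hom_eqI[OF lmul_hom[OF TA.Q.R.one_closed] rid_hom[OF rP]])
    fix \<phi> assume "\<phi> \<in> carrier P"
    then have \<phi>: "\<phi> \<in> rmod_hom \<Lambda> X \<Lambda>\<Lambda>" by simp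
    have "lmul \<one>\<^bsub>\<Lambda>\<^esub> \<phi> = \<phi>"
      by (rule hom_eqI[OF lmul_closed[OF TA.Q.R.one_closed \<phi>] \<phi>]) (simp add: lmul_apply \<phi> P_closed)
    then show "lmul \<one>\<^bsub>\<Lambda>\<^esub> \<phi> = rid P \<phi>" using \<phi> by simp
  qed
next
  note rP = rT[OF rL]
  \<comment> \<open>\<open>l b = m b\<close> for all maps \<open>b : X \<rightarrow> \<Lambda>\<close>, and \<open>1\<close> is a sum of values of such maps.\<close>
  have inj: "inj_on lmul (carrier \<Lambda>)"
  proof (rule inj_onI)
    fix l m assume l: "l \<in> carrier \<Lambda>" and m: "m \<in> carrier \<Lambda>" and eq: "lmul l = lmul m"
    have lb: "l \<otimes>\<^bsub>\<Lambda>\<^esub> b x = m \<otimes>\<^bsub>\<Lambda>\<^esub> b x" if "b \<in> rmod_hom \<Lambda> X \<Lambda>\<Lambda>" "x \<in> carrier X" for b x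
      using fun_cong[OF fun_cong[OF eq, of b], of x] that by (simp add: lmul_apply)
    have "l \<otimes>\<^bsub>\<Lambda>\<^esub> f \<one>\<^bsub>\<Lambda>\<^esub> = m \<otimes>\<^bsub>\<Lambda>\<^esub> f \<one>\<^bsub>\<Lambda>\<^esub>" if "f \<in> through_all \<Lambda> X \<Lambda>\<Lambda> \<Lambda>\<Lambda>" for f
      using that
    proof induction
      case zero
      then show ?case using l m by simp
    next
      case (step f a b)
      have a1: "a \<one>\<^bsub>\<Lambda>\<^esub> \<in> carrier X" using hom_closed[OF step.hyps(2)] by simp
      have f1: "f \<one>\<^bsub>\<Lambda>\<^esub> \<in> carrier \<Lambda>" using hom_closed[OF through_hom[OF rL rL subset_refl step.hyps(1)]] by simp
      show ?case
        using step.IH lb[OF step.hyps(3) a1] P_closed[OF step.hyps(3) a1] f1 l m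
        by (simp add: compose_eq TA.Q.R.r_distr)
    qed
    from this[OF generator[unfolded in_add_def]] show "l = m" using l m by simp
  qed
  have surj: "\<exists>l\<in>carrier \<Lambda>. lmul l = y" if y: "y \<in> rmod_hom \<Gamma> P P" for y
  proof -
    have yc: "y \<phi> \<in> rmod_hom \<Lambda> X \<Lambda>\<Lambda>" if "\<phi> \<in> rmod_hom \<Lambda> X \<Lambda>\<Lambda>" for \<phi> using hom_closed[OF y] that by simp
    have "\<exists>l\<in>carrier \<Lambda>. \<forall>\<phi>\<in>rmod_hom \<Lambda> X \<Lambda>\<Lambda>. y (rcomp X f \<phi>) = lmul l \<phi>"
      if "f \<in> through_all \<Lambda> X \<Lambda>\<Lambda> \<Lambda>\<Lambda>" for f
      using that
    proof induction
      case zero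
      have "y (rcomp X (hzero \<Lambda>\<Lambda> \<Lambda>\<Lambda>) \<phi>) = lmul \<zero>\<^bsub>\<Lambda>\<^esub> \<phi>" if \<phi>: "\<phi> \<in> rmod_hom \<Lambda> X \<Lambda>\<Lambda>" for \<phi>
      proof -
        have "rcomp X (hzero \<Lambda>\<Lambda> \<Lambda>\<Lambda>) \<phi> = \<zero>\<^bsub>P\<^esub>"
          using hom_closed[OF \<phi>] by (auto simp: compose_def hzero_def fun_eq_iff)
        moreover have "lmul \<zero>\<^bsub>\<Lambda>\<^esub> \<phi> = \<zero>\<^bsub>P\<^esub>"
          using P_closed[OF \<phi>] \<phi> by (auto simp: lmul_def hzero_def fun_eq_iff)
        ultimately show ?thesis using hom_zero[OF rP rP y] by simp
      qed
      then show ?case using TA.Q.R.zero_closed by blast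
    next
      case (step f a b)
      then obtain l where l: "l \<in> carrier \<Lambda>"
        and lf: "\<And>\<phi>. \<phi> \<in> rmod_hom \<Lambda> X \<Lambda>\<Lambda> \<Longrightarrow> y (rcomp X f \<phi>) = lmul l \<phi>" by blast
      note a = step.hyps(2) and b = step.hyps(3)
      have f: "f \<in> rmod_hom \<Lambda> \<Lambda>\<Lambda> \<Lambda>\<Lambda>" by (rule through_hom[OF rL rL subset_refl step.hyps(1)])
      have a1: "a \<one>\<^bsub>\<Lambda>\<^esub> \<in> carrier X" using hom_closed[OF a] by simp
      have l': "y b (a \<one>\<^bsub>\<Lambda>\<^esub>) \<in> carrier \<Lambda>" by (rule P_closed[OF yc[OF b] a1])
      have "y (rcomp X (hadd \<Lambda>\<Lambda> \<Lambda>\<Lambda> f (rcomp \<Lambda>\<Lambda> b a)) \<phi>) = lmul (l \<oplus>\<^bsub>\<Lambda>\<^esub> y b (a \<one>\<^bsub>\<Lambda>\<^esub>)) \<phi>"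
        if \<phi>: "\<phi> \<in> rmod_hom \<Lambda> X \<Lambda>\<Lambda>" for \<phi>
      proof -
        have a\<phi>: "rcomp X a \<phi> \<in> rmod_hom \<Lambda> X X" by (rule rcomp_hom[OF rX \<phi> a])
        have ba\<phi>: "rcomp X b (rcomp X a \<phi>) \<in> rmod_hom \<Lambda> X \<Lambda>\<Lambda>" by (rule rcomp_hom[OF rX a\<phi> b])
        have f\<phi>: "rcomp X f \<phi> \<in> rmod_hom \<Lambda> X \<Lambda>\<Lambda>" by (rule rcomp_hom[OF rX \<phi> f])
        have "rcomp X (hadd \<Lambda>\<Lambda> \<Lambda>\<Lambda> f (rcomp \<Lambda>\<Lambda> b a)) \<phi> = hadd X \<Lambda>\<Lambda> (rcomp X f \<phi>) (rcomp X b (rcomp X a \<phi>))"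
          using P_closed[OF \<phi>] by (auto simp: compose_def hadd_def fun_eq_iff)
        then have "y (rcomp X (hadd \<Lambda>\<Lambda> \<Lambda>\<Lambda> f (rcomp \<Lambda>\<Lambda> b a)) \<phi>) = hadd X \<Lambda>\<Lambda> (y (rcomp X f \<phi>)) (y (rcomp X b (rcomp X a \<phi>)))"
          using hom_add[OF y, of "rcomp X f \<phi>" "rcomp X b (rcomp X a \<phi>)"] f\<phi> ba\<phi> by simp
        also have "y (rcomp X b (rcomp X a \<phi>)) = rcomp X (y b) (rcomp X a \<phi>)"
          using hom_smult[OF y, of "rcomp X a \<phi>" b] a\<phi> b T_smult[OF b a\<phi>] T_smult[OF yc[OF b] a\<phi>] by simp
        finally have 1: "y (rcomp X (hadd \<Lambda>\<Lambda> \<Lambda>\<Lambda> f (rcomp \<Lambda>\<Lambda> b a)) \<phi>) = hadd X \<Lambda>\<Lambda> (lmul l \<phi>) (rcomp X (y b) (rcomp X a \<phi>))"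
          by (simp only: lf[OF \<phi>])
        show ?thesis
          unfolding 1
        proof (rule hom_eqI[OF hadd_hom[OF rX rL lmul_closed[OF l \<phi>] rcomp_hom[OF rX a\<phi> yc[OF b]]] lmul_closed[OF TA.Q.R.a_closed[OF l l'] \<phi>]])
          fix x assume x: "x \<in> carrier X"
          have \<phi>x: "\<phi> x \<in> carrier \<Lambda>" by (rule P_closed[OF \<phi> x])
          have "a (\<phi> x) = \<phi> x \<odot>\<^bsub>X\<^esub> a \<one>\<^bsub>\<Lambda>\<^esub>" using hom_smult[OF a \<phi>x, of "\<one>\<^bsub>\<Lambda>\<^esub>"] \<phi>x by simp
          then have "y b (a (\<phi> x)) = y b (a \<one>\<^bsub>\<Lambda>\<^esub>) \<otimes>\<^bsub>\<Lambda>\<^esub> \<phi> x" using hom_smult[OF yc[OF b] \<phi>x a1] by simp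
          then show "hadd X \<Lambda>\<Lambda> (lmul l \<phi>) (rcomp X (y b) (rcomp X a \<phi>)) x = lmul (l \<oplus>\<^bsub>\<Lambda>\<^esub> y b (a \<one>\<^bsub>\<Lambda>\<^esub>)) \<phi> x"
            using x \<phi> \<phi>x l l' by (simp add: compose_eq lmul_apply TA.Q.R.l_distr)
        qed
      qed
      then show ?case using l l' by blast
    qed
    from this[OF generator[unfolded in_add_def]] obtain l where l: "l \<in> carrier \<Lambda>"
      and ly: "\<And>\<phi>. \<phi> \<in> rmod_hom \<Lambda> X \<Lambda>\<Lambda> \<Longrightarrow> y (rcomp X (rid \<Lambda>\<Lambda>) \<phi>) = lmul l \<phi>" by blast
    have "lmul l = y"
    proof (rule hom_eqI[OF lmul_hom[OF l] y])
      fix \<phi> assume "\<phi> \<in> carrier P"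
      then have \<phi>: "\<phi> \<in> rmod_hom \<Lambda> X \<Lambda>\<Lambda>" by simp
      have "rcomp X (rid \<Lambda>\<Lambda>) \<phi> = \<phi>"
        by (rule rcomp_rid(2)[OF \<phi>])
      then show "lmul l \<phi> = y \<phi>" using ly[OF \<phi>] by simp
    qed
    then show ?thesis using l by blast
  qed
  have "lmul ` carrier \<Lambda> = rmod_hom \<Gamma> P P" using surj lmul_hom by blast
  then show "bij_betw lmul (carrier \<Lambda>) (carrier (End_ring \<Gamma> P))" using inj by (simp add: bij_betw_def)
qed

text \<open>The endomorphism \<open>x \<phi>\<close> of \<open>X\<close>, the composite of \<open>\<phi> : X \<rightarrow> \<Lambda>\<close> and the map \<open>\<Lambda> \<rightarrow> X\<close> that sends \<open>1\<close> to \<open>x\<close>.\<close>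

definition rank_one where "rank_one x \<phi> = (\<lambda>z\<in>carrier X. \<phi> z \<odot>\<^bsub>X\<^esub> x)"

lemma rank_one_hom:
  assumes x: "x \<in> carrier X" and \<phi>: "\<phi> \<in> rmod_hom \<Lambda> X \<Lambda>\<Lambda>"
  shows "rank_one x \<phi> \<in> rmod_hom \<Lambda> X X"
proof -
  show ?thesis
    unfolding rank_one_def
    by (rule rmod_hom_restrictI[OF rX])
      (simp_all add: P_closed[OF \<phi>] x hom_add[OF \<phi>] hom_smult[OF \<phi>] TA.Q.smult_l_distr TA.Q.smult_assoc)
qed

text \<open>The maps \<open>\<phi> \<mapsto> v (x \<phi>)\<close> from \<open>P\<close> to a \<open>\<Gamma>\<close>-module: they are linear because \<open>(x \<phi>) \<gamma> = x (\<phi> \<gamma>)\<close>.\<close>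

lemma rank_one_smult_hom:
  assumes x: "x \<in> carrier X" and V: "right_module \<Gamma> V" and v: "v \<in> carrier V"
  shows "(\<lambda>\<phi>\<in>carrier P. rank_one x \<phi> \<odot>\<^bsub>V\<^esub> v) \<in> rmod_hom \<Gamma> P V"
proof (rule rmod_hom_restrictI[OF rT[OF rL]])
  interpret V: right_module \<Gamma> V by fact
  fix \<phi> \<phi>' \<gamma> assume "\<phi> \<in> carrier P"
  then have \<phi>: "\<phi> \<in> rmod_hom \<Lambda> X \<Lambda>\<Lambda>" by simp
  note o = rank_one_hom[OF x \<phi>]
  show "rank_one x \<phi> \<odot>\<^bsub>V\<^esub> v \<in> carrier V" using V.smult_closed[of "rank_one x \<phi>" v] o v by simp
  { assume "\<phi>' \<in> carrier P"
    then have \<phi>': "\<phi>' \<in> rmod_hom \<Lambda> X \<Lambda>\<Lambda>" by simp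
    have "rank_one x (\<phi> \<oplus>\<^bsub>P\<^esub> \<phi>') = rank_one x \<phi> \<oplus>\<^bsub>\<Gamma>\<^esub> rank_one x \<phi>'"
      using P_closed[OF \<phi>] P_closed[OF \<phi>'] x by (auto simp: rank_one_def hadd_def fun_eq_iff TA.Q.smult_l_distr)
    then show "rank_one x (\<phi> \<oplus>\<^bsub>P\<^esub> \<phi>') \<odot>\<^bsub>V\<^esub> v = rank_one x \<phi> \<odot>\<^bsub>V\<^esub> v \<oplus>\<^bsub>V\<^esub> rank_one x \<phi>' \<odot>\<^bsub>V\<^esub> v"
      using V.smult_l_distr[of "rank_one x \<phi>" "rank_one x \<phi>'" v] o rank_one_hom[OF x \<phi>'] v by simp }
  assume "\<gamma> \<in> carrier \<Gamma>"
  then have \<gamma>: "\<gamma> \<in> rmod_hom \<Lambda> X X" by simp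
  have "rank_one x (\<gamma> \<odot>\<^bsub>P\<^esub> \<phi>) = rank_one x \<phi> \<otimes>\<^bsub>\<Gamma>\<^esub> \<gamma>"
    using hom_closed[OF \<gamma>] by (auto simp: rank_one_def compose_def fun_eq_iff)
  then show "rank_one x (\<gamma> \<odot>\<^bsub>P\<^esub> \<phi>) \<odot>\<^bsub>V\<^esub> v = \<gamma> \<odot>\<^bsub>V\<^esub> (rank_one x \<phi> \<odot>\<^bsub>V\<^esub> v)"
    using V.smult_assoc[of "rank_one x \<phi>" \<gamma> v] o \<gamma> v by simp
qed

lemma \<C>D: "W \<in> \<C> \<Longrightarrow> W \<in> fp_modules \<Gamma>" "W \<in> \<C> \<Longrightarrow> in_add \<Gamma> (regular_module \<Gamma>) W"
  "W \<in> \<C> \<Longrightarrow> right_module \<Gamma> W"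
  using fp_modules_rm by (auto simp: \<C>_def)

text \<open>As \<open>W\<close> is a summand of some \<open>\<Gamma>\<^sup>n\<close>, it suffices that every map \<open>c : W \<rightarrow> \<Gamma>\<close> kills \<open>w\<close>.  The
  endomorphism \<open>c w\<close> of \<open>X\<close> satisfies \<open>(c w) (x \<phi>) = 0\<close>, so it vanishes on all elements \<open>x (\<phi> z)\<close>, and
  these span \<open>X\<close> because \<open>1\<close> is a sum of elements \<open>\<phi> z\<close>.\<close>

lemma rank_one_faithful:
  assumes W: "W \<in> \<C>" and w: "w \<in> carrier W"
    and z: "\<And>x \<phi>. \<lbrakk>x \<in> carrier X; \<phi> \<in> rmod_hom \<Lambda> X \<Lambda>\<Lambda>\<rbrakk> \<Longrightarrow> rank_one x \<phi> \<odot>\<^bsub>W\<^esub> w = \<zero>\<^bsub>W\<^esub>"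
  shows "w = \<zero>\<^bsub>W\<^esub>"
proof -
  note rW = \<C>D(3)[OF W]
  interpret W: right_module \<Gamma> W by (rule rW)
  note rG = regular_right_module[OF ring_\<Gamma>]
  have cw: "c w = hzero X X" if c: "c \<in> rmod_hom \<Gamma> W (regular_module \<Gamma>)" for c
  proof (rule hom_eqI[OF _ hzero_hom[OF rX rX]])
    show ch: "c w \<in> rmod_hom \<Lambda> X X" using hom_closed[OF c w] by simp
    fix x assume x: "x \<in> carrier X"
    have c0: "c w (b y \<odot>\<^bsub>X\<^esub> x) = \<zero>\<^bsub>X\<^esub>" if b: "b \<in> rmod_hom \<Lambda> X \<Lambda>\<Lambda>" and y: "y \<in> carrier X" for b y
    proof -
      have o: "rank_one x b \<in> carrier \<Gamma>" using rank_one_hom[OF x b] by simp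
      have "rcomp X (c w) (rank_one x b) = hzero X X"
        using hom_smult[OF c o w] z[OF x b] hom_zero[OF rW rG c] by simp
      from fun_cong[OF this, of y] show ?thesis using y by (simp add: compose_eq rank_one_def)
    qed
    have "c w (f \<one>\<^bsub>\<Lambda>\<^esub> \<odot>\<^bsub>X\<^esub> x) = \<zero>\<^bsub>X\<^esub>" if "f \<in> through_all \<Lambda> X \<Lambda>\<Lambda> \<Lambda>\<Lambda>" for f
      using that
    proof induction
      case zero
      then show ?case using x hom_zero[OF rX rX ch] by simp
    next
      case (step f a b)
      have a1: "a \<one>\<^bsub>\<Lambda>\<^esub> \<in> carrier X" using hom_closed[OF step.hyps(2)] by simp
      have f1: "f \<one>\<^bsub>\<Lambda>\<^esub> \<in> carrier \<Lambda>" using hom_closed[OF through_hom[OF rL rL subset_refl step.hyps(1)]] by simp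
      show ?case
        using step.IH c0[OF step.hyps(3) a1] P_closed[OF step.hyps(3) a1] f1 x
        by (simp add: compose_eq TA.Q.smult_l_distr hom_add[OF ch])
    qed
    from this[OF generator[unfolded in_add_def]] show "c w x = hzero X X x" using x by simp
  qed
  have "f w = \<zero>\<^bsub>W\<^esub>" if "f \<in> through_all \<Gamma> (regular_module \<Gamma>) W W" for f
    using that
  proof induction
    case zero
    then show ?case using w by simp
  next
    case (step f a s)
    then show ?case using w cw[OF step.hyps(2)] hom_zero[OF rG rW step.hyps(3)] by (simp add: compose_eq)
  qed
  from this[OF \<C>D(2)[OF W, unfolded in_add_def]] show ?thesis using w by simp
qed

text \<open>The maps \<open>\<phi> \<mapsto> v (x \<phi>)\<close> from \<open>P\<close> to \<open>V\<close>, with \<open>x\<close> and \<open>v\<close> ranging over generators of \<open>X\<close> and \<open>V\<close>, are jointly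
  epimorphic by \<open>rank_one_faithful\<close>, and a splitting of this family exhibits \<open>V\<close> as a summand of some
  \<open>P\<^sup>n\<close>.\<close>

lemma split_imp_in_add_P:
  assumes V: "V \<in> \<C>" and sp: "split_wrt \<Gamma> \<C> V"
  shows "in_add \<Gamma> P V"
proof -
  note rV = \<C>D(3)[OF V] and rP = rT[OF rL] and fpP = T_fp[OF rL generator]
  interpret V: right_module \<Gamma> V by (rule rV)
  let ?W = "fp_copy \<Gamma> P"
  note W = T_copy[OF rL generator]
  note rW = \<C>D(3)[OF W]
  note c = from_copy_hom[OF fpP] and t = to_copy_hom[OF fpP]
  obtain G where G: "finite G" "G \<subseteq> carrier V" "\<And>H. submodule H \<Gamma> V \<Longrightarrow> G \<subseteq> H \<Longrightarrow> carrier V \<subseteq> H"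
    using finitely_presented_fg[of \<Gamma> V] \<C>D(1)[OF V] unfolding fg_whole[OF rV] fp_modules_def by blast
  obtain K where K: "finite K" "K \<subseteq> carrier X" "\<And>H. submodule H \<Lambda> X \<Longrightarrow> K \<subseteq> H \<Longrightarrow> carrier X \<subseteq> H"
    using finitely_presented_fg[of \<Lambda> X] X_fp unfolding fg_whole[OF rX] fp_modules_def by blast
  define s where "s x v = rcomp ?W (\<lambda>\<phi>\<in>carrier P. rank_one x \<phi> \<odot>\<^bsub>V\<^esub> v) (from_copy \<Gamma> P)" for x v
  have s: "s x v \<in> rmod_hom \<Gamma> ?W V" if "x \<in> carrier X" "v \<in> carrier V" for x v
    unfolding s_def by (rule rcomp_hom[OF rW c rank_one_smult_hom[OF that(1) rV that(2)]])
  let ?S = "(\<lambda>(x, v). s x v) ` (K \<times> G)"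
  have S: "?S \<subseteq> rmod_hom \<Gamma> ?W V" using s K(2) G(2) by auto
  have "rid V \<in> through \<Gamma> ?W V V ?S"
  proof (rule split_wrtD[OF sp W _ S])
    show "finite ?S" using K(1) G(1) by simp
    fix W' g assume W': "W' \<in> \<C>" and g: "g \<in> rmod_hom \<Gamma> V W'"
      and z: "\<And>r. r \<in> ?S \<Longrightarrow> rcomp ?W g r = hzero ?W W'"
    note rW' = \<C>D(3)[OF W']
    interpret W': right_module \<Gamma> W' by (rule rW')
    have z1: "rank_one x \<phi> \<odot>\<^bsub>W'\<^esub> g v = \<zero>\<^bsub>W'\<^esub>"
      if x: "x \<in> K" and v: "v \<in> G" and \<phi>: "\<phi> \<in> rmod_hom \<Lambda> X \<Lambda>\<Lambda>" for x v \<phi>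
    proof -
      have xX: "x \<in> carrier X" and vV: "v \<in> carrier V" using x v K(2) G(2) by blast+
      have \<phi>P: "\<phi> \<in> carrier P" using \<phi> by simp
      have o: "rank_one x \<phi> \<in> carrier \<Gamma>" using rank_one_hom[OF xX \<phi>] by simp
      have "rcomp ?W g (s x v) = hzero ?W W'" using z[of "s x v"] x v by blast
      from fun_cong[OF this, of "to_copy \<Gamma> P \<phi>"]
      have "g (rank_one x \<phi> \<odot>\<^bsub>V\<^esub> v) = \<zero>\<^bsub>W'\<^esub>"
        using hom_closed[OF t \<phi>P] from_to_copy[OF fpP \<phi>P] \<phi>P by (simp add: s_def compose_eq)
      then show ?thesis using hom_smult[OF g o vV] by simp
    qed
    have "g v = \<zero>\<^bsub>W'\<^esub>" if v: "v \<in> G" for v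
    proof -
      have vV: "v \<in> carrier V" using v G(2) by blast
      have gv: "g v \<in> carrier W'" by (rule hom_closed[OF g vV])
      \<comment> \<open>The condition is linear in \<open>x\<close>, so it extends from the generators of \<open>X\<close> to all of \<open>X\<close>.\<close>
      let ?H = "{x \<in> carrier X. \<forall>\<phi>\<in>rmod_hom \<Lambda> X \<Lambda>\<Lambda>. rank_one x \<phi> \<odot>\<^bsub>W'\<^esub> g v = \<zero>\<^bsub>W'\<^esub>}"
      have "submodule ?H \<Lambda> X"
      proof (rule TA.Q.rsubmoduleI)
        show "?H \<subseteq> carrier X" by blast
        have "rank_one \<zero>\<^bsub>X\<^esub> \<phi> = \<zero>\<^bsub>\<Gamma>\<^esub>" if "\<phi> \<in> rmod_hom \<Lambda> X \<Lambda>\<Lambda>" for \<phi>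
          using P_closed[OF that] by (auto simp: rank_one_def hzero_def fun_eq_iff)
        then show "\<zero>\<^bsub>X\<^esub> \<in> ?H" using W'.zero_smult[OF gv] by simp
        fix x y a assume x: "x \<in> ?H"
        { assume y: "y \<in> ?H"
          have "rank_one (x \<oplus>\<^bsub>X\<^esub> y) \<phi> = rank_one x \<phi> \<oplus>\<^bsub>\<Gamma>\<^esub> rank_one y \<phi>" if "\<phi> \<in> rmod_hom \<Lambda> X \<Lambda>\<Lambda>" for \<phi>
            using P_closed[OF that] x y by (auto simp: rank_one_def hadd_def fun_eq_iff TA.Q.smult_r_distr)
          then have "rank_one (x \<oplus>\<^bsub>X\<^esub> y) \<phi> \<odot>\<^bsub>W'\<^esub> g v = \<zero>\<^bsub>W'\<^esub>" if \<phi>: "\<phi> \<in> rmod_hom \<Lambda> X \<Lambda>\<Lambda>" for \<phi>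
            using W'.smult_l_distr[of "rank_one x \<phi>" "rank_one y \<phi>" "g v"] rank_one_hom[of x \<phi>] rank_one_hom[of y \<phi>] x y \<phi> gv by simp
          then show "x \<oplus>\<^bsub>X\<^esub> y \<in> ?H" using x y by simp }
        assume a: "a \<in> carrier \<Lambda>"
        have "rank_one (a \<odot>\<^bsub>X\<^esub> x) \<phi> = rank_one x (lmul a \<phi>)" if \<phi>: "\<phi> \<in> rmod_hom \<Lambda> X \<Lambda>\<Lambda>" for \<phi>
          using P_closed[OF \<phi>] x a by (auto simp: rank_one_def lmul_apply[OF \<phi>] fun_eq_iff TA.Q.smult_assoc)
        then show "a \<odot>\<^bsub>X\<^esub> x \<in> ?H" using x a lmul_closed[OF a] by simp
      qed
      then have "carrier X \<subseteq> ?H" by (rule K(3)) (use z1 v K(2) in blast)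
      then show ?thesis by (intro rank_one_faithful[OF W' gv]) blast
    qed
    then have "carrier V \<subseteq> {x \<in> carrier V. g x = \<zero>\<^bsub>W'\<^esub>}"
      using G(2) by (intro G(3) submodule_kernel[OF rV rW' g]) blast
    then have "g x = \<zero>\<^bsub>W'\<^esub>" if "x \<in> carrier V" for x using that by blast
    then show "g = hzero V W'" using hom_undefined[OF g] by (auto simp: hzero_def fun_eq_iff)
  qed
  then have "in_add \<Gamma> ?W V" unfolding in_add_def by (rule through_mono[OF _ S])
  then show ?thesis by (rule in_add_trans[OF rP rW rV in_add_iso(1)[OF rP rW fp_copy_iso[OF fpP]]])
qed

text \<open>Those \<open>l\<close> in \<open>\<Lambda>\<close> for which left multiplication by \<open>l\<close> is a sum of maps through the family \<open>S\<close> form a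
  right ideal \<open>N\<close>, and \<open>N\<close> contains all values \<open>s w x\<close>.  If \<open>N\<close> were proper, then a nonzero functional
  \<open>\<eta>\<close> killing \<open>N\<close> would define a nonzero map \<open>\<Lambda> \<rightarrow> D(\<Lambda>)\<close> killing \<open>N\<close>, hence a nonzero map \<open>P \<rightarrow> T (D \<Lambda>)\<close>
  killing the family; but \<open>T (D \<Lambda>)\<close> is finitely generated projective, so it is a valid test module.
  Therefore \<open>1\<close> is in \<open>N\<close>.\<close>

lemma split_wrt_P: "split_wrt \<Gamma> \<C> P"
  unfolding split_wrt_def
proof (intro ballI allI impI)
  note rP = rT[OF rL]
  interpret LL: right_module \<Lambda> \<Lambda>\<Lambda> by (rule rL)
  fix W S assume W: "W \<in> \<C>" and fin: "finite S" and S: "S \<subseteq> rmod_hom \<Gamma> W P"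
    and epi: "\<forall>W'\<in>\<C>. \<forall>g\<in>rmod_hom \<Gamma> P W'. (\<forall>s\<in>S. rcomp W g s = hzero W W') \<longrightarrow> g = hzero P W'"
  note rW = \<C>D(3)[OF W]
  interpret W: right_module \<Gamma> W by (rule rW)
  define N where "N = {l \<in> carrier \<Lambda>. lmul l \<in> through \<Gamma> W P P S}"
  have ah: "lmul \<in> ring_hom \<Lambda> (End_ring \<Gamma> P)" using lmul_ring_iso by (simp add: ring_iso_def)
  have N: "submodule N \<Lambda> \<Lambda>\<Lambda>"
  proof (rule LL.rsubmoduleI)
    show "N \<subseteq> carrier \<Lambda>\<Lambda>" by (auto simp: N_def)
    have "lmul \<zero>\<^bsub>\<Lambda>\<^esub> = hzero P P"
      by (rule hom_eqI[OF lmul_hom[OF TA.Q.R.zero_closed] hzero_hom[OF rP rP]])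
        (auto simp: lmul_def hzero_def fun_eq_iff P_closed)
    then show "\<zero>\<^bsub>\<Lambda>\<Lambda>\<^esub> \<in> N" using through.zero by (simp add: N_def)
    fix x y a assume x: "x \<in> N"
    show "x \<oplus>\<^bsub>\<Lambda>\<Lambda>\<^esub> y \<in> N" if "y \<in> N"
      using x that through_add[OF rP rP S, of "lmul x" "lmul y"] ring_hom_add[OF ah, of x y] by (simp add: N_def)
    assume a: "a \<in> carrier \<Lambda>"
    have "rcomp P (rid P) (rcomp P (lmul x) (lmul a)) \<in> through \<Gamma> W P P S"
    proof (rule through_conj[OF rW rP rP rP rP S S lmul_hom[OF a] rid_hom[OF rP]])
      show "lmul x \<in> through \<Gamma> W P P S" using x by (simp add: N_def)
      fix s assume s: "s \<in> S"
      then have sh: "s \<in> rmod_hom \<Gamma> W P" using S by blast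
      show "rcomp W (rid P) s \<in> S" using s by (simp only: rcomp_rid(2)[OF sh])
    qed
    moreover have "rcomp P (rid P) (rcomp P (lmul x) (lmul a)) = lmul (x \<otimes>\<^bsub>\<Lambda>\<^esub> a)"
    proof -
      have xL: "x \<in> carrier \<Lambda>" using x by (simp add: N_def)
      note xa = rcomp_hom[OF rP lmul_hom[OF a] lmul_hom[OF xL]]
      show ?thesis using ring_hom_mult[OF ah xL a] by (simp only: rcomp_rid(2)[OF xa] End_ring_simps)
    qed
    ultimately show "a \<odot>\<^bsub>\<Lambda>\<Lambda>\<^esub> x \<in> N" using x a by (simp add: N_def)
  qed
  have sN: "s w x \<in> N" if s: "s \<in> S" and w: "w \<in> carrier W" and x: "x \<in> carrier X" for s w x
  proof -
    have sh: "s \<in> rmod_hom \<Gamma> W P" using s S by blast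
    have sw: "s w \<in> rmod_hom \<Lambda> X \<Lambda>\<Lambda>" using hom_closed[OF sh w] by simp
    have swx: "s w x \<in> carrier \<Lambda>" by (rule P_closed[OF sw x])
    note oh = rank_one_smult_hom[OF x rW w]
    have "rcomp P s (\<lambda>\<phi>\<in>carrier P. rank_one x \<phi> \<odot>\<^bsub>W\<^esub> w) = lmul (s w x)"
    proof (rule hom_eqI[OF rcomp_hom[OF rP oh sh] lmul_hom[OF swx]])
      fix \<phi> assume \<phi>P: "\<phi> \<in> carrier P"
      then have \<phi>: "\<phi> \<in> rmod_hom \<Lambda> X \<Lambda>\<Lambda>" by simp
      have o: "rank_one x \<phi> \<in> rmod_hom \<Lambda> X X" by (rule rank_one_hom[OF x \<phi>])
      have 1: "s (rank_one x \<phi> \<odot>\<^bsub>W\<^esub> w) = rcomp X (s w) (rank_one x \<phi>)"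
        using hom_smult[OF sh _ w, of "rank_one x \<phi>"] o T_smult[OF sw o] by simp
      have "rcomp X (s w) (rank_one x \<phi>) = lmul (s w x) \<phi>"
        by (rule hom_eqI[OF rcomp_hom[OF rX o sw] lmul_closed[OF swx \<phi>]])
          (simp add: compose_eq rank_one_def lmul_apply[OF \<phi>] hom_smult[OF sw] P_closed[OF \<phi>] x)
      then show "rcomp P s (\<lambda>\<phi>\<in>carrier P. rank_one x \<phi> \<odot>\<^bsub>W\<^esub> w) \<phi> = lmul (s w x) \<phi>"
        using \<phi>P 1 by (simp add: compose_eq)
    qed
    then show ?thesis using through_single[OF rP rP S oh s] swx by (simp add: N_def)
  qed
  have "N = carrier \<Lambda>"
  proof (rule ccontr)
    assume "N \<noteq> carrier \<Lambda>"
    then obtain \<eta> l0 where \<eta>: "\<eta> \<in> rmod_hom R \<Lambda> E" and \<eta>N: "\<And>n. n \<in> N \<Longrightarrow> \<eta> n = \<zero>\<^bsub>E\<^esub>"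
      and l0: "l0 \<in> carrier \<Lambda>" "\<eta> l0 \<noteq> \<zero>\<^bsub>E\<^esub>"
      by (rule artin_algebra_separating_functional[OF artin E N]) blast
    have rE: "right_module R E" using E by (simp add: injective_envelope_def injective_module_def)
    note rR = artin_algebra_right_module[OF artin]
    interpret DA: left_action R \<Lambda> \<Lambda> "mult \<Lambda>" by (rule artin_algebra_left_action[OF artin])
    let ?D = "dual_regular R \<Lambda> E"
    note rD = dual_regular_right_module[OF artin rE]
    have D: "carrier ?D = rmod_hom R \<Lambda> E" "\<And>h k. h \<oplus>\<^bsub>?D\<^esub> k = hadd \<Lambda> E h k" "\<zero>\<^bsub>?D\<^esub> = hzero \<Lambda> E"
      "\<And>b h. b \<odot>\<^bsub>?D\<^esub> h = (\<lambda>x\<in>carrier \<Lambda>. h (b \<otimes>\<^bsub>\<Lambda>\<^esub> x))"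
      by (simp_all add: dual_regular_eq)
    \<comment> \<open>The map \<open>\<Lambda> \<rightarrow> D(\<Lambda>)\<close> that sends \<open>1\<close> to \<open>\<eta>\<close>.\<close>
    define \<theta> where "\<theta> = (\<lambda>l\<in>carrier \<Lambda>\<Lambda>. \<lambda>a\<in>carrier \<Lambda>. \<eta> (l \<otimes>\<^bsub>\<Lambda>\<^esub> a))"
    have \<theta>a: "\<theta> l a = \<eta> (l \<otimes>\<^bsub>\<Lambda>\<^esub> a)" if "l \<in> carrier \<Lambda>" "a \<in> carrier \<Lambda>" for l a using that by (simp add: \<theta>_def)
    have \<theta>: "\<theta> \<in> rmod_hom \<Lambda> \<Lambda>\<Lambda> ?D"
      unfolding \<theta>_def
    proof (rule rmod_hom_restrictI[OF rL], unfold D regular_simps)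
      fix l m a assume l: "l \<in> carrier \<Lambda>"
      show "(\<lambda>a\<in>carrier \<Lambda>. \<eta> (l \<otimes>\<^bsub>\<Lambda>\<^esub> a)) \<in> rmod_hom R \<Lambda> E" by (rule DA.act_hom[OF rE l \<eta>])
      show "(\<lambda>a\<in>carrier \<Lambda>. \<eta> ((l \<oplus>\<^bsub>\<Lambda>\<^esub> m) \<otimes>\<^bsub>\<Lambda>\<^esub> a)) =
        hadd \<Lambda> E (\<lambda>a\<in>carrier \<Lambda>. \<eta> (l \<otimes>\<^bsub>\<Lambda>\<^esub> a)) (\<lambda>a\<in>carrier \<Lambda>. \<eta> (m \<otimes>\<^bsub>\<Lambda>\<^esub> a))" if m: "m \<in> carrier \<Lambda>"
        using l m by (auto simp: hadd_def fun_eq_iff TA.Q.R.l_distr hom_add[OF \<eta>])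
      show "(\<lambda>b\<in>carrier \<Lambda>. \<eta> ((l \<otimes>\<^bsub>\<Lambda>\<^esub> a) \<otimes>\<^bsub>\<Lambda>\<^esub> b)) = (\<lambda>x\<in>carrier \<Lambda>. (\<lambda>b\<in>carrier \<Lambda>. \<eta> (l \<otimes>\<^bsub>\<Lambda>\<^esub> b)) (a \<otimes>\<^bsub>\<Lambda>\<^esub> x))"
        if a: "a \<in> carrier \<Lambda>"
        using l a by (auto simp: fun_eq_iff TA.Q.R.m_assoc)
    qed
    note fpD = T_fp[OF rD cogenerator] and cD = T_copy[OF rD cogenerator]
    let ?W = "fp_copy \<Gamma> (T ?D)"
    note h\<theta> = TA.hmap_hom[OF rL rD \<theta>] and t = to_copy_hom[OF fpD]
    let ?g = "rcomp P (to_copy \<Gamma> (T ?D)) (hmap \<Lambda> X \<Lambda>\<Lambda> \<theta>)"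
    have g: "?g \<in> rmod_hom \<Gamma> P ?W" by (rule rcomp_hom[OF rP h\<theta> t])
    have \<theta>N: "\<theta> n = hzero \<Lambda> E" if n: "n \<in> N" for n
    proof -
      have nL: "n \<in> carrier \<Lambda>" using n by (simp add: N_def)
      have "n \<otimes>\<^bsub>\<Lambda>\<^esub> a \<in> N" if "a \<in> carrier \<Lambda>" for a using LL.rsubmoduleD(4)[OF N that n] by simp
      then show ?thesis using nL \<eta>N by (auto simp: \<theta>_def hzero_def fun_eq_iff)
    qed
    have "rcomp W ?g s = hzero W ?W" if s: "s \<in> S" for s
    proof (rule hom_eqI)
      have sh: "s \<in> rmod_hom \<Gamma> W P" using s S by blast
      show "rcomp W ?g s \<in> rmod_hom \<Gamma> W ?W" by (rule rcomp_hom[OF rW sh g])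
      show "hzero W ?W \<in> rmod_hom \<Gamma> W ?W" by (rule hzero_hom[OF rW \<C>D(3)[OF cD]])
      fix w assume w: "w \<in> carrier W"
      have sw: "s w \<in> rmod_hom \<Lambda> X \<Lambda>\<Lambda>" using hom_closed[OF sh w] by simp
      have "hmap \<Lambda> X \<Lambda>\<Lambda> \<theta> (s w) = hzero X ?D"
        by (rule hom_eqI[OF TA.hmap_closed[OF \<theta> sw] hzero_hom[OF rX rD]])
          (simp add: TA.hmap_apply sw \<theta>N sN[OF s w] D)
      then show "rcomp W ?g s w = hzero W ?W w"
        using w sw hom_zero[OF rT[OF rD] \<C>D(3)[OF cD] t] by (simp add: compose_eq)
    qed
    then have g0: "?g = hzero P ?W" using epi cD g by blast
    have \<theta>0: "\<theta> (\<phi> x) = hzero \<Lambda> E" if \<phi>: "\<phi> \<in> rmod_hom \<Lambda> X \<Lambda>\<Lambda>" and x: "x \<in> carrier X" for \<phi> x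
    proof -
      have h: "hmap \<Lambda> X \<Lambda>\<Lambda> \<theta> \<phi> \<in> carrier (T ?D)" using TA.hmap_closed[OF \<theta> \<phi>] by simp
      have "to_copy \<Gamma> (T ?D) (hmap \<Lambda> X \<Lambda>\<Lambda> \<theta> \<phi>) = \<zero>\<^bsub>?W\<^esub>"
        using fun_cong[OF g0, of \<phi>] \<phi> by (simp add: compose_eq)
      then have "hmap \<Lambda> X \<Lambda>\<Lambda> \<theta> \<phi> = \<zero>\<^bsub>T ?D\<^esub>"
        using from_to_copy[OF fpD h] hom_zero[OF \<C>D(3)[OF cD] rT[OF rD] from_copy_hom[OF fpD]] by metis
      then have "hmap \<Lambda> X \<Lambda>\<Lambda> \<theta> \<phi> = hzero X ?D" by simp
      from fun_cong[OF this, of x] show ?thesis using x by (simp add: TA.hmap_apply \<phi> D)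
    qed
    \<comment> \<open>\<open>\<theta>\<close> vanishes on the values of maps \<open>X \<rightarrow> \<Lambda>\<close>, and these span \<open>\<Lambda>\<close>.\<close>
    have "\<theta> (f l0) = hzero \<Lambda> E" if "f \<in> through_all \<Lambda> X \<Lambda>\<Lambda> \<Lambda>\<Lambda>" for f
      using that
    proof induction
      case zero
      then show ?case using l0(1) hom_zero[OF rL rD \<theta>] D(3) by simp
    next
      case (step f a b)
      have al: "a l0 \<in> carrier X" using hom_closed[OF step.hyps(2)] l0(1) by simp
      have fl: "f l0 \<in> carrier \<Lambda>" using hom_closed[OF through_hom[OF rL rL subset_refl step.hyps(1)]] l0(1) by simp
      have "\<theta> (f l0 \<oplus>\<^bsub>\<Lambda>\<^esub> b (a l0)) = hadd \<Lambda> E (\<theta> (f l0)) (\<theta> (b (a l0)))"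
        using hom_add[OF \<theta>, of "f l0" "b (a l0)"] fl P_closed[OF step.hyps(3) al] by (simp add: D)
      also have "\<dots> = hadd \<Lambda> E (hzero \<Lambda> E) (hzero \<Lambda> E)" by (simp only: step.IH \<theta>0[OF step.hyps(3) al])
      also have "\<dots> = hzero \<Lambda> E"
      proof -
        interpret rE: right_module R E by (rule rE)
        show ?thesis by (auto simp: hadd_def hzero_def)
      qed
      finally show ?case using l0(1) by (simp add: compose_eq)
    qed
    from this[OF generator[unfolded in_add_def]] have "\<theta> l0 = hzero \<Lambda> E" using l0(1) by simp
    from fun_cong[OF this, of "\<one>\<^bsub>\<Lambda>\<^esub>"] have "\<eta> l0 = \<zero>\<^bsub>E\<^esub>" using l0(1) by (simp add: \<theta>a)
    then show False using l0(2) by simp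
  qed
  then have "\<one>\<^bsub>\<Lambda>\<^esub> \<in> N" using TA.Q.R.one_closed by (simp only:)
  then have "lmul \<one>\<^bsub>\<Lambda>\<^esub> \<in> through \<Gamma> W P P S" by (simp add: N_def)
  then show "rid P \<in> through \<Gamma> W P P S" using ring_hom_one[OF ah] by simp
qed

text \<open>The module \<open>T X\<close> is \<open>\<Gamma>\<close> itself, with left composition as the action of its endomorphism ring.\<close>

lemma hmap_ring_iso: "hmap \<Lambda> X X \<in> ring_iso \<Gamma> (End_ring \<Gamma> (T X))"
proof (rule ring_iso_memI)
  note rTX = rT[OF rX]
  have eqI: "f = g" if "f \<in> rmod_hom \<Gamma> (T X) (T X)" "g \<in> rmod_hom \<Gamma> (T X) (T X)"
    "\<And>h x. h \<in> rmod_hom \<Lambda> X X \<Longrightarrow> x \<in> carrier X \<Longrightarrow> f h x = g h x" for f g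
  proof (rule hom_eqI[OF that(1,2)])
    fix h assume h: "h \<in> carrier (T X)"
    have "f h \<in> rmod_hom \<Lambda> X X" "g h \<in> rmod_hom \<Lambda> X X"
      using hom_closed[OF that(1) h] hom_closed[OF that(2) h] by simp_all
    then show "f h = g h" by (rule hom_eqI) (use that(3)[of h] h in simp)
  qed
  have H: "hmap \<Lambda> X X f \<in> rmod_hom \<Gamma> (T X) (T X)" if "f \<in> rmod_hom \<Lambda> X X" for f
    by (rule TA.hmap_hom[OF rX rX that])
  note hc = TA.hmap_closed
  fix f g assume "f \<in> carrier \<Gamma>" then have f: "f \<in> rmod_hom \<Lambda> X X" by simp
  show "hmap \<Lambda> X X f \<in> carrier (End_ring \<Gamma> (T X))" using H[OF f] by simp
  assume "g \<in> carrier \<Gamma>" then have g: "g \<in> rmod_hom \<Lambda> X X" by simp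
  have "hmap \<Lambda> X X (rcomp X f g) = rcomp (T X) (hmap \<Lambda> X X f) (hmap \<Lambda> X X g)"
    by (rule eqI[OF H[OF rcomp_hom[OF rX g f]] rcomp_hom[OF rTX H[OF g] H[OF f]]])
      (simp add: compose_eq TA.hmap_apply hc[OF g] hom_closed)
  then show "hmap \<Lambda> X X (f \<otimes>\<^bsub>\<Gamma>\<^esub> g) = hmap \<Lambda> X X f \<otimes>\<^bsub>End_ring \<Gamma> (T X)\<^esub> hmap \<Lambda> X X g" by simp
  have "hmap \<Lambda> X X (hadd X X f g) = hadd (T X) (T X) (hmap \<Lambda> X X f) (hmap \<Lambda> X X g)"
    by (rule eqI[OF H[OF hadd_hom[OF rX rX f g]] hadd_hom[OF rTX rTX H[OF f] H[OF g]]])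
      (simp add: TA.hmap_apply hc[OF g] hc[OF f] hom_closed)
  then show "hmap \<Lambda> X X (f \<oplus>\<^bsub>\<Gamma>\<^esub> g) = hmap \<Lambda> X X f \<oplus>\<^bsub>End_ring \<Gamma> (T X)\<^esub> hmap \<Lambda> X X g" by simp
next
  show "hmap \<Lambda> X X \<one>\<^bsub>\<Gamma>\<^esub> = \<one>\<^bsub>End_ring \<Gamma> (T X)\<^esub>" by (simp only: End_ring_simps TA.hmap_rid)
next
  note rTX = rT[OF rX] and I = rid_hom[OF rX]
  have I': "rid X \<in> carrier (T X)" using I by simp
  have ev: "hmap \<Lambda> X X f (rid X) = f" if f: "f \<in> rmod_hom \<Lambda> X X" for f
    by (rule hom_eqI[OF TA.hmap_closed[OF f I] f]) (simp add: TA.hmap_apply I)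
  have inj: "inj_on (hmap \<Lambda> X X) (rmod_hom \<Lambda> X X)"
  proof (rule inj_onI)
    fix f g assume f: "f \<in> rmod_hom \<Lambda> X X" and g: "g \<in> rmod_hom \<Lambda> X X" and eq: "hmap \<Lambda> X X f = hmap \<Lambda> X X g"
    show "f = g" using fun_cong[OF eq, of "rid X"] unfolding ev[OF f] ev[OF g] .
  qed
  have surj: "hmap \<Lambda> X X (y (rid X)) = y" if y: "y \<in> rmod_hom \<Gamma> (T X) (T X)" for y
  proof -
    have y1: "y (rid X) \<in> rmod_hom \<Lambda> X X" using hom_closed[OF y I'] by simp
    show ?thesis
    proof (rule hom_eqI[OF TA.hmap_hom[OF rX rX y1] y])
      fix h assume "h \<in> carrier (T X)"
      then have h: "h \<in> rmod_hom \<Lambda> X X" by simp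
      have "rcomp X (rid X) h = h" by (rule rcomp_rid(2)[OF h])
      then have "y h = h \<odot>\<^bsub>T X\<^esub> y (rid X)"
        using hom_smult[OF y _ I', of h] h T_smult[OF I h] by simp
      also have "\<dots> = hmap \<Lambda> X X (y (rid X)) h" using T_smult[OF y1 h] h by (simp add: hmap_def)
      finally show "hmap \<Lambda> X X (y (rid X)) h = y h" by (rule sym)
    qed
  qed
  have "hmap \<Lambda> X X ` rmod_hom \<Lambda> X X = rmod_hom \<Gamma> (T X) (T X)"
  proof (intro equalityI subsetI)
    fix y assume "y \<in> hmap \<Lambda> X X ` rmod_hom \<Lambda> X X"
    then show "y \<in> rmod_hom \<Gamma> (T X) (T X)" using TA.hmap_hom[OF rX rX] by blast
  next
    fix y assume y: "y \<in> rmod_hom \<Gamma> (T X) (T X)"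
    have "y (rid X) \<in> rmod_hom \<Lambda> X X" using hom_closed[OF y I'] by simp
    then show "y \<in> hmap \<Lambda> X X ` rmod_hom \<Lambda> X X" by (rule rev_image_eqI) (rule surj[OF y, symmetric])
  qed
  then show "bij_betw (hmap \<Lambda> X X) (carrier \<Gamma>) (carrier (End_ring \<Gamma> (T X)))"
    using inj by (simp add: bij_betw_def)
qed

text \<open>For the converse, a \<open>\<Gamma>\<close>-map \<open>b : P \<rightarrow> T X\<close> sends each \<open>\<phi> : X \<rightarrow> \<Lambda>\<close> to an endomorphism of \<open>X\<close> that is a
  sum of maps through \<open>\<Lambda>\<close>: write \<open>\<phi> = \<Sum> c\<^sub>i (a\<^sub>i \<phi>)\<close> with maps \<open>a\<^sub>i : \<Lambda> \<rightarrow> X\<close> and \<open>c\<^sub>i : X \<rightarrow> \<Lambda>\<close>; then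
  \<open>b \<phi> = \<Sum> (b c\<^sub>i) (a\<^sub>i \<phi>)\<close>, since \<open>a\<^sub>i \<phi>\<close> is in \<open>\<Gamma>\<close>.  Evaluation at the identity of \<open>X\<close> recovers \<open>\<gamma>\<close>.\<close>

lemma hmap_through_P_iff:
  assumes \<gamma>: "\<gamma> \<in> rmod_hom \<Lambda> X X"
  shows "hmap \<Lambda> X X \<gamma> \<in> through_all \<Gamma> P (T X) (T X) \<longleftrightarrow> \<gamma> \<in> proj_ideal \<Lambda> X"
  unfolding proj_ideal_eq_through[OF rX]
proof
  assume "\<gamma> \<in> through_all \<Lambda> \<Lambda>\<Lambda> X X"
  then show "hmap \<Lambda> X X \<gamma> \<in> through_all \<Gamma> P (T X) (T X)" by (rule TA.hmap_through[OF rL rX rX])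
next
  note I = rid_hom[OF rX]
  have I': "rid X \<in> carrier (T X)" using I by simp
  note rP = rT[OF rL] and rTX = rT[OF rX]
  have bP: "b (rcomp X f \<phi>) \<in> through_all \<Lambda> \<Lambda>\<Lambda> X X"
    if b: "b \<in> rmod_hom \<Gamma> P (T X)" and \<phi>: "\<phi> \<in> rmod_hom \<Lambda> X \<Lambda>\<Lambda>" and f: "f \<in> through_all \<Lambda> X \<Lambda>\<Lambda> \<Lambda>\<Lambda>" for b \<phi> f
    using f
  proof induction
    case zero
    have "rcomp X (hzero \<Lambda>\<Lambda> \<Lambda>\<Lambda>) \<phi> = \<zero>\<^bsub>P\<^esub>"
      using hom_closed[OF \<phi>] by (auto simp: compose_def hzero_def fun_eq_iff)
    then show ?case using hom_zero[OF rP rTX b] through.zero by simp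
  next
    case (step f a c)
    note a = step.hyps(2) and c = step.hyps(3)
    have f: "f \<in> rmod_hom \<Lambda> \<Lambda>\<Lambda> \<Lambda>\<Lambda>" by (rule through_hom[OF rL rL subset_refl step.hyps(1)])
    have a\<phi>: "rcomp X a \<phi> \<in> rmod_hom \<Lambda> X X" by (rule rcomp_hom[OF rX \<phi> a])
    have ca\<phi>: "rcomp X c (rcomp X a \<phi>) \<in> rmod_hom \<Lambda> X \<Lambda>\<Lambda>" by (rule rcomp_hom[OF rX a\<phi> c])
    have f\<phi>: "rcomp X f \<phi> \<in> rmod_hom \<Lambda> X \<Lambda>\<Lambda>" by (rule rcomp_hom[OF rX \<phi> f])
    have bc: "b c \<in> rmod_hom \<Lambda> X X" using hom_closed[OF b, of c] c by simp
    have bca: "rcomp \<Lambda>\<Lambda> (b c) a \<in> rmod_hom \<Lambda> \<Lambda>\<Lambda> X" by (rule rcomp_hom[OF rL a bc])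
    have "rcomp X (hadd \<Lambda>\<Lambda> \<Lambda>\<Lambda> f (rcomp \<Lambda>\<Lambda> c a)) \<phi> = hadd X \<Lambda>\<Lambda> (rcomp X f \<phi>) (rcomp X c (rcomp X a \<phi>))"
      using P_closed[OF \<phi>] by (auto simp: compose_def hadd_def fun_eq_iff)
    then have "b (rcomp X (hadd \<Lambda>\<Lambda> \<Lambda>\<Lambda> f (rcomp \<Lambda>\<Lambda> c a)) \<phi>) = hadd X X (b (rcomp X f \<phi>)) (b (rcomp X c (rcomp X a \<phi>)))"
      using hom_add[OF b, of "rcomp X f \<phi>" "rcomp X c (rcomp X a \<phi>)"] f\<phi> ca\<phi> by simp
    moreover have "b (rcomp X c (rcomp X a \<phi>)) = rcomp X (b c) (rcomp X a \<phi>)"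
      using hom_smult[OF b, of "rcomp X a \<phi>" c] a\<phi> c T_smult[OF c a\<phi>] T_smult[OF bc a\<phi>] by simp
    moreover have "rcomp X (b c) (rcomp X a \<phi>) = rcomp X (rcomp \<Lambda>\<Lambda> (b c) a) \<phi>"
      using P_closed[OF \<phi>] by (auto simp: compose_def fun_eq_iff)
    ultimately show ?case
      using through_add[OF rX rX subset_refl step.IH through_single[OF rX rX subset_refl \<phi> bca]] by simp
  qed
  have bP': "b \<phi> \<in> through_all \<Lambda> \<Lambda>\<Lambda> X X" if b: "b \<in> rmod_hom \<Gamma> P (T X)" and \<phi>: "\<phi> \<in> rmod_hom \<Lambda> X \<Lambda>\<Lambda>" for b \<phi>
  proof -
    have "rcomp X (rid \<Lambda>\<Lambda>) \<phi> = \<phi>"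
      by (rule rcomp_rid(2)[OF \<phi>])
    then show ?thesis using bP[OF b \<phi> generator[unfolded in_add_def]] by simp
  qed
  assume "hmap \<Lambda> X X \<gamma> \<in> through_all \<Gamma> P (T X) (T X)"
  moreover have "y (rid X) \<in> through_all \<Lambda> \<Lambda>\<Lambda> X X" if "y \<in> through_all \<Gamma> P (T X) (T X)" for y
    using that
  proof induction
    case zero
    show ?case by (simp only: hzero_apply[OF I'] hom_mod_simps through.zero)
  next
    case (step f a b)
    have "a (rid X) \<in> rmod_hom \<Lambda> X \<Lambda>\<Lambda>" using hom_closed[OF step.hyps(2), of "rid X"] I by simp
    then have "b (a (rid X)) \<in> through_all \<Lambda> \<Lambda>\<Lambda> X X" by (rule bP'[OF step.hyps(3)])
    then show ?case
      unfolding hadd_apply[OF I'] compose_eq[OF I'] unfolding hom_mod_simps by (rule through_add[OF rX rX subset_refl step.IH])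
  qed
  moreover have "hmap \<Lambda> X X \<gamma> (rid X) = \<gamma>"
    by (rule hom_eqI[OF TA.hmap_closed[OF \<gamma> I] \<gamma>]) (simp add: TA.hmap_apply I)
  ultimately show "\<gamma> \<in> through_all \<Lambda> \<Lambda>\<Lambda> X X" by metis
qed

abbreviation "Pc \<equiv> fp_copy \<Gamma> P"
abbreviation "Xc \<equiv> fp_copy \<Gamma> (T X)"

lemma Pc: "Pc \<in> \<C>" "rmod_iso \<Gamma> P Pc" and Xc: "Xc \<in> \<C>" "rmod_iso \<Gamma> (T X) Xc"
  using T_copy[OF rL generator] fp_copy_iso[OF T_fp[OF rL generator]]
    T_copy[OF rX in_add_refl[OF rX]] fp_copy_iso[OF T_fp[OF rX in_add_refl[OF rX]]] .

lemma split_wrt_Pc: "split_wrt \<Gamma> \<C> Pc"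
  using split_wrt_iso[OF _ rT[OF rL] \<C>D(3)[OF Pc(1)] Pc(2) split_wrt_P] \<C>D(1) by blast

lemma in_add_Xc:
  assumes "V \<in> \<C>" shows "in_add \<Gamma> Xc V"
  by (rule in_add_trans[OF \<C>D(3)[OF Xc(1)] rT[OF rX] \<C>D(3)[OF assms]
    in_add_iso(2)[OF rT[OF rX] \<C>D(3)[OF Xc(1)] Xc(2)]
    in_add_trans[OF rT[OF rX] regular_right_module[OF ring_\<Gamma>] \<C>D(3)[OF assms]
      in_add_iso(1)[OF rT[OF rX] regular_right_module[OF ring_\<Gamma>] T_X_iso_regular] \<C>D(2)[OF assms]]])

end

section \<open>Comparing two relative Auslander algebras\<close>

lemma conj_ring_iso:
  assumes M: "right_module R M" and N: "right_module R N"
    and u: "u \<in> rmod_hom R M N" and t: "t \<in> rmod_hom R N M"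
    and tu: "\<And>x. x \<in> carrier M \<Longrightarrow> t (u x) = x" and ut: "\<And>y. y \<in> carrier N \<Longrightarrow> u (t y) = y"
  shows "(\<lambda>f. rcomp N u (rcomp N f t)) \<in> ring_iso (End_ring R M) (End_ring R N)"
proof (rule ring_iso_memI, unfold End_ring_simps)
  note cu = hom_closed[OF u] and ct = hom_closed[OF t]
  have c: "rcomp N u (rcomp N f t) \<in> rmod_hom R N N" if "f \<in> rmod_hom R M M" for f
    by (rule rcomp_hom[OF N rcomp_hom[OF N t that] u])
  have c': "rcomp M t (rcomp M f u) \<in> rmod_hom R M M" if "f \<in> rmod_hom R N N" for f
    by (rule rcomp_hom[OF M rcomp_hom[OF M u that] t])
  fix f g assume f: "f \<in> rmod_hom R M M"
  show "rcomp N u (rcomp N f t) \<in> rmod_hom R N N" by (rule c[OF f])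
  assume g: "g \<in> rmod_hom R M M"
  show "rcomp N u (rcomp N (rcomp M f g) t) = rcomp N (rcomp N u (rcomp N f t)) (rcomp N u (rcomp N g t))"
    by (rule hom_eqI[OF c[OF rcomp_hom[OF M g f]] rcomp_hom[OF N c[OF g] c[OF f]]])
      (simp add: compose_eq cu ct tu hom_closed[OF g])
  show "rcomp N u (rcomp N (hadd M M f g) t) = hadd N N (rcomp N u (rcomp N f t)) (rcomp N u (rcomp N g t))"
    by (rule hom_eqI[OF c[OF hadd_hom[OF M M f g]] hadd_hom[OF N N c[OF f] c[OF g]]])
      (simp add: compose_eq ct hom_add[OF u] hom_closed[OF f] hom_closed[OF g])
next
  note cu = hom_closed[OF u] and ct = hom_closed[OF t]
  show "rcomp N u (rcomp N (rid M) t) = rid N"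
    by (rule hom_eqI[OF rcomp_hom[OF N rcomp_hom[OF N t rid_hom[OF M]] u] rid_hom[OF N]])
      (simp add: compose_eq ct ut)
  show "bij_betw (\<lambda>f. rcomp N u (rcomp N f t)) (rmod_hom R M M) (rmod_hom R N N)"
  proof (rule bij_betw_byWitness[of _ "\<lambda>f. rcomp M t (rcomp M f u)"])
    show "\<forall>f\<in>rmod_hom R M M. rcomp M t (rcomp M (rcomp N u (rcomp N f t)) u) = f"
    proof
      fix f assume f: "f \<in> rmod_hom R M M"
      show "rcomp M t (rcomp M (rcomp N u (rcomp N f t)) u) = f"
        by (rule hom_eqI[OF rcomp_hom[OF M rcomp_hom[OF M u rcomp_hom[OF N rcomp_hom[OF N t f] u]] t] f])
          (simp add: compose_eq cu ct tu hom_closed[OF f])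
    qed
    show "\<forall>f\<in>rmod_hom R N N. rcomp N u (rcomp N (rcomp M t (rcomp M f u)) t) = f"
    proof
      fix f assume f: "f \<in> rmod_hom R N N"
      show "rcomp N u (rcomp N (rcomp M t (rcomp M f u)) t) = f"
        by (rule hom_eqI[OF rcomp_hom[OF N rcomp_hom[OF N t rcomp_hom[OF M rcomp_hom[OF M u f] t]] u] f])
          (simp add: compose_eq cu ct ut hom_closed[OF f])
    qed
    show "(\<lambda>f. rcomp N u (rcomp N f t)) ` rmod_hom R M M \<subseteq> rmod_hom R N N"
      using rcomp_hom[OF N rcomp_hom[OF N t] u] by blast
    show "(\<lambda>f. rcomp M t (rcomp M f u)) ` rmod_hom R N N \<subseteq> rmod_hom R M M"
      using rcomp_hom[OF M rcomp_hom[OF M u] t] by blast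
  qed
qed

locale relative_auslander_equiv =
  A: relative_auslander R \<Lambda> E X + A': relative_auslander R' \<Lambda>' E' X' +
  M: mod_equiv "End_ring \<Lambda> X" "End_ring \<Lambda>' X'" F \<phi> G \<psi>
  for R :: "('r, 'p) ring_scheme" and \<Lambda> :: "('r, 'a) module" and E :: "('r, 'e) module" and X :: "'a umodule"
    and R' :: "('s, 'q) ring_scheme" and \<Lambda>' :: "('s, 'b) module" and E' :: "('s, 'd) module" and X' :: "'b umodule"
    and F \<phi> G \<psi>
begin

lemma F_\<C>: "W \<in> A.\<C> \<Longrightarrow> F W \<in> A'.\<C>"
  using M.F_ob M.F_in_add_regular unfolding A.\<C>_def A'.\<C>_def by blast

lemma swap: "relative_auslander_equiv R' \<Lambda>' E' X' R \<Lambda> E X G \<psi> F \<phi>"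
  by (intro relative_auslander_equiv.intro A.relative_auslander_axioms A'.relative_auslander_axioms M.swap)

text \<open>The criterion that singles out \<open>P\<close> among the finitely generated projective modules is preserved
  by the equivalence, so \<open>F P\<close> satisfies the one for \<open>P'\<close>.\<close>

lemma in_add_P'_F_Pc: "in_add A'.\<Gamma> A'.P (F A.Pc)"
proof -
  interpret S: relative_auslander_equiv R' \<Lambda>' E' X' R \<Lambda> E X G \<psi> F \<phi> by (rule swap)
  have "A.\<C> \<subseteq> fp_modules A.\<Gamma>" "A'.\<C> \<subseteq> fp_modules A'.\<Gamma>" using A.\<C>D(1) A'.\<C>D(1) by blast+
  then have "split_wrt A'.\<Gamma> A'.\<C> (F A.Pc)"
    by (rule M.F_split[OF _ _ _ _ A.\<C>D(1)[OF A.Pc(1)] A.\<C>D(2)[OF A.Pc(1)] A.split_wrt_Pc])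
      (erule F_\<C>, erule S.F_\<C>)
  then show ?thesis by (rule A'.split_imp_in_add_P[OF F_\<C>[OF A.Pc(1)]])
qed

lemma in_add_F_preimage:
  assumes U: "U \<in> A.\<C>" and V: "V \<in> A'.\<C>" and UG: "in_add A.\<Gamma> U (G V)" and GV: "G V \<in> A.\<C>"
  shows "in_add A'.\<Gamma> (F U) V"
proof -
  interpret W: mod_equiv A'.\<Gamma> A.\<Gamma> G \<psi> F \<phi> by (rule M.swap)
  note rFU = A'.\<C>D(3)[OF F_\<C>[OF U]] and rFGV = A'.\<C>D(3)[OF F_\<C>[OF GV]] and rV = A'.\<C>D(3)[OF V]
  have "in_add A'.\<Gamma> (F U) (F (G V))"
    by (rule M.F_in_add[OF A.\<C>D(1)[OF U] A.\<C>D(1)[OF GV] A.\<C>D(2)[OF GV] UG])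
  then show ?thesis
    by (rule in_add_trans[OF rFU rFGV rV _ in_add_iso(2)[OF rV rFGV W.iso_X_GFX[OF A'.\<C>D(1)[OF V]]]])
qed

text \<open>The previous argument for \<open>G\<close> shows that \<open>G P'\<close> is in \<open>add P\<close>; apply \<open>F\<close>.\<close>

lemma in_add_F_Pc_P': "in_add A'.\<Gamma> (F A.Pc) A'.P"
proof -
  interpret S: relative_auslander_equiv R' \<Lambda>' E' X' R \<Lambda> E X G \<psi> F \<phi> by (rule swap)
  note GP = S.F_\<C>[OF A'.Pc(1)]
  note rP = A.rT[OF A.rL] and rP' = A'.rT[OF A'.rL]
  have "in_add A.\<Gamma> A.Pc (G A'.Pc)"
    by (rule in_add_trans[OF A.\<C>D(3)[OF A.Pc(1)] rP A.\<C>D(3)[OF GP]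
      in_add_iso(2)[OF rP A.\<C>D(3)[OF A.Pc(1)] A.Pc(2)] S.in_add_P'_F_Pc])
  then have "in_add A'.\<Gamma> (F A.Pc) A'.Pc" by (rule in_add_F_preimage[OF A.Pc(1) A'.Pc(1) _ GP])
  then show ?thesis
    by (rule in_add_trans[OF A'.\<C>D(3)[OF F_\<C>[OF A.Pc(1)]] A'.\<C>D(3)[OF A'.Pc(1)] rP' _
      in_add_iso(2)[OF rP' A'.\<C>D(3)[OF A'.Pc(1)] A'.Pc(2)]])
qed

text \<open>\<open>\<Lambda>\<close> is \<open>End(P)\<close>, hence \<open>End(F P)\<close>, while \<open>\<Lambda>'\<close> is \<open>End(P')\<close>, and \<open>F P\<close> and \<open>P'\<close> have the same \<open>add\<close>.\<close>

lemma morita_equivalent_base: "morita_equivalent \<Lambda> \<Lambda>'"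
proof -
  note rP = A.rT[OF A.rL] and rPc = A.\<C>D(3)[OF A.Pc(1)]
  obtain u t where ut: "u \<in> rmod_hom A.\<Gamma> A.P A.Pc" "t \<in> rmod_hom A.\<Gamma> A.Pc A.P"
    "\<And>x. x \<in> carrier A.P \<Longrightarrow> t (u x) = x" "\<And>y. y \<in> carrier A.Pc \<Longrightarrow> u (t y) = y"
    using rP A.Pc(2) by (rule rmod_isoE) blast
  have "\<phi> A.Pc A.Pc \<circ> ((\<lambda>f. rcomp A.Pc u (rcomp A.Pc f t)) \<circ> A.lmul) \<in> ring_iso \<Lambda> (End_ring A'.\<Gamma> (F A.Pc))"
    by (rule ring_iso_set_trans[OF ring_iso_set_trans[OF A.lmul_ring_iso conj_ring_iso[OF rP rPc ut(1,2), OF ut(3,4)]]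
      M.F_ring_iso[OF A.\<C>D(1)[OF A.Pc(1)] A.\<C>D(2)[OF A.Pc(1)]]])
  then show ?thesis
    by (rule morita_equivalent_End(1)[OF A'.\<C>D(3)[OF F_\<C>[OF A.Pc(1)]] A'.rT[OF A'.rL] A.ring_\<Lambda> A'.ring_\<Lambda> _
      A'.lmul_ring_iso in_add_F_Pc_P' in_add_P'_F_Pc])
qed

text \<open>\<open>\<Gamma>\<close> is \<open>End(T X)\<close>, hence \<open>End(F (T X))\<close>, while \<open>\<Gamma>'\<close> is \<open>End(T' X')\<close>, and \<open>F (T X)\<close> and \<open>T' X'\<close> have the same
  \<open>add\<close>.  On either side the ideal of maps through projective modules consists of the sums of maps
  through \<open>P'\<close>.\<close>

lemma morita_equivalent_stable: "morita_equivalent (stable_End_ring \<Lambda> X) (stable_End_ring \<Lambda>' X')"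
proof -
  interpret S: relative_auslander_equiv R' \<Lambda>' E' X' R \<Lambda> E X G \<psi> F \<phi> by (rule swap)
  note rT = A.rT[OF A.rX] and rXc = A.\<C>D(3)[OF A.Xc(1)] and rT' = A'.rT[OF A'.rX]
  note rP = A.rT[OF A.rL] and rP' = A'.rT[OF A'.rL]
  note rFX = A'.\<C>D(3)[OF F_\<C>[OF A.Xc(1)]] and rFP = A'.\<C>D(3)[OF F_\<C>[OF A.Pc(1)]]
  note rPc = A.\<C>D(3)[OF A.Pc(1)]
  obtain u t where u: "u \<in> rmod_hom A.\<Gamma> (A.T X) A.Xc" and t: "t \<in> rmod_hom A.\<Gamma> A.Xc (A.T X)"
    and tu: "\<And>x. x \<in> carrier (A.T X) \<Longrightarrow> t (u x) = x" and ut: "\<And>y. y \<in> carrier A.Xc \<Longrightarrow> u (t y) = y"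
    using rT A.Xc(2) by (rule rmod_isoE) blast
  define a where "a = \<phi> A.Xc A.Xc \<circ> ((\<lambda>f. rcomp A.Xc u (rcomp A.Xc f t)) \<circ> hmap \<Lambda> X X)"
  have a: "a \<in> ring_iso A.\<Gamma> (End_ring A'.\<Gamma> (F A.Xc))"
    unfolding a_def
    by (rule ring_iso_set_trans[OF ring_iso_set_trans[OF A.hmap_ring_iso conj_ring_iso[OF rT rXc u t, OF tu ut]]
      M.F_ring_iso[OF A.\<C>D(1)[OF A.Xc(1)] A.\<C>D(2)[OF A.Xc(1)]]])
  have 1: "in_add A'.\<Gamma> (A'.T X') (F A.Xc)"
    by (rule in_add_trans[OF rT' A'.\<C>D(3)[OF A'.Xc(1)] rFX in_add_iso(1)[OF rT' A'.\<C>D(3)[OF A'.Xc(1)] A'.Xc(2)]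
      A'.in_add_Xc[OF F_\<C>[OF A.Xc(1)]]])
  have "in_add A'.\<Gamma> (F A.Xc) A'.Xc"
    by (rule in_add_F_preimage[OF A.Xc(1) A'.Xc(1) A.in_add_Xc S.F_\<C>[OF A'.Xc(1)]]) (rule S.F_\<C>[OF A'.Xc(1)])
  then have 2: "in_add A'.\<Gamma> (F A.Xc) (A'.T X')"
    by (rule in_add_trans[OF rFX A'.\<C>D(3)[OF A'.Xc(1)] rT' _ in_add_iso(2)[OF rT' A'.\<C>D(3)[OF A'.Xc(1)] A'.Xc(2)]])
  \<comment> \<open>The modules \<open>P'\<close> and \<open>F P\<close> may be exchanged because they have the same \<open>add\<close>.\<close>
  have "a \<gamma> \<in> through_all A'.\<Gamma> A'.P (F A.Xc) (F A.Xc) \<longleftrightarrow> \<gamma> \<in> proj_ideal \<Lambda> X" if "\<gamma> \<in> carrier A.\<Gamma>" for \<gamma>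
  proof -
    have \<gamma>: "\<gamma> \<in> rmod_hom \<Lambda> X X" using that by simp
    have h: "hmap \<Lambda> X X \<gamma> \<in> rmod_hom A.\<Gamma> (A.T X) (A.T X)" by (rule A.TA.hmap_hom[OF A.rX A.rX \<gamma>])
    have c: "rcomp A.Xc u (rcomp A.Xc (hmap \<Lambda> X X \<gamma>) t) \<in> rmod_hom A.\<Gamma> A.Xc A.Xc"
      by (rule rcomp_hom[OF rXc rcomp_hom[OF rXc t h] u])
    have "a \<gamma> \<in> through_all A'.\<Gamma> A'.P (F A.Xc) (F A.Xc) \<longleftrightarrow> a \<gamma> \<in> through_all A'.\<Gamma> (F A.Pc) (F A.Xc) (F A.Xc)"
      using through_change[OF rP' rFX rFX rFP in_add_F_Pc_P'] through_change[OF rFP rFX rFX rP' in_add_P'_F_Pc] by blast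
    also have "\<dots> \<longleftrightarrow> rcomp A.Xc u (rcomp A.Xc (hmap \<Lambda> X X \<gamma>) t) \<in> through_all A.\<Gamma> A.Pc A.Xc A.Xc"
      using M.F_through_all_iff[OF A.\<C>D(1)[OF A.Pc(1)] A.\<C>D(1)[OF A.Xc(1)] A.\<C>D(2)[OF A.Xc(1)] c]
      by (simp add: a_def)
    also have "\<dots> \<longleftrightarrow> hmap \<Lambda> X X \<gamma> \<in> through_all A.\<Gamma> A.Pc (A.T X) (A.T X)"
      by (rule through_all_retract_iff[OF rPc rT rXc u t, OF tu h])
    also have "\<dots> \<longleftrightarrow> hmap \<Lambda> X X \<gamma> \<in> through_all A.\<Gamma> A.P (A.T X) (A.T X)"
      using through_change[OF rPc rT rT rP in_add_iso(1)[OF rP rPc A.Pc(2)]]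
        through_change[OF rP rT rT rPc in_add_iso(2)[OF rP rPc A.Pc(2)]] by blast
    also have "\<dots> \<longleftrightarrow> \<gamma> \<in> proj_ideal \<Lambda> X" by (rule A.hmap_through_P_iff[OF \<gamma>])
    finally show ?thesis .
  qed
  moreover have "proj_ideal \<Lambda> X \<subseteq> carrier A.\<Gamma>" by (auto simp: proj_ideal_def)
  ultimately have J: "{x \<in> carrier A.\<Gamma>. a x \<in> through_all A'.\<Gamma> A'.P (F A.Xc) (F A.Xc)} = proj_ideal \<Lambda> X"
    by blast
  have "proj_ideal \<Lambda>' X' \<subseteq> carrier A'.\<Gamma>" by (auto simp: proj_ideal_def)
  moreover have "hmap \<Lambda>' X' X' \<gamma> \<in> through_all A'.\<Gamma> A'.P (A'.T X') (A'.T X') \<longleftrightarrow> \<gamma> \<in> proj_ideal \<Lambda>' X'"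
    if "\<gamma> \<in> carrier A'.\<Gamma>" for \<gamma> using A'.hmap_through_P_iff that by simp
  ultimately have J': "{x \<in> carrier A'.\<Gamma>. hmap \<Lambda>' X' X' x \<in> through_all A'.\<Gamma> A'.P (A'.T X') (A'.T X')} = proj_ideal \<Lambda>' X'"
    by blast
  show ?thesis
    using morita_equivalent_End(2)[OF rFX rT' A.ring_\<Gamma> A'.ring_\<Gamma> a A'.hmap_ring_iso 2 1 rP']
    unfolding J J' stable_End_ring_def .
qed

end

lemma relative_auslanderI:
  fixes R :: "('r, 'p) ring_scheme" and \<Lambda> :: "('r, 'a) module" and E :: "('r, 'e) module" and X :: "'a umodule"
  assumes art: "artin_algebra R \<Lambda>"
    and E: "injective_envelope R (quot_module R (jacobson_radical R)) E"
    and sub: "subcategory \<Lambda> \<X>" and X: "X \<in> \<X>" "\<X> = add_closure \<Lambda> X"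
    and reg: "belongs_to \<Lambda> (regular_module \<Lambda>) \<X>" and dual: "belongs_to \<Lambda> (dual_regular R \<Lambda> E) \<X>"
  shows "relative_auslander R \<Lambda> E X"
proof -
  have L: "ring \<Lambda>"
  proof -
    interpret artin_algebra R \<Lambda> by (rule art)
    show ?thesis by (rule L.ring_axioms)
  qed
  have fp: "\<X> \<subseteq> fp_modules \<Lambda>" using sub unfolding subcategory_def by (rule conjunct1)
  have Xfp: "X \<in> fp_modules \<Lambda>" using fp X(1) by (rule subsetD)
  note rX = fp_modules_rm[OF Xfp]
  have *: "in_add \<Lambda> X M" if M: "right_module \<Lambda> M" and b: "belongs_to \<Lambda> M \<X>" for M :: "('a, 'm) module"
  proof -
    obtain N where N: "N \<in> \<X>" "rmod_iso \<Lambda> M N" using b by (auto simp: belongs_to_def)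
    have rN: "right_module \<Lambda> N" by (rule fp_modules_rm[OF subsetD[OF fp N(1)]])
    have "in_add \<Lambda> X N" by (rule add_closure_in_add[OF rX]) (use N(1) X(2) in \<open>simp only:\<close>)
    then show ?thesis by (rule in_add_trans[OF rX rN M _ in_add_iso(2)[OF M rN N(2)]])
  qed
  have rE: "right_module R E" using E by (simp add: injective_envelope_def injective_module_def)
  show ?thesis
    by (rule relative_auslander.intro[OF art E Xfp *[OF regular_right_module[OF L] reg]
      *[OF dual_regular_right_module[OF art rE] dual]])
qed

theorem theorem5p2:
  fixes R :: "('r, 'p) ring_scheme" and \<Lambda> :: "('r, 'a) module" and E :: "('r, 'e) module"
    and R' :: "('s, 'q) ring_scheme" and \<Lambda>' :: "('s, 'b) module" and E' :: "('s, 'd) module"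
    and \<X> :: "'a umodule set" and X :: "'a umodule"
    and \<X>' :: "'b umodule set" and X' :: "'b umodule"
  assumes "artin_algebra R \<Lambda>" and "artin_algebra R' \<Lambda>'"
    and "injective_envelope R (quot_module R (jacobson_radical R)) E"
    and "injective_envelope R' (quot_module R' (jacobson_radical R')) E'"
    and "subcategory \<Lambda> \<X>" and "finite_type \<Lambda> \<X>"
    and "subcategory \<Lambda>' \<X>'" and "finite_type \<Lambda>' \<X>'"
    and "belongs_to \<Lambda> (regular_module \<Lambda>) \<X>" and "belongs_to \<Lambda> (dual_regular R \<Lambda> E) \<X>"
    and "belongs_to \<Lambda>' (regular_module \<Lambda>') \<X>'" and "belongs_to \<Lambda>' (dual_regular R' \<Lambda>' E') \<X>'"
    and "X \<in> \<X>" and "\<X> = add_closure \<Lambda> X"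
    and "X' \<in> \<X>'" and "\<X>' = add_closure \<Lambda>' X'"
    and "morita_equivalent (End_ring \<Lambda> X) (End_ring \<Lambda>' X')"
  shows "morita_equivalent \<Lambda> \<Lambda>' \<and>
    morita_equivalent (stable_End_ring \<Lambda> X) (stable_End_ring \<Lambda>' X')"
proof -
  have A: "relative_auslander R \<Lambda> E X"
    by (rule relative_auslanderI[OF assms(1,3,5,13,14,9,10)])
  have A': "relative_auslander R' \<Lambda>' E' X'"
    by (rule relative_auslanderI[OF assms(2,4,7,15,16,11,12)])
  obtain F \<phi> G \<psi> where "mod_equiv (End_ring \<Lambda> X) (End_ring \<Lambda>' X') F \<phi> G \<psi>"
    by (rule morita_equivalent_imp_mod_equiv[OF relative_auslander.ring_\<Gamma>[OF A] relative_auslander.ring_\<Gamma>[OF A'] assms(17)])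
  then interpret relative_auslander_equiv R \<Lambda> E X R' \<Lambda>' E' X' F \<phi> G \<psi>
    by (rule relative_auslander_equiv.intro[OF A A'])
  show ?thesis using morita_equivalent_base morita_equivalent_stable by blast
qed

end
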